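(* Let $(T^\bullet,\delta^\bullet):\mathcal C\to\mathcal D$ be a cohomological functor. The resolution construction $(T_{Res}^\bullet,\widetilde\delta^\bullet)$ forms a Mislin completion of $(T^\bullet,\delta^\bullet)$. More specifically, $(T_{Res}^\bullet,\widetilde\delta^\bullet)$ forms a cohomological functor and $\omega_\bullet:(\widehat T^\bullet,\widehat\delta^\bullet)\to(T_{Res}^\bullet,\widetilde\delta^\bullet)$ is an isomorphism of cohomological functors, where $(\widehat T^\bullet,\widehat\delta^\bullet)$ is the satellite functor construction and $\omega_n(M)=\varinjlim_{k\ge1}(\varepsilon^{-1}\circ\varepsilon^{-2}\circ\cdots\circ\varepsilon^{-k}):\widehat T^n(M)\to T_{Res}^n(M)$.
   Context: Standing assumptions: $\mathcal C$ is an abelian category with enough projectives; $\mathcal D$ is an abelian category in which all direct limits (colimits over directed sets) exist and are exact. A cohomological functor $(T^\bullet,\delta^\bullet):\mathcal C\to\mathcal D$ is a family of additive functors $(T^n)_{n\in\mathbb Z}$ with, for each short exact sequence $0\to A\to B\to C\to0$, connecting homomorphisms $\delta^n:T^n(C)\to T^{n+1}(A)$, natural in the sequence, giving a long exact sequence. Morphisms are families of natural transformations commuting with connecting homomorphisms; an isomorphism is a morphism all of whose components are isomorphisms. A Mislin completion of $T^\bullet$ is a cohomological functor $\widehat T^\bullet$ with a morphism $\nu^\bullet:T^\bullet\to\widehat T^\bullet$ such that $\widehat T^n(P)=0$ for all projective $P$ and $n\in\mathbb Z$, and every morphism from $T^\bullet$ to a cohomological functor vanishing on projectives factors uniquely through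 $\nu^\bullet$. Left satellites: for an additive functor $F$ and $0\to K\to P\to M\to0$ exact with $P$ projective, $S^{-1}F(M)=\mathrm{Ker}(F(K)\to F(P))$ (independent of choices), functorial via lifts; $S^0F=F$, $S^{-k}F=S^{-1}(S^{-k+1}F)$; a natural transformation $\varphi:F\to G$ restricts to $S^{-1}\varphi$, and $S^{-k}\varphi$ is the iterate. For $0\to A\to B\to C\to0$ exact and $k\ge0$, the connecting homomorphism $\varepsilon^{-k-1}:S^{-k-1}F(C)\to S^{-k}F(A)$ is the kernel inclusion $S^{-k-1}F(C)\to S^{-k}F(K)$ (for $0\to K\to P\to C\to 0$, $P$ projective) followed by $S^{-k}F(h^* )$, where $h:P\to B$ lifts $\mathrm{id}_C$ and $h^*:K\to A$ is induced by $h$. The morphism $\underline\delta^n:T^n(M)\to S^{-1}T^{n+1}(M)$ is the factorisation of $\delta^n:T^n(M)\to T^{n+1}(K)$ through the kernel. Satellite functor construction: $\widehat T^n(M)=\varinjlim_{k\in\mathbb N_0}(S^{-k}T^{n+k}(M),S^{-k}\underline\delta^{n+k})$, with $\widehat T^n(f)=\varinjlim_k S^{-k}T^{n+k}(f)$ and, for $0\to A\to B\to C\to0$ exact, $\widehat\delta^n=\varinjlim_{k\in\mathbb N}(\varepsilon^{-k}:S^{-k}T^{n+k}(C)\to S^{-k+1}T^{n+k}(A)):\widehat T^n(C)\to\widehat T^{n+1}(A)$. It is a Mislin completion of $T^\bullet$ via the canonical morphism $T^\bullet\to\widehat T^\bullet$. Resolution construction: for $M\in\mathcal C$ with projective resolution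 $M_\bullet$ let $\widetilde M_0=M$, $\widetilde M_k=\mathrm{Ker}(M_{k-1}\to\widetilde M_{k-1})$ be the syzygies. Put $T^n_{Res}(M)=\varinjlim_{k\in\mathbb N_0}(T^{n+k}(\widetilde M_k),\delta^{n+k})$, using the connecting homomorphisms of $0\to\widetilde M_{k+1}\to M_k\to\widetilde M_k\to0$. For $f:M\to N$, choose inductively $\widetilde f_0=f$ and $\widetilde f_{k+1}:\widetilde M_{k+1}\to\widetilde N_{k+1}$ induced by a lift $M_k\to N_k$ of $\widetilde f_k$; $T_{Res}^n(f)=\varinjlim_kT^{n+k}(\widetilde f_k)$. Objects computed from different resolutions are identified through lifts of the identity. For $0\to A\to B\to C\to0$ exact, choose projective resolutions as in the Horseshoe Lemma, so that there are short exact sequences of syzygies $0\to\widetilde A_k\to\widetilde B_k\to\widetilde C_k\to0$ for all $k$ compatible with short exact sequences $0\to A_k\to B_k\to C_k\to0$ of projectives; with $\delta^{n+k}:T^{n+k}(\widetilde C_k)\to T^{n+k+1}(\widetilde A_k)$ the associated connecting homomorphisms, $\widetilde\delta^n=\varinjlim_{k\in\mathbb N_0}(-1)^k\delta^{n+k}:T_{Res}^n(C)\to T_{Res}^{n+1}(A)$. In $\omega_n(M)$, the composite $\varepsilon^{-1}\circ\cdots\circ\varepsilon^{-k}:S^{-k}T^{n+k}(M)\to S^{-k+1}T^{n+k}(\widetilde M_1)\to\cdots\to T^{n+k}(\widetilde M_k)$ uses the sequences $0\to\widetilde M_{j+1}\to M_j\to\widetilde M_j\to0$. The morphism $T^\bullet\to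 T_{Res}^\bullet$ of the Mislin completion is the composite of the canonical morphism $T^\bullet\to\widehat T^\bullet$ with $\omega_\bullet$. *)

theory Defs
  imports "HOL-Algebra.Group"
begin

section \<open>Abelian categories\<close>

record ('o, 'a) category =
  Obj :: "'o set"
  Arr :: "'a set"
  Dom :: "'a \<Rightarrow> 'o"
  Cod :: "'a \<Rightarrow> 'o"
  Ident :: "'o \<Rightarrow> 'a"
  Comp :: "'a \<Rightarrow> 'a \<Rightarrow> 'a"  (infixl "\<cdot>\<index>" 70)
  Plus :: "'a \<Rightarrow> 'a \<Rightarrow> 'a"
  Zero :: "'o \<Rightarrow> 'o \<Rightarrow> 'a"

definition Hom :: "('o, 'a) category \<Rightarrow> 'o \<Rightarrow> 'o \<Rightarrow> 'a set" where
  "Hom C A B = {f \<in> Arr C. Dom C f = A \<and> Cod C f = B}"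

definition is_category :: "('o, 'a) category \<Rightarrow> bool" where
  "is_category C \<longleftrightarrow>
     (\<forall>f\<in>Arr C. Dom C f \<in> Obj C \<and> Cod C f \<in> Obj C) \<and>
     (\<forall>A\<in>Obj C. Ident C A \<in> Hom C A A) \<and>
     (\<forall>X Y Z f g. f \<in> Hom C X Y \<longrightarrow> g \<in> Hom C Y Z \<longrightarrow> g \<cdot>\<^bsub>C\<^esub> f \<in> Hom C X Z) \<and>
     (\<forall>X Y f. f \<in> Hom C X Y \<longrightarrow> f \<cdot>\<^bsub>C\<^esub> Ident C X = f \<and> Ident C Y \<cdot>\<^bsub>C\<^esub> f = f) \<and>
     (\<forall>W X Y Z f g h. f \<in> Hom C W X \<longrightarrow> g \<in> Hom C X Y \<longrightarrow> h \<in> Hom C Y Z \<longrightarrow>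
        h \<cdot>\<^bsub>C\<^esub> (g \<cdot>\<^bsub>C\<^esub> f) = (h \<cdot>\<^bsub>C\<^esub> g) \<cdot>\<^bsub>C\<^esub> f)"

text \<open>The additive group of arrows \<open>A \<rightarrow> B\<close>, written multiplicatively as a library group.\<close>

definition hom_group :: "('o, 'a) category \<Rightarrow> 'o \<Rightarrow> 'o \<Rightarrow> 'a monoid" where
  "hom_group C A B = \<lparr>carrier = Hom C A B, mult = Plus C, one = Zero C A B\<rparr>"

definition preadditive :: "('o, 'a) category \<Rightarrow> bool" where
  "preadditive C \<longleftrightarrow> is_category C \<and>
     (\<forall>A\<in>Obj C. \<forall>B\<in>Obj C. comm_group (hom_group C A B)) \<and>
     (\<forall>X Y Z f f' g. f \<in> Hom C X Y \<longrightarrow> f' \<in> Hom C X Y \<longrightarrow> g \<in> Hom C Y Z \<longrightarrow>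
        g \<cdot>\<^bsub>C\<^esub> Plus C f f' = Plus C (g \<cdot>\<^bsub>C\<^esub> f) (g \<cdot>\<^bsub>C\<^esub> f')) \<and>
     (\<forall>X Y Z f g g'. f \<in> Hom C X Y \<longrightarrow> g \<in> Hom C Y Z \<longrightarrow> g' \<in> Hom C Y Z \<longrightarrow>
        Plus C g g' \<cdot>\<^bsub>C\<^esub> f = Plus C (g \<cdot>\<^bsub>C\<^esub> f) (g' \<cdot>\<^bsub>C\<^esub> f))"

definition is_mono :: "('o, 'a) category \<Rightarrow> 'a \<Rightarrow> bool" where
  "is_mono C f \<longleftrightarrow> f \<in> Arr C \<and>
     (\<forall>X. \<forall>g\<in>Hom C X (Dom C f). \<forall>h\<in>Hom C X (Dom C f). f \<cdot>\<^bsub>C\<^esub> g = f \<cdot>\<^bsub>C\<^esub> h \<longrightarrow> g = h)"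

definition is_epi :: "('o, 'a) category \<Rightarrow> 'a \<Rightarrow> bool" where
  "is_epi C f \<longleftrightarrow> f \<in> Arr C \<and>
     (\<forall>X. \<forall>g\<in>Hom C (Cod C f) X. \<forall>h\<in>Hom C (Cod C f) X. g \<cdot>\<^bsub>C\<^esub> f = h \<cdot>\<^bsub>C\<^esub> f \<longrightarrow> g = h)"

definition is_iso :: "('o, 'a) category \<Rightarrow> 'a \<Rightarrow> bool" where
  "is_iso C f \<longleftrightarrow> f \<in> Arr C \<and>
     (\<exists>g\<in>Hom C (Cod C f) (Dom C f).
        g \<cdot>\<^bsub>C\<^esub> f = Ident C (Dom C f) \<and> f \<cdot>\<^bsub>C\<^esub> g = Ident C (Cod C f))"

definition zero_object :: "('o, 'a) category \<Rightarrow> 'o \<Rightarrow> bool" where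
  "zero_object C Z \<longleftrightarrow> Z \<in> Obj C \<and>
     (\<forall>X\<in>Obj C. (\<exists>!f. f \<in> Hom C X Z) \<and> (\<exists>!f. f \<in> Hom C Z X))"

definition is_biproduct ::
  "('o, 'a) category \<Rightarrow> 'o \<Rightarrow> 'o \<Rightarrow> 'o \<Rightarrow> 'a \<Rightarrow> 'a \<Rightarrow> 'a \<Rightarrow> 'a \<Rightarrow> bool" where
  "is_biproduct C A B S i1 i2 p1 p2 \<longleftrightarrow>
     i1 \<in> Hom C A S \<and> i2 \<in> Hom C B S \<and> p1 \<in> Hom C S A \<and> p2 \<in> Hom C S B \<and>
     p1 \<cdot>\<^bsub>C\<^esub> i1 = Ident C A \<and> p2 \<cdot>\<^bsub>C\<^esub> i2 = Ident C B \<and>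
     p2 \<cdot>\<^bsub>C\<^esub> i1 = Zero C A B \<and> p1 \<cdot>\<^bsub>C\<^esub> i2 = Zero C B A \<and>
     Plus C (i1 \<cdot>\<^bsub>C\<^esub> p1) (i2 \<cdot>\<^bsub>C\<^esub> p2) = Ident C S"

definition is_kernel :: "('o, 'a) category \<Rightarrow> 'a \<Rightarrow> 'a \<Rightarrow> bool" where
  "is_kernel C f k \<longleftrightarrow> f \<in> Arr C \<and> k \<in> Arr C \<and> Cod C k = Dom C f \<and>
     f \<cdot>\<^bsub>C\<^esub> k = Zero C (Dom C k) (Cod C f) \<and>
     (\<forall>X. \<forall>t\<in>Hom C X (Dom C f). f \<cdot>\<^bsub>C\<^esub> t = Zero C X (Cod C f) \<longrightarrow>
        (\<exists>!s. s \<in> Hom C X (Dom C k) \<and> k \<cdot>\<^bsub>C\<^esub> s = t))"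

definition is_cokernel :: "('o, 'a) category \<Rightarrow> 'a \<Rightarrow> 'a \<Rightarrow> bool" where
  "is_cokernel C f c \<longleftrightarrow> f \<in> Arr C \<and> c \<in> Arr C \<and> Dom C c = Cod C f \<and>
     c \<cdot>\<^bsub>C\<^esub> f = Zero C (Dom C f) (Cod C c) \<and>
     (\<forall>X. \<forall>t\<in>Hom C (Cod C f) X. t \<cdot>\<^bsub>C\<^esub> f = Zero C (Dom C f) X \<longrightarrow>
        (\<exists>!s. s \<in> Hom C (Cod C c) X \<and> s \<cdot>\<^bsub>C\<^esub> c = t))"

definition abelian_category :: "('o, 'a) category \<Rightarrow> bool" where
  "abelian_category C \<longleftrightarrow> preadditive C \<and>
     (\<exists>Z. zero_object C Z) \<and>
     (\<forall>A\<in>Obj C. \<forall>B\<in>Obj C. \<exists>S i1 i2 p1 p2. is_biproduct C A B S i1 i2 p1 p2) \<and>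
     (\<forall>f\<in>Arr C. \<exists>k. is_kernel C f k) \<and>
     (\<forall>f\<in>Arr C. \<exists>c. is_cokernel C f c) \<and>
     (\<forall>f. is_mono C f \<longrightarrow> (\<exists>g. is_kernel C g f)) \<and>
     (\<forall>f. is_epi C f \<longrightarrow> (\<exists>g. is_cokernel C g f))"

text \<open>The image of an arrow is the kernel of its cokernel.\<close>

definition is_image :: "('o, 'a) category \<Rightarrow> 'a \<Rightarrow> 'a \<Rightarrow> bool" where
  "is_image C f m \<longleftrightarrow> (\<exists>c. is_cokernel C f c \<and> is_kernel C c m)"

definition exact_at :: "('o, 'a) category \<Rightarrow> 'a \<Rightarrow> 'a \<Rightarrow> bool" where
  "exact_at C f g \<longleftrightarrow> f \<in> Arr C \<and> g \<in> Arr C \<and> Cod C f = Dom C g \<and>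
     (\<exists>m. is_image C f m \<and> is_kernel C g m)"

text \<open>\<open>short_exact C f g\<close>: the sequence \<open>0 \<rightarrow> A \<rightarrow> B \<rightarrow> C \<rightarrow> 0\<close> with maps \<open>f\<close>, \<open>g\<close> is exact.\<close>

definition short_exact :: "('o, 'a) category \<Rightarrow> 'a \<Rightarrow> 'a \<Rightarrow> bool" where
  "short_exact C f g \<longleftrightarrow> is_mono C f \<and> exact_at C f g \<and> is_epi C g"

definition projective :: "('o, 'a) category \<Rightarrow> 'o \<Rightarrow> bool" where
  "projective C P \<longleftrightarrow> P \<in> Obj C \<and>
     (\<forall>e f. is_epi C e \<longrightarrow> f \<in> Hom C P (Cod C e) \<longrightarrow> (\<exists>h\<in>Hom C P (Dom C e). e \<cdot>\<^bsub>C\<^esub> h = f))"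

definition enough_projectives :: "('o, 'a) category \<Rightarrow> bool" where
  "enough_projectives C \<longleftrightarrow>
     (\<forall>M\<in>Obj C. \<exists>P p. projective C P \<and> p \<in> Hom C P M \<and> is_epi C p)"


section \<open>Direct limits\<close>

definition directed_set :: "'i set \<Rightarrow> ('i \<times> 'i) set \<Rightarrow> bool" where
  "directed_set J r \<longleftrightarrow> J \<noteq> {} \<and> preorder_on J r \<and>
     (\<forall>i\<in>J. \<forall>j\<in>J. \<exists>k\<in>J. (i, k) \<in> r \<and> (j, k) \<in> r)"

definition direct_system ::
  "('o, 'a) category \<Rightarrow> 'i set \<Rightarrow> ('i \<times> 'i) set \<Rightarrow> ('i \<Rightarrow> 'o) \<Rightarrow> ('i \<Rightarrow> 'i \<Rightarrow> 'a) \<Rightarrow> bool" where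
  "direct_system D J r X x \<longleftrightarrow>
     (\<forall>j\<in>J. X j \<in> Obj D \<and> x j j = Ident D (X j)) \<and>
     (\<forall>i j. (i, j) \<in> r \<longrightarrow> x i j \<in> Hom D (X i) (X j)) \<and>
     (\<forall>i j k. (i, j) \<in> r \<longrightarrow> (j, k) \<in> r \<longrightarrow> x j k \<cdot>\<^bsub>D\<^esub> x i j = x i k)"

definition cocone ::
  "('o, 'a) category \<Rightarrow> 'i set \<Rightarrow> ('i \<times> 'i) set \<Rightarrow> ('i \<Rightarrow> 'o) \<Rightarrow> ('i \<Rightarrow> 'i \<Rightarrow> 'a) \<Rightarrow>
    'o \<Rightarrow> ('i \<Rightarrow> 'a) \<Rightarrow> bool" where
  "cocone D J r X x Y c \<longleftrightarrow> Y \<in> Obj D \<and> (\<forall>j\<in>J. c j \<in> Hom D (X j) Y) \<and>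
     (\<forall>i j. (i, j) \<in> r \<longrightarrow> c j \<cdot>\<^bsub>D\<^esub> x i j = c i)"

definition is_direct_limit ::
  "('o, 'a) category \<Rightarrow> 'i set \<Rightarrow> ('i \<times> 'i) set \<Rightarrow> ('i \<Rightarrow> 'o) \<Rightarrow> ('i \<Rightarrow> 'i \<Rightarrow> 'a) \<Rightarrow>
    'o \<Rightarrow> ('i \<Rightarrow> 'a) \<Rightarrow> bool" where
  "is_direct_limit D J r X x L c \<longleftrightarrow> cocone D J r X x L c \<and>
     (\<forall>Y d. cocone D J r X x Y d \<longrightarrow> (\<exists>!u. u \<in> Hom D L Y \<and> (\<forall>j\<in>J. u \<cdot>\<^bsub>D\<^esub> c j = d j)))"

text \<open>The type argument bounds the directed sets considered: HOL cannot quantify over all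
  sets, so ``all direct limits'' means those indexed by directed subsets of the type \<open>'i\<close>.
  If \<open>'i\<close> is infinite, these include the ones indexed by the natural numbers.\<close>

definition has_direct_limits :: "'i itself \<Rightarrow> ('o, 'a) category \<Rightarrow> bool" where
  "has_direct_limits _ D \<longleftrightarrow>
     (\<forall>(J :: 'i set) r X x. directed_set J r \<longrightarrow> direct_system D J r X x \<longrightarrow>
        (\<exists>L c. is_direct_limit D J r X x L c))"

definition exact_direct_limits :: "'i itself \<Rightarrow> ('o, 'a) category \<Rightarrow> bool" where
  "exact_direct_limits _ D \<longleftrightarrow>
     (\<forall>(J :: 'i set) r X x Y y Z z f g LX a LY b LZ c u v.
        directed_set J r \<longrightarrow>
        direct_system D J r X x \<longrightarrow> direct_system D J r Y y \<longrightarrow> direct_system D J r Z z \<longrightarrow>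
        (\<forall>j\<in>J. f j \<in> Hom D (X j) (Y j) \<and> g j \<in> Hom D (Y j) (Z j) \<and> short_exact D (f j) (g j)) \<longrightarrow>
        (\<forall>i j. (i, j) \<in> r \<longrightarrow>
           f j \<cdot>\<^bsub>D\<^esub> x i j = y i j \<cdot>\<^bsub>D\<^esub> f i \<and> g j \<cdot>\<^bsub>D\<^esub> y i j = z i j \<cdot>\<^bsub>D\<^esub> g i) \<longrightarrow>
        is_direct_limit D J r X x LX a \<longrightarrow> is_direct_limit D J r Y y LY b \<longrightarrow>
        is_direct_limit D J r Z z LZ c \<longrightarrow>
        u \<in> Hom D LX LY \<longrightarrow> (\<forall>j\<in>J. u \<cdot>\<^bsub>D\<^esub> a j = b j \<cdot>\<^bsub>D\<^esub> f j) \<longrightarrow>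
        v \<in> Hom D LY LZ \<longrightarrow> (\<forall>j\<in>J. v \<cdot>\<^bsub>D\<^esub> b j = c j \<cdot>\<^bsub>D\<^esub> g j) \<longrightarrow>
        short_exact D u v)"

text \<open>A system indexed by the natural numbers is given by its steps \<open>x k : X\<^sub>k \<rightarrow> X\<^sub>k\<^sub>+\<^sub>1\<close>;
  \<open>steps D x i m\<close> is the composite \<open>X\<^sub>i \<rightarrow> X\<^sub>i\<^sub>+\<^sub>m\<close>.\<close>

definition sequential :: "('o, 'a) category \<Rightarrow> (nat \<Rightarrow> 'a) \<Rightarrow> bool" where
  "sequential D x \<longleftrightarrow> (\<forall>k. x k \<in> Arr D \<and> Cod D (x k) = Dom D (x (Suc k)))"

primrec steps :: "('o, 'a) category \<Rightarrow> (nat \<Rightarrow> 'a) \<Rightarrow> nat \<Rightarrow> nat \<Rightarrow> 'a" where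
  "steps D x i 0 = Ident D (Dom D (x i))"
| "steps D x i (Suc m) = x (i + m) \<cdot>\<^bsub>D\<^esub> steps D x i m"

definition is_seq_limit :: "('o, 'a) category \<Rightarrow> (nat \<Rightarrow> 'a) \<Rightarrow> 'o \<Rightarrow> (nat \<Rightarrow> 'a) \<Rightarrow> bool" where
  "is_seq_limit D x L c \<longleftrightarrow>
     is_direct_limit D UNIV {(i, j). i \<le> j} (\<lambda>k. Dom D (x k)) (\<lambda>i j. steps D x i (j - i)) L c"

text \<open>The arrow out of a limit \<open>L\<close> with legs \<open>c\<close> determined by its restrictions to the stages
  in a cofinal set \<open>K\<close>.\<close>

definition lim_map ::
  "('o, 'a) category \<Rightarrow> nat set \<Rightarrow> 'o \<Rightarrow> (nat \<Rightarrow> 'a) \<Rightarrow> 'o \<Rightarrow> (nat \<Rightarrow> 'a) \<Rightarrow> 'a" where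
  "lim_map D K L c Y d = (THE u. u \<in> Hom D L Y \<and> (\<forall>k\<in>K. u \<cdot>\<^bsub>D\<^esub> c k = d k))"


section \<open>Cohomological functors and Mislin completions\<close>

record ('o, 'a, 'p, 'b) fctr =
  FOb :: "'o \<Rightarrow> 'p"
  FAr :: "'a \<Rightarrow> 'b"

definition additive_functor ::
  "('o, 'a) category \<Rightarrow> ('p, 'b) category \<Rightarrow> ('o, 'a, 'p, 'b) fctr \<Rightarrow> bool" where
  "additive_functor C D F \<longleftrightarrow>
     (\<forall>A\<in>Obj C. FOb F A \<in> Obj D \<and> FAr F (Ident C A) = Ident D (FOb F A)) \<and>
     (\<forall>A B f. f \<in> Hom C A B \<longrightarrow> FAr F f \<in> Hom D (FOb F A) (FOb F B)) \<and>
     (\<forall>X Y Z f g. f \<in> Hom C X Y \<longrightarrow> g \<in> Hom C Y Z \<longrightarrow>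
        FAr F (g \<cdot>\<^bsub>C\<^esub> f) = FAr F g \<cdot>\<^bsub>D\<^esub> FAr F f) \<and>
     (\<forall>A B f g. f \<in> Hom C A B \<longrightarrow> g \<in> Hom C A B \<longrightarrow>
        FAr F (Plus C f g) = Plus D (FAr F f) (FAr F g))"

definition natural_transformation ::
  "('o, 'a) category \<Rightarrow> ('p, 'b) category \<Rightarrow> ('o, 'a, 'p, 'b) fctr \<Rightarrow> ('o, 'a, 'p, 'b) fctr \<Rightarrow>
    ('o \<Rightarrow> 'b) \<Rightarrow> bool" where
  "natural_transformation C D F G \<phi> \<longleftrightarrow>
     (\<forall>A\<in>Obj C. \<phi> A \<in> Hom D (FOb F A) (FOb G A)) \<and>
     (\<forall>A B f. f \<in> Hom C A B \<longrightarrow> \<phi> B \<cdot>\<^bsub>D\<^esub> FAr F f = FAr G f \<cdot>\<^bsub>D\<^esub> \<phi> A)"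

text \<open>\<open>conn T n f g\<close> is the connecting homomorphism \<open>T\<^sup>n(C) \<rightarrow> T\<^sup>n\<^sup>+\<^sup>1(A)\<close> of the short exact
  sequence with maps \<open>f : A \<rightarrow> B\<close> and \<open>g : B \<rightarrow> C\<close>.\<close>

record ('o, 'a, 'p, 'b) cohom =
  fn :: "int \<Rightarrow> ('o, 'a, 'p, 'b) fctr"
  conn :: "int \<Rightarrow> 'a \<Rightarrow> 'a \<Rightarrow> 'b"

definition cohomological_functor ::
  "('o, 'a) category \<Rightarrow> ('p, 'b) category \<Rightarrow> ('o, 'a, 'p, 'b) cohom \<Rightarrow> bool" where
  "cohomological_functor C D T \<longleftrightarrow>
     (\<forall>n. additive_functor C D (fn T n)) \<and>
     (\<forall>n f g. short_exact C f g \<longrightarrow>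
        conn T n f g \<in> Hom D (FOb (fn T n) (Cod C g)) (FOb (fn T (n + 1)) (Dom C f))) \<and>
     (\<forall>n f g f' g' a b c. short_exact C f g \<longrightarrow> short_exact C f' g' \<longrightarrow>
        a \<in> Hom C (Dom C f) (Dom C f') \<longrightarrow> b \<in> Hom C (Cod C f) (Cod C f') \<longrightarrow>
        c \<in> Hom C (Cod C g) (Cod C g') \<longrightarrow>
        b \<cdot>\<^bsub>C\<^esub> f = f' \<cdot>\<^bsub>C\<^esub> a \<longrightarrow> c \<cdot>\<^bsub>C\<^esub> g = g' \<cdot>\<^bsub>C\<^esub> b \<longrightarrow>
        FAr (fn T (n + 1)) a \<cdot>\<^bsub>D\<^esub> conn T n f g = conn T n f' g' \<cdot>\<^bsub>D\<^esub> FAr (fn T n) c) \<and>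
     (\<forall>n f g. short_exact C f g \<longrightarrow>
        exact_at D (FAr (fn T n) f) (FAr (fn T n) g) \<and>
        exact_at D (FAr (fn T n) g) (conn T n f g) \<and>
        exact_at D (conn T n f g) (FAr (fn T (n + 1)) f))"

definition cohom_morphism ::
  "('o, 'a) category \<Rightarrow> ('p, 'b) category \<Rightarrow> ('o, 'a, 'p, 'b) cohom \<Rightarrow> ('o, 'a, 'p, 'b) cohom \<Rightarrow>
    (int \<Rightarrow> 'o \<Rightarrow> 'b) \<Rightarrow> bool" where
  "cohom_morphism C D T U \<nu> \<longleftrightarrow>
     cohomological_functor C D T \<and> cohomological_functor C D U \<and>
     (\<forall>n. natural_transformation C D (fn T n) (fn U n) (\<nu> n)) \<and>
     (\<forall>n f g. short_exact C f g \<longrightarrow>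
        \<nu> (n + 1) (Dom C f) \<cdot>\<^bsub>D\<^esub> conn T n f g = conn U n f g \<cdot>\<^bsub>D\<^esub> \<nu> n (Cod C g))"

definition cohom_isomorphism ::
  "('o, 'a) category \<Rightarrow> ('p, 'b) category \<Rightarrow> ('o, 'a, 'p, 'b) cohom \<Rightarrow> ('o, 'a, 'p, 'b) cohom \<Rightarrow>
    (int \<Rightarrow> 'o \<Rightarrow> 'b) \<Rightarrow> bool" where
  "cohom_isomorphism C D T U \<nu> \<longleftrightarrow> cohom_morphism C D T U \<nu> \<and>
     (\<forall>n. \<forall>M\<in>Obj C. is_iso D (\<nu> n M))"

definition vanishes_on_projectives ::
  "('o, 'a) category \<Rightarrow> ('p, 'b) category \<Rightarrow> ('o, 'a, 'p, 'b) cohom \<Rightarrow> bool" where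
  "vanishes_on_projectives C D T \<longleftrightarrow> (\<forall>n P. projective C P \<longrightarrow> zero_object D (FOb (fn T n) P))"

definition mislin_completion ::
  "('o, 'a) category \<Rightarrow> ('p, 'b) category \<Rightarrow> ('o, 'a, 'p, 'b) cohom \<Rightarrow> ('o, 'a, 'p, 'b) cohom \<Rightarrow>
    (int \<Rightarrow> 'o \<Rightarrow> 'b) \<Rightarrow> bool" where
  "mislin_completion C D T U \<nu> \<longleftrightarrow>
     cohomological_functor C D U \<and> cohom_morphism C D T U \<nu> \<and> vanishes_on_projectives C D U \<and>
     (\<forall>V \<mu>. cohomological_functor C D V \<longrightarrow> vanishes_on_projectives C D V \<longrightarrow>
        cohom_morphism C D T V \<mu> \<longrightarrow>
        (\<exists>\<kappa>. cohom_morphism C D U V \<kappa> \<and> (\<forall>n. \<forall>M\<in>Obj C. \<kappa> n M \<cdot>\<^bsub>D\<^esub> \<nu> n M = \<mu> n M) \<and>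
           (\<forall>\<kappa>'. cohom_morphism C D U V \<kappa>' \<longrightarrow>
              (\<forall>n. \<forall>M\<in>Obj C. \<kappa>' n M \<cdot>\<^bsub>D\<^esub> \<nu> n M = \<mu> n M) \<longrightarrow>
              (\<forall>n. \<forall>M\<in>Obj C. \<kappa>' n M = \<kappa> n M))))"


section \<open>Projective resolutions and the choices entering the constructions\<close>

text \<open>A projective resolution \<open>\<cdots> \<rightarrow> M\<^sub>1 \<rightarrow> M\<^sub>0 \<rightarrow> M\<close> together with its syzygies \<open>S\<^sub>k\<close> (\<open>S\<^sub>0 = M\<close>):
  \<open>rdiff R 0 : M\<^sub>0 \<rightarrow> M\<close> is the augmentation, \<open>rdiff R (Suc k) : M\<^sub>k\<^sub>+\<^sub>1 \<rightarrow> M\<^sub>k\<close> are the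
  differentials, \<open>sproj R k : M\<^sub>k \<rightarrow> S\<^sub>k\<close> and \<open>sincl R k : S\<^sub>k\<^sub>+\<^sub>1 \<rightarrow> M\<^sub>k\<close>.\<close>

record 'a resolution =
  rdiff :: "nat \<Rightarrow> 'a"
  sproj :: "nat \<Rightarrow> 'a"
  sincl :: "nat \<Rightarrow> 'a"

definition projective_resolution :: "('o, 'a) category \<Rightarrow> 'o \<Rightarrow> 'a resolution \<Rightarrow> bool" where
  "projective_resolution C M R \<longleftrightarrow>
     (\<forall>k. projective C (Dom C (rdiff R k))) \<and>
     Cod C (rdiff R 0) = M \<and> is_epi C (rdiff R 0) \<and>
     (\<forall>k. exact_at C (rdiff R (Suc k)) (rdiff R k)) \<and>
     sproj R 0 = rdiff R 0 \<and>
     (\<forall>k. is_kernel C (sproj R k) (sincl R k)) \<and>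
     (\<forall>k. sproj R (Suc k) \<in> Hom C (Dom C (rdiff R (Suc k))) (Dom C (sincl R k)) \<and>
          sincl R k \<cdot>\<^bsub>C\<^esub> sproj R (Suc k) = rdiff R (Suc k))"

text \<open>\<open>kernel_lift C i p j q f fs\<close>: for sequences \<open>0 \<rightarrow> K \<rightarrow> P \<rightarrow> M\<close> (maps \<open>i\<close>, \<open>p\<close>) and
  \<open>0 \<rightarrow> L \<rightarrow> Q \<rightarrow> N\<close> (maps \<open>j\<close>, \<open>q\<close>), the arrow \<open>fs : K \<rightarrow> L\<close> is induced by some lift
  \<open>P \<rightarrow> Q\<close> of \<open>f : M \<rightarrow> N\<close>.\<close>

definition kernel_lift ::
  "('o, 'a) category \<Rightarrow> 'a \<Rightarrow> 'a \<Rightarrow> 'a \<Rightarrow> 'a \<Rightarrow> 'a \<Rightarrow> 'a \<Rightarrow> bool" where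
  "kernel_lift C i p j q f fs \<longleftrightarrow>
     (\<exists>h\<in>Hom C (Dom C p) (Dom C q). q \<cdot>\<^bsub>C\<^esub> h = f \<cdot>\<^bsub>C\<^esub> p \<and>
        fs \<in> Hom C (Dom C i) (Dom C j) \<and> j \<cdot>\<^bsub>C\<^esub> fs = h \<cdot>\<^bsub>C\<^esub> i)"

definition syzygy_lift ::
  "('o, 'a) category \<Rightarrow> 'a resolution \<Rightarrow> 'a resolution \<Rightarrow> 'a \<Rightarrow> (nat \<Rightarrow> 'a) \<Rightarrow> bool" where
  "syzygy_lift C R R' f ft \<longleftrightarrow> ft 0 = f \<and>
     (\<forall>k. kernel_lift C (sincl R k) (sproj R k) (sincl R' k) (sproj R' k) (ft k) (ft (Suc k)))"

text \<open>A resolution \<open>RB\<close> of the middle term of the short exact sequence \<open>f\<close>, \<open>g\<close> as in the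
  Horseshoe Lemma, with \<open>RA\<close> and \<open>RC\<close> resolving the outer terms: \<open>a\<close>, \<open>b\<close> are the short exact
  sequences of projectives, \<open>sa\<close>, \<open>sb\<close> those of syzygies.\<close>

definition horseshoe ::
  "('o, 'a) category \<Rightarrow> 'a \<Rightarrow> 'a \<Rightarrow> 'a resolution \<Rightarrow> 'a resolution \<Rightarrow> 'a resolution \<Rightarrow>
    (nat \<Rightarrow> 'a) \<Rightarrow> (nat \<Rightarrow> 'a) \<Rightarrow> (nat \<Rightarrow> 'a) \<Rightarrow> (nat \<Rightarrow> 'a) \<Rightarrow> bool" where
  "horseshoe C f g RA RB RC a b sa sb \<longleftrightarrow>
     projective_resolution C (Dom C f) RA \<and> projective_resolution C (Cod C f) RB \<and>
     projective_resolution C (Cod C g) RC \<and> sa 0 = f \<and> sb 0 = g \<and>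
     (\<forall>k. short_exact C (a k) (b k) \<and> short_exact C (sa k) (sb k) \<and>
        a k \<in> Hom C (Dom C (sproj RA k)) (Dom C (sproj RB k)) \<and>
        b k \<in> Hom C (Dom C (sproj RB k)) (Dom C (sproj RC k)) \<and>
        sa k \<in> Hom C (Cod C (sproj RA k)) (Cod C (sproj RB k)) \<and>
        sb k \<in> Hom C (Cod C (sproj RB k)) (Cod C (sproj RC k)) \<and>
        sproj RB k \<cdot>\<^bsub>C\<^esub> a k = sa k \<cdot>\<^bsub>C\<^esub> sproj RA k \<and>
        sproj RC k \<cdot>\<^bsub>C\<^esub> b k = sb k \<cdot>\<^bsub>C\<^esub> sproj RB k \<and>
        sincl RB k \<cdot>\<^bsub>C\<^esub> sa (Suc k) = a k \<cdot>\<^bsub>C\<^esub> sincl RA k \<and>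
        sincl RC k \<cdot>\<^bsub>C\<^esub> sb (Suc k) = b k \<cdot>\<^bsub>C\<^esub> sincl RB k)"

text \<open>The objects chosen in the constructions: for every \<open>M\<close> in \<open>C\<close> a short exact sequence
  \<open>0 \<rightarrow> K \<rightarrow> P \<rightarrow> M \<rightarrow> 0\<close> with \<open>P\<close> projective (used for satellites) and a projective resolution,
  and in \<open>D\<close> a kernel of every arrow and a direct limit (object and legs) of every
  sequential system. These are arbitrary; they exist by the axiom of choice as soon as \<open>C\<close>
  has enough projectives and \<open>D\<close> has direct limits.\<close>

record ('o, 'a, 'p, 'b) choices =
  pincl :: "'o \<Rightarrow> 'a"
  pproj :: "'o \<Rightarrow> 'a"
  resn :: "'o \<Rightarrow> 'a resolution"
  kern :: "'b \<Rightarrow> 'b"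
  dlim :: "(nat \<Rightarrow> 'b) \<Rightarrow> 'p"
  dleg :: "(nat \<Rightarrow> 'b) \<Rightarrow> nat \<Rightarrow> 'b"

definition valid_choices ::
  "('o, 'a) category \<Rightarrow> ('p, 'b) category \<Rightarrow> ('o, 'a, 'p, 'b) choices \<Rightarrow> bool" where
  "valid_choices C D ch \<longleftrightarrow>
     (\<forall>M\<in>Obj C. short_exact C (pincl ch M) (pproj ch M) \<and> Cod C (pproj ch M) = M \<and>
        projective C (Dom C (pproj ch M)) \<and> projective_resolution C M (resn ch M)) \<and>
     (\<forall>f\<in>Arr D. is_kernel D f (kern ch f)) \<and>
     (\<forall>x. sequential D x \<longrightarrow> is_seq_limit D x (dlim ch x) (dleg ch x))"


section \<open>Left satellites and the satellite functor construction\<close>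

text \<open>Wherever a construction depends on a lift, the description
  \<open>THE u. \<forall>lift. \<dots> \<longrightarrow> u = \<dots>\<close> denotes the common value obtained from all lifts.\<close>

definition ker_factor :: "('o, 'a) category \<Rightarrow> 'a \<Rightarrow> 'a \<Rightarrow> 'a" where
  "ker_factor D k t = (THE s. s \<in> Hom D (Dom D t) (Dom D k) \<and> k \<cdot>\<^bsub>D\<^esub> s = t)"

definition sat_incl :: "('o, 'a, 'p, 'b) choices \<Rightarrow> ('o, 'a, 'p, 'b) fctr \<Rightarrow> 'o \<Rightarrow> 'b" where
  "sat_incl ch F M = kern ch (FAr F (pincl ch M))"

definition sat ::
  "('o, 'a) category \<Rightarrow> ('p, 'b) category \<Rightarrow> ('o, 'a, 'p, 'b) choices \<Rightarrow>
    ('o, 'a, 'p, 'b) fctr \<Rightarrow> ('o, 'a, 'p, 'b) fctr" where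
  "sat C D ch F =
     \<lparr>FOb = (\<lambda>M. Dom D (sat_incl ch F M)),
      FAr = (\<lambda>f. THE s. \<forall>fs.
        kernel_lift C (pincl ch (Dom C f)) (pproj ch (Dom C f))
          (pincl ch (Cod C f)) (pproj ch (Cod C f)) f fs \<longrightarrow>
        s = ker_factor D (sat_incl ch F (Cod C f)) (FAr F fs \<cdot>\<^bsub>D\<^esub> sat_incl ch F (Dom C f)))\<rparr>"

text \<open>\<open>S\<^sup>-\<^sup>k F\<close> is \<open>(sat C D ch ^^ k) F\<close>, and \<open>sat_trans C D ch F G k \<phi>\<close> is \<open>S\<^sup>-\<^sup>k \<phi>\<close>.\<close>

primrec sat_trans ::
  "('o, 'a) category \<Rightarrow> ('p, 'b) category \<Rightarrow> ('o, 'a, 'p, 'b) choices \<Rightarrow>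
    ('o, 'a, 'p, 'b) fctr \<Rightarrow> ('o, 'a, 'p, 'b) fctr \<Rightarrow> nat \<Rightarrow> ('o \<Rightarrow> 'b) \<Rightarrow> 'o \<Rightarrow> 'b" where
  "sat_trans C D ch F G 0 \<phi> = \<phi>"
| "sat_trans C D ch F G (Suc k) \<phi> = (\<lambda>M.
     ker_factor D (sat_incl ch ((sat C D ch ^^ k) G) M)
       (sat_trans C D ch F G k \<phi> (Dom C (pincl ch M)) \<cdot>\<^bsub>D\<^esub> sat_incl ch ((sat C D ch ^^ k) F) M))"

text \<open>\<open>sat_conn C D ch F k f g\<close> is \<open>\<epsilon>\<^sup>-\<^sup>k : S\<^sup>-\<^sup>k F(C) \<rightarrow> S\<^sup>-\<^sup>k\<^sup>+\<^sup>1 F(A)\<close>, meaningful for \<open>k \<ge> 1\<close>.\<close>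

definition sat_conn ::
  "('o, 'a) category \<Rightarrow> ('p, 'b) category \<Rightarrow> ('o, 'a, 'p, 'b) choices \<Rightarrow>
    ('o, 'a, 'p, 'b) fctr \<Rightarrow> nat \<Rightarrow> 'a \<Rightarrow> 'a \<Rightarrow> 'b" where
  "sat_conn C D ch F k f g =
     (let G = (sat C D ch ^^ (k - 1)) F; Q = Cod C g
      in THE e. \<forall>hs. kernel_lift C (pincl ch Q) (pproj ch Q) f g (Ident C Q) hs \<longrightarrow>
           e = FAr G hs \<cdot>\<^bsub>D\<^esub> sat_incl ch G Q)"

definition under_delta ::
  "('p, 'b) category \<Rightarrow> ('o, 'a, 'p, 'b) choices \<Rightarrow> ('o, 'a, 'p, 'b) cohom \<Rightarrow>
    int \<Rightarrow> 'o \<Rightarrow> 'b" where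
  "under_delta D ch T n M =
     ker_factor D (sat_incl ch (fn T (n + 1)) M) (conn T n (pincl ch M) (pproj ch M))"

definition sat_sys ::
  "('o, 'a) category \<Rightarrow> ('p, 'b) category \<Rightarrow> ('o, 'a, 'p, 'b) choices \<Rightarrow>
    ('o, 'a, 'p, 'b) cohom \<Rightarrow> int \<Rightarrow> 'o \<Rightarrow> nat \<Rightarrow> 'b" where
  "sat_sys C D ch T n M k =
     sat_trans C D ch (fn T (n + int k)) (sat C D ch (fn T (n + int k + 1))) k
       (under_delta D ch T (n + int k)) M"

definition satellite_construction ::
  "('o, 'a) category \<Rightarrow> ('p, 'b) category \<Rightarrow> ('o, 'a, 'p, 'b) choices \<Rightarrow>
    ('o, 'a, 'p, 'b) cohom \<Rightarrow> ('o, 'a, 'p, 'b) cohom" where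
  "satellite_construction C D ch T =
     (let L = (\<lambda>n M. dlim ch (sat_sys C D ch T n M));
          c = (\<lambda>n M. dleg ch (sat_sys C D ch T n M))
      in \<lparr>fn = (\<lambda>n. \<lparr>FOb = L n,
            FAr = (\<lambda>f. lim_map D UNIV (L n (Dom C f)) (c n (Dom C f)) (L n (Cod C f))
              (\<lambda>k. c n (Cod C f) k \<cdot>\<^bsub>D\<^esub> FAr ((sat C D ch ^^ k) (fn T (n + int k))) f))\<rparr>),
          conn = (\<lambda>n f g. lim_map D {1..} (L n (Cod C g)) (c n (Cod C g)) (L (n + 1) (Dom C f))
              (\<lambda>k. c (n + 1) (Dom C f) (k - 1) \<cdot>\<^bsub>D\<^esub> sat_conn C D ch (fn T (n + int k)) k f g))\<rparr>)"

definition satellite_canonical ::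
  "('o, 'a) category \<Rightarrow> ('p, 'b) category \<Rightarrow> ('o, 'a, 'p, 'b) choices \<Rightarrow>
    ('o, 'a, 'p, 'b) cohom \<Rightarrow> int \<Rightarrow> 'o \<Rightarrow> 'b" where
  "satellite_canonical C D ch T n M = dleg ch (sat_sys C D ch T n M) 0"


section \<open>The resolution construction and the comparison morphism\<close>

definition res_sys ::
  "('o, 'a, 'p, 'b) choices \<Rightarrow> ('o, 'a, 'p, 'b) cohom \<Rightarrow> int \<Rightarrow> 'o \<Rightarrow> nat \<Rightarrow> 'b" where
  "res_sys ch T n M k = conn T (n + int k) (sincl (resn ch M) k) (sproj (resn ch M) k)"

text \<open>\<open>signed D k f\<close> is \<open>(-1)\<^sup>k f\<close>.\<close>

definition signed :: "('o, 'a) category \<Rightarrow> nat \<Rightarrow> 'a \<Rightarrow> 'a" where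
  "signed D k f = (if even k then f else inv\<^bsub>hom_group D (Dom D f) (Cod D f)\<^esub> f)"

definition resolution_construction ::
  "('o, 'a) category \<Rightarrow> ('p, 'b) category \<Rightarrow> ('o, 'a, 'p, 'b) choices \<Rightarrow>
    ('o, 'a, 'p, 'b) cohom \<Rightarrow> ('o, 'a, 'p, 'b) cohom" where
  "resolution_construction C D ch T =
     (let L = (\<lambda>n M. dlim ch (res_sys ch T n M));
          c = (\<lambda>n M. dleg ch (res_sys ch T n M))
      in \<lparr>fn = (\<lambda>n. \<lparr>FOb = L n,
            FAr = (\<lambda>f. THE u. \<forall>ft.
              syzygy_lift C (resn ch (Dom C f)) (resn ch (Cod C f)) f ft \<longrightarrow>
              u = lim_map D UNIV (L n (Dom C f)) (c n (Dom C f)) (L n (Cod C f))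
                    (\<lambda>k. c n (Cod C f) k \<cdot>\<^bsub>D\<^esub> FAr (fn T (n + int k)) (ft k)))\<rparr>),
          conn = (\<lambda>n f g. THE u. \<forall>RB a b sa sb.
              horseshoe C f g (resn ch (Dom C f)) RB (resn ch (Cod C g)) a b sa sb \<longrightarrow>
              u = lim_map D UNIV (L n (Cod C g)) (c n (Cod C g)) (L (n + 1) (Dom C f))
                    (\<lambda>k. c (n + 1) (Dom C f) k \<cdot>\<^bsub>D\<^esub> signed D k (conn T (n + int k) (sa k) (sb k))))\<rparr>)"

text \<open>With \<open>F = T\<^sup>n\<^sup>+\<^sup>k\<close>, \<open>omega_part C D ch F M k j\<close> is
  \<open>\<epsilon>\<^sup>-\<^sup>(\<^sup>k\<^sup>-\<^sup>j\<^sup>+\<^sup>1\<^sup>) \<circ> \<cdots> \<circ> \<epsilon>\<^sup>-\<^sup>k : S\<^sup>-\<^sup>k F(M) \<rightarrow> S\<^sup>-\<^sup>(\<^sup>k\<^sup>-\<^sup>j\<^sup>) F(S\<^sub>j)\<close>, where \<open>S\<^sub>j\<close> is the \<open>j\<close>-th syzygy of \<open>M\<close>.\<close>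

primrec omega_part ::
  "('o, 'a) category \<Rightarrow> ('p, 'b) category \<Rightarrow> ('o, 'a, 'p, 'b) choices \<Rightarrow>
    ('o, 'a, 'p, 'b) fctr \<Rightarrow> 'o \<Rightarrow> nat \<Rightarrow> nat \<Rightarrow> 'b" where
  "omega_part C D ch F M k 0 = Ident D (FOb ((sat C D ch ^^ k) F) M)"
| "omega_part C D ch F M k (Suc j) =
     sat_conn C D ch F (k - j) (sincl (resn ch M) j) (sproj (resn ch M) j)
       \<cdot>\<^bsub>D\<^esub> omega_part C D ch F M k j"

definition omega ::
  "('o, 'a) category \<Rightarrow> ('p, 'b) category \<Rightarrow> ('o, 'a, 'p, 'b) choices \<Rightarrow>
    ('o, 'a, 'p, 'b) cohom \<Rightarrow> int \<Rightarrow> 'o \<Rightarrow> 'b" where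
  "omega C D ch T n M =
     lim_map D {1..} (dlim ch (sat_sys C D ch T n M)) (dleg ch (sat_sys C D ch T n M))
       (dlim ch (res_sys ch T n M))
       (\<lambda>k. dleg ch (res_sys ch T n M) k \<cdot>\<^bsub>D\<^esub> omega_part C D ch (fn T (n + int k)) M k k)"

end

theory Submission
  imports Defs
begin

text \<open>
  Two maps induced on syzygies by lifts of the same arrow differ by a map that factors through a
  projective, so they agree after composition with the next connecting homomorphism. Hence the
  limit along any projective resolution is the same object, lifts act on it without ambiguity, and
  it vanishes on projectives. For \<open>0 \<rightarrow> A \<rightarrow> B \<rightarrow> C \<rightarrow> 0\<close>, a splitting of the projectives in the
  horseshoe gives maps \<open>h\<^sub>k\<close> from the \<open>(k+1)\<close>-st syzygy of \<open>C\<close> to the \<open>k\<close>-th syzygy of \<open>A\<close>, with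
  \<open>h\<^sub>k\<^sub>+\<^sub>1\<close> induced by a lift of \<open>-h\<^sub>k\<close>. Thus \<open>(-1)\<^sup>k h\<^sub>k\<close> is a chain of lifts of \<open>h\<^sub>0\<close>, and the
  connecting homomorphism with its signs is the dimension shift followed by the map induced by
  \<open>h\<^sub>0\<close>. This formula makes it well defined and natural; the long exact sequence is a direct limit
  of those of \<open>T\<close>.

  Each \<open>\<epsilon>\<^sup>-\<^sup>1 \<circ> \<cdots> \<circ> \<epsilon>\<^sup>-\<^sup>k\<close> is mono, and the transition maps of the resolution system factor through
  it, so the two systems interleave and \<open>\<omega>\<close> is an isomorphism. The satellite construction is
  therefore a cohomological functor by transport of structure.

  For the universal property, the resolution construction is functorial in \<open>T\<close> and does not change
  a cohomological functor that vanishes on projectives. Uniqueness follows by dimension shifting,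
  since every leg of the limit is reached from the zeroth leg of a syzygy.
\<close>

section \<open>Abelian categories\<close>

text \<open>Two obstacles shape the proof. The limits are fixed along the chosen resolutions only,
  whereas the middle resolution of a horseshoe and the shifted resolution of a syzygy are not chosen
  ones; \<open>rleg\<close> therefore exhibits the fixed object \<open>lob n M\<close> as a limit
  along every resolution of \<open>M\<close>. Moreover, lifts are determined only up to arrows that
  factor through projectives. Once the limit functor is known to vanish on projectives it cannot see
  this ambiguity, and naturality of the connecting homomorphism becomes a comparison of two lifts of
  one arrow.

  The satellite of any additive functor vanishes on projectives. So in the composite defining
  \<open>omega\<close> every factor except the one applied last is an isomorphism, and the last one
  is the kernel of the arrow that \<open>F\<close> assigns to an inclusion of syzygies. Connecting
  homomorphisms land in that kernel, which is why transition maps factor through the whole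
  composite.

  Diagram chases use no elements: exactness is tested on arbitrary arrows, and a preimage may be
  taken after composition with an epi.\<close>

lemma Hom_iff [simp]: "f \<in> Hom C A B \<longleftrightarrow> f \<in> Arr C \<and> Dom C f = A \<and> Cod C f = B"
  by (auto simp: Hom_def)

text \<open>Domain and codomain are read off the arrow, exactly as in \<open>signed\<close>, so that
  \<open>signed D k f\<close> unfolds to \<open>neg D f\<close> for odd \<open>k\<close>.\<close>

definition neg :: "('o, 'a) category \<Rightarrow> 'a \<Rightarrow> 'a" where
  "neg C f = inv\<^bsub>hom_group C (Dom C f) (Cod C f)\<^esub> f"

definition sub :: "('o, 'a) category \<Rightarrow> 'a \<Rightarrow> 'a \<Rightarrow> 'a" where
  "sub C f g = Plus C f (neg C g)"

locale abelian =
  fixes C :: "('o, 'a) category" (structure)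
  assumes abelian: "abelian_category C"
begin

lemma preadditive: "preadditive C" and category: "is_category C"
  using abelian by (auto simp: abelian_category_def preadditive_def)

section \<open>Typing of arrows and the additive calculus\<close>

lemma Dom_Obj [simp]: "f \<in> Arr C \<Longrightarrow> Dom C f \<in> Obj C"
  and Cod_Obj [simp]: "f \<in> Arr C \<Longrightarrow> Cod C f \<in> Obj C"
  using category by (auto simp: is_category_def)

lemma Ident_simps [simp]:
  assumes "A \<in> Obj C"
  shows "Ident C A \<in> Arr C" "Dom C (Ident C A) = A" "Cod C (Ident C A) = A"
  using category assms by (auto simp: is_category_def)

lemma comp_simps [simp]:
  assumes "f \<in> Arr C" "g \<in> Arr C" "Cod C f = Dom C g"
  shows "g \<cdot> f \<in> Arr C" "Dom C (g \<cdot> f) = Dom C f" "Cod C (g \<cdot> f) = Cod C g"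
proof -
  have "g \<cdot> f \<in> Hom C (Dom C f) (Cod C g)"
    using category assms unfolding is_category_def by (metis Hom_iff)
  then show "g \<cdot> f \<in> Arr C" "Dom C (g \<cdot> f) = Dom C f" "Cod C (g \<cdot> f) = Cod C g" by auto
qed

lemma comp_Ident [simp]:
  "f \<in> Arr C \<Longrightarrow> Dom C f = A \<Longrightarrow> f \<cdot> Ident C A = f"
  "f \<in> Arr C \<Longrightarrow> Cod C f = A \<Longrightarrow> Ident C A \<cdot> f = f"
  using category unfolding is_category_def by (metis Hom_iff)+

lemma assoc [simp]:
  assumes "f \<in> Arr C" "g \<in> Arr C" "h \<in> Arr C" "Cod C f = Dom C g" "Cod C g = Dom C h"
  shows "(h \<cdot> g) \<cdot> f = h \<cdot> (g \<cdot> f)"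
  using category assms unfolding is_category_def by (metis Hom_iff)

text \<open>As \<open>assoc\<close> nests composites to the right, a known product
  \<open>g \<cdot> f\<close> is hidden in \<open>g \<cdot> (f \<cdot> x)\<close>; this rule makes
  the rewrite available there.\<close>

lemma reassoc:
  assumes "g \<cdot> f = r" "f \<in> Arr C" "g \<in> Arr C" "x \<in> Arr C" "Cod C x = Dom C f" "Cod C f = Dom C g"
  shows "g \<cdot> (f \<cdot> x) = r \<cdot> x"
  using assms by (metis assoc)

lemma hom_comm_group: "A \<in> Obj C \<Longrightarrow> B \<in> Obj C \<Longrightarrow> comm_group (hom_group C A B)"
  using preadditive by (auto simp: preadditive_def)

lemma hom_group_simps [simp]:
  "carrier (hom_group C A B) = Hom C A B" "mult (hom_group C A B) = Plus C" "one (hom_group C A B) = Zero C A B"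
  by (auto simp: hom_group_def)

lemma Zero_simps [simp]:
  assumes "A \<in> Obj C" "B \<in> Obj C"
  shows "Zero C A B \<in> Arr C" "Dom C (Zero C A B) = A" "Cod C (Zero C A B) = B"
  using monoid.one_closed[OF group.is_monoid[OF comm_group.axioms(2)[OF hom_comm_group[OF assms]]]] by auto

lemma Plus_simps [simp]:
  assumes "f \<in> Arr C" "g \<in> Arr C" "Dom C g = Dom C f" "Cod C g = Cod C f"
  shows "Plus C f g \<in> Arr C" "Dom C (Plus C f g) = Dom C f" "Cod C (Plus C f g) = Cod C f"
  using monoid.m_closed[OF group.is_monoid[OF comm_group.axioms(2)[OF hom_comm_group]], of "Dom C f" "Cod C f" f g] assms by auto

lemma neg_simps [simp]:
  assumes "f \<in> Arr C"
  shows "neg C f \<in> Arr C" "Dom C (neg C f) = Dom C f" "Cod C (neg C f) = Cod C f"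
  using group.inv_closed[OF comm_group.axioms(2)[OF hom_comm_group], of "Dom C f" "Cod C f" f] assms
  by (auto simp: neg_def)

lemma Plus_Zero [simp]:
  assumes "f \<in> Arr C" "Dom C f = A" "Cod C f = B"
  shows "Plus C f (Zero C A B) = f" "Plus C (Zero C A B) f = f"
  using monoid.r_one[OF group.is_monoid[OF comm_group.axioms(2)[OF hom_comm_group]], of A B f]
    monoid.l_one[OF group.is_monoid[OF comm_group.axioms(2)[OF hom_comm_group]], of A B f] assms by auto

lemma Plus_neg [simp]:
  assumes "f \<in> Arr C"
  shows "Plus C f (neg C f) = Zero C (Dom C f) (Cod C f)" "Plus C (neg C f) f = Zero C (Dom C f) (Cod C f)"
  using group.r_inv[OF comm_group.axioms(2)[OF hom_comm_group], of "Dom C f" "Cod C f" f]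
   group.l_inv[OF comm_group.axioms(2)[OF hom_comm_group], of "Dom C f" "Cod C f" f] assms
  by (auto simp: neg_def)

lemma comp_Plus [simp]:
  assumes "f \<in> Arr C" "g \<in> Arr C" "Dom C g = Dom C f" "Cod C g = Cod C f" "h \<in> Arr C" "Cod C f = Dom C h"
  shows "h \<cdot> Plus C f g = Plus C (h \<cdot> f) (h \<cdot> g)"
  using preadditive assms unfolding preadditive_def by (metis Hom_iff)

lemma Plus_comp [simp]:
  assumes "f \<in> Arr C" "g \<in> Arr C" "Dom C g = Dom C f" "Cod C g = Cod C f" "h \<in> Arr C" "Cod C h = Dom C f"
  shows "Plus C f g \<cdot> h = Plus C (f \<cdot> h) (g \<cdot> h)"
  using preadditive assms unfolding preadditive_def by (metis Hom_iff)

lemma Plus_cancel: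
  assumes "f \<in> Arr C" "g \<in> Arr C" "h \<in> Arr C" "Dom C g = Dom C f" "Cod C g = Cod C f" "Dom C h = Dom C f" "Cod C h = Cod C f"
    and "Plus C f g = Plus C f h"
  shows "g = h"
  using monoid.Units_l_cancel[OF group.is_monoid[OF comm_group.axioms(2)[OF hom_comm_group]], of "Dom C f" "Cod C f" f g h]
    group.Units_eq[OF comm_group.axioms(2)[OF hom_comm_group], of "Dom C f" "Cod C f"] assms by auto

lemma Plus_self_Zero:
  assumes "f \<in> Arr C" "Plus C f f = f"
  shows "f = Zero C (Dom C f) (Cod C f)"
  using Plus_cancel[of f f "Zero C (Dom C f) (Cod C f)"] assms by auto

lemma comp_Zero [simp]:
  assumes "f \<in> Arr C" "A \<in> Obj C" "Dom C f = B"
  shows "f \<cdot> Zero C A B = Zero C A (Cod C f)"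
proof -
  have "Plus C (f \<cdot> Zero C A B) (f \<cdot> Zero C A B) = f \<cdot> Plus C (Zero C A B) (Zero C A B)"
    using assms by (subst comp_Plus) auto
  then show ?thesis using Plus_self_Zero[of "f \<cdot> Zero C A B"] assms by auto
qed

lemma Zero_comp [simp]:
  assumes "f \<in> Arr C" "B \<in> Obj C" "Cod C f = A"
  shows "Zero C A B \<cdot> f = Zero C (Dom C f) B"
proof -
  have "Plus C (Zero C A B \<cdot> f) (Zero C A B \<cdot> f) = Plus C (Zero C A B) (Zero C A B) \<cdot> f"
    using assms by (subst Plus_comp) auto
  then show ?thesis using Plus_self_Zero[of "Zero C A B \<cdot> f"] assms by auto
qed

lemma Plus_eq_Zero:
  assumes "f \<in> Arr C" "g \<in> Arr C" "Dom C g = Dom C f" "Cod C g = Cod C f"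
    and "Plus C f g = Zero C (Dom C f) (Cod C f)"
  shows "g = neg C f"
  by (rule Plus_cancel[of f]) (use assms in auto)

lemma neg_neg [simp]: "f \<in> Arr C \<Longrightarrow> neg C (neg C f) = f"
  by (rule Plus_eq_Zero[symmetric]) auto

lemma neg_Zero [simp]: "A \<in> Obj C \<Longrightarrow> B \<in> Obj C \<Longrightarrow> neg C (Zero C A B) = Zero C A B"
  by (rule Plus_eq_Zero[symmetric]) auto

lemma comp_neg [simp]:
  assumes "f \<in> Arr C" "h \<in> Arr C" "Cod C f = Dom C h"
  shows "h \<cdot> neg C f = neg C (h \<cdot> f)"
  by (rule Plus_eq_Zero) (use assms comp_Plus[of f "neg C f" h] in auto)

lemma neg_comp [simp]:
  assumes "f \<in> Arr C" "h \<in> Arr C" "Cod C h = Dom C f"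
  shows "neg C f \<cdot> h = neg C (f \<cdot> h)"
  by (rule Plus_eq_Zero) (use assms Plus_comp[of f "neg C f" h] in auto)

lemma sub_simps [simp]:
  assumes "f \<in> Arr C" "g \<in> Arr C" "Dom C g = Dom C f" "Cod C g = Cod C f"
  shows "sub C f g \<in> Arr C" "Dom C (sub C f g) = Dom C f" "Cod C (sub C f g) = Cod C f"
  using assms by (auto simp: sub_def)

lemma comp_sub [simp]:
  assumes "f \<in> Arr C" "g \<in> Arr C" "Dom C g = Dom C f" "Cod C g = Cod C f" "h \<in> Arr C" "Cod C f = Dom C h"
  shows "h \<cdot> sub C f g = sub C (h \<cdot> f) (h \<cdot> g)"
  using assms by (auto simp: sub_def)

lemma sub_comp [simp]:
  assumes "f \<in> Arr C" "g \<in> Arr C" "Dom C g = Dom C f" "Cod C g = Cod C f" "h \<in> Arr C" "Cod C h = Dom C f"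
  shows "sub C f g \<cdot> h = sub C (f \<cdot> h) (g \<cdot> h)"
  using assms by (auto simp: sub_def)

lemma sub_self [simp]: "f \<in> Arr C \<Longrightarrow> sub C f f = Zero C (Dom C f) (Cod C f)"
  by (auto simp: sub_def)

lemma sub_Zero [simp]:
  assumes "f \<in> Arr C" "Dom C f = A" "Cod C f = B"
  shows "sub C f (Zero C A B) = f" "sub C (Zero C A B) f = neg C f"
  using assms by (auto simp: sub_def)

lemma sub_eq_Zero:
  assumes "f \<in> Arr C" "g \<in> Arr C" "Dom C g = Dom C f" "Cod C g = Cod C f"
  shows "sub C f g = Zero C (Dom C f) (Cod C f) \<longleftrightarrow> f = g"
  using assms Plus_eq_Zero[of f "neg C g"] neg_neg[of f] neg_neg[of g] by (metis neg_simps sub_def Plus_neg(1))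

section \<open>Monomorphisms and epimorphisms\<close>

lemma is_monoD:
  assumes "is_mono C f" "g \<in> Arr C" "h \<in> Arr C" "Cod C g = Dom C f" "Cod C h = Dom C f" "f \<cdot> g = f \<cdot> h"
  shows "g = h"
proof -
  have "f \<in> Arr C" using assms by (auto simp: is_mono_def)
  then have "Dom C g = Dom C h" using assms by (metis comp_simps(2))
  then show ?thesis using assms unfolding is_mono_def by (metis Hom_iff)
qed

lemma is_epiD:
  assumes "is_epi C f" "g \<in> Arr C" "h \<in> Arr C" "Dom C g = Cod C f" "Dom C h = Cod C f" "g \<cdot> f = h \<cdot> f"
  shows "g = h"
proof -
  have "f \<in> Arr C" using assms by (auto simp: is_epi_def)
  then have "Cod C g = Cod C h" using assms by (metis comp_simps(3))
  then show ?thesis using assms unfolding is_epi_def by (metis Hom_iff)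
qed

lemma mono_Arr [simp]: "is_mono C f \<Longrightarrow> f \<in> Arr C" and epi_Arr [simp]: "is_epi C f \<Longrightarrow> f \<in> Arr C"
  by (auto simp: is_mono_def is_epi_def)

text \<open>The test is applied to the difference of two arrows, which is zero only if they
  agree.\<close>

lemma monoI:
  assumes f: "f \<in> Arr C" "Dom C f = A" "Cod C f = B"
    and z: "\<And>x X. x \<in> Arr C \<Longrightarrow> Dom C x = X \<Longrightarrow> Cod C x = A \<Longrightarrow> f \<cdot> x = Zero C X B \<Longrightarrow> x = Zero C X A"
  shows "is_mono C f"
  unfolding is_mono_def
proof (intro conjI allI ballI impI f)
  fix X g h assume a: "g \<in> Hom C X (Dom C f)" "h \<in> Hom C X (Dom C f)" "f \<cdot> g = f \<cdot> h"
  have "f \<cdot> sub C g h = Zero C X B" using a f by (auto simp: sub_eq_Zero)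
  then show "g = h" using z[of "sub C g h" X] sub_eq_Zero[of g h] a f by auto
qed

lemma epiI:
  assumes f: "f \<in> Arr C" "Dom C f = A" "Cod C f = B"
    and z: "\<And>x X. x \<in> Arr C \<Longrightarrow> Dom C x = B \<Longrightarrow> Cod C x = X \<Longrightarrow> x \<cdot> f = Zero C A X \<Longrightarrow> x = Zero C B X"
  shows "is_epi C f"
  unfolding is_epi_def
proof (intro conjI allI ballI impI f)
  fix X g h assume a: "g \<in> Hom C (Cod C f) X" "h \<in> Hom C (Cod C f) X" "g \<cdot> f = h \<cdot> f"
  have "sub C g h \<cdot> f = Zero C A X" using a f by (auto simp: sub_eq_Zero)
  then show "g = h" using z[of "sub C g h" X] sub_eq_Zero[of g h] a f by auto
qed

lemma mono_ZeroD:
  assumes "is_mono C f" "x \<in> Arr C" "Dom C x = X" "Cod C x = A" "Dom C f = A" "Cod C f = B" "f \<cdot> x = Zero C X B"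
  shows "x = Zero C X A"
proof -
  have "f \<in> Arr C" using assms(1) by simp
  then have "A \<in> Obj C" "X \<in> Obj C" using assms by auto
  then show ?thesis using assms \<open>f \<in> Arr C\<close> is_monoD[OF assms(1), of x "Zero C X A"] by auto
qed

lemma epi_ZeroD:
  assumes "is_epi C f" "x \<in> Arr C" "Dom C x = B" "Cod C x = X" "Cod C f = B" "Dom C f = A" "x \<cdot> f = Zero C A X"
  shows "x = Zero C B X"
proof -
  have "f \<in> Arr C" using assms(1) by simp
  then have "B \<in> Obj C" "X \<in> Obj C" using assms by auto
  then show ?thesis using assms \<open>f \<in> Arr C\<close> is_epiD[OF assms(1), of x "Zero C B X"] by auto
qed

lemma mono_comp:
  assumes "is_mono C f" "is_mono C g" "Cod C f = Dom C g"
  shows "is_mono C (g \<cdot> f)"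
proof (rule monoI[OF _ refl refl])
  fix x X assume x: "x \<in> Arr C" "Dom C x = X" "Cod C x = Dom C (g \<cdot> f)" "(g \<cdot> f) \<cdot> x = Zero C X (Cod C (g \<cdot> f))"
  have fg: "f \<in> Arr C" "g \<in> Arr C" using assms by auto
  have "f \<cdot> x = Zero C X (Cod C f)" by (rule mono_ZeroD[OF assms(2), where B="Cod C g"]) (use x fg assms(3) in auto)
  then show "x = Zero C X (Dom C (g \<cdot> f))" using mono_ZeroD[OF assms(1)] x fg assms(3) by auto
qed (use assms in auto)

lemma epi_comp:
  assumes "is_epi C f" "is_epi C g" "Cod C f = Dom C g"
  shows "is_epi C (g \<cdot> f)"
proof (rule epiI[OF _ refl refl])
  fix x X assume x: "x \<in> Arr C" "Dom C x = Cod C (g \<cdot> f)" "Cod C x = X" "x \<cdot> (g \<cdot> f) = Zero C (Dom C (g \<cdot> f)) X"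
  have fg: "f \<in> Arr C" "g \<in> Arr C" using assms by auto
  have "x \<cdot> g = Zero C (Dom C g) X" by (rule epi_ZeroD[OF assms(1), where A="Dom C f"]) (use x fg assms(3) in auto)
  then show "x = Zero C (Cod C (g \<cdot> f)) X" using epi_ZeroD[OF assms(2)] x fg assms(3) by auto
qed (use assms in auto)

lemma mono_cancel:
  assumes "is_mono C (g \<cdot> f)" "f \<in> Arr C" "g \<in> Arr C" "Cod C f = Dom C g"
  shows "is_mono C f"
proof (rule monoI[OF assms(2) refl refl])
  fix x X assume x: "x \<in> Arr C" "Dom C x = X" "Cod C x = Dom C f" "f \<cdot> x = Zero C X (Cod C f)"
  show "x = Zero C X (Dom C f)"
    by (rule mono_ZeroD[OF assms(1), where B="Cod C g"]) (use x assms(2-) in auto)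
qed

lemma epi_cancel:
  assumes "is_epi C (g \<cdot> f)" "f \<in> Arr C" "g \<in> Arr C" "Cod C f = Dom C g"
  shows "is_epi C g"
proof (rule epiI[OF assms(3) refl refl])
  fix x X assume x: "x \<in> Arr C" "Dom C x = Cod C g" "Cod C x = X" "x \<cdot> g = Zero C (Dom C g) X"
  show "x = Zero C (Cod C g) X"
    by (rule epi_ZeroD[OF assms(1), where A="Dom C f"]) (use x assms(2-) reassoc[OF x(4), of f] in auto)
qed

lemma epi_Ident [simp]: "A \<in> Obj C \<Longrightarrow> is_epi C (Ident C A)" and mono_Ident [simp]: "A \<in> Obj C \<Longrightarrow> is_mono C (Ident C A)"
  by (rule epiI[OF _ refl refl] monoI[OF _ refl refl]; simp)+

section \<open>Kernels and cokernels\<close>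

lemma kernel_simps:
  assumes "is_kernel C f k"
  shows "f \<in> Arr C" "k \<in> Arr C" "Cod C k = Dom C f" "f \<cdot> k = Zero C (Dom C k) (Cod C f)"
  using assms by (auto simp: is_kernel_def)

lemma cokernel_simps:
  assumes "is_cokernel C f c"
  shows "f \<in> Arr C" "c \<in> Arr C" "Dom C c = Cod C f" "c \<cdot> f = Zero C (Dom C f) (Cod C c)"
  using assms by (auto simp: is_cokernel_def)

lemma kernel_factor:
  assumes "is_kernel C f k" "t \<in> Arr C" "Cod C t = Dom C f" "f \<cdot> t = Zero C (Dom C t) (Cod C f)"
  obtains s where "s \<in> Arr C" "Dom C s = Dom C t" "Cod C s = Dom C k" "k \<cdot> s = t"
  using assms unfolding is_kernel_def by (metis Hom_iff)

lemma cokernel_factor: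
  assumes "is_cokernel C f c" "t \<in> Arr C" "Dom C t = Cod C f" "t \<cdot> f = Zero C (Dom C f) (Cod C t)"
  obtains s where "s \<in> Arr C" "Dom C s = Cod C c" "Cod C s = Cod C t" "s \<cdot> c = t"
  using assms unfolding is_cokernel_def by (metis Hom_iff)

lemma kernel_mono: assumes "is_kernel C f k" shows "is_mono C k"
proof (rule monoI[OF _ refl refl])
  note k = kernel_simps[OF assms]
  fix x X assume x: "x \<in> Arr C" "Dom C x = X" "Cod C x = Dom C k" "k \<cdot> x = Zero C X (Cod C k)"
  have z: "Zero C X (Dom C f) \<in> Hom C X (Dom C f)" "f \<cdot> Zero C X (Dom C f) = Zero C X (Cod C f)"
    "Zero C X (Dom C k) \<in> Hom C X (Dom C k)" "k \<cdot> Zero C X (Dom C k) = Zero C X (Dom C f)"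
    using k x by auto
  have "\<exists>!s. s \<in> Hom C X (Dom C k) \<and> k \<cdot> s = Zero C X (Dom C f)"
    using assms z unfolding is_kernel_def by blast
  moreover have "x \<in> Hom C X (Dom C k)" "k \<cdot> x = Zero C X (Dom C f)" using x k by auto
  ultimately show "x = Zero C X (Dom C k)" using z by blast
qed (use kernel_simps[OF assms] in auto)

lemma cokernel_epi: assumes "is_cokernel C f c" shows "is_epi C c"
proof (rule epiI[OF _ refl refl])
  note k = cokernel_simps[OF assms]
  fix x X assume x: "x \<in> Arr C" "Dom C x = Cod C c" "Cod C x = X" "x \<cdot> c = Zero C (Dom C c) X"
  have z: "Zero C (Cod C f) X \<in> Hom C (Cod C f) X" "Zero C (Cod C f) X \<cdot> f = Zero C (Dom C f) X"
    "Zero C (Cod C c) X \<in> Hom C (Cod C c) X" "Zero C (Cod C c) X \<cdot> c = Zero C (Cod C f) X"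
    using k x by auto
  have "\<exists>!s. s \<in> Hom C (Cod C c) X \<and> s \<cdot> c = Zero C (Cod C f) X"
    using assms z unfolding is_cokernel_def by blast
  moreover have "x \<in> Hom C (Cod C c) X" "x \<cdot> c = Zero C (Cod C f) X" using x k by auto
  ultimately show "x = Zero C (Cod C c) X" using z by blast
qed (use cokernel_simps[OF assms] in auto)

lemma kernelI:
  assumes "is_mono C k" "f \<in> Arr C" "Cod C k = Dom C f" "f \<cdot> k = Zero C (Dom C k) (Cod C f)"
    and "\<And>t. t \<in> Arr C \<Longrightarrow> Cod C t = Dom C f \<Longrightarrow> f \<cdot> t = Zero C (Dom C t) (Cod C f) \<Longrightarrow>
       \<exists>s. s \<in> Arr C \<and> Dom C s = Dom C t \<and> Cod C s = Dom C k \<and> k \<cdot> s = t"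
  shows "is_kernel C f k"
  unfolding is_kernel_def
proof (intro conjI allI ballI impI)
  fix X t assume "t \<in> Hom C X (Dom C f)" "f \<cdot> t = Zero C X (Cod C f)"
  then show "\<exists>!s. s \<in> Hom C X (Dom C k) \<and> k \<cdot> s = t"
    using assms(5)[of t] is_monoD[OF assms(1)] by (intro ex_ex1I) auto
qed (use assms in auto)

lemma cokernelI:
  assumes "is_epi C c" "f \<in> Arr C" "Dom C c = Cod C f" "c \<cdot> f = Zero C (Dom C f) (Cod C c)"
    and "\<And>t. t \<in> Arr C \<Longrightarrow> Dom C t = Cod C f \<Longrightarrow> t \<cdot> f = Zero C (Dom C f) (Cod C t) \<Longrightarrow>
       \<exists>s. s \<in> Arr C \<and> Dom C s = Cod C c \<and> Cod C s = Cod C t \<and> s \<cdot> c = t"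
  shows "is_cokernel C f c"
  unfolding is_cokernel_def
proof (intro conjI allI ballI impI)
  fix X t assume "t \<in> Hom C (Cod C f) X" "t \<cdot> f = Zero C (Dom C f) X"
  then show "\<exists>!s. s \<in> Hom C (Cod C c) X \<and> s \<cdot> c = t"
    using assms(5)[of t] is_epiD[OF assms(1)] by (intro ex_ex1I) auto
qed (use assms in auto)

lemma ex_kernel: assumes "f \<in> Arr C" obtains k where "is_kernel C f k"
  using abelian assms by (auto simp: abelian_category_def)

lemma ex_cokernel: assumes "f \<in> Arr C" obtains k where "is_cokernel C f k"
  using abelian assms by (auto simp: abelian_category_def)

text \<open>The epi is the cokernel of some \<open>g\<close>, and \<open>g\<close> factors through
  the kernel \<open>k\<close>; whatever kills \<open>k\<close> thus kills \<open>g\<close> and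
  factors through \<open>f\<close>.\<close>

lemma epi_cokernel:
  assumes "is_epi C f" "is_kernel C f k"
  shows "is_cokernel C k f"
proof -
  obtain g where g: "is_cokernel C g f" using abelian assms by (auto simp: abelian_category_def)
  note gs = cokernel_simps[OF g] and ks = kernel_simps[OF assms(2)]
  obtain s where s: "s \<in> Arr C" "Dom C s = Dom C g" "Cod C s = Dom C k" "k \<cdot> s = g"
    using kernel_factor[OF assms(2), of g] gs by auto
  show ?thesis
  proof (rule cokernelI)
    fix t assume t: "t \<in> Arr C" "Dom C t = Cod C k" "t \<cdot> k = Zero C (Dom C k) (Cod C t)"
    have "t \<cdot> (k \<cdot> s) = Zero C (Dom C g) (Cod C t)" using reassoc[OF t(3), of s] t s(1-3) ks by simp
    then have "t \<cdot> g = Zero C (Dom C g) (Cod C t)" by (simp add: s(4))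
    then show "\<exists>s. s \<in> Arr C \<and> Dom C s = Cod C f \<and> Cod C s = Cod C t \<and> s \<cdot> f = t"
      using cokernel_factor[OF g, of t] t gs ks by metis
  qed (use assms gs ks in auto)
qed

text \<open>Dual to \<open>epi_cokernel\<close>.\<close>

lemma mono_kernel:
  assumes "is_mono C f" "is_cokernel C f c"
  shows "is_kernel C c f"
proof -
  obtain g where g: "is_kernel C g f" using abelian assms by (auto simp: abelian_category_def)
  note gs = kernel_simps[OF g] and ks = cokernel_simps[OF assms(2)]
  obtain s where s: "s \<in> Arr C" "Dom C s = Cod C c" "Cod C s = Cod C g" "s \<cdot> c = g"
    using cokernel_factor[OF assms(2), of g] gs by auto
  show ?thesis
  proof (rule kernelI)
    fix t assume t: "t \<in> Arr C" "Cod C t = Dom C c" "c \<cdot> t = Zero C (Dom C t) (Cod C c)"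
    have "(s \<cdot> c) \<cdot> t = Zero C (Dom C t) (Cod C g)" using t s(1-3) ks by simp
    then have "g \<cdot> t = Zero C (Dom C t) (Cod C g)" by (simp add: s(4))
    then show "\<exists>s. s \<in> Arr C \<and> Dom C s = Dom C t \<and> Cod C s = Dom C f \<and> f \<cdot> s = t"
      using kernel_factor[OF g, of t] t gs ks by metis
  qed (use assms gs ks in auto)
qed

section \<open>Pullbacks of epimorphisms, images and exactness\<close>

lemma biproduct:
  assumes "A \<in> Obj C" "B \<in> Obj C"
  obtains S i1 i2 p1 p2 where "S \<in> Obj C" "is_biproduct C A B S i1 i2 p1 p2"
proof -
  obtain S i1 i2 p1 p2 where b: "is_biproduct C A B S i1 i2 p1 p2"
    using abelian assms unfolding abelian_category_def by blast
  then have "S \<in> Obj C" by (auto simp: is_biproduct_def)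
  then show ?thesis using b that by blast
qed

text \<open>Since \<open>e\<close> is epi, so is \<open>e p\<^sub>1 - t p\<^sub>2\<close>, hence it is the cokernel of its kernel, the pullback.\<close>

lemma epi_pullback:
  assumes e: "is_epi C e" and t: "t \<in> Arr C" "Cod C t = Cod C e"
  obtains e' s where "is_epi C e'" "Cod C e' = Dom C t" "s \<in> Arr C" "Dom C s = Dom C e'" "Cod C s = Dom C e"
    "e \<cdot> s = t \<cdot> e'"
proof -
  obtain S i1 i2 p1 p2 where S: "S \<in> Obj C" and b: "is_biproduct C (Dom C e) (Dom C t) S i1 i2 p1 p2"
    by (rule biproduct[of "Dom C e" "Dom C t"]) (use e t in auto)
  have i: "i1 \<in> Arr C" "i2 \<in> Arr C" "p1 \<in> Arr C" "p2 \<in> Arr C"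
    "Dom C i1 = Dom C e" "Cod C i1 = S" "Dom C i2 = Dom C t" "Cod C i2 = S"
    "Dom C p1 = S" "Dom C p2 = S" "Cod C p1 = Dom C e" "Cod C p2 = Dom C t"
    "p1 \<cdot> i1 = Ident C (Dom C e)" "p2 \<cdot> i2 = Ident C (Dom C t)"
    "p2 \<cdot> i1 = Zero C (Dom C e) (Dom C t)" "p1 \<cdot> i2 = Zero C (Dom C t) (Dom C e)"
    using b by (auto simp: is_biproduct_def)
  have ea: "e \<in> Arr C" using e by simp
  define w where "w = sub C (e \<cdot> p1) (t \<cdot> p2)"
  have w: "w \<in> Arr C" "Dom C w = S" "Cod C w = Cod C e" using i t ea by (auto simp: w_def)
  have wi: "w \<cdot> i1 = e" using i t ea by (auto simp: w_def)
  have "is_epi C w" by (rule epi_cancel[of w i1]) (use i w wi e in auto)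
  obtain k where k: "is_kernel C w k" using ex_kernel w by blast
  note ks = kernel_simps[OF k]
  have wk: "is_cokernel C k w" using epi_cokernel \<open>is_epi C w\<close> k by blast
  \<comment> \<open>If \<open>x\<close> kills \<open>p2 \<cdot> k\<close>, then
    \<open>x \<cdot> p2\<close> factors through the cokernel \<open>w\<close> as
    \<open>v \<cdot> w\<close>. On the first summand \<open>w\<close> is \<open>e\<close> and
    \<open>p2\<close> is zero, so \<open>v \<cdot> e\<close> and hence \<open>v\<close> vanish;
    restricting \<open>x \<cdot> p2 = 0\<close> along \<open>i2\<close> gives
    \<open>x = 0\<close>.\<close>
  have "is_epi C (p2 \<cdot> k)"
  proof (rule epiI[OF _ refl refl])
    fix x X assume x: "x \<in> Arr C" "Dom C x = Cod C (p2 \<cdot> k)" "Cod C x = X" "x \<cdot> (p2 \<cdot> k) = Zero C (Dom C (p2 \<cdot> k)) X"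
    have xd: "Dom C x = Dom C t" using x i ks w by auto
    obtain v where v: "v \<in> Arr C" "Dom C v = Cod C w" "Cod C v = Cod C x" "v \<cdot> w = x \<cdot> p2"
      using cokernel_factor[OF wk, of "x \<cdot> p2"] x i ks w by auto
    have "v \<cdot> e = (v \<cdot> w) \<cdot> i1" using v(1-3) w i wi by simp
    also have "\<dots> = Zero C (Dom C e) X" unfolding v(4) using i x xd ea by simp
    finally have "v = Zero C (Cod C e) X" using epi_ZeroD[OF e, of v] v w x by simp
    then have "x \<cdot> p2 = Zero C S X" using v w x Zero_comp[of w X "Cod C e"] by auto
    from reassoc[OF this, of i2] have "x \<cdot> (p2 \<cdot> i2) = Zero C S X \<cdot> i2" using x(1,3) i xd by simp
    then have "x = Zero C (Dom C t) X" unfolding i(14) using x(1) Cod_Obj[OF x(1)] i(2,7,8) xd S unfolding x(3) by simp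
    then show "x = Zero C (Cod C (p2 \<cdot> k)) X" using x xd by auto
  qed (use i ks w in auto)
  moreover have "sub C (e \<cdot> (p1 \<cdot> k)) (t \<cdot> (p2 \<cdot> k)) = Zero C (Dom C k) (Cod C e)"
    using ks(4) ks(1-3) i t ea w by (auto simp: w_def)
  then have "e \<cdot> (p1 \<cdot> k) = t \<cdot> (p2 \<cdot> k)" using sub_eq_Zero[of "e \<cdot> (p1 \<cdot> k)" "t \<cdot> (p2 \<cdot> k)"] ks(1-3) i t ea w by auto
  ultimately show ?thesis using that[of "p2 \<cdot> k" "p1 \<cdot> k"] i ks w by auto
qed

text \<open>A mono has zero kernel, so the identity of its domain kills that kernel; an epi is the
  cokernel of its kernel, so the identity factors through \<open>f\<close>.\<close>

lemma mono_epi_iso: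
  assumes "is_mono C f" "is_epi C f"
  obtains g where "g \<in> Arr C" "Dom C g = Cod C f" "Cod C g = Dom C f" "g \<cdot> f = Ident C (Dom C f)" "f \<cdot> g = Ident C (Cod C f)"
proof -
  have f: "f \<in> Arr C" using assms by simp
  obtain k where k: "is_kernel C f k" using ex_kernel f by blast
  note ks = kernel_simps[OF k]
  have "k = Zero C (Dom C k) (Dom C f)" using mono_ZeroD[OF assms(1) ks(2) refl ks(3) refl refl ks(4)] .
  then have "Ident C (Dom C f) \<cdot> k = Zero C (Dom C k) (Dom C f)" using ks by auto
  then obtain g where g: "g \<in> Arr C" "Dom C g = Cod C f" "Cod C g = Dom C f" "g \<cdot> f = Ident C (Dom C f)"
    using cokernel_factor[OF epi_cokernel[OF assms(2) k], of "Ident C (Dom C f)"] ks by auto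
  moreover have "f \<cdot> g = Ident C (Cod C f)"
    by (rule is_epiD[OF assms(2)]) (use g f in auto)
  ultimately show ?thesis using that by blast
qed

lemma iso_iff: "is_iso C f \<longleftrightarrow> is_mono C f \<and> is_epi C f"
proof
  assume "is_iso C f"
  then obtain g where fg: "f \<in> Arr C" "g \<in> Arr C" "Dom C g = Cod C f" "Cod C g = Dom C f"
    "g \<cdot> f = Ident C (Dom C f)" "f \<cdot> g = Ident C (Cod C f)"
    by (auto simp: is_iso_def)
  have "is_mono C (g \<cdot> f)" "is_epi C (f \<cdot> g)" unfolding fg(5,6) using fg(1) by simp_all
  then show "is_mono C f \<and> is_epi C f"
    using mono_cancel[OF _ fg(1,2) fg(3)[symmetric]] epi_cancel[OF _ fg(2,1,4)] by simp
next
  assume "is_mono C f \<and> is_epi C f"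
  then show "is_iso C f" using mono_epi_iso[of f] unfolding is_iso_def by (metis Hom_iff mono_Arr)
qed

text \<open>To see that \<open>p\<close> is epi, let \<open>w\<close> kill \<open>p\<close> and let
  \<open>k\<close> be the kernel of \<open>w\<close>. Then \<open>f\<close> factors through the mono
  \<open>m \<cdot> k\<close>, so the cokernel \<open>d\<close> of \<open>m \<cdot> k\<close> kills
  \<open>f\<close> and factors through \<open>c\<close>, which kills \<open>m\<close>. Thus
  \<open>m\<close> factors through \<open>m \<cdot> k\<close>, which makes \<open>k\<close> a split
  epi and \<open>w\<close> zero.\<close>

lemma image_factor:
  assumes "is_image C f m"
  obtains p where "is_epi C p" "Dom C p = Dom C f" "Cod C p = Dom C m" "m \<cdot> p = f"
proof -
  obtain c where c: "is_cokernel C f c" "is_kernel C c m" using assms by (auto simp: is_image_def)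
  note cs = cokernel_simps[OF c(1)] and ms = kernel_simps[OF c(2)]
  obtain p where p: "p \<in> Arr C" "Dom C p = Dom C f" "Cod C p = Dom C m" "m \<cdot> p = f"
    using kernel_factor[OF c(2), of f] cs by auto
  have "is_epi C p"
  proof (rule epiI[OF _ refl refl])
    fix w W assume w: "w \<in> Arr C" "Dom C w = Cod C p" "Cod C w = W" "w \<cdot> p = Zero C (Dom C p) W"
    obtain k where k: "is_kernel C w k" using ex_kernel w by blast
    note ks = kernel_simps[OF k]
    obtain p' where p': "p' \<in> Arr C" "Dom C p' = Dom C p" "Cod C p' = Dom C k" "k \<cdot> p' = p"
      using kernel_factor[OF k, of p] w p by auto
    have mk: "is_mono C (m \<cdot> k)" using mono_comp kernel_mono c(2) k ks w p by auto
    obtain d where d: "is_cokernel C (m \<cdot> k) d" using ex_cokernel mk mono_Arr by blast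
    note ds = cokernel_simps[OF d]
    have d4: "d \<cdot> (m \<cdot> k) = Zero C (Dom C k) (Cod C d)" using ds ks ms w p by auto
    have "f = m \<cdot> (k \<cdot> p')" by (simp add: p p')
    then have "d \<cdot> f = (d \<cdot> (m \<cdot> k)) \<cdot> p'" using p(1-3) p'(1-3) ds(1-3) ms(1-3) ks(1-3) w(1-3) by simp
    also have "\<dots> = Zero C (Dom C f) (Cod C d)" unfolding d4 using p(1-3) p'(1-3) ds(1-3) ms(1-3) ks(1-3) w(1-3) by simp
    finally have "d \<cdot> f = Zero C (Dom C f) (Cod C d)" .
    then obtain d' where d': "d' \<in> Arr C" "Dom C d' = Cod C c" "Cod C d' = Cod C d" "d' \<cdot> c = d"
      using cokernel_factor[OF c(1), of d] ds ms cs ks w p by auto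
    have "d \<cdot> m = (d' \<cdot> c) \<cdot> m" by (simp add: d')
    also have "\<dots> = Zero C (Dom C m) (Cod C d)" using d'(1-3) cs(1-3) ms by simp
    finally obtain u where u: "u \<in> Arr C" "Dom C u = Dom C m" "Cod C u = Dom C (m \<cdot> k)" "(m \<cdot> k) \<cdot> u = m"
      using kernel_factor[OF mono_kernel[OF mk d], of m] ds ms ks w p by auto
    have "k \<cdot> u = Ident C (Dom C m)"
      by (rule is_monoD[OF kernel_mono[OF c(2)]]) (use u ms ks p w in auto)
    then have "is_epi C (k \<cdot> u)" using ms by auto
    then have "is_epi C k" by (rule epi_cancel) (use u ms ks p w in auto)
    then show "w = Zero C (Cod C p) W" using epi_ZeroD[of k w] ks w by simp
  qed (use p in auto)
  then show ?thesis using that p by auto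
qed

text \<open>This replaces element chases: an arrow \<open>t\<close> killed by \<open>g\<close> plays
  the role of an element, and since epis are stable under pullback, its preimage under
  \<open>f\<close> may be chosen after composing with an epi \<open>e\<close>.\<close>

lemma exact_at_iff:
  "exact_at C f g \<longleftrightarrow> f \<in> Arr C \<and> g \<in> Arr C \<and> Cod C f = Dom C g \<and> g \<cdot> f = Zero C (Dom C f) (Cod C g) \<and>
    (\<forall>t\<in>Arr C. Cod C t = Dom C g \<longrightarrow> g \<cdot> t = Zero C (Dom C t) (Cod C g) \<longrightarrow>
      (\<exists>e s. is_epi C e \<and> s \<in> Arr C \<and> Cod C e = Dom C t \<and> Dom C s = Dom C e \<and> Cod C s = Dom C f \<and> f \<cdot> s = t \<cdot> e))"
  (is "_ \<longleftrightarrow> ?R")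
proof
  assume "exact_at C f g"
  then obtain m where fg: "f \<in> Arr C" "g \<in> Arr C" "Cod C f = Dom C g" and m: "is_image C f m" "is_kernel C g m"
    by (auto simp: exact_at_def)
  note ms = kernel_simps[OF m(2)]
  obtain p where p: "is_epi C p" "Dom C p = Dom C f" "Cod C p = Dom C m" "m \<cdot> p = f" using image_factor[OF m(1)] .
  have pa: "p \<in> Arr C" using p by simp
  show ?R
  proof (intro conjI ballI impI fg)
    have "g \<cdot> (m \<cdot> p) = Zero C (Dom C f) (Cod C g)" using reassoc[OF ms(4), of p] ms p pa by auto
    then show "g \<cdot> f = Zero C (Dom C f) (Cod C g)" by (simp add: p)
    fix t assume t: "t \<in> Arr C" "Cod C t = Dom C g" "g \<cdot> t = Zero C (Dom C t) (Cod C g)"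
    obtain s where s: "s \<in> Arr C" "Dom C s = Dom C t" "Cod C s = Dom C m" "m \<cdot> s = t"
      using kernel_factor[OF m(2), of t] t by auto
    obtain e r where e: "is_epi C e" "Cod C e = Dom C s" "r \<in> Arr C" "Dom C r = Dom C e" "Cod C r = Dom C p" "p \<cdot> r = s \<cdot> e"
      using epi_pullback[OF p(1), of s] s p by auto
    have "f \<cdot> r = (m \<cdot> p) \<cdot> r" by (simp add: p)
    also have "\<dots> = m \<cdot> (s \<cdot> e)" using p(2,3) pa ms(1-3) e by simp
    also have "\<dots> = (m \<cdot> s) \<cdot> e" using s(1-3) ms(1-3) e(1-5) by simp
    also have "\<dots> = t \<cdot> e" by (simp add: s)
    finally show "\<exists>e s. is_epi C e \<and> s \<in> Arr C \<and> Cod C e = Dom C t \<and> Dom C s = Dom C e \<and> Cod C s = Dom C f \<and> f \<cdot> s = t \<cdot> e"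
      using e s p by (intro exI[of _ e] exI[of _ r]) auto
  qed
next
  assume R: ?R
  obtain c where c: "is_cokernel C f c" using ex_cokernel R by blast
  note cs = cokernel_simps[OF c]
  obtain m where m: "is_kernel C c m" using ex_kernel cs by blast
  note ms = kernel_simps[OF m]
  obtain g' where g': "g' \<in> Arr C" "Dom C g' = Cod C c" "Cod C g' = Cod C g" "g' \<cdot> c = g"
    using cokernel_factor[OF c, of g] R by auto
  \<comment> \<open>If \<open>g\<close> kills \<open>t\<close>, then
    \<open>c \<cdot> t \<cdot> e = c \<cdot> f \<cdot> s = 0\<close> for the epi \<open>e\<close> of
    the criterion, so \<open>c\<close> kills \<open>t\<close> itself and \<open>t\<close> factors
    through \<open>m\<close>.\<close>
  have "is_kernel C g m"
  proof (rule kernelI)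
    have "g \<cdot> m = (g' \<cdot> c) \<cdot> m" by (simp add: g')
    then show "g \<cdot> m = Zero C (Dom C m) (Cod C g)" using ms g'(1-3) cs(1-3) by simp
    fix t assume t: "t \<in> Arr C" "Cod C t = Dom C g" "g \<cdot> t = Zero C (Dom C t) (Cod C g)"
    then obtain e s where e: "is_epi C e" "s \<in> Arr C" "Cod C e = Dom C t" "Dom C s = Dom C e" "Cod C s = Dom C f" "f \<cdot> s = t \<cdot> e"
      using R by blast
    have dc: "Dom C c = Dom C g" using R cs by simp
    have "(c \<cdot> t) \<cdot> e = c \<cdot> (f \<cdot> s)" unfolding e(6) using e(1-5) t(1,2) cs(2) dc by simp
    also have "\<dots> = Zero C (Dom C e) (Cod C c)" using reassoc[OF cs(4), of s] e(1-5) cs(1-3) by simp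
    finally have "c \<cdot> t = Zero C (Dom C t) (Cod C c)" using epi_ZeroD[OF e(1), of "c \<cdot> t"] e(1-5) t(1,2) cs(1-2) dc by simp
    then show "\<exists>s. s \<in> Arr C \<and> Dom C s = Dom C t \<and> Cod C s = Dom C m \<and> m \<cdot> s = t"
      using kernel_factor[OF m, of t] t dc by metis
  qed (use R kernel_mono[OF m] ms cs in auto)
  then show "exact_at C f g" using R c m by (auto simp: exact_at_def is_image_def)
qed

lemma kernel_exact: "is_kernel C g f \<Longrightarrow> exact_at C f g"
  unfolding exact_at_iff
proof (intro conjI ballI impI)
  assume k: "is_kernel C g f"
  note ks = kernel_simps[OF k]
  fix t assume t: "t \<in> Arr C" "Cod C t = Dom C g" "g \<cdot> t = Zero C (Dom C t) (Cod C g)"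
  obtain s where s: "s \<in> Arr C" "Dom C s = Dom C t" "Cod C s = Dom C f" "f \<cdot> s = t"
    using kernel_factor[OF k, of t] t by auto
  show "\<exists>e s. is_epi C e \<and> s \<in> Arr C \<and> Cod C e = Dom C t \<and> Dom C s = Dom C e \<and> Cod C s = Dom C f \<and> f \<cdot> s = t \<cdot> e"
    by (rule exI[of _ "Ident C (Dom C t)"], rule exI[of _ s]) (use s t in auto)
qed (auto dest: kernel_simps)

text \<open>The lift \<open>s\<close>, given only after the epi \<open>e\<close>, descends along
  \<open>e\<close>: \<open>f \<cdot> s = t \<cdot> e\<close> vanishes on the kernel of
  \<open>e\<close>, hence so does \<open>s\<close> because \<open>f\<close> is mono.\<close>

lemma exact_mono_kernel:
  assumes "is_mono C f" "exact_at C f g"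
  shows "is_kernel C g f"
proof (rule kernelI)
  note R = assms(2)[unfolded exact_at_iff]
  fix t assume t: "t \<in> Arr C" "Cod C t = Dom C g" "g \<cdot> t = Zero C (Dom C t) (Cod C g)"
  then obtain e s where e: "is_epi C e" "s \<in> Arr C" "Cod C e = Dom C t" "Dom C s = Dom C e" "Cod C s = Dom C f" "f \<cdot> s = t \<cdot> e"
    using R by blast
  obtain k where k: "is_kernel C e k" using ex_kernel e epi_Arr by blast
  note ks = kernel_simps[OF k]
  have f: "f \<in> Arr C" "Cod C f = Dom C g" using R by auto
  have "f \<cdot> (s \<cdot> k) = (t \<cdot> e) \<cdot> k" using reassoc[OF e(6), of k] ks(1-3) e(1-5) f by simp
  also have "\<dots> = Zero C (Dom C k) (Cod C f)" using ks t(1,2) e(1-5) f by simp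
  finally have "s \<cdot> k = Zero C (Dom C k) (Cod C s)"
    using mono_ZeroD[OF assms(1), of "s \<cdot> k"] e(1-5) ks(1-3) f by simp
  then obtain s' where s': "s' \<in> Arr C" "Dom C s' = Cod C e" "Cod C s' = Cod C s" "s' \<cdot> e = s"
    using cokernel_factor[OF epi_cokernel[OF e(1) k], of s] e(1-5) ks(1-3) by auto
  have "f \<cdot> (s' \<cdot> e) = t \<cdot> e" by (simp add: s'(4) e(6))
  then have "f \<cdot> s' = t" by (intro is_epiD[OF e(1), of "f \<cdot> s'" t]) (use s'(1-3) e(1-5) f t(1,2) in simp_all)
  then show "\<exists>s. s \<in> Arr C \<and> Dom C s = Dom C t \<and> Cod C s = Dom C f \<and> f \<cdot> s = t"
    using s'(1-3) e(3,5) by (intro exI[of _ s']) simp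
qed (use assms(1) assms(2)[unfolded exact_at_iff] in blast)+

lemma short_exact_iff: "short_exact C f g \<longleftrightarrow> is_kernel C g f \<and> is_epi C g"
  unfolding short_exact_def using exact_mono_kernel kernel_exact kernel_mono by blast

lemma short_exactD:
  assumes "short_exact C f g"
  shows "is_kernel C g f" "is_epi C g" "is_mono C f" "f \<in> Arr C" "g \<in> Arr C" "Cod C f = Dom C g" "g \<cdot> f = Zero C (Dom C f) (Cod C g)"
proof -
  show k: "is_kernel C g f" and "is_epi C g" using assms short_exact_iff by blast+
  show "is_mono C f" by (rule kernel_mono[OF k])
  show "f \<in> Arr C" "g \<in> Arr C" "Cod C f = Dom C g" "g \<cdot> f = Zero C (Dom C f) (Cod C g)"
    by (rule kernel_simps[OF k])+
qed

lemma exact_comp_mono: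
  assumes "exact_at C f g" "is_mono C m" "Dom C m = Cod C g"
  shows "exact_at C f (m \<cdot> g)"
proof -
  note R = assms(1)[unfolded exact_at_iff]
  have m: "m \<in> Arr C" using assms by simp
  have g: "f \<in> Arr C" "g \<in> Arr C" "Cod C f = Dom C g" "g \<cdot> f = Zero C (Dom C f) (Cod C g)" using R by blast+
  have "g \<cdot> t = Zero C (Dom C t) (Cod C g)"
    if "(m \<cdot> g) \<cdot> t = Zero C (Dom C t) (Cod C (m \<cdot> g))" "t \<in> Arr C" "Cod C t = Dom C (m \<cdot> g)" for t
    by (rule mono_ZeroD[OF assms(2)]) (use that m g(2) assms(3) in simp_all)
  moreover have "(m \<cdot> g) \<cdot> f = Zero C (Dom C f) (Cod C (m \<cdot> g))" using m g assms(3) by simp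
  moreover have "m \<cdot> g \<in> Arr C" "Dom C (m \<cdot> g) = Dom C g" using m g assms(3) by simp_all
  ultimately show ?thesis using R unfolding exact_at_iff by metis
qed

lemma exact_comp_epi:
  assumes "exact_at C f g" "is_epi C p" "Cod C p = Dom C f"
  shows "exact_at C (f \<cdot> p) g"
proof -
  note R = assms(1)[unfolded exact_at_iff]
  have p: "p \<in> Arr C" using assms by simp
  have f: "f \<in> Arr C" "g \<in> Arr C" "Cod C f = Dom C g" "g \<cdot> f = Zero C (Dom C f) (Cod C g)" using R by blast+
  show ?thesis unfolding exact_at_iff
  proof (intro conjI ballI impI)
    show "g \<cdot> (f \<cdot> p) = Zero C (Dom C (f \<cdot> p)) (Cod C g)" using reassoc[OF f(4), of p] f(1-3) p assms(3) by simp
    fix t assume t: "t \<in> Arr C" "Cod C t = Dom C g" "g \<cdot> t = Zero C (Dom C t) (Cod C g)"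
    then obtain e s where e: "is_epi C e" "s \<in> Arr C" "Cod C e = Dom C t" "Dom C s = Dom C e" "Cod C s = Dom C f" "f \<cdot> s = t \<cdot> e"
      using R by blast
    obtain e' r where r: "is_epi C e'" "Cod C e' = Dom C s" "r \<in> Arr C" "Dom C r = Dom C e'" "Cod C r = Dom C p" "p \<cdot> r = s \<cdot> e'"
      using epi_pullback[OF assms(2), of s] e assms(3) by metis
    have "(f \<cdot> p) \<cdot> r = f \<cdot> (s \<cdot> e')" using r f(1-3) p assms(3) by simp
    also have "\<dots> = t \<cdot> (e \<cdot> e')" using reassoc[OF e(6), of e'] e(1-5) r(1-5) f(1-3) t(1,2) by simp
    finally have "(f \<cdot> p) \<cdot> r = t \<cdot> (e \<cdot> e')" .
    then show "\<exists>e s. is_epi C e \<and> s \<in> Arr C \<and> Cod C e = Dom C t \<and> Dom C s = Dom C e \<and> Cod C s = Dom C (f \<cdot> p) \<and> (f \<cdot> p) \<cdot> s = t \<cdot> e"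
      using e(1-5) r(1-5) f(1-3) p assms(3) by (intro exI[of _ "e \<cdot> e'"] exI[of _ r]) (simp add: epi_comp)
  qed (use assms f p in auto)
qed

lemma exact_Zero_mono:
  assumes "exact_at C (Zero C A B) g" "A \<in> Obj C" "B \<in> Obj C"
  shows "is_mono C g"
proof -
  note R = assms(1)[unfolded exact_at_iff]
  show ?thesis
  proof (rule monoI[OF _ refl refl])
    fix t X assume t: "t \<in> Arr C" "Dom C t = X" "Cod C t = Dom C g" "g \<cdot> t = Zero C X (Cod C g)"
    then obtain e s where e: "is_epi C e" "s \<in> Arr C" "Cod C e = X" "Dom C s = Dom C e" "Cod C s = A" "Zero C A B \<cdot> s = t \<cdot> e"
      using R assms by (metis Zero_simps(2))
    then have "t \<cdot> e = Zero C (Dom C e) B" using assms by simp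
    then show "t = Zero C X (Dom C g)" using epi_ZeroD[OF e(1), of t] t e(1-5) R assms by simp
  qed (use R in simp)
qed

lemma exact_Zero_epi:
  assumes "exact_at C f (Zero C A B)" "A \<in> Obj C" "B \<in> Obj C"
  shows "is_epi C f"
proof -
  note R = assms(1)[unfolded exact_at_iff]
  have f: "f \<in> Arr C" "Cod C f = A" using R assms by auto
  \<comment> \<open>A zero arrow kills everything, so the criterion applies to the identity and
    makes \<open>f \<cdot> s\<close> an epi.\<close>
  have I: "Ident C A \<in> Arr C" "Cod C (Ident C A) = Dom C (Zero C A B)" "Dom C (Ident C A) = A"
    "Zero C A B \<cdot> Ident C A = Zero C (Dom C (Ident C A)) (Cod C (Zero C A B))" using assms by simp_all
  then obtain e s where e: "is_epi C e" "s \<in> Arr C" "Cod C e = A" "Dom C s = Dom C e" "Cod C s = Dom C f" "f \<cdot> s = Ident C A \<cdot> e"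
    using R by metis
  then have "is_epi C (f \<cdot> s)" by simp
  then show ?thesis by (rule epi_cancel) (use e(1-5) f in auto)
qed

section \<open>Projective objects and zero objects\<close>

lemma projective_lift:
  assumes "projective C P" "is_epi C e" "f \<in> Arr C" "Dom C f = P" "Cod C f = Cod C e"
  obtains h where "h \<in> Arr C" "Dom C h = P" "Cod C h = Dom C e" "e \<cdot> h = f"
  using assms unfolding projective_def by (metis Hom_iff)

lemma Zero_object_arrow:
  assumes "zero_object C Z" "f \<in> Arr C" "Dom C f = A" "Cod C f = B" "A = Z \<or> B = Z"
  shows "f = Zero C A B"
proof -
  have AB: "A \<in> Obj C" "B \<in> Obj C" using assms by auto
  then have *: "\<exists>!g. g \<in> Hom C Z B" "\<exists>!g. g \<in> Hom C A Z"
    using assms(1) by (auto simp: zero_object_def)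
  have "Zero C A B \<in> Hom C A B" "f \<in> Hom C A B" using assms AB by auto
  then show ?thesis using * assms(5) by metis
qed

lemma Zero_objectI:
  assumes "Z \<in> Obj C" "Ident C Z = Zero C Z Z"
  shows "zero_object C Z"
  unfolding zero_object_def
proof (intro conjI ballI assms(1))
  fix X assume X: "X \<in> Obj C"
  show "\<exists>!f. f \<in> Hom C X Z"
  proof (rule ex1I[of _ "Zero C X Z"])
    fix f assume "f \<in> Hom C X Z"
    then show "f = Zero C X Z" using assms comp_Ident(2)[of f Z] Zero_comp[of f Z Z] by (metis Hom_iff)
  qed (use X assms in simp)
  show "\<exists>!f. f \<in> Hom C Z X"
  proof (rule ex1I[of _ "Zero C Z X"])
    fix f assume "f \<in> Hom C Z X"
    then show "f = Zero C Z X" using assms comp_Ident(1)[of f Z] comp_Zero[of f Z Z] by (metis Hom_iff)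
  qed (use X assms in simp)
qed

end

section \<open>Kernel lifts and syzygies\<close>

text \<open>Keeps of a resolution only the short exact sequences of its syzygies. In this form the
  notion is stable under \<open>shift\<close>.\<close>

definition syzygies :: "('o, 'a) category \<Rightarrow> 'o \<Rightarrow> 'a resolution \<Rightarrow> bool" where
  "syzygies C M R \<longleftrightarrow> Cod C (sproj R 0) = M \<and>
     (\<forall>k. short_exact C (sincl R k) (sproj R k) \<and> projective C (Dom C (sproj R k)) \<and>
        Dom C (sincl R k) = Cod C (sproj R (Suc k)))"

text \<open>In general \<open>shift R\<close> is not a \<open>projective_resolution\<close>:
  \<open>rdiff (shift R) 0\<close> is the differential \<open>rdiff R 1\<close>, whereas
  \<open>sproj (shift R) 0\<close> is the projection onto the first syzygy.\<close>

definition shift :: "'a resolution \<Rightarrow> 'a resolution" where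
  "shift R = \<lparr>rdiff = (\<lambda>k. rdiff R (Suc k)), sproj = (\<lambda>k. sproj R (Suc k)), sincl = (\<lambda>k. sincl R (Suc k))\<rparr>"

lemma shift_simps [simp]: "sproj (shift R) k = sproj R (Suc k)" "sincl (shift R) k = sincl R (Suc k)"
  by (simp_all add: shift_def)

context abelian
begin

section \<open>Arrows induced on kernels by lifts\<close>

lemma kernel_liftE:
  assumes "kernel_lift C i p j q f fs"
  obtains h where "h \<in> Arr C" "Dom C h = Dom C p" "Cod C h = Dom C q" "q \<cdot> h = f \<cdot> p" "j \<cdot> fs = h \<cdot> i"
  using assms by (auto simp: kernel_lift_def)

lemma kernel_liftI:
  assumes "h \<in> Arr C" "Dom C h = Dom C p" "Cod C h = Dom C q" "q \<cdot> h = f \<cdot> p"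
    "fs \<in> Arr C" "Dom C fs = Dom C i" "Cod C fs = Dom C j" "j \<cdot> fs = h \<cdot> i"
  shows "kernel_lift C i p j q f fs"
  unfolding kernel_lift_def by (rule bexI[of _ h]) (use assms in simp_all)

lemma kernel_lift_hom:
  assumes "kernel_lift C i p j q f fs"
  shows "fs \<in> Arr C" "Dom C fs = Dom C i" "Cod C fs = Dom C j"
  using assms by (auto simp: kernel_lift_def)

lemma short_exact_factor:
  assumes "short_exact C j q" "t \<in> Arr C" "Dom C t = X" "Cod C t = Dom C q" "q \<cdot> t = Zero C X (Cod C q)"
  obtains s where "s \<in> Arr C" "Dom C s = X" "Cod C s = Dom C j" "j \<cdot> s = t"
  using kernel_factor[OF short_exactD(1)[OF assms(1)], of t] assms(2-) by metis

lemma short_exact_cofactor: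
  assumes "short_exact C j q" "t \<in> Arr C" "Cod C t = X" "Dom C t = Cod C j" "t \<cdot> j = Zero C (Dom C j) X"
  obtains s where "s \<in> Arr C" "Dom C s = Cod C q" "Cod C s = X" "s \<cdot> q = t"
  using cokernel_factor[OF epi_cokernel[OF short_exactD(2,1)[OF assms(1)]], of t] assms(2-) by metis

lemma kernel_lift_extend:
  assumes "short_exact C i p" "short_exact C j q" "f \<in> Arr C" "Dom C f = Cod C p" "Cod C f = Cod C q"
    "h \<in> Arr C" "Dom C h = Dom C p" "Cod C h = Dom C q" "q \<cdot> h = f \<cdot> p"
  obtains fs where "kernel_lift C i p j q f fs" "fs \<in> Arr C" "Dom C fs = Dom C i" "Cod C fs = Dom C j" "j \<cdot> fs = h \<cdot> i"
proof -
  note i = short_exactD[OF assms(1)] and j = short_exactD[OF assms(2)]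
  have "q \<cdot> (h \<cdot> i) = (f \<cdot> p) \<cdot> i" using reassoc[OF assms(9), of i] i(4-6) j(4-6) assms(3-8) by simp
  also have "\<dots> = Zero C (Dom C i) (Cod C q)" using i(4-7) assms(3-5) by simp
  finally obtain fs where "fs \<in> Arr C" "Dom C fs = Dom C i" "Cod C fs = Dom C j" "j \<cdot> fs = h \<cdot> i"
    using short_exact_factor[OF assms(2), of "h \<cdot> i" "Dom C i"] i(4-6) assms(6-8) by force
  then show ?thesis using that[of fs] kernel_liftI[OF assms(6-9)] by simp
qed

lemma ex_kernel_lift:
  assumes "short_exact C i p" "projective C (Dom C p)" "short_exact C j q" "f \<in> Arr C" "Dom C f = Cod C p" "Cod C f = Cod C q"
  obtains fs where "kernel_lift C i p j q f fs"
proof -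
  note i = short_exactD[OF assms(1)] and j = short_exactD[OF assms(3)]
  obtain h where h: "h \<in> Arr C" "Dom C h = Dom C p" "Cod C h = Dom C q" "q \<cdot> h = f \<cdot> p"
    by (rule projective_lift[OF assms(2) j(2), of "f \<cdot> p"]) (use i(5) assms(4-6) in simp_all)
  show ?thesis using kernel_lift_extend[OF assms(1,3-6) h] that by metis
qed

text \<open>Two lifts of \<open>f\<close> differ by an arrow that \<open>q\<close> kills, and
  \<open>u\<close> is its factorisation through the kernel \<open>j\<close>. As \<open>u\<close> is
  defined on the whole middle term, \<open>fs\<close> and \<open>gs\<close> are indistinguishable
  wherever \<open>i\<close> becomes zero.\<close>

lemma kernel_lift_unique:
  assumes "kernel_lift C i p j q f fs" "kernel_lift C i p j q f gs" "short_exact C i p" "short_exact C j q"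
  obtains u where "u \<in> Arr C" "Dom C u = Dom C p" "Cod C u = Dom C j" "sub C fs gs = u \<cdot> i"
proof -
  note i = short_exactD[OF assms(3)] and j = short_exactD[OF assms(4)]
  note fs = kernel_lift_hom[OF assms(1)] and gs = kernel_lift_hom[OF assms(2)]
  obtain h where h: "h \<in> Arr C" "Dom C h = Dom C p" "Cod C h = Dom C q" "q \<cdot> h = f \<cdot> p" "j \<cdot> fs = h \<cdot> i"
    using kernel_liftE[OF assms(1)] .
  obtain h' where h': "h' \<in> Arr C" "Dom C h' = Dom C p" "Cod C h' = Dom C q" "q \<cdot> h' = f \<cdot> p" "j \<cdot> gs = h' \<cdot> i"
    using kernel_liftE[OF assms(2)] .
  have "q \<cdot> h \<in> Arr C" "Dom C (q \<cdot> h) = Dom C p" "Cod C (q \<cdot> h) = Cod C q" using h(1-3) j(5) by simp_all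
  then have "q \<cdot> sub C h h' = Zero C (Dom C p) (Cod C q)"
    using h(1-3) h'(1-3) j(5) unfolding h(4) by (subst comp_sub) (simp_all add: h(4) h'(4))
  then obtain u where u: "u \<in> Arr C" "Dom C u = Dom C p" "Cod C u = Dom C j" "j \<cdot> u = sub C h h'"
    using short_exact_factor[OF assms(4), of "sub C h h'" "Dom C p"] h(1-3) h'(1-3) by force
  have "j \<cdot> sub C fs gs = sub C (h \<cdot> i) (h' \<cdot> i)"
    using fs gs j(4) by (simp add: h(5) h'(5))
  also have "\<dots> = sub C h h' \<cdot> i" using h(1-3) h'(1-3) i(4-6) by simp
  also have "\<dots> = j \<cdot> (u \<cdot> i)" unfolding u(4)[symmetric] using u(1-3) i(4-6) j(4) by simp
  finally have "sub C fs gs = u \<cdot> i"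
    by (intro is_monoD[OF j(3), of "sub C fs gs" "u \<cdot> i"]) (use fs gs u(1-3) i(4-6) in simp_all)
  then show ?thesis using that u by blast
qed

lemma kernel_lift_comp:
  assumes "kernel_lift C i p j q f fs" "kernel_lift C j q k r g gs"
    "short_exact C i p" "short_exact C j q" "short_exact C k r"
    "f \<in> Arr C" "Dom C f = Cod C p" "Cod C f = Cod C q" "g \<in> Arr C" "Dom C g = Cod C q" "Cod C g = Cod C r"
  shows "kernel_lift C i p k r (g \<cdot> f) (gs \<cdot> fs)"
proof -
  note i = short_exactD(4-6)[OF assms(3)] and j = short_exactD(4-6)[OF assms(4)] and k = short_exactD(4-6)[OF assms(5)]
  note fs = kernel_lift_hom[OF assms(1)] and gs = kernel_lift_hom[OF assms(2)]
  obtain h where h: "h \<in> Arr C" "Dom C h = Dom C p" "Cod C h = Dom C q" "q \<cdot> h = f \<cdot> p" "j \<cdot> fs = h \<cdot> i"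
    using kernel_liftE[OF assms(1)] .
  obtain h' where h': "h' \<in> Arr C" "Dom C h' = Dom C q" "Cod C h' = Dom C r" "r \<cdot> h' = g \<cdot> q" "k \<cdot> gs = h' \<cdot> j"
    using kernel_liftE[OF assms(2)] .
  show ?thesis
  proof (rule kernel_liftI[of "h' \<cdot> h"])
    have "r \<cdot> (h' \<cdot> h) = (g \<cdot> q) \<cdot> h" using reassoc[OF h'(4), of h] h(1-3) h'(1-3) k(2) by simp
    also have "\<dots> = g \<cdot> (f \<cdot> p)" using h(1-3) j(2) assms(9-11) by (simp add: h(4))
    also have "\<dots> = (g \<cdot> f) \<cdot> p" using i(2) assms(6-11) by simp
    finally show "r \<cdot> (h' \<cdot> h) = (g \<cdot> f) \<cdot> p" .
    have "k \<cdot> (gs \<cdot> fs) = (h' \<cdot> j) \<cdot> fs" using reassoc[OF h'(5), of fs] fs gs k(1) by simp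
    also have "\<dots> = h' \<cdot> (h \<cdot> i)" using fs j(1,3) h'(1-3) by (simp add: h(5))
    also have "\<dots> = (h' \<cdot> h) \<cdot> i" using i h(1-3) h'(1-3) by simp
    finally show "k \<cdot> (gs \<cdot> fs) = (h' \<cdot> h) \<cdot> i" .
  qed (use h(1-3) h'(1-3) fs gs in simp_all)
qed

lemma kernel_lift_Ident:
  assumes "short_exact C i p"
  shows "kernel_lift C i p i p (Ident C (Cod C p)) (Ident C (Dom C i))"
  by (rule kernel_liftI[of "Ident C (Dom C p)"]) (use short_exactD(4-6)[OF assms] in simp_all)

lemma kernel_lift_neg:
  assumes "kernel_lift C i p j q f fs" "short_exact C i p" "short_exact C j q" "f \<in> Arr C" "Dom C f = Cod C p" "Cod C f = Cod C q"
  shows "kernel_lift C i p j q (neg C f) (neg C fs)"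
proof -
  note i = short_exactD(4-6)[OF assms(2)] and j = short_exactD(4-6)[OF assms(3)] and fs = kernel_lift_hom[OF assms(1)]
  obtain h where h: "h \<in> Arr C" "Dom C h = Dom C p" "Cod C h = Dom C q" "q \<cdot> h = f \<cdot> p" "j \<cdot> fs = h \<cdot> i"
    using kernel_liftE[OF assms(1)] .
  show ?thesis by (rule kernel_liftI[of "neg C h"]) (use i j fs assms(4-6) h in simp_all)
qed

lemma kernel_lift_Plus:
  assumes "kernel_lift C i p j q f fs" "kernel_lift C i p j q g gs" "short_exact C i p" "short_exact C j q"
    "f \<in> Arr C" "Dom C f = Cod C p" "Cod C f = Cod C q" "g \<in> Arr C" "Dom C g = Cod C p" "Cod C g = Cod C q"
  shows "kernel_lift C i p j q (Plus C f g) (Plus C fs gs)"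
proof -
  note i = short_exactD(4-6)[OF assms(3)] and j = short_exactD(4-6)[OF assms(4)]
  note fs = kernel_lift_hom[OF assms(1)] and gs = kernel_lift_hom[OF assms(2)]
  obtain h where h: "h \<in> Arr C" "Dom C h = Dom C p" "Cod C h = Dom C q" "q \<cdot> h = f \<cdot> p" "j \<cdot> fs = h \<cdot> i"
    using kernel_liftE[OF assms(1)] .
  obtain h' where h': "h' \<in> Arr C" "Dom C h' = Dom C p" "Cod C h' = Dom C q" "q \<cdot> h' = g \<cdot> p" "j \<cdot> gs = h' \<cdot> i"
    using kernel_liftE[OF assms(2)] .
  show ?thesis by (rule kernel_liftI[of "Plus C h h'"]) (use i j fs gs assms(5-) h h' in simp_all)
qed

lemma kernel_lift_sub:
  assumes "kernel_lift C i p j q f fs" "kernel_lift C i p j q g gs" "short_exact C i p" "short_exact C j q"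
    "f \<in> Arr C" "Dom C f = Cod C p" "Cod C f = Cod C q" "g \<in> Arr C" "Dom C g = Cod C p" "Cod C g = Cod C q"
  shows "kernel_lift C i p j q (sub C f g) (sub C fs gs)"
  unfolding sub_def
  by (rule kernel_lift_Plus[OF assms(1) kernel_lift_neg[OF assms(2-4,8-10)] assms(3-7)]) (use assms(8-10) in simp_all)

text \<open>With \<open>f = q \<cdot> e\<close>, the arrow \<open>e \<cdot> p\<close> is a lift of
  \<open>f\<close> that induces zero on kernels. By \<open>kernel_lift_unique\<close> every induced
  arrow has the form \<open>u \<cdot> i\<close>, and \<open>u\<close> lifts along \<open>q'\<close>
  by projectivity.\<close>

lemma kernel_lift_factor:
  assumes "kernel_lift C i p j q f fs" "short_exact C i p" "short_exact C j q" "projective C (Dom C p)"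
    "is_epi C q'" "Cod C q' = Dom C j"
    "e \<in> Arr C" "Dom C e = Cod C p" "Cod C e = Dom C q" "f = q \<cdot> e"
  obtains v where "v \<in> Arr C" "Dom C v = Dom C i" "Cod C v = Dom C q'" "fs = q' \<cdot> v"
proof -
  note i = short_exactD[OF assms(2)] and j = short_exactD[OF assms(3)] and fs = kernel_lift_hom[OF assms(1)]
  have q': "q' \<in> Arr C" using assms(5) by simp
  have "kernel_lift C i p j q f (Zero C (Dom C i) (Dom C j))"
    by (rule kernel_liftI[of "e \<cdot> p"]) (use i(4-7) j(4-6) assms(7-10) in simp_all)
  then obtain u where u: "u \<in> Arr C" "Dom C u = Dom C p" "Cod C u = Dom C j" "sub C fs (Zero C (Dom C i) (Dom C j)) = u \<cdot> i"
    using kernel_lift_unique[OF assms(1) _ assms(2,3)] by blast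
  obtain v where v: "v \<in> Arr C" "Dom C v = Dom C p" "Cod C v = Dom C q'" "q' \<cdot> v = u"
    by (rule projective_lift[OF assms(4,5), of u]) (use u(1-3) assms(6) in simp_all)
  have "fs = (q' \<cdot> v) \<cdot> i" using u(4) fs by (simp add: v(4))
  also have "\<dots> = q' \<cdot> (v \<cdot> i)" using v(1-3) i(4-6) q' by simp
  finally show ?thesis using that[of "v \<cdot> i"] v(1-3) i(4-6) by simp
qed

section \<open>Syzygies and compatible chains of lifts\<close>

lemma syzygiesD:
  assumes "syzygies C M R"
  shows "short_exact C (sincl R k) (sproj R k)" "projective C (Dom C (sproj R k))"
    "Dom C (sincl R k) = Cod C (sproj R (Suc k))" "Cod C (sproj R 0) = M"
    "sincl R k \<in> Arr C" "sproj R k \<in> Arr C" "Cod C (sincl R k) = Dom C (sproj R k)" "is_epi C (sproj R k)" "M \<in> Obj C"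
  using assms short_exactD[of "sincl R k" "sproj R k"] short_exactD(5)[of "sincl R 0" "sproj R 0"]
    Cod_Obj[of "sproj R 0"] unfolding syzygies_def by metis+

lemma syzygies_shift: "syzygies C M R \<Longrightarrow> syzygies C (Cod C (sproj R (Suc 0))) (shift R)"
  by (auto simp: syzygies_def)

text \<open>The point is that \<open>sproj R (Suc j)\<close> is epi. By exactness
  \<open>sincl R j\<close> lifts along \<open>rdiff R (Suc j)\<close> after some epi
  \<open>e\<close>, and cancelling the mono \<open>sincl R j\<close> leaves
  \<open>sproj R (Suc j) \<cdot> t = e\<close>.\<close>

lemma projective_resolution_syzygies:
  assumes "projective_resolution C M R"
  shows "syzygies C M R"
proof -
  have R: "\<And>k. projective C (Dom C (rdiff R k))" "Cod C (rdiff R 0) = M" "is_epi C (rdiff R 0)"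
    "\<And>k. exact_at C (rdiff R (Suc k)) (rdiff R k)" "sproj R 0 = rdiff R 0" "\<And>k. is_kernel C (sproj R k) (sincl R k)"
    "\<And>k. sproj R (Suc k) \<in> Arr C" "\<And>k. Dom C (sproj R (Suc k)) = Dom C (rdiff R (Suc k))"
    "\<And>k. Cod C (sproj R (Suc k)) = Dom C (sincl R k)" "\<And>k. sincl R k \<cdot> sproj R (Suc k) = rdiff R (Suc k)"
    using assms unfolding projective_resolution_def by auto
  note s = kernel_simps[OF R(6)]
  have D: "Dom C (sproj R k) = Dom C (rdiff R k)" for k by (cases k) (simp_all add: R(5,8))
  have z: "rdiff R k \<cdot> sincl R k = Zero C (Dom C (sincl R k)) (Cod C (rdiff R k))" for k
  proof (cases k)
    case (Suc j)
    have "rdiff R k \<cdot> sincl R k = (sincl R j \<cdot> sproj R (Suc j)) \<cdot> sincl R (Suc j)" by (simp add: R(10) Suc)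
    also have "\<dots> = Zero C (Dom C (sincl R k)) (Cod C (sincl R j))" using s[of "Suc j"] s(2,3)[of j] R(9)[of j] Suc by simp
    also have "Cod C (sincl R j) = Cod C (rdiff R k)"
      using R(10)[of j] comp_simps(3)[of "sproj R (Suc j)" "sincl R j"] R(7,9)[of j] s(2)[of j] Suc by simp
    finally show ?thesis .
  qed (use s(4)[of 0] R(5) in simp)
  have "is_epi C (sproj R k)" for k
  proof (cases k)
    case (Suc j)
    have "\<forall>t\<in>Arr C. Cod C t = Dom C (rdiff R j) \<longrightarrow> rdiff R j \<cdot> t = Zero C (Dom C t) (Cod C (rdiff R j)) \<longrightarrow>
      (\<exists>e s. is_epi C e \<and> s \<in> Arr C \<and> Cod C e = Dom C t \<and> Dom C s = Dom C e \<and> Cod C s = Dom C (rdiff R (Suc j)) \<and> rdiff R (Suc j) \<cdot> s = t \<cdot> e)"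
      using R(4)[of j] unfolding exact_at_iff by blast
    moreover have "sincl R j \<in> Arr C" "Cod C (sincl R j) = Dom C (rdiff R j)" using s[of j] D by auto
    ultimately obtain e t where e: "is_epi C e" "t \<in> Arr C" "Cod C e = Dom C (sincl R j)" "Dom C t = Dom C e"
        "Cod C t = Dom C (rdiff R (Suc j))" "rdiff R (Suc j) \<cdot> t = sincl R j \<cdot> e" using z[of j] by blast
    have "sincl R j \<cdot> (sproj R (Suc j) \<cdot> t) = sincl R j \<cdot> e"
      unfolding e(6)[symmetric] by (rule reassoc[OF R(10)]) (use e(2-5) s(2,3)[of j] R(7-9)[of j] in simp_all)
    then have "sproj R (Suc j) \<cdot> t = e"
      by (intro is_monoD[OF kernel_mono[OF R(6)[of j]], of "sproj R (Suc j) \<cdot> t" e]) (use e(1-5) s(2,3)[of j] R(7-9)[of j] in simp_all)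
    then have "is_epi C (sproj R (Suc j) \<cdot> t)" using e(1) by simp
    then have "is_epi C (sproj R (Suc j))" by (rule epi_cancel) (use e(2,5) R(7,8)[of j] in simp_all)
    then show ?thesis using Suc by simp
  qed (use R in simp)
  then show ?thesis using R D by (auto simp: syzygies_def short_exact_iff)
qed

lemma syzygies_resolution:
  assumes "syzygies C M R" "rdiff R 0 = sproj R 0" "\<And>k. rdiff R (Suc k) = sincl R k \<cdot> sproj R (Suc k)"
  shows "projective_resolution C M R"
proof -
  note R = syzygiesD[OF assms(1)]
  have D: "Dom C (rdiff R k) = Dom C (sproj R k)" for k
    by (cases k) (use R(3,5,6,7) in \<open>simp_all add: assms(2,3)\<close>)
  have e: "exact_at C (sincl R k) (rdiff R k)" for k
  proof (cases k)
    case 0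
    then show ?thesis using R(1)[of 0] assms(2) by (simp add: short_exact_def)
  next
    case (Suc j)
    have "exact_at C (sincl R k) (sproj R k)" using R(1)[of k] by (simp add: short_exact_def)
    then show ?thesis using exact_comp_mono[of "sincl R k" "sproj R k" "sincl R j"] short_exactD(3)[OF R(1)[of j]] R(3)[of j] Suc assms(3)
      by simp
  qed
  have "exact_at C (rdiff R (Suc k)) (rdiff R k)" for k
    unfolding assms(3)[of k] by (rule exact_comp_epi[OF e R(8)]) (simp add: R(3))
  then show ?thesis unfolding projective_resolution_def
    using R(2-8) short_exactD(1)[OF R(1)] D assms(2,3) by simp
qed

lemma syzygy_liftD:
  assumes "syzygy_lift C R R' f ft"
  shows "ft 0 = f" "kernel_lift C (sincl R k) (sproj R k) (sincl R' k) (sproj R' k) (ft k) (ft (Suc k))"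
  using assms by (auto simp: syzygy_lift_def)

lemma syzygy_lift_hom:
  assumes "syzygy_lift C R R' f ft" "syzygies C M R" "syzygies C N R'" "f \<in> Arr C" "Dom C f = M" "Cod C f = N"
  shows "ft k \<in> Arr C" "Dom C (ft k) = Cod C (sproj R k)" "Cod C (ft k) = Cod C (sproj R' k)"
proof -
  have "ft k \<in> Arr C \<and> Dom C (ft k) = Cod C (sproj R k) \<and> Cod C (ft k) = Cod C (sproj R' k)"
  proof (cases k)
    case 0
    then show ?thesis using assms syzygy_liftD(1)[OF assms(1)] syzygiesD(4)[OF assms(2)] syzygiesD(4)[OF assms(3)] by simp
  next
    case (Suc j)
    then show ?thesis using kernel_lift_hom[OF syzygy_liftD(2)[OF assms(1), of j]] syzygiesD(3)[OF assms(2)] syzygiesD(3)[OF assms(3)] by simp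
  qed
  then show "ft k \<in> Arr C" "Dom C (ft k) = Cod C (sproj R k)" "Cod C (ft k) = Cod C (sproj R' k)" by auto
qed

lemma ex_syzygy_lift:
  assumes R: "syzygies C M R" and R': "syzygies C N R'" and f: "f \<in> Arr C" "Dom C f = M" "Cod C f = N"
  obtains ft where "syzygy_lift C R R' f ft"
proof -
  \<comment> \<open>The clause for \<open>k = 0\<close> fixes the start of the chain, which
    dependent choice would otherwise leave free.\<close>
  let ?P = "\<lambda>k x. x \<in> Arr C \<and> Dom C x = Cod C (sproj R k) \<and> Cod C x = Cod C (sproj R' k) \<and> (k = 0 \<longrightarrow> x = f)"
  let ?Q = "\<lambda>k. kernel_lift C (sincl R k) (sproj R k) (sincl R' k) (sproj R' k)"
  have "\<exists>g. \<forall>n. ?P n (g n) \<and> ?Q n (g n) (g (Suc n))"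
  proof (rule dependent_nat_choice)
    show "\<exists>x. ?P 0 x" using f syzygiesD(4)[OF R] syzygiesD(4)[OF R'] by auto
    fix x n assume x: "?P n x"
    then obtain y where y: "?Q n x y"
      using ex_kernel_lift[OF syzygiesD(1)[OF R] syzygiesD(2)[OF R] syzygiesD(1)[OF R'], of x n n] by auto
    then show "\<exists>y. ?P (Suc n) y \<and> ?Q n x y"
      using kernel_lift_hom[OF y] syzygiesD(3)[OF R] syzygiesD(3)[OF R'] by auto
  qed
  then show ?thesis using that by (auto simp: syzygy_lift_def)
qed

lemma syzygy_lift_comp:
  assumes ft: "syzygy_lift C R R' f ft" and gt: "syzygy_lift C R' R'' g gt"
    and R: "syzygies C L R" and R': "syzygies C M R'" and R'': "syzygies C N R''"
    and f: "f \<in> Arr C" "Dom C f = L" "Cod C f = M" and g: "g \<in> Arr C" "Dom C g = M" "Cod C g = N"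
  shows "syzygy_lift C R R'' (g \<cdot> f) (\<lambda>k. gt k \<cdot> ft k)"
  unfolding syzygy_lift_def
proof (intro conjI allI)
  fix k
  show "kernel_lift C (sincl R k) (sproj R k) (sincl R'' k) (sproj R'' k) (gt k \<cdot> ft k) (gt (Suc k) \<cdot> ft (Suc k))"
    by (rule kernel_lift_comp[OF syzygy_liftD(2)[OF ft] syzygy_liftD(2)[OF gt]])
      (use syzygiesD(1)[OF R] syzygiesD(1)[OF R'] syzygiesD(1)[OF R''] syzygy_lift_hom[OF ft R R' f] syzygy_lift_hom[OF gt R' R'' g] in simp_all)
qed (use syzygy_liftD(1)[OF ft] syzygy_liftD(1)[OF gt] in simp)

lemma syzygy_lift_Ident:
  assumes R: "syzygies C M R"
  shows "syzygy_lift C R R (Ident C M) (\<lambda>k. Ident C (Cod C (sproj R k)))"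
  using kernel_lift_Ident[OF syzygiesD(1)[OF R]] syzygiesD(3,4)[OF R] by (simp add: syzygy_lift_def)

lemma syzygy_lift_Plus:
  assumes ft: "syzygy_lift C R R' f ft" and gt: "syzygy_lift C R R' g gt"
    and R: "syzygies C L R" and R': "syzygies C M R'"
    and f: "f \<in> Arr C" "Dom C f = L" "Cod C f = M" and g: "g \<in> Arr C" "Dom C g = L" "Cod C g = M"
  shows "syzygy_lift C R R' (Plus C f g) (\<lambda>k. Plus C (ft k) (gt k))"
  using kernel_lift_Plus[OF syzygy_liftD(2)[OF ft] syzygy_liftD(2)[OF gt] syzygiesD(1)[OF R] syzygiesD(1)[OF R']]
    syzygy_lift_hom[OF ft R R' f] syzygy_lift_hom[OF gt R R' g] syzygy_liftD(1)[OF ft] syzygy_liftD(1)[OF gt]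
  unfolding syzygy_lift_def by simp

lemma syzygy_lift_sub:
  assumes ft: "syzygy_lift C R R' f ft" and gt: "syzygy_lift C R R' g gt"
    and R: "syzygies C L R" and R': "syzygies C M R'"
    and f: "f \<in> Arr C" "Dom C f = L" "Cod C f = M" and g: "g \<in> Arr C" "Dom C g = L" "Cod C g = M"
  shows "syzygy_lift C R R' (sub C f g) (\<lambda>k. sub C (ft k) (gt k))"
  using kernel_lift_sub[OF syzygy_liftD(2)[OF ft] syzygy_liftD(2)[OF gt] syzygiesD(1)[OF R] syzygiesD(1)[OF R']]
    syzygy_lift_hom[OF ft R R' f] syzygy_lift_hom[OF gt R R' g] syzygy_liftD(1)[OF ft] syzygy_liftD(1)[OF gt]
  unfolding syzygy_lift_def by simp

lemma syzygy_lift_shift: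
  assumes ft: "syzygy_lift C R R' f ft"
  shows "syzygy_lift C (shift R) (shift R') (ft 1) (\<lambda>k. ft (Suc k))"
  using ft by (simp add: syzygy_lift_def)

text \<open>\<open>kernel_lift_factor\<close> propagates the factorisation: if \<open>ft k\<close>
  passes through the projective of stage \<open>k\<close>, then \<open>ft (Suc k)\<close> passes
  through that of the next stage.\<close>

lemma syzygy_lift_factor:
  assumes ft: "syzygy_lift C R R' f ft" and R: "syzygies C M R" and R': "syzygies C N R'"
    and e: "e \<in> Arr C" "Dom C e = M" "Cod C e = Dom C (sproj R' 0)" "f = sproj R' 0 \<cdot> e"
  obtains v where "v \<in> Arr C" "Dom C v = Cod C (sproj R k)" "Cod C v = Dom C (sproj R' k)" "ft k = sproj R' k \<cdot> v"
proof -
  have "\<exists>v. v \<in> Arr C \<and> Dom C v = Cod C (sproj R k) \<and> Cod C v = Dom C (sproj R' k) \<and> ft k = sproj R' k \<cdot> v"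
  proof (induction k)
    case 0
    then show ?case using syzygy_liftD(1)[OF ft] syzygiesD(4)[OF R] e by auto
  next
    case (Suc k)
    then obtain v where v: "v \<in> Arr C" "Dom C v = Cod C (sproj R k)" "Cod C v = Dom C (sproj R' k)" "ft k = sproj R' k \<cdot> v"
      by blast
    show ?case
      by (rule kernel_lift_factor[OF syzygy_liftD(2)[OF ft, of k] syzygiesD(1)[OF R] syzygiesD(1)[OF R'] syzygiesD(2)[OF R]
         syzygiesD(8)[OF R', of "Suc k"] syzygiesD(3)[OF R', of k, symmetric] v])
        (use syzygiesD(3)[OF R, of k] in auto)
  qed
  then show ?thesis using that by blast
qed

end

section \<open>The Horseshoe Lemma\<close>

context abelian
begin

lemma projective_biproduct:
  assumes "is_biproduct C A B S i1 i2 p1 p2" "projective C A" "projective C B"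
  shows "projective C S"
proof -
  have i: "i1 \<in> Arr C" "i2 \<in> Arr C" "p1 \<in> Arr C" "p2 \<in> Arr C"
    "Dom C i1 = A" "Cod C i1 = S" "Dom C i2 = B" "Cod C i2 = S"
    "Dom C p1 = S" "Dom C p2 = S" "Cod C p1 = A" "Cod C p2 = B"
    "Plus C (i1 \<cdot> p1) (i2 \<cdot> p2) = Ident C S"
    using assms(1) by (auto simp: is_biproduct_def)
  show ?thesis unfolding projective_def
  proof (intro conjI allI impI)
    show "S \<in> Obj C" using i by auto
    fix e t assume e: "is_epi C e" and t: "t \<in> Hom C S (Cod C e)"
    have ea: "e \<in> Arr C" using e by simp
    have ta: "t \<in> Arr C" "Dom C t = S" "Cod C t = Cod C e" using t by auto
    obtain h1 where h1: "h1 \<in> Arr C" "Dom C h1 = A" "Cod C h1 = Dom C e" "e \<cdot> h1 = t \<cdot> i1"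
      by (rule projective_lift[OF assms(2) e, of "t \<cdot> i1"]) (use i(1-12) ta in simp_all)
    obtain h2 where h2: "h2 \<in> Arr C" "Dom C h2 = B" "Cod C h2 = Dom C e" "e \<cdot> h2 = t \<cdot> i2"
      by (rule projective_lift[OF assms(3) e, of "t \<cdot> i2"]) (use i(1-12) ta in simp_all)
    have "e \<cdot> Plus C (h1 \<cdot> p1) (h2 \<cdot> p2) = t \<cdot> Plus C (i1 \<cdot> p1) (i2 \<cdot> p2)"
      using h1(1-3) h2(1-3) i(1-12) ea ta reassoc[OF h1(4), of p1] reassoc[OF h2(4), of p2] by simp
    then have "e \<cdot> Plus C (h1 \<cdot> p1) (h2 \<cdot> p2) = t" unfolding i(13) using ta by simp
    then show "\<exists>h\<in>Hom C S (Dom C e). e \<cdot> h = t"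
      by (intro bexI[of _ "Plus C (h1 \<cdot> p1) (h2 \<cdot> p2)"]) (use h1(1-3) h2(1-3) i(1-12) ea in simp_all)
  qed
qed

lemma biproduct_short_exact:
  assumes "is_biproduct C A B S i1 i2 p1 p2"
  shows "short_exact C i1 p2"
proof -
  have i: "i1 \<in> Arr C" "i2 \<in> Arr C" "p1 \<in> Arr C" "p2 \<in> Arr C"
    "Dom C i1 = A" "Cod C i1 = S" "Dom C i2 = B" "Cod C i2 = S"
    "Dom C p1 = S" "Dom C p2 = S" "Cod C p1 = A" "Cod C p2 = B"
    "Plus C (i1 \<cdot> p1) (i2 \<cdot> p2) = Ident C S" "p1 \<cdot> i1 = Ident C A" "p2 \<cdot> i2 = Ident C B" "p2 \<cdot> i1 = Zero C A B"
    using assms(1) by (auto simp: is_biproduct_def)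
  have AB: "A \<in> Obj C" "B \<in> Obj C" "S \<in> Obj C" using Dom_Obj[OF i(1)] Dom_Obj[OF i(2)] Cod_Obj[OF i(1)] i(5-8) by simp_all
  have m: "is_mono C i1" by (rule mono_cancel[of p1 i1]) (use i(1,3,6,9) i(14) AB in simp_all)
  have e: "is_epi C p2" by (rule epi_cancel[of p2 i2]) (use i(2,4,8,10) i(15) AB in simp_all)
  show ?thesis unfolding short_exact_iff
  proof (intro conjI e kernelI m)
    fix t assume t: "t \<in> Arr C" "Cod C t = Dom C p2" "p2 \<cdot> t = Zero C (Dom C t) (Cod C p2)"
    have "t = Plus C (i1 \<cdot> p1) (i2 \<cdot> p2) \<cdot> t" unfolding i(13) using t(1,2) i(10) by simp
    also have "\<dots> = Plus C (i1 \<cdot> (p1 \<cdot> t)) (i2 \<cdot> (p2 \<cdot> t))" using t(1,2) i(1-12) by simp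
    also have "\<dots> = i1 \<cdot> (p1 \<cdot> t)" unfolding t(3) using t(1,2) i(1-12) by simp
    finally show "\<exists>s. s \<in> Arr C \<and> Dom C s = Dom C t \<and> Cod C s = Dom C i1 \<and> i1 \<cdot> s = t"
      by (intro exI[of _ "p1 \<cdot> t"]) (use t(1,2) i(1-12) in simp)
  qed (use i AB in simp_all)
qed

text \<open>The middle projective is the biproduct of the outer two, mapped by
  \<open>f \<cdot> pA\<close> on the first summand and by a lift \<open>s\<close> of
  \<open>pC\<close> along \<open>g\<close> on the second.\<close>

lemma horseshoe_middle:
  assumes "short_exact C f g" "short_exact C iA pA" "short_exact C iC pC" "projective C (Dom C pA)" "projective C (Dom C pC)"
    "Cod C pA = Dom C f" "Cod C pC = Cod C g"
  obtains a b p i where "short_exact C a b" "short_exact C i p" "projective C (Dom C p)" "Cod C p = Cod C f"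
    "Dom C a = Dom C pA" "Cod C a = Dom C p" "Cod C b = Dom C pC" "p \<cdot> a = f \<cdot> pA" "pC \<cdot> b = g \<cdot> p"
proof -
  note f = short_exactD[OF assms(1)] and A = short_exactD[OF assms(2)] and X = short_exactD[OF assms(3)]
  obtain S i1 i2 p1 p2 where b: "is_biproduct C (Dom C pA) (Dom C pC) S i1 i2 p1 p2"
    by (rule biproduct[of "Dom C pA" "Dom C pC"]) (use A X in auto)
  then have i: "i1 \<in> Arr C" "i2 \<in> Arr C" "p1 \<in> Arr C" "p2 \<in> Arr C"
    "Dom C i1 = Dom C pA" "Cod C i1 = S" "Dom C i2 = Dom C pC" "Cod C i2 = S"
    "Dom C p1 = S" "Dom C p2 = S" "Cod C p1 = Dom C pA" "Cod C p2 = Dom C pC"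
    "p1 \<cdot> i1 = Ident C (Dom C pA)" "p2 \<cdot> i2 = Ident C (Dom C pC)"
    "p2 \<cdot> i1 = Zero C (Dom C pA) (Dom C pC)" "p1 \<cdot> i2 = Zero C (Dom C pC) (Dom C pA)"
    by (auto simp: is_biproduct_def)
  obtain s where s: "s \<in> Arr C" "Dom C s = Dom C pC" "Cod C s = Dom C g" "g \<cdot> s = pC"
    by (rule projective_lift[OF assms(5) f(2), of pC]) (use X(5) assms(7) in simp_all)
  define p where "p = Plus C (f \<cdot> (pA \<cdot> p1)) (s \<cdot> p2)"
  have p: "p \<in> Arr C" "Dom C p = S" "Cod C p = Dom C g"
    using i(1-12) s(1-3) f(4-6) A(4-6) assms(6,7) by (simp_all add: p_def)
  have pi1: "p \<cdot> i1 = f \<cdot> pA" using i s(1-3) f(4-6) A(4-6) assms(6,7) by (simp add: p_def)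
  have pi2: "p \<cdot> i2 = s" using i s(1-3) f(4-6) A(4-6) X(5) assms(6,7) by (simp add: p_def)
  have gp: "g \<cdot> p = pC \<cdot> p2"
    using reassoc[OF f(7), of "pA \<cdot> p1"] reassoc[OF s(4), of p2] i(1-12) s(1-3) f(4-6) A(4-6) X(4-6) assms(6,7) by (simp add: p_def)
  \<comment> \<open>If \<open>x\<close> kills \<open>p\<close>, the first summand shows that
    \<open>x\<close> kills \<open>f\<close>, so \<open>x = x' \<cdot> g\<close>; the second then
    shows that \<open>x'\<close> kills the epi \<open>pC\<close>.\<close>
  have "is_epi C p"
  proof (rule epiI[OF p])
    fix x Y assume x: "x \<in> Arr C" "Dom C x = Dom C g" "Cod C x = Y" "x \<cdot> p = Zero C S Y"
    have Y: "Y \<in> Obj C" using x by auto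
    have "(x \<cdot> f) \<cdot> pA = Zero C (Dom C pA) Y"
      using reassoc[OF x(4), of i1] x(1-3) p i(1-6) f(4-6) A(5) assms(6) Y by (simp add: pi1)
    then have "x \<cdot> f = Zero C (Dom C f) Y"
      by (intro epi_ZeroD[OF A(2), of "x \<cdot> f"]) (use x(1-3) f(4-6) assms(6) in simp_all)
    then obtain x' where x': "x' \<in> Arr C" "Dom C x' = Cod C g" "Cod C x' = Y" "x' \<cdot> g = x"
      using short_exact_cofactor[OF assms(1) x(1,3)] x(2) f(6) by metis
    have "x \<cdot> s = Zero C (Dom C pC) Y"
      using reassoc[OF x(4), of i2] x(1-3) p i(1-8) Y by (simp add: pi2)
    then have "(x' \<cdot> g) \<cdot> s = Zero C (Dom C pC) Y" by (simp add: x'(4))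
    then have "x' \<cdot> pC = Zero C (Dom C pC) Y" using x'(1-3) s f(5) by simp
    then have "x' = Zero C (Cod C g) Y"
      by (intro epi_ZeroD[OF X(2), of x']) (use x' assms(7) in simp_all)
    then show "x = Zero C (Dom C g) Y" unfolding x'(4)[symmetric] using f(5) Y by simp
  qed
  moreover obtain k where k: "is_kernel C p k" using ex_kernel p by blast
  ultimately have "short_exact C k p" by (simp add: short_exact_iff)
  then show ?thesis
    using that[of i1 p2 k p] biproduct_short_exact[OF b] projective_biproduct[OF b assms(4,5)] p i(5,6,12) pi1 gp f(6) by simp
qed

lemma horseshoe_kernel:
  assumes "short_exact C f g" "short_exact C iA pA" "short_exact C iC pC" "short_exact C a b" "short_exact C i p"
    "Cod C pA = Dom C f" "Cod C pC = Cod C g" "Cod C p = Cod C f"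
    "Dom C a = Dom C pA" "Cod C a = Dom C p" "Cod C b = Dom C pC" "p \<cdot> a = f \<cdot> pA" "pC \<cdot> b = g \<cdot> p"
  obtains f' g' where "short_exact C f' g'" "Dom C f' = Dom C iA" "Cod C f' = Dom C i" "Cod C g' = Dom C iC"
    "i \<cdot> f' = a \<cdot> iA" "iC \<cdot> g' = b \<cdot> i"
proof -
  note f = short_exactD[OF assms(1)] and A = short_exactD[OF assms(2)] and X = short_exactD[OF assms(3)]
    and ab = short_exactD[OF assms(4)] and ip = short_exactD[OF assms(5)]
  have db: "Dom C b = Dom C p" using ab(6) assms(10) by simp
  have cp: "Dom C g = Cod C f" using f(6) by simp
  have "p \<cdot> (a \<cdot> iA) = Zero C (Dom C iA) (Cod C p)"
    using reassoc[OF assms(12), of iA] A(4-7) ab(4) ip(5) assms(6-10) f(4) by simp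
  then obtain f' where f': "f' \<in> Arr C" "Dom C f' = Dom C iA" "Cod C f' = Dom C i" "i \<cdot> f' = a \<cdot> iA"
    using short_exact_factor[OF assms(5), of "a \<cdot> iA" "Dom C iA"] A(4-6) ab(4) assms(9,10) by force
  have "pC \<cdot> (b \<cdot> i) = Zero C (Dom C i) (Cod C pC)"
    using reassoc[OF assms(13), of i] ip(4-7) ab(5) X(5) assms(7,8,11) f(5) cp db by simp
  then obtain g' where g': "g' \<in> Arr C" "Dom C g' = Dom C i" "Cod C g' = Dom C iC" "iC \<cdot> g' = b \<cdot> i"
    using short_exact_factor[OF assms(3), of "b \<cdot> i" "Dom C i"] ip(4-6) ab(5) assms(11) db by force
  have "is_mono C (i \<cdot> f')" unfolding f'(4) by (rule mono_comp[OF A(3) ab(3)]) (use A(6) assms(9) in simp)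
  then have mf: "is_mono C f'" by (rule mono_cancel) (use f' ip(4) in simp_all)
  have "iC \<cdot> (g' \<cdot> f') = b \<cdot> (i \<cdot> f')"
    using reassoc[OF g'(4), of f'] f'(1-3) g'(1-3) X(4) ip(4-6) ab(5) db by simp
  also have "\<dots> = Zero C (Dom C iA) (Cod C iC)"
    unfolding f'(4) using reassoc[OF ab(7), of iA] ab(4-6) A(4-6) assms(9,11) X(5,6) by simp
  finally have gf: "g' \<cdot> f' = Zero C (Dom C f') (Cod C g')"
    by (intro mono_ZeroD[OF X(3), of "g' \<cdot> f'"]) (use f'(1-3) g'(1-3) in simp_all)
  \<comment> \<open>If \<open>g'\<close> kills \<open>t\<close>, then \<open>i \<cdot> t\<close>
    comes from some \<open>t'\<close> along \<open>a\<close>; since \<open>f\<close> is mono,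
    \<open>pA\<close> kills \<open>t'\<close>, which therefore lies in \<open>iA\<close>.\<close>
  have k: "is_kernel C g' f'"
  proof (rule kernelI[OF mf g'(1) _ gf])
    fix t assume t: "t \<in> Arr C" "Cod C t = Dom C g'" "g' \<cdot> t = Zero C (Dom C t) (Cod C g')"
    have "b \<cdot> (i \<cdot> t) = iC \<cdot> (g' \<cdot> t)"
      using reassoc[OF g'(4), of t] t(1,2) g'(1-3) X(4) ip(4-6) ab(5) db by simp
    also have "\<dots> = Zero C (Dom C t) (Cod C b)" unfolding t(3) using X(4-6) g'(3) t(1) assms(11) by simp
    finally obtain t' where t': "t' \<in> Arr C" "Dom C t' = Dom C t" "Cod C t' = Dom C a" "a \<cdot> t' = i \<cdot> t"
      using short_exact_factor[OF assms(4), of "i \<cdot> t" "Dom C t"] t(1,2) g'(2) ip(4-6) db by force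
    have "f \<cdot> (pA \<cdot> t') = p \<cdot> (i \<cdot> t)"
      using reassoc[OF assms(12), of t'] t'(1-3) assms(6,8,9,10) ab(4) ip(5) f(4) A(5) by (simp add: t'(4))
    also have "\<dots> = Zero C (Dom C t) (Cod C f)" using reassoc[OF ip(7), of t] t(1,2) g'(2) ip(4-6) assms(8) f(4) by simp
    finally have "pA \<cdot> t' = Zero C (Dom C t) (Cod C pA)"
      by (intro mono_ZeroD[OF f(3), of "pA \<cdot> t'"]) (use t'(1-3) assms(6,9) A(5) in simp_all)
    then obtain w where w: "w \<in> Arr C" "Dom C w = Dom C t" "Cod C w = Dom C iA" "iA \<cdot> w = t'"
      using short_exact_factor[OF assms(2) t'(1,2)] t'(3) assms(9) by auto
    have "i \<cdot> (f' \<cdot> w) = a \<cdot> (iA \<cdot> w)"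
      using reassoc[OF f'(4), of w] w(1-3) f'(1-3) ip(4) A(4-6) ab(4) assms(9) by simp
    also have "\<dots> = i \<cdot> t" by (simp add: w(4) t'(4))
    finally have "f' \<cdot> w = t"
      by (intro is_monoD[OF ip(3), of "f' \<cdot> w" t]) (use w(1-3) f'(1-3) t(1,2) g'(2) in simp_all)
    then show "\<exists>s. s \<in> Arr C \<and> Dom C s = Dom C t \<and> Cod C s = Dom C f' \<and> f' \<cdot> s = t"
      using w(1-3) f'(2) by (intro exI[of _ w]) simp
  qed (use f' g' in simp)
  \<comment> \<open>After an epi, \<open>iC\<close> lifts along \<open>b\<close>; what \<open>p\<close> does to the lift comes from \<open>f\<close>, hence can be corrected using \<open>pA\<close>.\<close>
  have "is_epi C g'"
  proof -
    obtain z0 e0 where z0: "is_epi C e0" "Cod C e0 = Dom C iC" "z0 \<in> Arr C" "Dom C z0 = Dom C e0" "Cod C z0 = Dom C b" "b \<cdot> z0 = iC \<cdot> e0"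
      using epi_pullback[OF ab(2), of iC] X(4,6) assms(11) by metis
    have e0: "e0 \<in> Arr C" using z0(1) by simp
    have "g \<cdot> (p \<cdot> z0) = pC \<cdot> (iC \<cdot> e0)"
      using reassoc[OF assms(13)[symmetric], of z0] z0(2-5) f(5) cp assms(8,11) ip(5) db X(5) ab(5) by (simp add: z0(6))
    also have "\<dots> = Zero C (Dom C e0) (Cod C g)" using reassoc[OF X(7), of e0] X(4-6) e0 z0(2) assms(7) f(5) by simp
    finally obtain y where y: "y \<in> Arr C" "Dom C y = Dom C e0" "Cod C y = Dom C f" "f \<cdot> y = p \<cdot> z0"
      using short_exact_factor[OF assms(1), of "p \<cdot> z0" "Dom C e0"] z0(3-5) db ip(5) assms(8) cp by force
    obtain e r where e: "is_epi C e" "Cod C e = Dom C e0" "r \<in> Arr C" "Dom C r = Dom C e" "Cod C r = Dom C pA" "pA \<cdot> r = y \<cdot> e"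
      using epi_pullback[OF A(2), of y] y assms(6) by metis
    have ea: "e \<in> Arr C" using e(1) by simp
    define z where "z = sub C (z0 \<cdot> e) (a \<cdot> r)"
    have z: "z \<in> Arr C" "Dom C z = Dom C e" "Cod C z = Dom C p"
      using z0(3-5) e(2-5) ea ab(4-6) assms(9,10) db by (simp_all add: z_def)
    have zz: "z0 \<cdot> e \<in> Arr C" "Dom C (z0 \<cdot> e) = Dom C e" "Cod C (z0 \<cdot> e) = Dom C p"
      "a \<cdot> r \<in> Arr C" "Dom C (a \<cdot> r) = Dom C e" "Cod C (a \<cdot> r) = Dom C p"
      using z0(3-5) e(2-5) ea ab(4-6) assms(9,10) db by simp_all
    have "p \<cdot> (a \<cdot> r) = f \<cdot> (pA \<cdot> r)"
      using reassoc[OF assms(12), of r] e(3-5) ab(4) assms(6,8-10) ip(5) f(4) A(5) by simp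
    also have "\<dots> = (f \<cdot> y) \<cdot> e" unfolding e(6) using y(1-3) e(2) ea f(4) by simp
    also have "\<dots> = p \<cdot> (z0 \<cdot> e)" unfolding y(4) using z0(3-5) e(2) ea ip(5) db by simp
    finally have "p \<cdot> z = Zero C (Dom C e) (Cod C p)"
      unfolding z_def using zz ip(5) by simp
    then obtain w where w: "w \<in> Arr C" "Dom C w = Dom C e" "Cod C w = Dom C i" "i \<cdot> w = z"
      using short_exact_factor[OF assms(5) z(1,2)] z(3) by auto
    have "b \<cdot> (a \<cdot> r) = Zero C (Dom C e) (Cod C b)" using reassoc[OF ab(7), of r] e(3-5) ab(4-6) assms(9) by simp
    moreover have "b \<cdot> (z0 \<cdot> e) = iC \<cdot> (e0 \<cdot> e)"
      using reassoc[OF z0(6), of e] z0(3-5) e(2) ea ab(5) e0 X(4) z0(2) by simp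
    moreover have "Cod C (iC \<cdot> (e0 \<cdot> e)) = Cod C b" "Dom C (iC \<cdot> (e0 \<cdot> e)) = Dom C e" "iC \<cdot> (e0 \<cdot> e) \<in> Arr C"
      using e0 ea e(2) z0(2) X(4,6) assms(11) by simp_all
    ultimately have "b \<cdot> z = iC \<cdot> (e0 \<cdot> e)" unfolding z_def using zz ab(5) db by simp
    then have "iC \<cdot> (g' \<cdot> w) = iC \<cdot> (e0 \<cdot> e)"
      using reassoc[OF g'(4), of w] w(1-3) g'(1-3) X(4) ip(4-6) ab(5) db by (simp add: w(4))
    then have "g' \<cdot> w = e0 \<cdot> e"
      by (intro is_monoD[OF X(3), of "g' \<cdot> w" "e0 \<cdot> e"]) (use w(1-3) g'(1-3) e0 ea e(2) z0(2) in simp_all)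
    moreover have "is_epi C (e0 \<cdot> e)" by (rule epi_comp[OF e(1) z0(1) e(2)])
    ultimately have "is_epi C (g' \<cdot> w)" by simp
    then show ?thesis by (rule epi_cancel) (use w g' in simp_all)
  qed
  then show ?thesis using that[of f' g'] k f' g' by (simp add: short_exact_iff)
qed

lemma ex_horseshoe:
  assumes fg: "short_exact C f g" and RA: "projective_resolution C (Dom C f) RA" and RC: "projective_resolution C (Cod C g) RC"
  obtains RB a b sa sb where "horseshoe C f g RA RB RC a b sa sb"
proof -
  note SA = projective_resolution_syzygies[OF RA] and SC = projective_resolution_syzygies[OF RC]
  note A = syzygiesD[OF SA] and X = syzygiesD[OF SC]
  \<comment> \<open>A stage bundles a syzygy sequence \<open>f'\<close>, \<open>g'\<close> with the
    sequence of projectives and the middle projection \<open>p\<close> built over it.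
    \<open>?Q\<close> ties the next syzygy sequence to the kernel \<open>i\<close> of that
    projection, and \<open>?P\<close> also fixes the start.\<close>
  let ?S = "\<lambda>n f' g'. short_exact C f' g' \<and> Dom C f' = Cod C (sproj RA n) \<and> Cod C g' = Cod C (sproj RC n)"
  let ?L = "\<lambda>n f' g' a b p i. ?S n f' g' \<and> short_exact C a b \<and> short_exact C i p \<and> projective C (Dom C p) \<and> Cod C p = Cod C f' \<and>
    Dom C a = Dom C (sproj RA n) \<and> Cod C a = Dom C p \<and> Cod C b = Dom C (sproj RC n) \<and> p \<cdot> a = f' \<cdot> sproj RA n \<and> sproj RC n \<cdot> b = g' \<cdot> p"
  let ?P = "\<lambda>n (f', g', a, b, p, i). ?L n f' g' a b p i \<and> (n = 0 \<longrightarrow> f' = f \<and> g' = g)"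
  let ?Q = "\<lambda>n (f', g', a, b, p, i) (f'', g'', a', b', p', i').
    Cod C f'' = Dom C i \<and> i \<cdot> f'' = a \<cdot> sincl RA n \<and> sincl RC n \<cdot> g'' = b \<cdot> i"
  have ex: "\<exists>a b p i. ?L n f' g' a b p i" if "?S n f' g'" for n f' g'
    by (rule horseshoe_middle[of f' g' "sincl RA n" "sproj RA n" "sincl RC n" "sproj RC n"])
      (use that A(1,2) X(1,2) in auto)
  have "\<exists>h. \<forall>n. ?P n (h n) \<and> ?Q n (h n) (h (Suc n))"
  proof (rule dependent_nat_choice)
    have "?S 0 f g" using fg A(4) X(4) by simp
    from ex[OF this] obtain a b p i where "?L 0 f g a b p i" by blast
    then have "?P 0 (f, g, a, b, p, i)" by simp
    then show "\<exists>x. ?P 0 x" by blast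
    fix x n assume "?P n x"
    then obtain f' g' a b p i where x: "x = (f', g', a, b, p, i)" and L: "?L n f' g' a b p i" by (cases x) auto
    have L': "short_exact C f' g'" "Cod C (sproj RA n) = Dom C f'" "Cod C (sproj RC n) = Cod C g'" "short_exact C a b"
      "short_exact C i p" "Cod C p = Cod C f'" "Dom C a = Dom C (sproj RA n)" "Cod C a = Dom C p" "Cod C b = Dom C (sproj RC n)"
      "p \<cdot> a = f' \<cdot> sproj RA n" "sproj RC n \<cdot> b = g' \<cdot> p"
      using L by auto
    obtain f'' g'' where f'': "short_exact C f'' g''" "Dom C f'' = Dom C (sincl RA n)" "Cod C f'' = Dom C i" "Cod C g'' = Dom C (sincl RC n)"
      "i \<cdot> f'' = a \<cdot> sincl RA n" "sincl RC n \<cdot> g'' = b \<cdot> i"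
      by (rule horseshoe_kernel[OF L'(1) A(1)[of n] X(1)[of n] L'(4,5,2,3,6-)])
    have "?S (Suc n) f'' g''" using f'' A(3) X(3) by simp
    from ex[OF this] obtain a' b' p' i' where "?L (Suc n) f'' g'' a' b' p' i'" by blast
    then have "?P (Suc n) (f'', g'', a', b', p', i') \<and> ?Q n x (f'', g'', a', b', p', i')"
      using f'' x by simp
    then show "\<exists>y. ?P (Suc n) y \<and> ?Q n x y" by blast
  qed
  then obtain h where h0: "\<forall>n. ?P n (h n) \<and> ?Q n (h n) (h (Suc n))" by (rule exE)
  have h: "?P n (h n)" "?Q n (h n) (h (Suc n))" for n
    by (rule conjunct1[OF spec[OF h0]] conjunct2[OF spec[OF h0]])+
  define sa sb a b p i where "sa n = fst (h n)" "sb n = fst (snd (h n))" "a n = fst (snd (snd (h n)))"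
    "b n = fst (snd (snd (snd (h n))))" "p n = fst (snd (snd (snd (snd (h n)))))" "i n = snd (snd (snd (snd (snd (h n)))))" for n
  have hn: "h n = (sa n, sb n, a n, b n, p n, i n)" for n by (simp add: sa_sb_a_b_p_i_def)
  have L: "?L n (sa n) (sb n) (a n) (b n) (p n) (i n)" "n = 0 \<longrightarrow> sa n = f \<and> sb n = g" for n
    using h(1)[of n] unfolding hn prod.case by blast+
  have Q: "Cod C (sa (Suc n)) = Dom C (i n)" "i n \<cdot> sa (Suc n) = a n \<cdot> sincl RA n" "sincl RC n \<cdot> sb (Suc n) = b n \<cdot> i n" for n
    using h(2)[of n] unfolding hn prod.case by blast+
  \<comment> \<open>The differentials are recovered as projection onto a syzygy followed by its
    inclusion, the form that \<open>syzygies_resolution\<close> asks for.\<close>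
  define RB :: "'a resolution" where "RB = \<lparr>rdiff = (\<lambda>n. case n of 0 \<Rightarrow> p 0 | Suc k \<Rightarrow> i k \<cdot> p (Suc k)), sproj = p, sincl = i\<rparr>"
  have RB: "sproj RB = p" "sincl RB = i" by (simp_all add: RB_def)
  have "syzygies C (Cod C f) RB"
    using L Q(1) by (simp add: syzygies_def RB)
  then have "projective_resolution C (Cod C f) RB"
    by (rule syzygies_resolution) (simp_all add: RB_def)
  moreover have "sa n \<in> Arr C" "sb n \<in> Arr C" "Dom C (sb n) = Cod C (p n)" "a n \<in> Arr C" "b n \<in> Arr C" "Dom C (b n) = Dom C (p n)" for n
    using L(1)[of n] short_exactD(4-6)[of "sa n" "sb n"] short_exactD(4-6)[of "a n" "b n"] by auto
  ultimately have "horseshoe C f g RA RB RC a b sa sb"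
    unfolding horseshoe_def RB using RA RC L Q by simp
  then show ?thesis using that by blast
qed

lemma horseshoeD:
  assumes "horseshoe C f g RA RB RC a b sa sb"
  shows "syzygies C (Dom C f) RA" "syzygies C (Cod C f) RB" "syzygies C (Cod C g) RC" "sa 0 = f" "sb 0 = g"
    "short_exact C (sa k) (sb k)" "short_exact C (a k) (b k)"
    "Dom C (sa k) = Cod C (sproj RA k)" "Cod C (sa k) = Cod C (sproj RB k)" "Dom C (sb k) = Cod C (sproj RB k)" "Cod C (sb k) = Cod C (sproj RC k)"
    "Dom C (a k) = Dom C (sproj RA k)" "Cod C (a k) = Dom C (sproj RB k)" "Dom C (b k) = Dom C (sproj RB k)" "Cod C (b k) = Dom C (sproj RC k)"
    "sproj RB k \<cdot> a k = sa k \<cdot> sproj RA k" "sproj RC k \<cdot> b k = sb k \<cdot> sproj RB k"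
    "sincl RB k \<cdot> sa (Suc k) = a k \<cdot> sincl RA k" "sincl RC k \<cdot> sb (Suc k) = b k \<cdot> sincl RB k"
  using assms projective_resolution_syzygies unfolding horseshoe_def by (simp_all)

lemma horseshoe_lifts:
  assumes "horseshoe C f g RA RB RC a b sa sb"
  shows "syzygy_lift C RA RB f sa" "syzygy_lift C RB RC g sb"
proof -
  note h = horseshoeD[OF assms]
  note A = syzygiesD[OF h(1)] and B = syzygiesD[OF h(2)] and X = syzygiesD[OF h(3)]
  have "kernel_lift C (sincl RA k) (sproj RA k) (sincl RB k) (sproj RB k) (sa k) (sa (Suc k))" for k
    by (rule kernel_liftI[of "a k"]) (use short_exactD(4,5)[OF h(6)] short_exactD(4,5)[OF h(7)] h(8-16,18) A(3) B(3) in simp_all)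
  then show "syzygy_lift C RA RB f sa" using h(4) by (simp add: syzygy_lift_def)
  have "kernel_lift C (sincl RB k) (sproj RB k) (sincl RC k) (sproj RC k) (sb k) (sb (Suc k))" for k
    by (rule kernel_liftI[of "b k"]) (use short_exactD(4,5)[OF h(6)] short_exactD(4,5)[OF h(7)] h(8-15,17,19) X(3) B(3) in simp_all)
  then show "syzygy_lift C RB RC g sb" using h(5) by (simp add: syzygy_lift_def)
qed

text \<open>A splitting \<open>s\<close> of \<open>b k\<close> gives the lift \<open>sproj RB k \<cdot> s\<close>; comparing it with the
  inclusion of syzygies produces the sign.\<close>

lemma horseshoe_connect:
  assumes "horseshoe C f g RA RB RC a b sa sb"
  obtains h where "kernel_lift C (sincl RC k) (sproj RC k) (sa k) (sb k) (Ident C (Cod C (sproj RC k))) h"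
    "kernel_lift C (sa (Suc k)) (sb (Suc k)) (sincl RA k) (sproj RA k) (neg C h) (Ident C (Cod C (sproj RA (Suc k))))"
proof -
  note H = horseshoeD[OF assms]
  note A = syzygiesD[OF H(1)] and B = syzygiesD[OF H(2)] and X = syzygiesD[OF H(3)]
  note ab = short_exactD[OF H(7)[of k]] and S = short_exactD[OF H(6)[of k]] and S' = short_exactD[OF H(6)[of "Suc k"]]
  have PX: "Dom C (sproj RC k) \<in> Obj C" using X(6) by simp
  obtain s where s: "s \<in> Arr C" "Dom C s = Dom C (sproj RC k)" "Cod C s = Dom C (b k)" "b k \<cdot> s = Ident C (Dom C (sproj RC k))"
    by (rule projective_lift[OF X(2)[of k] ab(2), of "Ident C (Dom C (sproj RC k))"]) (use PX H(15) in simp_all)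
  define l where "l = sproj RB k \<cdot> s"
  have l: "l \<in> Arr C" "Dom C l = Dom C (sproj RC k)" "Cod C l = Dom C (sb k)"
    using s(1-3) B(6) H(10,14) by (simp_all add: l_def)
  have "sb k \<cdot> l = sproj RC k \<cdot> (b k \<cdot> s)"
    unfolding l_def using reassoc[OF H(17)[of k], of s] s(1-3) B(6) H(10,14,15) S(5) X(6) ab(5) by simp
  then have sl: "sb k \<cdot> l = Ident C (Cod C (sproj RC k)) \<cdot> sproj RC k" unfolding s(4) using X(6) by simp
  obtain h where kl: "kernel_lift C (sincl RC k) (sproj RC k) (sa k) (sb k) (Ident C (Cod C (sproj RC k))) h"
    and h: "h \<in> Arr C" "Dom C h = Dom C (sincl RC k)" "Cod C h = Dom C (sa k)" "sa k \<cdot> h = l \<cdot> sincl RC k"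
    by (rule kernel_lift_extend[OF X(1)[of k] H(6)[of k] _ _ _ l sl]) (use X(6) H(11) in simp_all)
  define w where "w = sincl RC k \<cdot> sb (Suc k)"
  have w: "w \<in> Arr C" "Dom C w = Dom C (sincl RB k)" "Cod C w = Dom C (sproj RC k)"
    using X(3,5,7) H(10,11) S'(5) B(3) by (simp_all add: w_def)
  have bw: "b k \<cdot> sincl RB k = w" using H(19) by (simp add: w_def)
  have bsw: "b k \<cdot> (s \<cdot> w) = w" using reassoc[OF s(4), of w] w s(1-3) ab(5) H(15) PX by simp
  \<comment> \<open>Subtracting from \<open>sincl RB k\<close> the part seen by the splitting leaves
    an arrow that \<open>b k\<close> kills. Its factorisation \<open>r\<close> through
    \<open>a k\<close> will be the lift of \<open>neg C h\<close>.\<close>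
  let ?d = "sub C (sincl RB k) (s \<cdot> w)"
  have d: "s \<cdot> w \<in> Arr C" "Dom C (s \<cdot> w) = Dom C (sincl RB k)" "Cod C (s \<cdot> w) = Dom C (sproj RB k)"
    using s(1-3) w H(14) by simp_all
  have "b k \<cdot> ?d = Zero C (Dom C (sincl RB k)) (Cod C (b k))"
    using d B(5,7) ab(5) H(14,15) w by (simp add: bsw bw)
  then obtain r where r: "r \<in> Arr C" "Dom C r = Dom C (sincl RB k)" "Cod C r = Dom C (a k)" "a k \<cdot> r = ?d"
    using short_exact_factor[OF H(7)[of k], of ?d "Dom C (sincl RB k)"] d B(5,7) H(14) by force
  have ws: "w \<cdot> sa (Suc k) = Zero C (Dom C (sincl RA k)) (Dom C (sproj RC k))"
    using S'(4-7) X(3,5,6,7) H(8,10,11) A(3,6) B(3) by (simp add: w_def)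
  have "a k \<cdot> (r \<cdot> sa (Suc k)) = ?d \<cdot> sa (Suc k)"
    using reassoc[OF r(4), of "sa (Suc k)"] r(1-3) S'(4) H(8,9) B(3) ab(4) by simp
  also have "\<dots> = a k \<cdot> sincl RA k"
    using d S'(4) H(8,9,12,13,14) B(3,5,7) A(3,5,6,7) PX s(1-3) w ab(4) by (simp add: ws H(18))
  finally have rs: "r \<cdot> sa (Suc k) = sincl RA k"
    by (intro is_monoD[OF ab(3), of "r \<cdot> sa (Suc k)" "sincl RA k"]) (use r(1-3) S'(4) H(8,9,12) B(3) A(3,5,7) in simp_all)
  have hs: "sa k \<cdot> (h \<cdot> sb (Suc k)) = sproj RB k \<cdot> (s \<cdot> w)"
    using reassoc[OF h(4), of "sb (Suc k)"] h(1-3) S'(5) H(10,11,14) X(3,5,7) S(4) s(1-3) l(1-3) B(6) by (simp add: l_def w_def)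
  \<comment> \<open>The sign appears here: \<open>sproj RB k\<close> kills
    \<open>sincl RB k\<close>, so only the subtracted term of \<open>?d\<close> survives, and by
    \<open>hs\<close> that term is what \<open>sa k\<close> makes of
    \<open>h \<cdot> sb (Suc k)\<close>.\<close>
  have "sa k \<cdot> (sproj RA k \<cdot> r) = sproj RB k \<cdot> (a k \<cdot> r)"
    using reassoc[OF H(16)[of k], of r] r(1-3) H(8,9,12,13) S(4) A(6) ab(4) B(6) by simp
  also have "\<dots> = neg C (sproj RB k \<cdot> (s \<cdot> w))"
    unfolding r(4) using d B(5,6,7) short_exactD(7)[OF B(1)] by simp
  also have "\<dots> = sa k \<cdot> neg C (h \<cdot> sb (Suc k))"
    unfolding hs[symmetric] using h(1-3) S'(5) S(4) H(11) X(3) by simp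
  finally have pr: "sproj RA k \<cdot> r = neg C (h \<cdot> sb (Suc k))"
    by (intro is_monoD[OF S(3), of "sproj RA k \<cdot> r"]) (use r(1-3) A(6) H(8,10,11,12) h(1-3) S'(5) X(3) in simp_all)
  have "kernel_lift C (sa (Suc k)) (sb (Suc k)) (sincl RA k) (sproj RA k) (neg C h) (Ident C (Cod C (sproj RA (Suc k))))"
    by (rule kernel_liftI[of r]) (use r(1-3) pr rs h(1-3) S'(4,5) H(8,10,11,12) X(3) A(3,5,6) B(3) in simp_all)
  then show ?thesis using that kl by blast
qed

lemma horseshoe_signed_lift:
  assumes "horseshoe C f g RA RB RC a b sa sb"
  obtains h where "\<And>k. kernel_lift C (sincl RC k) (sproj RC k) (sa k) (sb k) (Ident C (Cod C (sproj RC k))) (h k)"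
    "\<And>k. kernel_lift C (sa (Suc k)) (sb (Suc k)) (sincl RA k) (sproj RA k) (neg C (h k)) (Ident C (Cod C (sproj RA (Suc k))))"
    "syzygy_lift C (shift RC) RA (h 0) (\<lambda>k. signed C k (h k))"
proof -
  note H = horseshoeD[OF assms]
  note A = syzygiesD[OF H(1)] and X = syzygiesD[OF H(3)]
  have "\<exists>h. \<forall>k. kernel_lift C (sincl RC k) (sproj RC k) (sa k) (sb k) (Ident C (Cod C (sproj RC k))) (h k) \<and>
    kernel_lift C (sa (Suc k)) (sb (Suc k)) (sincl RA k) (sproj RA k) (neg C (h k)) (Ident C (Cod C (sproj RA (Suc k))))"
    using horseshoe_connect[OF assms] by (intro choice) metis
  then obtain h where h: "\<And>k. kernel_lift C (sincl RC k) (sproj RC k) (sa k) (sb k) (Ident C (Cod C (sproj RC k))) (h k)"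
    "\<And>k. kernel_lift C (sa (Suc k)) (sb (Suc k)) (sincl RA k) (sproj RA k) (neg C (h k)) (Ident C (Cod C (sproj RA (Suc k))))"
    by blast
  have h': "h k \<in> Arr C" "Dom C (h k) = Cod C (sproj RC (Suc k))" "Cod C (h k) = Cod C (sproj RA k)" for k
    using kernel_lift_hom[OF h(1)[of k]] X(3) H(8) by simp_all
  have O: "Cod C (sproj RC k) \<in> Obj C" "Cod C (sproj RA k) \<in> Obj C" for k using X(6) A(6) by simp_all
  \<comment> \<open>The lift of the identity at stage \<open>k + 1\<close> and the lift of
    \<open>neg C (h k)\<close> share the sequence \<open>sa (Suc k)\<close>,
    \<open>sb (Suc k)\<close>. Composing them shows that \<open>h (Suc k)\<close> is induced by a
    lift of \<open>neg C (h k)\<close>.\<close>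
  have l: "kernel_lift C (sincl RC (Suc k)) (sproj RC (Suc k)) (sincl RA k) (sproj RA k) (neg C (h k)) (h (Suc k))" for k
    using kernel_lift_comp[OF h(1)[of "Suc k"] h(2)[of k] X(1) H(6) A(1)] H(11) h' O by simp
  have l': "kernel_lift C (sincl RC (Suc k)) (sproj RC (Suc k)) (sincl RA k) (sproj RA k) (h k) (neg C (h (Suc k)))" for k
    using kernel_lift_neg[OF l[of k] X(1) A(1)] h' by simp
  have "signed C k (h k) = (if even k then h k else neg C (h k))" for k
    by (simp add: signed_def neg_def)
  then have "syzygy_lift C (shift RC) RA (h 0) (\<lambda>k. signed C k (h k))"
    using l l' by (simp add: syzygy_lift_def)
  then show ?thesis using that h by blast
qed

end

section \<open>Sequential direct limits\<close>

text \<open>The exactness hypothesis specialised to sequences, with squares for consecutive stages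
  only; it no longer refers to an index type.\<close>

definition exact_seq_limits :: "('o, 'a) category \<Rightarrow> bool" where
  "exact_seq_limits D \<longleftrightarrow>
     (\<forall>x y z f g LX a LY b LZ c u v.
        sequential D x \<longrightarrow> sequential D y \<longrightarrow> sequential D z \<longrightarrow>
        (\<forall>k. f k \<in> Hom D (Dom D (x k)) (Dom D (y k)) \<and> g k \<in> Hom D (Dom D (y k)) (Dom D (z k)) \<and> short_exact D (f k) (g k) \<and>
           f (Suc k) \<cdot>\<^bsub>D\<^esub> x k = y k \<cdot>\<^bsub>D\<^esub> f k \<and> g (Suc k) \<cdot>\<^bsub>D\<^esub> y k = z k \<cdot>\<^bsub>D\<^esub> g k) \<longrightarrow>
        is_seq_limit D x LX a \<longrightarrow> is_seq_limit D y LY b \<longrightarrow> is_seq_limit D z LZ c \<longrightarrow>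
        u \<in> Hom D LX LY \<longrightarrow> (\<forall>k. u \<cdot>\<^bsub>D\<^esub> a k = b k \<cdot>\<^bsub>D\<^esub> f k) \<longrightarrow>
        v \<in> Hom D LY LZ \<longrightarrow> (\<forall>k. v \<cdot>\<^bsub>D\<^esub> b k = c k \<cdot>\<^bsub>D\<^esub> g k) \<longrightarrow>
        short_exact D u v)"

definition seqlim :: "('o, 'a) category \<Rightarrow> (nat \<Rightarrow> 'a) \<Rightarrow> 'o \<Rightarrow> (nat \<Rightarrow> 'a) \<Rightarrow> bool" where
  "seqlim C x L c \<longleftrightarrow> sequential C x \<and> is_seq_limit C x L c"

text \<open>Compatibility is asked for single steps; \<open>cocone_iff\<close> identifies this with
  the notion over the directed set of natural numbers.\<close>

definition seq_cocone :: "('o, 'a) category \<Rightarrow> (nat \<Rightarrow> 'a) \<Rightarrow> 'o \<Rightarrow> (nat \<Rightarrow> 'a) \<Rightarrow> bool" where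
  "seq_cocone C x Y d \<longleftrightarrow> Y \<in> Obj C \<and>
     (\<forall>k. d k \<in> Arr C \<and> Dom C (d k) = Dom C (x k) \<and> Cod C (d k) = Y \<and> d (Suc k) \<cdot>\<^bsub>C\<^esub> x k = d k)"

context abelian
begin

section \<open>Sequential systems and their limits\<close>

lemma sequentialD:
  assumes "sequential C x"
  shows "x k \<in> Arr C" "Cod C (x k) = Dom C (x (Suc k))"
  using assms by (auto simp: sequential_def)

lemma steps_simps:
  assumes "sequential C x"
  shows "steps C x i m \<in> Arr C" "Dom C (steps C x i m) = Dom C (x i)" "Cod C (steps C x i m) = Dom C (x (i + m))"
proof -
  have "steps C x i m \<in> Arr C \<and> Dom C (steps C x i m) = Dom C (x i) \<and> Cod C (steps C x i m) = Dom C (x (i + m))"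
    by (induction m) (use sequentialD[OF assms] in simp_all)
  then show "steps C x i m \<in> Arr C" "Dom C (steps C x i m) = Dom C (x i)" "Cod C (steps C x i m) = Dom C (x (i + m))"
    by auto
qed

lemma steps_add:
  assumes "sequential C x"
  shows "steps C x (i + m) n \<cdot> steps C x i m = steps C x i (m + n)"
proof (induction n)
  case (Suc n)
  then show ?case using steps_simps[OF assms] sequentialD[OF assms] by (simp add: add.assoc)
qed (use steps_simps[OF assms] in simp)

lemma steps_natural:
  assumes "sequential C x" "sequential C y" "\<And>k. f k \<in> Arr C" "\<And>k. Dom C (f k) = Dom C (x k)" "\<And>k. Cod C (f k) = Dom C (y k)"
    "\<And>k. f (Suc k) \<cdot> x k = y k \<cdot> f k"
  shows "f (i + m) \<cdot> steps C x i m = steps C y i m \<cdot> f i"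
proof (induction m)
  case 0
  then show ?case using assms(3-5) by simp
next
  case (Suc m)
  have "f (i + Suc m) \<cdot> steps C x i (Suc m) = (f (Suc (i + m)) \<cdot> x (i + m)) \<cdot> steps C x i m"
    using assms(3-5) sequentialD[OF assms(1)] steps_simps[OF assms(1)] by simp
  also have "\<dots> = y (i + m) \<cdot> (f (i + m) \<cdot> steps C x i m)" unfolding assms(6)
    using assms(3-5) sequentialD[OF assms(2)] steps_simps[OF assms(1)] by simp
  also have "\<dots> = steps C y i (Suc m) \<cdot> f i" unfolding Suc
    using assms(3-5) sequentialD[OF assms(2)] steps_simps[OF assms(2)] by simp
  finally show ?case .
qed

lemma cocone_iff:
  assumes "sequential C x"
  shows "cocone C UNIV {(i, j). i \<le> j} (\<lambda>k. Dom C (x k)) (\<lambda>i j. steps C x i (j - i)) Y d \<longleftrightarrow> seq_cocone C x Y d" (is "?L \<longleftrightarrow> ?R")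
proof
  assume L: ?L
  have "d (Suc k) \<cdot> steps C x k (Suc k - k) = d k" for k
    using L unfolding cocone_def by (metis (mono_tags, lifting) case_prodI le_SucI mem_Collect_eq order_refl)
  then have "d (Suc k) \<cdot> x k = d k" for k using sequentialD[OF assms] by simp
  then show ?R using L by (auto simp: cocone_def seq_cocone_def)
next
  assume R: ?R
  have s: "d (i + m) \<cdot> steps C x i m = d i" for i m
  proof (induction m)
    case (Suc m)
    have "d (Suc (i + m)) \<cdot> x (i + m) = d (i + m)" using R by (simp add: seq_cocone_def)
    from reassoc[OF this, of "steps C x i m"] show ?case
      using Suc R sequentialD[OF assms] steps_simps[OF assms, of i m] by (simp add: seq_cocone_def)
  qed (use R in \<open>simp add: seq_cocone_def\<close>)
  have "d j \<cdot> steps C x i (j - i) = d i" if "i \<le> j" for i j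
    using s[of i "j - i"] that by simp
  then show ?L using R by (simp add: cocone_def seq_cocone_def)
qed

lemma seqlim_iff:
  "seqlim C x L c \<longleftrightarrow> sequential C x \<and> seq_cocone C x L c \<and>
    (\<forall>Y d. seq_cocone C x Y d \<longrightarrow> (\<exists>!u. u \<in> Hom C L Y \<and> (\<forall>k. u \<cdot> c k = d k)))"
  unfolding seqlim_def is_seq_limit_def is_direct_limit_def
  by (cases "sequential C x") (simp_all add: cocone_iff del: Hom_iff)

lemma seqlimD:
  assumes "seqlim C x L c"
  shows "sequential C x" "L \<in> Obj C" "c k \<in> Arr C" "Dom C (c k) = Dom C (x k)" "Cod C (c k) = L" "c (Suc k) \<cdot> x k = c k"
    "x k \<in> Arr C" "Cod C (x k) = Dom C (x (Suc k))"
  using assms sequentialD[of x k] unfolding seqlim_iff seq_cocone_def by auto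

lemma seqlim_factor:
  assumes "seqlim C x L c" "Y \<in> Obj C" "\<And>k. d k \<in> Arr C" "\<And>k. Dom C (d k) = Dom C (x k)" "\<And>k. Cod C (d k) = Y" "\<And>k. d (Suc k) \<cdot> x k = d k"
  obtains u where "u \<in> Arr C" "Dom C u = L" "Cod C u = Y" "\<And>k. u \<cdot> c k = d k"
proof -
  have "seq_cocone C x Y d" using assms(2-6) by (simp add: seq_cocone_def)
  then have "\<exists>!u. u \<in> Hom C L Y \<and> (\<forall>k. u \<cdot> c k = d k)" using assms(1) unfolding seqlim_iff by blast
  then show ?thesis using that by auto
qed

text \<open>Each leg factors through the next one, so agreement from stage one on is enough. This
  form fits the limit arrows that the constructions define by their values for
  \<open>k \<ge> 1\<close>.\<close>

lemma seqlim_eq: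
  assumes "seqlim C x L c" "u \<in> Arr C" "v \<in> Arr C" "Dom C u = L" "Dom C v = L" "\<And>k. u \<cdot> c (Suc k) = v \<cdot> c (Suc k)"
  shows "u = v"
proof -
  note L = seqlimD[OF assms(1)]
  have e: "u \<cdot> c k = v \<cdot> c k" for k
    using reassoc[OF assms(6)[of k], of "x k"] L assms(2-5) by simp
  have "Cod C u = Cod C (u \<cdot> c 0)" "Cod C v = Cod C (v \<cdot> c 0)" using L assms(2-5) by simp_all
  then have cod: "Cod C v = Cod C u" using e by simp
  have cc: "u \<cdot> (c (Suc k) \<cdot> x k) = u \<cdot> c k" for k using L(6) by simp
  have "seq_cocone C x (Cod C u) (\<lambda>k. u \<cdot> c k)"
    using L assms(2,4) by (simp add: seq_cocone_def)
  then have "\<exists>!w. w \<in> Hom C L (Cod C u) \<and> (\<forall>k. w \<cdot> c k = u \<cdot> c k)" using assms(1) unfolding seqlim_iff by blast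
  moreover have "u \<in> Hom C L (Cod C u) \<and> (\<forall>k. u \<cdot> c k = u \<cdot> c k)" "v \<in> Hom C L (Cod C u) \<and> (\<forall>k. v \<cdot> c k = u \<cdot> c k)"
    using assms(2-5) cod e by simp_all
  ultimately show ?thesis by blast
qed

lemma seqlimI:
  assumes "sequential C x" "L \<in> Obj C" "\<And>k. c k \<in> Arr C" "\<And>k. Dom C (c k) = Dom C (x k)" "\<And>k. Cod C (c k) = L" "\<And>k. c (Suc k) \<cdot> x k = c k"
    and ex: "\<And>Y d. Y \<in> Obj C \<Longrightarrow> (\<And>k. d k \<in> Arr C) \<Longrightarrow> (\<And>k. Dom C (d k) = Dom C (x k)) \<Longrightarrow> (\<And>k. Cod C (d k) = Y) \<Longrightarrow>
      (\<And>k. d (Suc k) \<cdot> x k = d k) \<Longrightarrow> \<exists>u. u \<in> Arr C \<and> Dom C u = L \<and> Cod C u = Y \<and> (\<forall>k. u \<cdot> c k = d k)"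
    and eq: "\<And>u v. u \<in> Arr C \<Longrightarrow> v \<in> Arr C \<Longrightarrow> Dom C u = L \<Longrightarrow> Dom C v = L \<Longrightarrow> (\<And>k. u \<cdot> c k = v \<cdot> c k) \<Longrightarrow> u = v"
  shows "seqlim C x L c"
  unfolding seqlim_iff
proof (intro conjI allI impI assms(1))
  show "seq_cocone C x L c" using assms(2-6) by (simp add: seq_cocone_def)
  fix Y d assume "seq_cocone C x Y d"
  then have "\<exists>u. u \<in> Arr C \<and> Dom C u = L \<and> Cod C u = Y \<and> (\<forall>k. u \<cdot> c k = d k)"
    using ex[of Y d] by (simp add: seq_cocone_def)
  then show "\<exists>!u. u \<in> Hom C L Y \<and> (\<forall>k. u \<cdot> c k = d k)"
    by (intro ex_ex1I) (auto intro: eq)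
qed

lemma seqlim_map:
  assumes x: "seqlim C x L c" and y: "seqlim C y L' c'"
    and f: "\<And>k. f k \<in> Arr C" "\<And>k. Dom C (f k) = Dom C (x k)" "\<And>k. Cod C (f k) = Dom C (y k)" "\<And>k. f (Suc k) \<cdot> x k = y k \<cdot> f k"
  obtains u where "u \<in> Arr C" "Dom C u = L" "Cod C u = L'" "\<And>k. u \<cdot> c k = c' k \<cdot> f k"
proof -
  note X = seqlimD[OF x] and Y = seqlimD[OF y]
  have e: "(c' (Suc k) \<cdot> f (Suc k)) \<cdot> x k = c' k \<cdot> f k" for k
    using X Y f reassoc[OF Y(6)[of k], of "f k"] by simp
  show ?thesis
    by (rule seqlim_factor[OF x, of L' "\<lambda>k. c' k \<cdot> f k"]) (use e X Y f that in simp_all)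
qed

text \<open>\<open>UNIV\<close> and \<open>{1..}\<close> are the index sets that occur in the
  constructions; both contain every successor, so \<open>seqlim_eq\<close> gives uniqueness.\<close>

lemma lim_map_eq:
  assumes "seqlim C x L c" "K = UNIV \<or> K = {1..}" "u \<in> Arr C" "Dom C u = L" "Cod C u = Y" "\<And>k. k \<in> K \<Longrightarrow> u \<cdot> c k = d k"
  shows "lim_map C K L c Y d = u"
  unfolding lim_map_def
proof (rule the_equality)
  show "u \<in> Hom C L Y \<and> (\<forall>k\<in>K. u \<cdot> c k = d k)" using assms by simp
  fix v assume v: "v \<in> Hom C L Y \<and> (\<forall>k\<in>K. v \<cdot> c k = d k)"
  have "Suc k \<in> K" for k using assms(2) by auto
  then have e: "v \<cdot> c (Suc k) = u \<cdot> c (Suc k)" for k using v assms(6) by simp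
  show "v = u" by (rule seqlim_eq[OF assms(1)]) (use e v assms(3,4) in simp_all)
qed

text \<open>The index type carries no order, so the natural numbers are copied into it:
  \<open>J\<close> is the range of an injection, \<open>r\<close> the transported order, and
  \<open>e\<close> recovers the number.\<close>

lemma directed_system_transport:
  fixes \<iota> :: "nat \<Rightarrow> 'i"
  assumes \<iota>: "inj \<iota>" and e: "\<And>n. e (\<iota> n) = n"
    and J: "J = range \<iota>" and r: "r = {(\<iota> i, \<iota> j) | i j. i \<le> j}" and x: "sequential C x"
  shows "direct_system C J r (\<lambda>j. Dom C (x (e j))) (\<lambda>i j. steps C x (e i) (e j - e i))"
    and "is_seq_limit C x L c \<Longrightarrow> is_direct_limit C J r (\<lambda>j. Dom C (x (e j))) (\<lambda>i j. steps C x (e i) (e j - e i)) L (\<lambda>j. c (e j))"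
proof -
  have mr: "(a, b) \<in> r \<longleftrightarrow> (\<exists>i j. a = \<iota> i \<and> b = \<iota> j \<and> i \<le> j)" for a b using r by auto
  have qr: "(\<forall>a b. (a, b) \<in> r \<longrightarrow> Q a b) \<longleftrightarrow> (\<forall>i j. i \<le> j \<longrightarrow> Q (\<iota> i) (\<iota> j))" for Q using r by blast
  have st: "steps C x j (k - j) \<cdot> steps C x i (j - i) = steps C x i (k - i)" if "i \<le> j" "j \<le> k" for i j k
    using steps_add[OF x, of i "j - i" "k - j"] that by simp
  have io: "\<iota> i = \<iota> j \<longleftrightarrow> i = j" for i j using \<iota> by (auto dest: injD)
  show "direct_system C J r (\<lambda>j. Dom C (x (e j))) (\<lambda>i j. steps C x (e i) (e j - e i))"
    unfolding direct_system_def mr J using steps_simps[OF x] sequentialD[OF x] st by (auto simp: e io)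
  have co: "cocone C J r (\<lambda>j. Dom C (x (e j))) (\<lambda>i j. steps C x (e i) (e j - e i)) Y d \<longleftrightarrow>
    cocone C UNIV {(i, j). i \<le> j} (\<lambda>k. Dom C (x k)) (\<lambda>i j. steps C x i (j - i)) Y (\<lambda>k. d (\<iota> k))" for Y d
    unfolding cocone_def qr J by (simp add: e)
  assume "is_seq_limit C x L c"
  then show "is_direct_limit C J r (\<lambda>j. Dom C (x (e j))) (\<lambda>i j. steps C x (e i) (e j - e i)) L (\<lambda>j. c (e j))"
    unfolding is_seq_limit_def is_direct_limit_def co by (simp add: e J)
qed

text \<open>An infinite type contains a copy of the natural numbers, over which sequential systems
  become systems indexed by a directed set.\<close>

lemma exact_direct_limits_sequential:
  assumes "infinite (UNIV :: 'i set)" "exact_direct_limits TYPE('i) C"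
  shows "exact_seq_limits C"
  unfolding exact_seq_limits_def
proof (intro allI impI)
  fix x y z f g LX a LY b LZ c u v
  assume x: "sequential C x" and y: "sequential C y" and z: "sequential C z"
    and fg: "\<forall>k. f k \<in> Hom C (Dom C (x k)) (Dom C (y k)) \<and> g k \<in> Hom C (Dom C (y k)) (Dom C (z k)) \<and> short_exact C (f k) (g k) \<and>
           f (Suc k) \<cdot> x k = y k \<cdot> f k \<and> g (Suc k) \<cdot> y k = z k \<cdot> g k"
    and lim: "is_seq_limit C x LX a" "is_seq_limit C y LY b" "is_seq_limit C z LZ c"
    and u: "u \<in> Hom C LX LY" "\<forall>k. u \<cdot> a k = b k \<cdot> f k" and v: "v \<in> Hom C LY LZ" "\<forall>k. v \<cdot> b k = c k \<cdot> g k"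
  obtain \<iota> :: "nat \<Rightarrow> 'i" where \<iota>: "inj \<iota>" using infinite_countable_subset[OF assms(1)] by auto
  define e where "e = inv_into UNIV \<iota>"
  have e: "e (\<iota> n) = n" for n using \<iota> by (simp add: e_def)
  define J where "J = range \<iota>"
  define r where "r = {(\<iota> i, \<iota> j) | i j. i \<le> j}"
  note tr = directed_system_transport[OF \<iota> e J_def r_def]
  have dir: "directed_set J r"
    unfolding directed_set_def preorder_on_def
  proof (intro conjI ballI)
    show "J \<noteq> {}" by (auto simp: J_def)
    show "refl_on J r" by (auto simp: refl_on_def J_def r_def)
    have "i = j" if "\<iota> i = \<iota> j" for i j using \<iota> that by (auto dest: injD)
    then show "trans r" unfolding trans_def r_def by (fastforce intro: order_trans)
    fix i j assume "i \<in> J" "j \<in> J"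
    then obtain m n where "i = \<iota> m" "j = \<iota> n" by (auto simp: J_def)
    moreover have "m \<le> max m n" "n \<le> max m n" by simp_all
    ultimately have "(i, \<iota> (max m n)) \<in> r" "(j, \<iota> (max m n)) \<in> r" unfolding r_def by blast+
    then show "\<exists>k\<in>J. (i, k) \<in> r \<and> (j, k) \<in> r" by (auto simp: J_def)
  qed (auto simp: J_def r_def)
  have nat: "f n \<cdot> steps C x m (n - m) = steps C y m (n - m) \<cdot> f m" "g n \<cdot> steps C y m (n - m) = steps C z m (n - m) \<cdot> g m" if "m \<le> n" for m n
    using steps_natural[OF x y, of f m "n - m"] steps_natural[OF y z, of g m "n - m"] fg that by simp_all
  show "short_exact C u v"
  proof (rule assms(2)[unfolded exact_direct_limits_def, rule_format, where J = J and r = r and LX = LX and LY = LY and LZ = LZ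
      and f = "\<lambda>j. f (e j)" and g = "\<lambda>j. g (e j)", OF dir tr(1)[OF x] tr(1)[OF y] tr(1)[OF z] _ _ tr(2)[OF x lim(1)] tr(2)[OF y lim(2)] tr(2)[OF z lim(3)] u(1) _ v(1)])
    fix i j assume "(i, j) \<in> r"
    then obtain m n where "i = \<iota> m" "j = \<iota> n" "m \<le> n" by (auto simp: r_def)
    then show "f (e j) \<cdot> steps C x (e i) (e j - e i) = steps C y (e i) (e j - e i) \<cdot> f (e i) \<and>
      g (e j) \<cdot> steps C y (e i) (e j - e i) = steps C z (e i) (e j - e i) \<cdot> g (e i)" using nat by (simp add: e)
  qed (use u v fg in auto)
qed

end

locale abelian_limits = abelian +
  assumes ex_limit: "\<And>x. sequential C x \<Longrightarrow> \<exists>L c. is_seq_limit C x L c"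
    and exact_limits: "exact_seq_limits C"
begin

section \<open>Exactness of sequential limits\<close>

lemma obtain_limit:
  assumes "\<And>k. x k \<in> Arr C" "\<And>k. Cod C (x k) = Dom C (x (Suc k))"
  obtains L c where "seqlim C x L c"
proof -
  have "sequential C x" using assms by (simp add: sequential_def)
  then show ?thesis using ex_limit[of x] that by (auto simp: seqlim_def)
qed

lemma limit_short_exact:
  assumes x: "seqlim C x LX a" and y: "seqlim C y LY b" and z: "seqlim C z LZ c"
    and f: "\<And>k. Dom C (f k) = Dom C (x k)" "\<And>k. Cod C (f k) = Dom C (y k)" "\<And>k. f (Suc k) \<cdot> x k = y k \<cdot> f k"
    and g: "\<And>k. Cod C (g k) = Dom C (z k)" "\<And>k. g (Suc k) \<cdot> y k = z k \<cdot> g k"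
    and se: "\<And>k. short_exact C (f k) (g k)"
    and u: "u \<in> Arr C" "Dom C u = LX" "Cod C u = LY" "\<And>k. u \<cdot> a k = b k \<cdot> f k"
    and v: "v \<in> Arr C" "Dom C v = LY" "Cod C v = LZ" "\<And>k. v \<cdot> b k = c k \<cdot> g k"
  shows "short_exact C u v"
proof -
  have "f k \<in> Hom C (Dom C (x k)) (Dom C (y k)) \<and> g k \<in> Hom C (Dom C (y k)) (Dom C (z k)) \<and> short_exact C (f k) (g k) \<and>
           f (Suc k) \<cdot> x k = y k \<cdot> f k \<and> g (Suc k) \<cdot> y k = z k \<cdot> g k" for k
    using f g se[of k] short_exactD(4-6)[OF se[of k]] by simp
  then show ?thesis
    using exact_limits[unfolded exact_seq_limits_def, rule_format, of x y z f g LX a LY b LZ c u v] x y z u v unfolding seqlim_def by simp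
qed

text \<open>The kernels of the \<open>f k\<close> form a system of their own; exactness makes
  \<open>u\<close> the second arrow of a short exact sequence of limits.\<close>

lemma limit_epi:
  assumes x: "seqlim C x LX a" and y: "seqlim C y LY b"
    and f: "\<And>k. Dom C (f k) = Dom C (x k)" "\<And>k. Cod C (f k) = Dom C (y k)" "\<And>k. f (Suc k) \<cdot> x k = y k \<cdot> f k" "\<And>k. is_epi C (f k)"
    and u: "u \<in> Arr C" "Dom C u = LX" "Cod C u = LY" "\<And>k. u \<cdot> a k = b k \<cdot> f k"
  shows "is_epi C u"
proof -
  note X = seqlimD[OF x] and Y = seqlimD[OF y]
  have fa: "f k \<in> Arr C" for k using f(4) by simp
  have "\<exists>n. is_kernel C (f k) n" for k using ex_kernel[OF fa] by blast
  then obtain n where n: "\<And>k. is_kernel C (f k) (n k)" by metis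
  note N = kernel_simps[OF n]
  have "\<exists>t. t \<in> Arr C \<and> Dom C t = Dom C (n k) \<and> Cod C t = Dom C (n (Suc k)) \<and> n (Suc k) \<cdot> t = x k \<cdot> n k" for k
  proof -
    have "f (Suc k) \<cdot> (x k \<cdot> n k) = Zero C (Dom C (x k \<cdot> n k)) (Cod C (f (Suc k)))"
      using reassoc[OF f(3)[of k], of "n k"] N X Y f(1,2) fa by simp
    then show ?thesis using kernel_factor[OF n[of "Suc k"], of "x k \<cdot> n k"] N(2,3) X(7,8) f(1,2) by (metis comp_simps)
  qed
  then obtain t where t: "\<And>k. t k \<in> Arr C" "\<And>k. Dom C (t k) = Dom C (n k)" "\<And>k. Cod C (t k) = Dom C (n (Suc k))" "\<And>k. n (Suc k) \<cdot> t k = x k \<cdot> n k"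
    by metis
  obtain LN c where c: "seqlim C t LN c" using obtain_limit[of t] t by auto
  have ndom: "Dom C (n k) = Dom C (t k)" for k using t(2) by simp
  obtain w where w: "w \<in> Arr C" "Dom C w = LN" "Cod C w = LX" "\<And>k. w \<cdot> c k = a k \<cdot> n k"
    by (rule seqlim_map[OF c x, of n]) (use N(2,3) f(1) t in simp_all)
  have "short_exact C w u"
    by (rule limit_short_exact[OF c x y, of n f]) (use N(2,3) f t n w u in \<open>simp_all add: short_exact_iff\<close>)
  then show ?thesis by (simp add: short_exact_iff)
qed

text \<open>Dual to \<open>limit_epi\<close>, with the system of cokernels.\<close>

lemma limit_mono:
  assumes x: "seqlim C x LX a" and y: "seqlim C y LY b"
    and f: "\<And>k. Dom C (f k) = Dom C (x k)" "\<And>k. Cod C (f k) = Dom C (y k)" "\<And>k. f (Suc k) \<cdot> x k = y k \<cdot> f k" "\<And>k. is_mono C (f k)"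
    and u: "u \<in> Arr C" "Dom C u = LX" "Cod C u = LY" "\<And>k. u \<cdot> a k = b k \<cdot> f k"
  shows "is_mono C u"
proof -
  note X = seqlimD[OF x] and Y = seqlimD[OF y]
  have fa: "f k \<in> Arr C" for k using f(4) by simp
  have "\<exists>n. is_cokernel C (f k) n" for k using ex_cokernel[OF fa] by blast
  then obtain n where n: "\<And>k. is_cokernel C (f k) (n k)" by metis
  note N = cokernel_simps[OF n]
  have se: "short_exact C (f k) (n k)" for k
    using mono_kernel[OF f(4) n] cokernel_epi[OF n] by (simp add: short_exact_iff)
  have "\<exists>t. t \<in> Arr C \<and> Dom C t = Cod C (n k) \<and> Cod C t = Cod C (n (Suc k)) \<and> t \<cdot> n k = n (Suc k) \<cdot> y k" for k
  proof -
    have "(n (Suc k) \<cdot> y k) \<cdot> f k = n (Suc k) \<cdot> (f (Suc k) \<cdot> x k)" unfolding f(3) using N(2,3) Y f(2) fa by simp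
    also have "\<dots> = Zero C (Dom C (f k)) (Cod C (n (Suc k) \<cdot> y k))"
      using reassoc[OF N(4)[of "Suc k"], of "x k"] N(2,3) X Y f(1,2) fa by simp
    finally show ?thesis using cokernel_factor[OF n[of k], of "n (Suc k) \<cdot> y k"] N(2,3) Y(7,8) f(1,2) by (metis comp_simps)
  qed
  then obtain t where t: "\<And>k. t k \<in> Arr C" "\<And>k. Dom C (t k) = Cod C (n k)" "\<And>k. Cod C (t k) = Cod C (n (Suc k))" "\<And>k. t k \<cdot> n k = n (Suc k) \<cdot> y k"
    by metis
  obtain LN c where c: "seqlim C t LN c" using obtain_limit[of t] t by auto
  obtain w where w: "w \<in> Arr C" "Dom C w = LY" "Cod C w = LN" "\<And>k. w \<cdot> b k = c k \<cdot> n k"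
    by (rule seqlim_map[OF y c, of n]) (use N(2,3) f(2) t in simp_all)
  have "short_exact C u w"
    by (rule limit_short_exact[OF x y c, of f n]) (use N(2,3) f t se w u in simp_all)
  then show ?thesis by (rule short_exactD)
qed

text \<open>Factor \<open>X \<rightarrow> Y \<rightarrow> Z\<close> as \<open>X \<rightarrow> K \<rightarrow> Y \<rightarrow> I \<rightarrow> Z\<close> through the kernel and the coimage of the second map.\<close>

lemma limit_exact:
  assumes x: "seqlim C x LX a" and y: "seqlim C y LY b" and z: "seqlim C z LZ c"
    and f: "\<And>k. Dom C (f k) = Dom C (x k)" "\<And>k. Cod C (f k) = Dom C (y k)" "\<And>k. f (Suc k) \<cdot> x k = y k \<cdot> f k"
    and g: "\<And>k. Cod C (g k) = Dom C (z k)" "\<And>k. g (Suc k) \<cdot> y k = z k \<cdot> g k"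
    and ex: "\<And>k. exact_at C (f k) (g k)"
    and u: "u \<in> Arr C" "Dom C u = LX" "Cod C u = LY" "\<And>k. u \<cdot> a k = b k \<cdot> f k"
    and v: "v \<in> Arr C" "Dom C v = LY" "Cod C v = LZ" "\<And>k. v \<cdot> b k = c k \<cdot> g k"
  shows "exact_at C u v"
proof -
  note X = seqlimD[OF x] and Y = seqlimD[OF y] and Z = seqlimD[OF z]
  have fg: "f k \<in> Arr C" "g k \<in> Arr C" "Dom C (g k) = Dom C (y k)" for k using ex[of k] f(2) by (auto simp: exact_at_iff)
  have "\<exists>m p. is_kernel C (g k) m \<and> is_epi C p \<and> Dom C p = Dom C (f k) \<and> Cod C p = Dom C m \<and> m \<cdot> p = f k" for k
    using ex[of k] unfolding exact_at_def using image_factor by metis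
  then obtain m p where m: "\<And>k. is_kernel C (g k) (m k)" and p: "\<And>k. is_epi C (p k)" "\<And>k. Dom C (p k) = Dom C (f k)"
    "\<And>k. Cod C (p k) = Dom C (m k)" "\<And>k. m k \<cdot> p k = f k" by metis
  note M = kernel_simps[OF m]
  have pa: "p k \<in> Arr C" for k using p(1) by simp
  have "\<exists>e. is_cokernel C (m k) e" for k using ex_cokernel[OF M(2)] by blast
  then obtain e where e: "\<And>k. is_cokernel C (m k) (e k)" by metis
  note E = cokernel_simps[OF e]
  have me: "short_exact C (m k) (e k)" for k
    using mono_kernel[OF kernel_mono[OF m] e] cokernel_epi[OF e] by (simp add: short_exact_iff)
  have "\<exists>i. i \<in> Arr C \<and> Dom C i = Cod C (e k) \<and> Cod C i = Cod C (g k) \<and> i \<cdot> e k = g k" for k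
    using cokernel_factor[OF e[of k], of "g k"] M by metis
  then obtain i where i: "\<And>k. i k \<in> Arr C" "\<And>k. Dom C (i k) = Cod C (e k)" "\<And>k. Cod C (i k) = Cod C (g k)" "\<And>k. i k \<cdot> e k = g k" by metis
  \<comment> \<open>If \<open>i k\<close> kills \<open>t\<close>, then after an epi \<open>t\<close>
    comes from some \<open>s\<close> along \<open>e k\<close>. This \<open>s\<close> is killed by
    \<open>g k\<close>, so it factors through the kernel \<open>m k\<close> and dies under
    \<open>e k\<close>.\<close>
  have im: "is_mono C (i k)" for k
  proof (rule monoI[OF i(1) refl refl])
    fix t T assume t: "t \<in> Arr C" "Dom C t = T" "Cod C t = Dom C (i k)" "i k \<cdot> t = Zero C T (Cod C (i k))"
    obtain e' s where s: "is_epi C e'" "Cod C e' = T" "s \<in> Arr C" "Dom C s = Dom C e'" "Cod C s = Dom C (e k)" "e k \<cdot> s = t \<cdot> e'"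
      using epi_pullback[OF cokernel_epi[OF e[of k]], of t] t i(2) by metis
    have e'a: "e' \<in> Arr C" using s(1) by simp
    have To: "T \<in> Obj C" using t by auto
    have "g k \<cdot> s = i k \<cdot> (e k \<cdot> s)" using reassoc[OF i(4)[of k], of s] s(3-5) E(2,3) i(1-3) by simp
    also have "\<dots> = Zero C (Dom C s) (Cod C (g k))"
      unfolding s(6) using reassoc[OF t(4), of e'] t(1-3) s(2,4) e'a i(1-3) fg(2) To by simp
    finally obtain w where w: "w \<in> Arr C" "Dom C w = Dom C s" "Cod C w = Dom C (m k)" "m k \<cdot> w = s"
      using kernel_factor[OF m[of k], of s] s(3,5) E(3) M(3) by metis
    have "t \<cdot> e' = e k \<cdot> (m k \<cdot> w)" by (simp add: w(4) s(6))
    also have "\<dots> = Zero C (Dom C e') (Dom C (i k))"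
      using reassoc[OF E(4)[of k], of w] w(1-3) E(2,3) M(2,3) s(4) i(2) by simp
    finally show "t = Zero C T (Dom C (i k))" using epi_ZeroD[OF s(1), of t] t(1-3) s(2) by simp
  qed
  have "\<exists>t. t \<in> Arr C \<and> Dom C t = Dom C (m k) \<and> Cod C t = Dom C (m (Suc k)) \<and> m (Suc k) \<cdot> t = y k \<cdot> m k" for k
  proof -
    have "g (Suc k) \<cdot> (y k \<cdot> m k) = Zero C (Dom C (y k \<cdot> m k)) (Cod C (g (Suc k)))"
      using reassoc[OF g(2)[of k], of "m k"] M Y Z g(1) fg by simp
    then show ?thesis using kernel_factor[OF m[of "Suc k"], of "y k \<cdot> m k"] M(2,3) Y(7,8) fg by (metis comp_simps)
  qed
  then obtain t where t: "\<And>k. t k \<in> Arr C" "\<And>k. Dom C (t k) = Dom C (m k)" "\<And>k. Cod C (t k) = Dom C (m (Suc k))" "\<And>k. m (Suc k) \<cdot> t k = y k \<cdot> m k"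
    by metis
  have "\<exists>s. s \<in> Arr C \<and> Dom C s = Cod C (e k) \<and> Cod C s = Cod C (e (Suc k)) \<and> s \<cdot> e k = e (Suc k) \<cdot> y k" for k
  proof -
    have "(e (Suc k) \<cdot> y k) \<cdot> m k = e (Suc k) \<cdot> (m (Suc k) \<cdot> t k)" unfolding t(4) using E(2,3) Y M fg by simp
    also have "\<dots> = Zero C (Dom C (m k)) (Cod C (e (Suc k) \<cdot> y k))"
      using reassoc[OF E(4)[of "Suc k"], of "t k"] E(2,3) M(2,3) t(1-3) Y(7,8) fg by simp
    finally show ?thesis using cokernel_factor[OF e[of k], of "e (Suc k) \<cdot> y k"] E(2,3) Y(7,8) fg M(3) by (metis comp_simps)
  qed
  then obtain s where s: "\<And>k. s k \<in> Arr C" "\<And>k. Dom C (s k) = Cod C (e k)" "\<And>k. Cod C (s k) = Cod C (e (Suc k))" "\<And>k. s k \<cdot> e k = e (Suc k) \<cdot> y k"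
    by metis
  obtain LK cK where K: "seqlim C t LK cK" using obtain_limit[of t] t by auto
  obtain LI cI where I: "seqlim C s LI cI" using obtain_limit[of s] s by auto
  have pn: "p (Suc k) \<cdot> x k = t k \<cdot> p k" for k
  proof (rule is_monoD[OF kernel_mono[OF m[of "Suc k"]]])
    have "m (Suc k) \<cdot> (p (Suc k) \<cdot> x k) = f (Suc k) \<cdot> x k"
      using reassoc[OF p(4)[of "Suc k"], of "x k"] pa p(2,3) X(7,8) f(1) M(2) by simp
    also have "\<dots> = y k \<cdot> (m k \<cdot> p k)" by (simp add: f(3) p(4))
    also have "\<dots> = m (Suc k) \<cdot> (t k \<cdot> p k)"
      using reassoc[OF t(4)[of k], of "p k"] pa p(2,3) t(1-3) M(2,3) Y(7,8) fg(3) by simp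
    finally show "m (Suc k) \<cdot> (p (Suc k) \<cdot> x k) = m (Suc k) \<cdot> (t k \<cdot> p k)" .
  qed (use pa p(2,3) t(1-3) X(7,8) f(1) in simp_all)
  have ine: "i (Suc k) \<cdot> s k = z k \<cdot> i k" for k
  proof (rule is_epiD[OF cokernel_epi[OF e[of k]]])
    have "(i (Suc k) \<cdot> s k) \<cdot> e k = i (Suc k) \<cdot> (e (Suc k) \<cdot> y k)" using i(1-3) s E(2,3) by simp
    also have "\<dots> = g (Suc k) \<cdot> y k" using reassoc[OF i(4)[of "Suc k"], of "y k"] i(1-3) E(2,3) Y(7,8) M(3) fg(3) by simp
    also have "\<dots> = (z k \<cdot> i k) \<cdot> e k" using g i(1-4) E(2,3) Z(7,8) by simp
    finally show "(i (Suc k) \<cdot> s k) \<cdot> e k = (z k \<cdot> i k) \<cdot> e k" .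
  qed (use i(1-3) s(1-3) Z(7,8) g(1) in simp_all)
  obtain up where up: "up \<in> Arr C" "Dom C up = LX" "Cod C up = LK" "\<And>k. up \<cdot> a k = cK k \<cdot> p k"
    by (rule seqlim_map[OF x K, of p]) (use pa p(2,3) f(1) t(2) pn in simp_all)
  obtain um where um: "um \<in> Arr C" "Dom C um = LK" "Cod C um = LY" "\<And>k. um \<cdot> cK k = b k \<cdot> m k"
    by (rule seqlim_map[OF K y, of m]) (use M(2,3) t fg(3) in simp_all)
  obtain ue where ue: "ue \<in> Arr C" "Dom C ue = LY" "Cod C ue = LI" "\<And>k. ue \<cdot> b k = cI k \<cdot> e k"
    by (rule seqlim_map[OF y I, of e]) (use E(2,3) M(3) s fg(3) in simp_all)
  obtain ui where ui: "ui \<in> Arr C" "Dom C ui = LI" "Cod C ui = LZ" "\<And>k. ui \<cdot> cI k = c k \<cdot> i k"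
    by (rule seqlim_map[OF I z, of i]) (use i(1-3) s(2) ine g(1) in simp_all)
  have "is_epi C up" by (rule limit_epi[OF x K _ _ pn p(1) up]) (use p(2,3) f(1) t(2) in simp_all)
  moreover have "is_mono C ui" by (rule limit_mono[OF I z _ _ ine im ui]) (use i(1-3) s(2) g(1) in simp_all)
  moreover have "short_exact C um ue"
    by (rule limit_short_exact[OF K y I _ _ t(4) _ _ me um ue]) (use t(2) M(3) fg(3) s(2,4) in simp_all)
  then have "exact_at C um ue" by (simp add: short_exact_def)
  \<comment> \<open>Exactness survives precomposition with the epi \<open>up\<close> and
    postcomposition with the mono \<open>ui\<close>; uniqueness of limit arrows then identifies the
    composites with \<open>u\<close> and \<open>v\<close>.\<close>
  ultimately have "exact_at C (um \<cdot> up) (ui \<cdot> ue)"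
    using exact_comp_mono exact_comp_epi up(3) um(2) ui(2) ue(3) by metis
  moreover have "u = um \<cdot> up"
  proof (rule seqlim_eq[OF x u(1) _ u(2)])
    fix k show "u \<cdot> a (Suc k) = (um \<cdot> up) \<cdot> a (Suc k)"
      using u X(3-5) um(1-3) up reassoc[OF um(4)[of "Suc k"], of "p (Suc k)"] seqlimD[OF K] pa p(2-4) M(2,3) Y(3-5) fg(3) t(2) by simp
  qed (use um up in simp_all)
  moreover have "v = ui \<cdot> ue"
  proof (rule seqlim_eq[OF y v(1) _ v(2)])
    fix k show "v \<cdot> b (Suc k) = (ui \<cdot> ue) \<cdot> b (Suc k)"
      using v Y(3-5) ui(1-3) ue reassoc[OF ui(4)[of "Suc k"], of "e (Suc k)"] seqlimD[OF I] i E(2,3) M(3) Z(3-5) fg(3) g(1) s(2) by simp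
  qed (use ui ue in simp_all)
  ultimately show ?thesis by simp
qed

end

section \<open>The resolution construction as a functor\<close>

text \<open>Unlike \<open>res_sys\<close>, this takes the resolution as an argument, so that shifted
  and horseshoe resolutions are covered.\<close>

definition rsys :: "('o, 'a, 'p, 'b) cohom \<Rightarrow> int \<Rightarrow> 'a resolution \<Rightarrow> nat \<Rightarrow> 'b" where
  "rsys T n R k = conn T (n + int k) (sincl R k) (sproj R k)"

lemma res_sys_rsys: "res_sys ch T n M = rsys T n (resn ch M)"
  by (simp add: fun_eq_iff res_sys_def rsys_def)

locale completion_setting = C: abelian C + D: abelian_limits D
  for C :: "('o, 'a) category" and D :: "('p, 'b) category" (structure) +
  fixes ch :: "('o, 'a, 'p, 'b) choices"
  assumes valid: "valid_choices C D ch"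
begin

section \<open>Additive functors applied to lifts\<close>

lemma functor_simps:
  assumes F: "additive_functor C D F"
  shows "A \<in> Obj C \<Longrightarrow> FOb F A \<in> Obj D" "A \<in> Obj C \<Longrightarrow> FAr F (Ident C A) = Ident D (FOb F A)"
    "f \<in> Arr C \<Longrightarrow> FAr F f \<in> Arr D" "f \<in> Arr C \<Longrightarrow> Dom D (FAr F f) = FOb F (Dom C f)"
    "f \<in> Arr C \<Longrightarrow> Cod D (FAr F f) = FOb F (Cod C f)"
    "f \<in> Arr C \<Longrightarrow> g \<in> Arr C \<Longrightarrow> Cod C f = Dom C g \<Longrightarrow> FAr F (g \<cdot>\<^bsub>C\<^esub> f) = FAr F g \<cdot> FAr F f"
    "f \<in> Arr C \<Longrightarrow> g \<in> Arr C \<Longrightarrow> Dom C g = Dom C f \<Longrightarrow> Cod C g = Cod C f \<Longrightarrow> FAr F (Plus C f g) = Plus D (FAr F f) (FAr F g)"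
  using F unfolding additive_functor_def by (auto simp del: Hom_iff) (auto simp: Hom_def)

lemma functor_Zero:
  assumes F: "additive_functor C D F" and AB: "A \<in> Obj C" "B \<in> Obj C"
  shows "FAr F (Zero C A B) = Zero D (FOb F A) (FOb F B)"
proof -
  have "FAr F (Zero C A B) = FAr F (Plus C (Zero C A B) (Zero C A B))" using AB by simp
  also have "\<dots> = Plus D (FAr F (Zero C A B)) (FAr F (Zero C A B))"
    by (rule functor_simps(7)[OF F]) (use AB in simp_all)
  finally show ?thesis
    using D.Plus_self_Zero[of "FAr F (Zero C A B)"] AB functor_simps(3-5)[OF F, of "Zero C A B"] by simp
qed

lemma functor_neg:
  assumes F: "additive_functor C D F" and f: "f \<in> Arr C"
  shows "FAr F (neg C f) = neg D (FAr F f)"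
proof (rule D.Plus_eq_Zero)
  show "Plus D (FAr F f) (FAr F (neg C f)) = Zero D (Dom D (FAr F f)) (Cod D (FAr F f))"
    using functor_simps(7)[OF F, of f "neg C f", symmetric] f functor_Zero[OF F] functor_simps(3-5)[OF F] by simp
qed (use f functor_simps(3-5)[OF F] in simp_all)

lemma functor_sub:
  assumes F: "additive_functor C D F" and f: "f \<in> Arr C" "g \<in> Arr C" "Dom C g = Dom C f" "Cod C g = Cod C f"
  shows "FAr F (sub C f g) = sub D (FAr F f) (FAr F g)"
  unfolding sub_def using f functor_simps(7)[OF F, of f "neg C g"] functor_neg[OF F] by simp

text \<open>The difference of \<open>fs\<close> and \<open>gs\<close> is \<open>u \<cdot> i\<close>,
  and \<open>FAr F i\<close> kills \<open>t\<close>. Used with a satellite inclusion as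
  \<open>t\<close>, and with an identity when \<open>F\<close> vanishes on the middle term.\<close>

lemma functor_kernel_lift_eq:
  assumes F: "additive_functor C D F" and t: "t \<in> Arr D" "Cod D t = FOb F (Dom C i)" "FAr F i \<cdot> t = Zero D (Dom D t) (FOb F (Cod C i))"
    and l: "kernel_lift C i p j q f fs" "kernel_lift C i p j q f gs" and se: "short_exact C i p" "short_exact C j q"
  shows "FAr F fs \<cdot> t = FAr F gs \<cdot> t"
proof -
  note s = functor_simps[OF F] and fs = C.kernel_lift_hom[OF l(1)] and gs = C.kernel_lift_hom[OF l(2)] and i = C.short_exactD(4-6)[OF se(1)]
  obtain u where u: "u \<in> Arr C" "Dom C u = Dom C p" "Cod C u = Dom C j" "sub C fs gs = u \<cdot>\<^bsub>C\<^esub> i"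
    using C.kernel_lift_unique[OF l se] .
  have j: "Dom C j \<in> Obj C" using C.Cod_Obj[OF u(1)] u(3) by simp
  have "sub D (FAr F fs) (FAr F gs) = FAr F u \<cdot> FAr F i"
    using functor_sub[OF F, of fs gs, symmetric] fs gs u(1-3) i s by (simp add: u(4))
  then have "sub D (FAr F fs) (FAr F gs) \<cdot> t = Zero D (Dom D t) (FOb F (Dom C j))"
    using t u(1-3) i s j by simp
  then have "sub D (FAr F fs \<cdot> t) (FAr F gs \<cdot> t) = Zero D (Dom D t) (FOb F (Dom C j))"
    using t fs gs s by simp
  then show ?thesis
    using D.sub_eq_Zero[of "FAr F fs \<cdot> t" "FAr F gs \<cdot> t"] t fs gs s by simp
qed

lemma functor_zero_kernel_lift_eq:
  assumes F: "additive_functor C D F" and z: "zero_object D (FOb F (Dom C p))"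
    and l: "kernel_lift C i p j q f fs" "kernel_lift C i p j q f gs" and se: "short_exact C i p" "short_exact C j q"
  shows "FAr F fs = FAr F gs"
proof -
  note s = functor_simps[OF F] and fs = C.kernel_lift_hom[OF l(1)] and gs = C.kernel_lift_hom[OF l(2)] and i = C.short_exactD(4-6)[OF se(1)]
  have Di: "Dom C i \<in> Obj C" using i by simp
  have "FAr F i = Zero D (FOb F (Dom C i)) (FOb F (Cod C i))"
    by (rule D.Zero_object_arrow[OF z]) (use s i in simp_all)
  then have "FAr F fs \<cdot> Ident D (FOb F (Dom C i)) = FAr F gs \<cdot> Ident D (FOb F (Dom C i))"
    by (intro functor_kernel_lift_eq[OF F _ _ _ l se]) (use s i Di in simp_all)
  then show ?thesis using fs gs s by simp
qed

lemma resn_syzygies: "M \<in> Obj C \<Longrightarrow> syzygies C M (resn ch M)"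
  using valid C.projective_resolution_syzygies by (simp add: valid_choices_def)

lemma seqlim_dlim: "sequential D x \<Longrightarrow> seqlim D x (dlim ch x) (dleg ch x)"
  using valid by (simp add: valid_choices_def seqlim_def)

end

locale cohom = completion_setting +
  fixes T :: "('a, 'b, 'c, 'd) cohom"
  assumes T: "cohomological_functor C D T"
begin

declare of_nat_Suc [simp del]

text \<open>Normal form of degrees: the target degree of stage \<open>k\<close> in the system for
  \<open>n\<close> is written as the degree of stage \<open>k\<close> in the system for
  \<open>n + 1\<close>. The rule \<open>of_nat_Suc\<close> would steer the simplifier away from
  it.\<close>

lemma int_shift [simp]: "(n :: int) + int (Suc k) = n + 1 + int k" "(n :: int) + int k + 1 = n + 1 + int k"
  by (simp_all add: of_nat_Suc)

section \<open>Connecting homomorphisms and the systems along resolutions\<close>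

lemma fn_functor: "additive_functor C D (fn T n)"
  using T by (simp add: cohomological_functor_def)

lemmas fn_simps [simp] = functor_simps[OF fn_functor]

lemma conn_simps [simp]:
  assumes "short_exact C f g"
  shows "conn T n f g \<in> Arr D" "Dom D (conn T n f g) = FOb (fn T n) (Cod C g)" "Cod D (conn T n f g) = FOb (fn T (n + 1)) (Dom C f)"
  using T assms unfolding cohomological_functor_def by auto

text \<open>Naturality in the form in which it is used: the middle arrow of the morphism of
  sequences is the lift hidden in \<open>kernel_lift\<close>.\<close>

lemma conn_natural:
  assumes "short_exact C f g" "short_exact C f' g'" "kernel_lift C f g f' g' c a" "c \<in> Arr C" "Dom C c = Cod C g" "Cod C c = Cod C g'"
  shows "FAr (fn T (n + 1)) a \<cdot> conn T n f g = conn T n f' g' \<cdot> FAr (fn T n) c"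
proof -
  obtain b where b: "b \<in> Arr C" "Dom C b = Dom C g" "Cod C b = Dom C g'" "g' \<cdot>\<^bsub>C\<^esub> b = c \<cdot>\<^bsub>C\<^esub> g" "f' \<cdot>\<^bsub>C\<^esub> a = b \<cdot>\<^bsub>C\<^esub> f"
    using C.kernel_liftE[OF assms(3)] .
  have "\<forall>n f g f' g' a b c. short_exact C f g \<longrightarrow> short_exact C f' g' \<longrightarrow>
        a \<in> Hom C (Dom C f) (Dom C f') \<longrightarrow> b \<in> Hom C (Cod C f) (Cod C f') \<longrightarrow>
        c \<in> Hom C (Cod C g) (Cod C g') \<longrightarrow>
        b \<cdot>\<^bsub>C\<^esub> f = f' \<cdot>\<^bsub>C\<^esub> a \<longrightarrow> c \<cdot>\<^bsub>C\<^esub> g = g' \<cdot>\<^bsub>C\<^esub> b \<longrightarrow>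
        FAr (fn T (n + 1)) a \<cdot> conn T n f g = conn T n f' g' \<cdot> FAr (fn T n) c"
    using T unfolding cohomological_functor_def by blast
  from this[rule_format, OF assms(1,2), of a b c n] show ?thesis
    using b C.kernel_lift_hom[OF assms(3)] assms C.short_exactD(6)[OF assms(1)] C.short_exactD(6)[OF assms(2)] by simp
qed

lemma conn_exact:
  assumes "short_exact C f g"
  shows "exact_at D (FAr (fn T n) f) (FAr (fn T n) g)" "exact_at D (FAr (fn T n) g) (conn T n f g)"
    "exact_at D (conn T n f g) (FAr (fn T (n + 1)) f)"
  using T assms unfolding cohomological_functor_def by blast+

lemma conn_comp:
  assumes "short_exact C f g"
  shows "conn T n f g \<cdot> FAr (fn T n) g = Zero D (FOb (fn T n) (Dom C g)) (FOb (fn T (n + 1)) (Dom C f))"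
    "FAr (fn T (n + 1)) f \<cdot> conn T n f g = Zero D (FOb (fn T n) (Cod C g)) (FOb (fn T (n + 1)) (Cod C f))"
  using conn_exact(2)[OF assms, of n] conn_exact(3)[OF assms, of n] assms C.short_exactD(4-6)[OF assms]
  unfolding D.exact_at_iff by simp_all

lemma rsys_simps:
  assumes "syzygies C M R"
  shows "rsys T n R k \<in> Arr D" "Dom D (rsys T n R k) = FOb (fn T (n + int k)) (Cod C (sproj R k))"
    "Cod D (rsys T n R k) = FOb (fn T (n + 1 + int k)) (Cod C (sproj R (Suc k)))"
  using C.syzygiesD[OF assms] by (simp_all add: rsys_def)

lemma sequential_rsys:
  assumes "syzygies C M R"
  shows "sequential D (rsys T n R)"
  using rsys_simps[OF assms] by (simp add: sequential_def)

lemma rsys_sproj: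
  assumes "syzygies C M R"
  shows "rsys T n R k \<cdot> FAr (fn T (n + int k)) (sproj R k) = Zero D (FOb (fn T (n + int k)) (Dom C (sproj R k))) (FOb (fn T (n + 1 + int k)) (Cod C (sproj R (Suc k))))"
  using conn_comp(1)[OF C.syzygiesD(1)[OF assms, of k], of "n + int k"] C.syzygiesD(3)[OF assms, of k] by (simp add: rsys_def)

lemma rsys_natural:
  assumes ft: "syzygy_lift C R R' f ft" and R: "syzygies C M R" and R': "syzygies C N R'" and f: "f \<in> Arr C" "Dom C f = M" "Cod C f = N"
  shows "FAr (fn T (n + 1 + int k)) (ft (Suc k)) \<cdot> rsys T n R k = rsys T n R' k \<cdot> FAr (fn T (n + int k)) (ft k)"
  using conn_natural[OF C.syzygiesD(1)[OF R, of k] C.syzygiesD(1)[OF R', of k] C.syzygy_liftD(2)[OF ft, of k], of "n + int k"]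
    C.syzygy_lift_hom[OF ft R R' f] by (simp add: rsys_def)

text \<open>Each \<open>ft k\<close> passes through a projective of \<open>R'\<close> by
  \<open>syzygy_lift_factor\<close>, and the transition map kills what comes from there, since the
  two arrows are consecutive in a long exact sequence.\<close>

lemma rsys_factor_Zero:
  assumes ft: "syzygy_lift C R R' f ft" and R: "syzygies C M R" and R': "syzygies C N R'"
    and e: "e \<in> Arr C" "Dom C e = M" "Cod C e = Dom C (sproj R' 0)" "f = sproj R' 0 \<cdot>\<^bsub>C\<^esub> e"
  shows "rsys T n R' k \<cdot> FAr (fn T (n + int k)) (ft k) = Zero D (FOb (fn T (n + int k)) (Cod C (sproj R k))) (FOb (fn T (n + 1 + int k)) (Cod C (sproj R' (Suc k))))"
proof -
  note r = rsys_simps[OF R'] and s = C.syzygiesD[OF R']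
  obtain v where v: "v \<in> Arr C" "Dom C v = Cod C (sproj R k)" "Cod C v = Dom C (sproj R' k)" "ft k = sproj R' k \<cdot>\<^bsub>C\<^esub> v"
    using C.syzygy_lift_factor[OF ft R R' e] .
  have "FAr (fn T (n + int k)) (ft k) = FAr (fn T (n + int k)) (sproj R' k) \<cdot> FAr (fn T (n + int k)) v"
    unfolding v(4) using v(1-3) s(6) by simp
  then show ?thesis
    using D.reassoc[OF rsys_sproj[OF R', of n k], of "FAr (fn T (n + int k)) v"] v(1-3) s(6) r by simp
qed

text \<open>The difference of the two chains is a chain of lifts of zero, and zero factors through
  the first projective.\<close>

lemma rsys_indep:
  assumes ft: "syzygy_lift C R R' f ft" and gt: "syzygy_lift C R R' f gt"
    and R: "syzygies C M R" and R': "syzygies C N R'" and f: "f \<in> Arr C" "Dom C f = M" "Cod C f = N"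
  shows "rsys T n R' k \<cdot> FAr (fn T (n + int k)) (ft k) = rsys T n R' k \<cdot> FAr (fn T (n + int k)) (gt k)"
proof -
  note r = rsys_simps[OF R'] and s = C.syzygiesD[OF R'] and h = C.syzygy_lift_hom[OF ft R R' f] C.syzygy_lift_hom[OF gt R R' f]
  have M: "M \<in> Obj C" using f by auto
  have "rsys T n R' k \<cdot> FAr (fn T (n + int k)) (sub C (ft k) (gt k)) = Zero D (FOb (fn T (n + int k)) (Cod C (sproj R k))) (FOb (fn T (n + 1 + int k)) (Cod C (sproj R' (Suc k))))"
    by (rule rsys_factor_Zero[OF C.syzygy_lift_sub[OF ft gt R R' f f] R R', of "Zero C M (Dom C (sproj R' 0))"])
      (use f M s(4,6) in simp_all)
  then have "sub D (rsys T n R' k \<cdot> FAr (fn T (n + int k)) (ft k)) (rsys T n R' k \<cdot> FAr (fn T (n + int k)) (gt k))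
    = Zero D (FOb (fn T (n + int k)) (Cod C (sproj R k))) (FOb (fn T (n + 1 + int k)) (Cod C (sproj R' (Suc k))))"
    using functor_sub[OF fn_functor] h r by simp
  then show ?thesis
    using D.sub_eq_Zero[of "rsys T n R' k \<cdot> FAr (fn T (n + int k)) (ft k)"  "rsys T n R' k \<cdot> FAr (fn T (n + int k)) (gt k)"] h r by simp
qed

text \<open>A leg of a cocone passes through the next transition map, after which
  \<open>rsys_indep\<close> applies.\<close>

lemma cocone_indep:
  assumes "syzygy_lift C R R' f ft" "syzygy_lift C R R' f gt"
    and R: "syzygies C M R" and R': "syzygies C N R'" and f: "f \<in> Arr C" "Dom C f = M" "Cod C f = N"
    and d: "d (Suc k) \<in> Arr D" "Dom D (d (Suc k)) = Dom D (rsys T n R' (Suc k))" "d (Suc k) \<cdot> rsys T n R' k = d k"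
  shows "d k \<cdot> FAr (fn T (n + int k)) (ft k) = d k \<cdot> FAr (fn T (n + int k)) (gt k)"
proof -
  note r = rsys_simps[OF R'] and h = C.syzygy_lift_hom[OF assms(1) R R' f] C.syzygy_lift_hom[OF assms(2) R R' f]
  have "d (Suc k) \<cdot> (rsys T n R' k \<cdot> FAr (fn T (n + int k)) (ft k)) = d (Suc k) \<cdot> (rsys T n R' k \<cdot> FAr (fn T (n + int k)) (gt k))"
    using rsys_indep[OF assms(1-7)] by simp
  then show ?thesis
    using D.reassoc[OF d(3), of "FAr (fn T (n + int k)) (ft k)"] D.reassoc[OF d(3), of "FAr (fn T (n + int k)) (gt k)"] d(1,2) r h by simp
qed

abbreviation lob :: "int \<Rightarrow> 'a \<Rightarrow> 'c" where "lob n M \<equiv> dlim ch (rsys T n (resn ch M))"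
abbreviation leg :: "int \<Rightarrow> 'a \<Rightarrow> nat \<Rightarrow> 'd" where "leg n M \<equiv> dleg ch (rsys T n (resn ch M))"
abbreviation res :: "('a, 'b, 'c, 'd) cohom" where "res \<equiv> resolution_construction C D ch T"

section \<open>The limit functor along the chosen resolutions\<close>

lemma seqlim_leg: "M \<in> Obj C \<Longrightarrow> seqlim D (rsys T n (resn ch M)) (lob n M) (leg n M)"
  using seqlim_dlim sequential_rsys resn_syzygies by blast

lemma leg_simps:
  assumes "M \<in> Obj C"
  shows "lob n M \<in> Obj D" "leg n M k \<in> Arr D" "Dom D (leg n M k) = FOb (fn T (n + int k)) (Cod C (sproj (resn ch M) k))"
    "Cod D (leg n M k) = lob n M" "leg n M (Suc k) \<cdot> rsys T n (resn ch M) k = leg n M k"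
  using D.seqlimD[OF seqlim_leg[OF assms]] rsys_simps[OF resn_syzygies[OF assms]] by simp_all

lemma leg_indep:
  assumes "syzygy_lift C R (resn ch N) f ft" "syzygy_lift C R (resn ch N) f gt"
    and R: "syzygies C M R" and f: "f \<in> Arr C" "Dom C f = M" "Cod C f = N"
  shows "leg n N k \<cdot> FAr (fn T (n + int k)) (ft k) = leg n N k \<cdot> FAr (fn T (n + int k)) (gt k)"
proof -
  have N: "N \<in> Obj C" using f by auto
  show ?thesis
    by (rule cocone_indep[OF assms(1,2) R resn_syzygies[OF N] f, of "leg n N"])
      (use leg_simps[OF N] rsys_simps[OF resn_syzygies[OF N]] in simp_all)
qed

lemma res_FOb: "FOb (fn res n) M = lob n M"
  by (simp add: resolution_construction_def res_sys_rsys)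

lemma res_FAr_lemma:
  assumes f: "f \<in> Arr C"
  shows "FAr (fn res n) f \<in> Arr D" (is ?A) "Dom D (FAr (fn res n) f) = lob n (Dom C f)" (is ?B)
    "Cod D (FAr (fn res n) f) = lob n (Cod C f)" (is ?E)
    "syzygy_lift C (resn ch (Dom C f)) (resn ch (Cod C f)) f ft \<Longrightarrow>
      FAr (fn res n) f \<cdot> leg n (Dom C f) k = leg n (Cod C f) k \<cdot> FAr (fn T (n + int k)) (ft k)" (is "?P \<Longrightarrow> ?F")
proof -
  define M N where "M = Dom C f" "N = Cod C f"
  have MN: "M \<in> Obj C" "N \<in> Obj C" using f by (simp_all add: M_N_def)
  note R = resn_syzygies[OF MN(1)] and R' = resn_syzygies[OF MN(2)]
  have f': "Dom C f = M" "Cod C f = N" by (simp_all add: M_N_def)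
  note l = leg_simps[OF MN(1)] and l' = leg_simps[OF MN(2)]
  obtain gt where gt: "syzygy_lift C (resn ch M) (resn ch N) f gt" using C.ex_syzygy_lift[OF R R' f f'] .
  note hg = C.syzygy_lift_hom[OF gt R R' f f']
  obtain u where u: "u \<in> Arr D" "Dom D u = lob n M" "Cod D u = lob n N"
    "\<And>k. u \<cdot> leg n M k = leg n N k \<cdot> FAr (fn T (n + int k)) (gt k)"
  proof (rule D.seqlim_map[OF seqlim_leg[OF MN(1)] seqlim_leg[OF MN(2)], of "\<lambda>k. FAr (fn T (n + int k)) (gt k)"])
    show "FAr (fn T (n + int (Suc k))) (gt (Suc k)) \<cdot> rsys T n (resn ch M) k = rsys T n (resn ch N) k \<cdot> FAr (fn T (n + int k)) (gt k)" for k
      using rsys_natural[OF gt R R' f f'] by simp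
  qed (use hg rsys_simps[OF R] rsys_simps[OF R'] that in simp_all)
  have u': "u \<cdot> leg n M k = leg n N k \<cdot> FAr (fn T (n + int k)) (ft k)" if "syzygy_lift C (resn ch M) (resn ch N) f ft" for ft k
    using u(4) leg_indep[OF gt that R f f'] by simp
  have e: "lim_map D UNIV (lob n M) (leg n M) (lob n N) (\<lambda>k. leg n N k \<cdot> FAr (fn T (n + int k)) (ft k)) = u"
    if "syzygy_lift C (resn ch M) (resn ch N) f ft" for ft
    by (rule D.lim_map_eq[OF seqlim_leg[OF MN(1)] _ u(1-3)]) (use u'[OF that] in simp_all)
  have "FAr (fn res n) f = (THE u. \<forall>ft. syzygy_lift C (resn ch M) (resn ch N) f ft \<longrightarrow>
    u = lim_map D UNIV (lob n M) (leg n M) (lob n N) (\<lambda>k. leg n N k \<cdot> FAr (fn T (n + int k)) (ft k)))"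
    by (simp add: resolution_construction_def res_sys_rsys M_N_def)
  \<comment> \<open>By \<open>leg_indep\<close> all chains of lifts define the same arrow, and
    \<open>gt\<close> is one such chain; so the description denotes \<open>u\<close>.\<close>
  also have "\<dots> = u"
    by (rule the_equality) (use e gt in auto)
  finally have fu: "FAr (fn res n) f = u" .
  show ?A ?B ?E using u by (simp_all add: fu f')
  show ?F if ?P using u'[of ft] that by (simp add: fu f')
qed

lemma res_FAr:
  assumes "f \<in> Arr C" "Dom C f = M" "Cod C f = N"
  shows "FAr (fn res n) f \<in> Arr D" "Dom D (FAr (fn res n) f) = lob n M" "Cod D (FAr (fn res n) f) = lob n N"
    "syzygy_lift C (resn ch M) (resn ch N) f ft \<Longrightarrow>
      FAr (fn res n) f \<cdot> leg n M k = leg n N k \<cdot> FAr (fn T (n + int k)) (ft k)"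
  using res_FAr_lemma[OF assms(1)] assms by simp_all

lemma res_functor: "additive_functor C D (fn res n)"
  unfolding additive_functor_def res_FOb
proof (intro conjI ballI allI impI)
  fix A assume A: "A \<in> Obj C"
  note R = resn_syzygies[OF A] and l = leg_simps[OF A] and r = res_FAr[where f="Ident C A" and M=A and N=A and n=n]
  show "lob n A \<in> Obj D" by (rule l)
  show "FAr (fn res n) (Ident C A) = Ident D (lob n A)"
  proof (rule D.seqlim_eq[OF seqlim_leg[OF A]])
    fix k
    have O: "Cod C (sproj (resn ch A) (Suc k)) \<in> Obj C" using C.syzygiesD[OF R] by simp
    show "FAr (fn res n) (Ident C A) \<cdot> leg n A (Suc k) = Ident D (lob n A) \<cdot> leg n A (Suc k)"
      using r(4)[OF _ _ _ C.syzygy_lift_Ident[OF R], of "Suc k"] A O l by simp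
  qed (use A l r in simp_all)
next
  fix A B f assume "f \<in> Hom C A B"
  then show "FAr (fn res n) f \<in> Hom D (lob n A) (lob n B)" using res_FAr(1-3)[where f=f and M=A and N=B and n=n] by simp
next
  fix X Y Z f g assume "f \<in> Hom C X Y" "g \<in> Hom C Y Z"
  then have f: "f \<in> Arr C" "Dom C f = X" "Cod C f = Y" and g: "g \<in> Arr C" "Dom C g = Y" "Cod C g = Z" by auto
  have gf: "g \<cdot>\<^bsub>C\<^esub> f \<in> Arr C" "Dom C (g \<cdot>\<^bsub>C\<^esub> f) = X" "Cod C (g \<cdot>\<^bsub>C\<^esub> f) = Z" using f g by simp_all
  have O: "X \<in> Obj C" "Y \<in> Obj C" "Z \<in> Obj C" using f g by auto
  note RX = resn_syzygies[OF O(1)] and RY = resn_syzygies[OF O(2)] and RZ = resn_syzygies[OF O(3)]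
  obtain ft where ft: "syzygy_lift C (resn ch X) (resn ch Y) f ft" using C.ex_syzygy_lift[OF RX RY f] .
  obtain gt where gt: "syzygy_lift C (resn ch Y) (resn ch Z) g gt" using C.ex_syzygy_lift[OF RY RZ g] .
  note hf = C.syzygy_lift_hom[OF ft RX RY f] and hg = C.syzygy_lift_hom[OF gt RY RZ g]
  note rf = res_FAr[OF f, where n=n] and rg = res_FAr[OF g, where n=n] and rgf = res_FAr[OF gf, where n=n]
  show "FAr (fn res n) (g \<cdot>\<^bsub>C\<^esub> f) = FAr (fn res n) g \<cdot> FAr (fn res n) f"
  proof (rule D.seqlim_eq[OF seqlim_leg[OF O(1)]])
    fix k
    have "FAr (fn res n) (g \<cdot>\<^bsub>C\<^esub> f) \<cdot> leg n X (Suc k) = leg n Z (Suc k) \<cdot> (FAr (fn T (n + int (Suc k))) (gt (Suc k)) \<cdot> FAr (fn T (n + int (Suc k))) (ft (Suc k)))"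
      using rgf(4)[OF C.syzygy_lift_comp[OF ft gt RX RY RZ f g], of "Suc k"] hf hg by simp
    also have "\<dots> = (FAr (fn res n) g \<cdot> leg n Y (Suc k)) \<cdot> FAr (fn T (n + int (Suc k))) (ft (Suc k))"
      unfolding rg(4)[OF gt] using leg_simps[OF O(3)] hf hg by simp
    also have "\<dots> = FAr (fn res n) g \<cdot> (FAr (fn res n) f \<cdot> leg n X (Suc k))"
      unfolding rf(4)[OF ft] using leg_simps[OF O(2)] hf rg by simp
    also have "\<dots> = (FAr (fn res n) g \<cdot> FAr (fn res n) f) \<cdot> leg n X (Suc k)"
      using leg_simps[OF O(1)] rf rg by simp
    finally show "FAr (fn res n) (g \<cdot>\<^bsub>C\<^esub> f) \<cdot> leg n X (Suc k) = (FAr (fn res n) g \<cdot> FAr (fn res n) f) \<cdot> leg n X (Suc k)" .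
  qed (use rf rg rgf in simp_all)
next
  fix X Y f g assume "f \<in> Hom C X Y" "g \<in> Hom C X Y"
  then have f: "f \<in> Arr C" "Dom C f = X" "Cod C f = Y" and g: "g \<in> Arr C" "Dom C g = X" "Cod C g = Y" by auto
  have gf: "Plus C f g \<in> Arr C" "Dom C (Plus C f g) = X" "Cod C (Plus C f g) = Y" using f g by simp_all
  have O: "X \<in> Obj C" "Y \<in> Obj C" using f g by auto
  note RX = resn_syzygies[OF O(1)] and RY = resn_syzygies[OF O(2)]
  obtain ft where ft: "syzygy_lift C (resn ch X) (resn ch Y) f ft" using C.ex_syzygy_lift[OF RX RY f] .
  obtain gt where gt: "syzygy_lift C (resn ch X) (resn ch Y) g gt" using C.ex_syzygy_lift[OF RX RY g] .
  note hf = C.syzygy_lift_hom[OF ft RX RY f] and hg = C.syzygy_lift_hom[OF gt RX RY g]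
  note rf = res_FAr[OF f, where n=n] and rg = res_FAr[OF g, where n=n] and rgf = res_FAr[OF gf, where n=n]
  show "FAr (fn res n) (Plus C f g) = Plus D (FAr (fn res n) f) (FAr (fn res n) g)"
  proof (rule D.seqlim_eq[OF seqlim_leg[OF O(1)]])
    fix k
    show "FAr (fn res n) (Plus C f g) \<cdot> leg n X (Suc k) = Plus D (FAr (fn res n) f) (FAr (fn res n) g) \<cdot> leg n X (Suc k)"
      using rgf(4)[OF C.syzygy_lift_Plus[OF ft gt RX RY f g], of "Suc k"] hf hg rf(1-3) rg(1-3) rf(4)[OF ft, of "Suc k"] rg(4)[OF gt, of "Suc k"]
        leg_simps[OF O(1)] leg_simps[OF O(2)] by simp
  qed (use rf rg rgf in simp_all)
qed

text \<open>The legs of the fixed limit along any resolution of \<open>M\<close>, with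
  \<open>M\<close> recovered as \<open>Cod C (sproj R 0)\<close>. They compare \<open>R\<close> with
  the chosen resolution through an arbitrary chain of lifts of the identity; by
  \<open>rleg_eq\<close> all such chains give the same legs.\<close>

definition rleg :: "int \<Rightarrow> 'b resolution \<Rightarrow> nat \<Rightarrow> 'd" where
  "rleg n R k = leg n (Cod C (sproj R 0)) k \<cdot>
     FAr (fn T (n + int k)) ((SOME \<theta>. syzygy_lift C R (resn ch (Cod C (sproj R 0))) (Ident C (Cod C (sproj R 0))) \<theta>) k)"

lemma rleg_eq:
  assumes R: "syzygies C M R" and \<theta>: "syzygy_lift C R (resn ch M) (Ident C M) \<theta>"
  shows "rleg n R k = leg n M k \<cdot> FAr (fn T (n + int k)) (\<theta> k)"
proof -
  have M: "Cod C (sproj R 0) = M" "M \<in> Obj C" using C.syzygiesD[OF R] by simp_all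
  have "syzygy_lift C R (resn ch M) (Ident C M) (SOME \<theta>. syzygy_lift C R (resn ch M) (Ident C M) \<theta>)"
    by (rule someI[where P="\<lambda>\<theta>. syzygy_lift C R (resn ch M) (Ident C M) \<theta>"]) (rule \<theta>)
  then show ?thesis unfolding rleg_def M(1) by (rule leg_indep[OF _ \<theta> R]) (use M in simp_all)
qed

lemma obtain_rleg:
  assumes R: "syzygies C M R"
  obtains \<theta> where "syzygy_lift C R (resn ch M) (Ident C M) \<theta>" "\<And>n k. rleg n R k = leg n M k \<cdot> FAr (fn T (n + int k)) (\<theta> k)"
    "\<And>k. \<theta> k \<in> Arr C" "\<And>k. Dom C (\<theta> k) = Cod C (sproj R k)" "\<And>k. Cod C (\<theta> k) = Cod C (sproj (resn ch M) k)" "\<theta> 0 = Ident C M"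
proof -
  have M: "M \<in> Obj C" using C.syzygiesD[OF R] by simp
  have i: "Ident C M \<in> Arr C" "Dom C (Ident C M) = M" "Cod C (Ident C M) = M" using M by simp_all
  obtain \<theta> where \<theta>: "syzygy_lift C R (resn ch M) (Ident C M) \<theta>" using C.ex_syzygy_lift[OF R resn_syzygies[OF M] i] .
  show ?thesis using that[OF \<theta> rleg_eq[OF R \<theta>] C.syzygy_lift_hom[OF \<theta> R resn_syzygies[OF M] i]] C.syzygy_liftD(1)[OF \<theta>] by simp
qed

lemma rleg_simps:
  assumes R: "syzygies C M R"
  shows "rleg n R k \<in> Arr D" "Dom D (rleg n R k) = FOb (fn T (n + int k)) (Cod C (sproj R k))" "Cod D (rleg n R k) = lob n M"
    "rleg n R (Suc k) \<cdot> rsys T n R k = rleg n R k" "rleg n R 0 = leg n M 0"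
proof -
  have M: "M \<in> Obj C" using C.syzygiesD[OF R] by simp
  obtain \<theta> where \<theta>: "syzygy_lift C R (resn ch M) (Ident C M) \<theta>" "\<And>n k. rleg n R k = leg n M k \<cdot> FAr (fn T (n + int k)) (\<theta> k)"
    "\<And>k. \<theta> k \<in> Arr C" "\<And>k. Dom C (\<theta> k) = Cod C (sproj R k)" "\<And>k. Cod C (\<theta> k) = Cod C (sproj (resn ch M) k)" "\<theta> 0 = Ident C M"
    using obtain_rleg[OF R] by blast
  have i: "Ident C M \<in> Arr C" "Dom C (Ident C M) = M" "Cod C (Ident C M) = M" using M by simp_all
  note l = leg_simps[OF M] and r = rsys_simps[OF R] and r' = rsys_simps[OF resn_syzygies[OF M]]
  show "rleg n R k \<in> Arr D" "Dom D (rleg n R k) = FOb (fn T (n + int k)) (Cod C (sproj R k))" "Cod D (rleg n R k) = lob n M"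
    using \<theta> l by simp_all
  have "rleg n R (Suc k) \<cdot> rsys T n R k = leg n M (Suc k) \<cdot> (FAr (fn T (n + 1 + int k)) (\<theta> (Suc k)) \<cdot> rsys T n R k)"
    using \<theta> l r by simp
  also have "\<dots> = (leg n M (Suc k) \<cdot> rsys T n (resn ch M) k) \<cdot> FAr (fn T (n + int k)) (\<theta> k)"
    unfolding rsys_natural[OF \<theta>(1) R resn_syzygies[OF M] i] using \<theta>(3-5) l(2-4) r' by simp
  also have "\<dots> = rleg n R k" unfolding l(5) by (simp add: \<theta>(2))
  finally show "rleg n R (Suc k) \<cdot> rsys T n R k = rleg n R k" .
  show "rleg n R 0 = leg n M 0" using \<theta>(2)[of n 0] \<theta>(6) M l C.syzygiesD(4)[OF resn_syzygies[OF M]] by simp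
qed

lemma rleg_resn:
  assumes M: "M \<in> Obj C"
  shows "rleg n (resn ch M) k = leg n M k"
  using rleg_eq[OF resn_syzygies[OF M] C.syzygy_lift_Ident[OF resn_syzygies[OF M]], of n k] leg_simps[OF M] C.syzygiesD[OF resn_syzygies[OF M]]
  by simp

text \<open>Both sides are the leg at \<open>N\<close> after a chain of lifts of \<open>f\<close>
  from \<open>R\<close> to the chosen resolution of \<open>N\<close>, one chain passing through the
  chosen resolution of \<open>M\<close>, the other through \<open>R'\<close>.\<close>

lemma res_FAr_rleg:
  assumes ft: "syzygy_lift C R R' f ft" and R: "syzygies C M R" and R': "syzygies C N R'" and f: "f \<in> Arr C" "Dom C f = M" "Cod C f = N"
  shows "FAr (fn res n) f \<cdot> rleg n R k = rleg n R' k \<cdot> FAr (fn T (n + int k)) (ft k)"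
proof -
  have O: "M \<in> Obj C" "N \<in> Obj C" using f by auto
  note S = resn_syzygies[OF O(1)] and S' = resn_syzygies[OF O(2)]
  note h = C.syzygy_lift_hom[OF ft R R' f]
  obtain \<theta> where \<theta>: "syzygy_lift C R (resn ch M) (Ident C M) \<theta>" "\<And>n k. rleg n R k = leg n M k \<cdot> FAr (fn T (n + int k)) (\<theta> k)"
    "\<And>k. \<theta> k \<in> Arr C" "\<And>k. Dom C (\<theta> k) = Cod C (sproj R k)" "\<And>k. Cod C (\<theta> k) = Cod C (sproj (resn ch M) k)"
    using obtain_rleg[OF R] by metis
  obtain \<theta>' where \<theta>': "syzygy_lift C R' (resn ch N) (Ident C N) \<theta>'" "\<And>n k. rleg n R' k = leg n N k \<cdot> FAr (fn T (n + int k)) (\<theta>' k)"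
    "\<And>k. \<theta>' k \<in> Arr C" "\<And>k. Dom C (\<theta>' k) = Cod C (sproj R' k)" "\<And>k. Cod C (\<theta>' k) = Cod C (sproj (resn ch N) k)"
    using obtain_rleg[OF R'] by metis
  obtain gt where gt: "syzygy_lift C (resn ch M) (resn ch N) f gt" using C.ex_syzygy_lift[OF S S' f] .
  note hg = C.syzygy_lift_hom[OF gt S S' f] and l = leg_simps[OF O(1)] and l' = leg_simps[OF O(2)]
  have i: "Ident C M \<in> Arr C" "Dom C (Ident C M) = M" "Cod C (Ident C M) = M" "Ident C N \<in> Arr C" "Dom C (Ident C N) = N" "Cod C (Ident C N) = N" using O by simp_all
  have c1: "syzygy_lift C R (resn ch N) f (\<lambda>k. gt k \<cdot>\<^bsub>C\<^esub> \<theta> k)"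
    using C.syzygy_lift_comp[OF \<theta>(1) gt R S S' i(1-3) f] f by simp
  have c2: "syzygy_lift C R (resn ch N) f (\<lambda>k. \<theta>' k \<cdot>\<^bsub>C\<^esub> ft k)"
    using C.syzygy_lift_comp[OF ft \<theta>'(1) R R' S' f i(4-6)] f by simp
  have "FAr (fn res n) f \<cdot> rleg n R k = (FAr (fn res n) f \<cdot> leg n M k) \<cdot> FAr (fn T (n + int k)) (\<theta> k)"
    using \<theta>(2-) l res_FAr[OF f] by simp
  also have "\<dots> = leg n N k \<cdot> FAr (fn T (n + int k)) (gt k \<cdot>\<^bsub>C\<^esub> \<theta> k)"
    unfolding res_FAr(4)[OF f gt] using \<theta>(3-) l' hg by simp
  also have "\<dots> = leg n N k \<cdot> FAr (fn T (n + int k)) (\<theta>' k \<cdot>\<^bsub>C\<^esub> ft k)"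
    by (rule leg_indep[OF c1 c2 R f])
  also have "\<dots> = rleg n R' k \<cdot> FAr (fn T (n + int k)) (ft k)"
    unfolding \<theta>'(2) using \<theta>'(3-) h l' by simp
  finally show ?thesis .
qed

text \<open>Comparison chains in the two directions compose to chains of lifts of the identity,
  which no cocone can distinguish from the identity by \<open>cocone_indep\<close>.\<close>

lemma seqlim_rleg:
  assumes R: "syzygies C M R"
  shows "seqlim D (rsys T n R) (lob n M) (rleg n R)"
proof -
  have M: "M \<in> Obj C" using C.syzygiesD[OF R] by simp
  note S = resn_syzygies[OF M] and l = leg_simps[OF M]
  have i: "Ident C M \<in> Arr C" "Dom C (Ident C M) = M" "Cod C (Ident C M) = M" using M by simp_all
  obtain \<theta> where \<theta>: "syzygy_lift C R (resn ch M) (Ident C M) \<theta>" "\<And>n k. rleg n R k = leg n M k \<cdot> FAr (fn T (n + int k)) (\<theta> k)"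
    "\<And>k. \<theta> k \<in> Arr C" "\<And>k. Dom C (\<theta> k) = Cod C (sproj R k)" "\<And>k. Cod C (\<theta> k) = Cod C (sproj (resn ch M) k)"
    using obtain_rleg[OF R] by metis
  obtain \<zeta> where \<zeta>: "syzygy_lift C (resn ch M) R (Ident C M) \<zeta>" using C.ex_syzygy_lift[OF S R i] .
  note h = C.syzygy_lift_hom[OF \<zeta> S R i] and r = rsys_simps[OF R] and rl = rleg_simps[OF R] and rs = rsys_simps[OF S]
  have c1: "syzygy_lift C R R (Ident C M) (\<lambda>k. \<zeta> k \<cdot>\<^bsub>C\<^esub> \<theta> k)"
    using C.syzygy_lift_comp[OF \<theta>(1) \<zeta> R S R i i] i by simp
  have c2: "syzygy_lift C (resn ch M) (resn ch M) (Ident C M) (\<lambda>k. \<theta> k \<cdot>\<^bsub>C\<^esub> \<zeta> k)"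
    using C.syzygy_lift_comp[OF \<zeta> \<theta>(1) S R S i i] i by simp
  have O: "Cod C (sproj R k) \<in> Obj C" "Cod C (sproj (resn ch M) k) \<in> Obj C" for k
    using C.syzygiesD[OF R] C.syzygiesD[OF S] by simp_all
  show ?thesis
  proof (rule D.seqlimI[OF sequential_rsys[OF R]])
    fix Y d assume d: "Y \<in> Obj D" "\<And>k. d k \<in> Arr D" "\<And>k. Dom D (d k) = Dom D (rsys T n R k)" "\<And>k. Cod D (d k) = Y" "\<And>k. d (Suc k) \<cdot> rsys T n R k = d k"
    obtain u where u: "u \<in> Arr D" "Dom D u = lob n M" "Cod D u = Y" "\<And>k. u \<cdot> leg n M k = d k \<cdot> FAr (fn T (n + int k)) (\<zeta> k)"
    proof (rule D.seqlim_factor[OF seqlim_leg[OF M], of Y "\<lambda>k. d k \<cdot> FAr (fn T (n + int k)) (\<zeta> k)"])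
      fix k
      have "(d (Suc k) \<cdot> FAr (fn T (n + int (Suc k))) (\<zeta> (Suc k))) \<cdot> rsys T n (resn ch M) k = d (Suc k) \<cdot> (rsys T n R k \<cdot> FAr (fn T (n + int k)) (\<zeta> k))"
        using rsys_natural[OF \<zeta> S R i, of n k] d(1-4) h r rs by simp
      also have "\<dots> = d k \<cdot> FAr (fn T (n + int k)) (\<zeta> k)"
        using D.reassoc[OF d(5)[of k], of "FAr (fn T (n + int k)) (\<zeta> k)"] d(1-4) h r by simp
      finally show "(d (Suc k) \<cdot> FAr (fn T (n + int (Suc k))) (\<zeta> (Suc k))) \<cdot> rsys T n (resn ch M) k = d k \<cdot> FAr (fn T (n + int k)) (\<zeta> k)" .
    qed (use d(1-4) h r rs that in simp_all)
    have "u \<cdot> rleg n R k = d k" for k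
    proof -
      have "u \<cdot> rleg n R k = (u \<cdot> leg n M k) \<cdot> FAr (fn T (n + int k)) (\<theta> k)"
        using \<theta>(2-) u(1-3) l by simp
      also have "\<dots> = d k \<cdot> FAr (fn T (n + int k)) (\<zeta> k \<cdot>\<^bsub>C\<^esub> \<theta> k)"
        unfolding u(4) using \<theta>(3-) h d(1-4) r by simp
      also have "\<dots> = d k \<cdot> FAr (fn T (n + int k)) (Ident C (Cod C (sproj R k)))"
        by (rule cocone_indep[OF c1 C.syzygy_lift_Ident[OF R] R R i]) (use d in simp_all)
      also have "\<dots> = d k" using O d(1-4) r by simp
      finally show ?thesis .
    qed
    then show "\<exists>u. u \<in> Arr D \<and> Dom D u = lob n M \<and> Cod D u = Y \<and> (\<forall>k. u \<cdot> rleg n R k = d k)"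
      using u by blast
  next
    fix u v assume uv: "u \<in> Arr D" "v \<in> Arr D" "Dom D u = lob n M" "Dom D v = lob n M" "\<And>k. u \<cdot> rleg n R k = v \<cdot> rleg n R k"
    have e: "rleg n R k \<cdot> FAr (fn T (n + int k)) (\<zeta> k) = leg n M k" for k
    proof -
      have "rleg n R k \<cdot> FAr (fn T (n + int k)) (\<zeta> k) = leg n M k \<cdot> FAr (fn T (n + int k)) (\<theta> k \<cdot>\<^bsub>C\<^esub> \<zeta> k)"
        unfolding \<theta>(2) using \<theta>(3-) h l by simp
      also have "\<dots> = leg n M k \<cdot> FAr (fn T (n + int k)) (Ident C (Cod C (sproj (resn ch M) k)))"
        by (rule leg_indep[OF c2 C.syzygy_lift_Ident[OF S] S i])
      also have "\<dots> = leg n M k" using O l by simp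
      finally show ?thesis .
    qed
    show "u = v"
    proof (rule D.seqlim_eq[OF seqlim_leg[OF M] uv(1-4)])
      fix k
      show "u \<cdot> leg n M (Suc k) = v \<cdot> leg n M (Suc k)"
        using D.reassoc[OF uv(5)[of "Suc k"], of "FAr (fn T (n + int (Suc k))) (\<zeta> (Suc k))"] e[of "Suc k"] uv(1-4) rl h by simp
    qed
  qed (use l rl r in simp_all)
qed

end

section \<open>The resolution construction as a cohomological functor\<close>

context cohom
begin

text \<open>The identity of \<open>P\<close> factors through the first projective of its resolution,
  so \<open>rsys_factor_Zero\<close> makes every transition map zero; then the legs and the identity
  of the limit vanish.\<close>

lemma res_projective:
  assumes P: "projective C P"
  shows "zero_object D (lob n P)"
proof -
  have PO: "P \<in> Obj C" using P by (simp add: projective_def)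
  note S = resn_syzygies[OF PO] and l = leg_simps[OF PO]
  note s = C.syzygiesD[OF S] and r = rsys_simps[OF S]
  have i: "Ident C P \<in> Arr C" "Dom C (Ident C P) = P" "Cod C (Ident C P) = P" using PO by simp_all
  have sO: "Cod C (sproj (resn ch P) k) \<in> Obj C" for k using s(6) by simp
  obtain e where e: "e \<in> Arr C" "Dom C e = P" "Cod C e = Dom C (sproj (resn ch P) 0)" "sproj (resn ch P) 0 \<cdot>\<^bsub>C\<^esub> e = Ident C P"
    by (rule C.projective_lift[OF P s(8)[of 0] i(1)]) (use i s in simp_all)
  have "leg n P k = Zero D (FOb (fn T (n + int k)) (Cod C (sproj (resn ch P) k))) (lob n P)" for k
  proof -
    have "rsys T n (resn ch P) k \<cdot> FAr (fn T (n + int k)) (Ident C (Cod C (sproj (resn ch P) k))) =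
      Zero D (FOb (fn T (n + int k)) (Cod C (sproj (resn ch P) k))) (FOb (fn T (n + 1 + int k)) (Cod C (sproj (resn ch P) (Suc k))))"
      by (rule rsys_factor_Zero[OF C.syzygy_lift_Ident[OF S] S S e(1-3) e(4)[symmetric]])
    then have z: "rsys T n (resn ch P) k = Zero D (FOb (fn T (n + int k)) (Cod C (sproj (resn ch P) k))) (FOb (fn T (n + 1 + int k)) (Cod C (sproj (resn ch P) (Suc k))))"
      using r sO by simp
    show ?thesis unfolding l(5)[of n k, symmetric] z using l(1-4) sO by simp
  qed
  then have "leg n P (Suc k) = Zero D (FOb (fn T (n + 1 + int k)) (Cod C (sproj (resn ch P) (Suc k)))) (lob n P)" for k
    using int_shift(1) by metis
  then have "Ident D (lob n P) \<cdot> leg n P (Suc k) = Zero D (lob n P) (lob n P) \<cdot> leg n P (Suc k)" for k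
    using l(1-4) sO by simp
  from D.seqlim_eq[OF seqlim_leg[OF PO] _ _ _ _ this] have "Ident D (lob n P) = Zero D (lob n P) (lob n P)"
    using l(1) by simp
  then show ?thesis using D.Zero_objectI l(1) by blast
qed

text \<open>Changing the lift changes the induced arrow by one that passes through the projective
  \<open>Dom C p\<close>, on which the limit functor vanishes.\<close>

lemma res_kernel_lift_eq:
  assumes "kernel_lift C i p j q f fs" "kernel_lift C i p j q f gs" "short_exact C i p" "short_exact C j q" "projective C (Dom C p)"
  shows "FAr (fn res n) fs = FAr (fn res n) gs"
  by (rule functor_zero_kernel_lift_eq[OF res_functor _ assms(1-4)]) (use res_projective[OF assms(5)] res_FOb in simp)

section \<open>The dimension shift\<close>

definition syz :: "'a \<Rightarrow> 'a" where "syz M = Cod C (sproj (resn ch M) (Suc 0))"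

text \<open>The shift to the first syzygy: stage \<open>k + 1\<close> for \<open>M\<close> is stage
  \<open>k\<close> along the shifted resolution in degree \<open>n + 1\<close>. Stage zero has no
  counterpart, hence the index set \<open>{1..}\<close>.\<close>

definition sigma :: "int \<Rightarrow> 'a \<Rightarrow> 'd" where
  "sigma n M = lim_map D {1..} (lob n M) (leg n M) (lob (n + 1) (syz M)) (\<lambda>k. rleg (n + 1) (shift (resn ch M)) (k - 1))"

lemma syzygies_shift_resn: "M \<in> Obj C \<Longrightarrow> syzygies C (syz M) (shift (resn ch M))"
  unfolding syz_def by (rule C.syzygies_shift[OF resn_syzygies])

lemma syz_Obj: "M \<in> Obj C \<Longrightarrow> syz M \<in> Obj C"
  using C.syzygiesD(9)[OF syzygies_shift_resn] .

lemma rsys_shift: "rsys T (n + 1) (shift R) k = rsys T n R (Suc k)"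
  by (simp add: rsys_def)

lemma sigma_simps:
  assumes M: "M \<in> Obj C"
  shows "sigma n M \<in> Arr D" "Dom D (sigma n M) = lob n M" "Cod D (sigma n M) = lob (n + 1) (syz M)"
    "sigma n M \<cdot> leg n M (Suc k) = rleg (n + 1) (shift (resn ch M)) k"
proof -
  note S = resn_syzygies[OF M] and S' = syzygies_shift_resn[OF M]
  note l = leg_simps[OF M] and r = rleg_simps[OF S'] and rs = rsys_simps[OF S] and rs' = rsys_simps[OF S']
  have O: "lob (n + 1) (syz M) \<in> Obj D" using D.Cod_Obj[OF r(1)[of "n + 1" 0]] r(3) by simp
  \<comment> \<open>At stage zero the value is forced: one transition map, then leg zero along the
    shifted resolution.\<close>
  let ?d = "\<lambda>k. case k of 0 \<Rightarrow> rleg (n + 1) (shift (resn ch M)) 0 \<cdot> rsys T n (resn ch M) 0 | Suc j \<Rightarrow> rleg (n + 1) (shift (resn ch M)) j"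
  have "\<exists>u. u \<in> Arr D \<and> Dom D u = lob n M \<and> Cod D u = lob (n + 1) (syz M) \<and> (\<forall>k. u \<cdot> leg n M k = ?d k)"
  proof (rule D.seqlim_factor[OF seqlim_leg[OF M] O, of ?d])
    fix k
    show "?d k \<in> Arr D" "Dom D (?d k) = Dom D (rsys T n (resn ch M) k)" "Cod D (?d k) = lob (n + 1) (syz M)"
      using r(1-3) rs by (cases k; simp)+
    show "?d (Suc k) \<cdot> rsys T n (resn ch M) k = ?d k"
      using r(4)[of "n + 1"] by (cases k) (simp_all add: rsys_shift)
  qed blast
  then obtain u where u: "u \<in> Arr D" "Dom D u = lob n M" "Cod D u = lob (n + 1) (syz M)" "\<And>k. u \<cdot> leg n M k = ?d k" by blast
  have u': "u \<cdot> leg n M (Suc k) = rleg (n + 1) (shift (resn ch M)) k" for k using u(4)[of "Suc k"] by simp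
  have "sigma n M = u" unfolding sigma_def
  proof (rule D.lim_map_eq[OF seqlim_leg[OF M] _ u(1-3)])
    fix k :: nat assume "k \<in> {1..}"
    then show "u \<cdot> leg n M k = rleg (n + 1) (shift (resn ch M)) (k - 1)" using u'[of "k - 1"] by simp
  qed simp
  then show "sigma n M \<in> Arr D" "Dom D (sigma n M) = lob n M" "Cod D (sigma n M) = lob (n + 1) (syz M)"
    "sigma n M \<cdot> leg n M (Suc k) = rleg (n + 1) (shift (resn ch M)) k" using u u' by simp_all
qed

abbreviation res_lift :: "'b \<Rightarrow> 'b \<Rightarrow> 'a \<Rightarrow> 'b \<Rightarrow> 'b \<Rightarrow> bool" where
  "res_lift f g M c h \<equiv> kernel_lift C (sincl (resn ch M) 0) (sproj (resn ch M) 0) f g c h"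

text \<open>The given \<open>f1\<close> may be exchanged for the first term of a chain of lifts of
  \<open>f\<close>; the rest of that chain is a chain for the shifted resolutions.\<close>

lemma sigma_natural:
  assumes f: "f \<in> Arr C" "Dom C f = M" "Cod C f = N" and f1: "res_lift (sincl (resn ch N) 0) (sproj (resn ch N) 0) M f f1"
  shows "sigma n N \<cdot> FAr (fn res n) f = FAr (fn res (n + 1)) f1 \<cdot> sigma n M"
proof -
  have O: "M \<in> Obj C" "N \<in> Obj C" using f by auto
  note S = resn_syzygies[OF O(1)] and S' = resn_syzygies[OF O(2)]
  note H = syzygies_shift_resn[OF O(1)] and H' = syzygies_shift_resn[OF O(2)]
  obtain ft where ft: "syzygy_lift C (resn ch M) (resn ch N) f ft" using C.ex_syzygy_lift[OF S S' f] .
  note h = C.syzygy_lift_hom[OF ft S S' f] and sl = C.syzygy_lift_shift[OF ft] and r = res_FAr[OF f, where n=n]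
  note sM = sigma_simps[OF O(1)] and sN = sigma_simps[OF O(2)] and lM = leg_simps[OF O(1)] and lN = leg_simps[OF O(2)]
  have h1: "ft 1 \<in> Arr C" "Dom C (ft 1) = syz M" "Cod C (ft 1) = syz N" using h[of 1] by (simp_all add: syz_def)
  have "kernel_lift C (sincl (resn ch M) 0) (sproj (resn ch M) 0) (sincl (resn ch N) 0) (sproj (resn ch N) 0) f (ft 1)"
    using C.syzygy_liftD(1)[OF ft] C.syzygy_liftD(2)[OF ft, of 0] by simp
  then have e: "FAr (fn res (n + 1)) f1 = FAr (fn res (n + 1)) (ft 1)"
    by (intro res_kernel_lift_eq[OF f1 _ C.syzygiesD(1)[OF S] C.syzygiesD(1)[OF S'] C.syzygiesD(2)[OF S]])
  note r1 = res_FAr(1-3)[OF h1, where n="n+1"]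
  show ?thesis unfolding e
  proof (rule D.seqlim_eq[OF seqlim_leg[OF O(1)]])
    fix k
    have "(sigma n N \<cdot> FAr (fn res n) f) \<cdot> leg n M (Suc k) = sigma n N \<cdot> (leg n N (Suc k) \<cdot> FAr (fn T (n + int (Suc k))) (ft (Suc k)))"
      unfolding r(4)[OF ft, symmetric] using r(1-3) sN lM by simp
    also have "\<dots> = rleg (n + 1) (shift (resn ch N)) k \<cdot> FAr (fn T (n + 1 + int k)) (ft (Suc k))"
      using D.reassoc[OF sN(4)[of n k], of "FAr (fn T (n + 1 + int k)) (ft (Suc k))"] sN(1-3) lN h by simp
    also have "\<dots> = FAr (fn res (n + 1)) (ft 1) \<cdot> rleg (n + 1) (shift (resn ch M)) k"
      using res_FAr_rleg[OF sl H H' h1, of "n + 1" k] by simp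
    also have "\<dots> = (FAr (fn res (n + 1)) (ft 1) \<cdot> sigma n M) \<cdot> leg n M (Suc k)"
      unfolding sM(4)[symmetric] using sM(1-3) r1 lM by simp
    finally show "(sigma n N \<cdot> FAr (fn res n) f) \<cdot> leg n M (Suc k) = (FAr (fn res (n + 1)) (ft 1) \<cdot> sigma n M) \<cdot> leg n M (Suc k)" .
  qed (use r(1-3) r1 sM(1-3) sN(1-3) in simp_all)
qed

text \<open>Both equations are naturality of the connecting homomorphism for the two lifts of
  \<open>horseshoe_connect\<close>. Preceded by a transition along \<open>RC\<close>, the arrow of
  \<open>h k\<close> gives stage \<open>k\<close>; followed by one along \<open>RA\<close>, it gives
  stage \<open>k + 1\<close>, signs included.\<close>

lemma signed_conn:
  assumes hs: "horseshoe C f g RA RB RC a b sa sb"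
  obtains h where "kernel_lift C (sincl RC 0) (sproj RC 0) f g (Ident C (Cod C g)) (h 0)"
    "syzygy_lift C (shift RC) RA (h 0) h"
    "\<And>n k. signed D (Suc k) (conn T (n + 1 + int k) (sa (Suc k)) (sb (Suc k))) = rsys T (n + 1) RA k \<cdot> FAr (fn T (n + 1 + int k)) (h k)"
    "\<And>n k. FAr (fn T (n + 1 + int k)) (h k) \<cdot> rsys T n RC k = signed D k (conn T (n + int k) (sa k) (sb k))"
proof -
  note H = C.horseshoeD[OF hs]
  note A = C.syzygiesD[OF H(1)] and X = C.syzygiesD[OF H(3)]
  obtain h where h: "\<And>k. kernel_lift C (sincl RC k) (sproj RC k) (sa k) (sb k) (Ident C (Cod C (sproj RC k))) (h k)"
    "\<And>k. kernel_lift C (sa (Suc k)) (sb (Suc k)) (sincl RA k) (sproj RA k) (neg C (h k)) (Ident C (Cod C (sproj RA (Suc k))))"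
    "syzygy_lift C (shift RC) RA (h 0) (\<lambda>k. signed C k (h k))"
    using C.horseshoe_signed_lift[OF hs] by blast
  have h': "h k \<in> Arr C" "Dom C (h k) = Cod C (sproj RC (Suc k))" "Cod C (h k) = Cod C (sproj RA k)" for k
    using C.kernel_lift_hom[OF h(1)[of k]] X(3) H(8) by simp_all
  have O: "Cod C (sproj RC k) \<in> Obj C" "Cod C (sproj RA k) \<in> Obj C" for k using X(6) A(6) by simp_all
  have sC: "signed C k x = (if even k then x else neg C x)" for k x by (simp add: signed_def neg_def)
  have sD: "signed D k x = (if even k then x else neg D x)" for k x by (simp add: signed_def neg_def)
  note cs = conn_simps[OF H(6)]
  have sT: "FAr (fn T m) (signed C k (h k)) = signed D k (FAr (fn T m) (h k))" for m k
    using h' functor_neg[OF fn_functor] by (simp add: sC sD)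
  have c1: "conn T m (sa (Suc k)) (sb (Suc k)) = neg D (conn T m (sincl RA k) (sproj RA k) \<cdot> FAr (fn T m) (h k))" for m k
    using conn_natural[OF H(6)[of "Suc k"] A(1)[of k] h(2)[of k], of m] h'[of k] O H(8,11) functor_neg[OF fn_functor] A(1) X(3)
      cs[of m "Suc k"] by simp
  have c2: "FAr (fn T (m + 1)) (h k) \<cdot> conn T m (sincl RC k) (sproj RC k) = conn T m (sa k) (sb k)" for m k
    using conn_natural[OF X(1)[of k] H(6)[of k] h(1)[of k], of m] O H(11) cs[of m k] by simp
  have ty: "conn T m (sincl RC k) (sproj RC k) \<in> Arr D" "Cod D (conn T m (sincl RC k) (sproj RC k)) = FOb (fn T (m + 1)) (Cod C (sproj RC (Suc k)))"
    "conn T m (sincl RA k) (sproj RA k) \<in> Arr D" "Dom D (conn T m (sincl RA k) (sproj RA k)) = FOb (fn T m) (Cod C (sproj RA k))" for m k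
    using X(1,3) A(1,3) by simp_all
  show ?thesis
  proof (rule that[of "\<lambda>k. signed C k (h k)"])
    show "kernel_lift C (sincl RC 0) (sproj RC 0) f g (Ident C (Cod C g)) (signed C 0 (h 0))"
      using h(1)[of 0] H(4,5) X(4) by (simp add: sC)
    show "syzygy_lift C (shift RC) RA (signed C 0 (h 0)) (\<lambda>k. signed C k (h k))" using h(3) by (simp add: sC)
    fix n k
    show "signed D (Suc k) (conn T (n + 1 + int k) (sa (Suc k)) (sb (Suc k))) = rsys T (n + 1) RA k \<cdot> FAr (fn T (n + 1 + int k)) (signed C k (h k))"
      unfolding sT c1 rsys_def sD using ty h'[of k] by simp
    show "FAr (fn T (n + 1 + int k)) (signed C k (h k)) \<cdot> rsys T n RC k = signed D k (conn T (n + int k) (sa k) (sb k))"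
      unfolding sT rsys_def sD using c2[of "n + int k" k] ty h'[of k] by simp
  qed
qed

text \<open>On legs, the dimension shift followed by \<open>h\<close> amounts to
  \<open>\<phi> j\<close> from stage \<open>j + 1\<close> to stage \<open>j\<close>;
  \<open>signed_conn\<close> rewrites this as the signed connecting homomorphism.\<close>

lemma res_conn_lemma:
  assumes fg: "short_exact C f g" and hs: "horseshoe C f g (resn ch (Dom C f)) RB (resn ch (Cod C g)) a b sa sb"
    and l: "res_lift f g (Cod C g) (Ident C (Cod C g)) h"
  shows "(FAr (fn res (n + 1)) h \<cdot> sigma n (Cod C g)) \<cdot> leg n (Cod C g) k = leg (n + 1) (Dom C f) k \<cdot> signed D k (conn T (n + int k) (sa k) (sb k))"
proof -
  define A M where "A = Dom C f" "M = Cod C g"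
  have O: "A \<in> Obj C" "M \<in> Obj C" using C.short_exactD(4,5)[OF fg] by (simp_all add: A_M_def)
  note S = resn_syzygies[OF O(1)] and S' = resn_syzygies[OF O(2)] and H = syzygies_shift_resn[OF O(2)]
  note lA = leg_simps[OF O(1)] and lM = leg_simps[OF O(2)] and sM = sigma_simps[OF O(2)]
  have hs': "horseshoe C f g (resn ch A) RB (resn ch M) a b sa sb" using hs by (simp add: A_M_def)
  have hl: "h \<in> Arr C" "Dom C h = syz M" "Cod C h = A"
    using C.kernel_lift_hom[OF l] C.syzygiesD(3)[OF S'] by (simp_all add: A_M_def syz_def)
  obtain \<phi> where \<phi>: "kernel_lift C (sincl (resn ch M) 0) (sproj (resn ch M) 0) f g (Ident C (Cod C g)) (\<phi> 0)"
    "syzygy_lift C (shift (resn ch M)) (resn ch A) (\<phi> 0) \<phi>"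
    "\<And>n k. signed D (Suc k) (conn T (n + 1 + int k) (sa (Suc k)) (sb (Suc k))) = rsys T (n + 1) (resn ch A) k \<cdot> FAr (fn T (n + 1 + int k)) (\<phi> k)"
    "\<And>n k. FAr (fn T (n + 1 + int k)) (\<phi> k) \<cdot> rsys T n (resn ch M) k = signed D k (conn T (n + int k) (sa k) (sb k))"
    by (rule signed_conn[OF hs']) blast
  have p0: "\<phi> 0 \<in> Arr C" "Dom C (\<phi> 0) = syz M" "Cod C (\<phi> 0) = A"
    using C.kernel_lift_hom[OF \<phi>(1)] C.syzygiesD(3)[OF S'] by (simp_all add: A_M_def syz_def)
  note ph = C.syzygy_lift_hom[OF \<phi>(2) H S p0]
  have e: "FAr (fn res (n + 1)) h = FAr (fn res (n + 1)) (\<phi> 0)"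
    by (rule res_kernel_lift_eq[OF _ \<phi>(1) C.syzygiesD(1)[OF S'] fg C.syzygiesD(2)[OF S']]) (use l in \<open>simp add: A_M_def\<close>)
  note r = res_FAr(1-3)[OF p0, where n="n + 1"] and rs = rsys_simps[OF S'] and rsA = rsys_simps[OF S]
  have suc: "(FAr (fn res (n + 1)) h \<cdot> sigma n M) \<cdot> leg n M (Suc j) = leg (n + 1) A j \<cdot> FAr (fn T (n + 1 + int j)) (\<phi> j)" for j
  proof -
    have "(FAr (fn res (n + 1)) h \<cdot> sigma n M) \<cdot> leg n M (Suc j) = FAr (fn res (n + 1)) (\<phi> 0) \<cdot> rleg (n + 1) (shift (resn ch M)) j"
      unfolding e using r sM lM by simp
    also have "\<dots> = rleg (n + 1) (resn ch A) j \<cdot> FAr (fn T (n + 1 + int j)) (\<phi> j)"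
      by (rule res_FAr_rleg[OF \<phi>(2) H S p0])
    finally show ?thesis by (simp add: rleg_resn[OF O(1)])
  qed
  have rh: "FAr (fn res (n + 1)) h \<in> Arr D" "Dom D (FAr (fn res (n + 1)) h) = lob (n + 1) (syz M)" using e r by simp_all
  have "(FAr (fn res (n + 1)) h \<cdot> sigma n M) \<cdot> leg n M k = leg (n + 1) A k \<cdot> signed D k (conn T (n + int k) (sa k) (sb k))"
  proof (cases k)
    \<comment> \<open>Stage zero lies below the range of the shift and is obtained from stage one by
      precomposing with the transition map.\<close>
    case 0
    have "(FAr (fn res (n + 1)) h \<cdot> sigma n M) \<cdot> leg n M 0 = ((FAr (fn res (n + 1)) h \<cdot> sigma n M) \<cdot> leg n M (Suc 0)) \<cdot> rsys T n (resn ch M) 0"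
      using rh sM(1-3) lM(1-4) rs lM(5)[of n 0] by simp
    also have "\<dots> = leg (n + 1) A 0 \<cdot> (FAr (fn T (n + 1 + int 0)) (\<phi> 0) \<cdot> rsys T n (resn ch M) 0)"
      unfolding suc using lA ph[of 0] rs[of n 0] by simp
    also have "\<dots> = leg (n + 1) A 0 \<cdot> signed D 0 (conn T (n + int 0) (sa 0) (sb 0))"
      unfolding \<phi>(4) ..
    finally show ?thesis using 0 by simp
  next
    case (Suc j)
    have "leg (n + 1) A (Suc j) \<cdot> (rsys T (n + 1) (resn ch A) j \<cdot> FAr (fn T (n + 1 + int j)) (\<phi> j)) = leg (n + 1) A j \<cdot> FAr (fn T (n + 1 + int j)) (\<phi> j)"
      using D.reassoc[OF lA(5)[of "n + 1" j], of "FAr (fn T (n + 1 + int j)) (\<phi> j)"] lA(1-4) rsA ph[of j] by simp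
    then show ?thesis using suc[of j] \<phi>(3)[of j n] Suc by simp
  qed
  then show ?thesis by (simp add: A_M_def)
qed

section \<open>The connecting homomorphism of the limit: formula, naturality, exactness\<close>

lemma ex_res_lift:
  assumes fg: "short_exact C f g"
  obtains h where "res_lift f g (Cod C g) (Ident C (Cod C g)) h"
proof -
  have O: "Cod C g \<in> Obj C" using C.short_exactD(5)[OF fg] by simp
  note S = C.syzygiesD[OF resn_syzygies[OF O]]
  show ?thesis
    by (rule C.ex_kernel_lift[OF S(1)[of 0] S(2)[of 0] fg, of "Ident C (Cod C g)"]) (use O S(4) that in auto)
qed

lemma obtain_horseshoe:
  assumes fg: "short_exact C f g"
  obtains RB a b sa sb where "horseshoe C f g (resn ch (Dom C f)) RB (resn ch (Cod C g)) a b sa sb"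
proof -
  have "Dom C f \<in> Obj C" "Cod C g \<in> Obj C" using C.short_exactD(4,5)[OF fg] by simp_all
  then have "projective_resolution C (Dom C f) (resn ch (Dom C f))" "projective_resolution C (Cod C g) (resn ch (Cod C g))"
    using valid by (simp_all add: valid_choices_def)
  then show ?thesis using C.ex_horseshoe[OF fg] that by blast
qed

text \<open>The sign in the resolution construction is exactly what makes its connecting homomorphism
  the dimension shift followed by the map induced by \<open>h\<close>.\<close>

lemma res_conn:
  assumes fg: "short_exact C f g" and l: "res_lift f g (Cod C g) (Ident C (Cod C g)) h"
  shows "conn res n f g = FAr (fn res (n + 1)) h \<cdot> sigma n (Cod C g)"
proof -
  let ?u = "FAr (fn res (n + 1)) h \<cdot> sigma n (Cod C g)"
  let ?l = "\<lambda>sa sb. lim_map D UNIV (lob n (Cod C g)) (leg n (Cod C g)) (lob (n + 1) (Dom C f))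
                    (\<lambda>k. leg (n + 1) (Dom C f) k \<cdot> signed D k (conn T (n + int k) (sa k) (sb k)))"
  have O: "Dom C f \<in> Obj C" "Cod C g \<in> Obj C" using C.short_exactD(4,5)[OF fg] by simp_all
  note S = resn_syzygies[OF O(2)]
  have hl: "h \<in> Arr C" "Dom C h = syz (Cod C g)" "Cod C h = Dom C f"
    using C.kernel_lift_hom[OF l] C.syzygiesD(3)[OF S] by (simp_all add: syz_def)
  note r = res_FAr(1-3)[OF hl, where n="n + 1"] and s = sigma_simps[OF O(2), of n]
  have u: "?u \<in> Arr D" "Dom D ?u = lob n (Cod C g)" "Cod D ?u = lob (n + 1) (Dom C f)" using r s by simp_all
  have e: "?l sa sb = ?u" if "horseshoe C f g (resn ch (Dom C f)) RB (resn ch (Cod C g)) a b sa sb" for RB a b sa sb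
    by (rule D.lim_map_eq[OF seqlim_leg[OF O(2)] _ u]) (use res_conn_lemma[OF fg that l] in simp_all)
  obtain RB a b sa sb where hs: "horseshoe C f g (resn ch (Dom C f)) RB (resn ch (Cod C g)) a b sa sb"
    using obtain_horseshoe[OF fg] .
  have "conn res n f g = (THE u. \<forall>RB a b sa sb. horseshoe C f g (resn ch (Dom C f)) RB (resn ch (Cod C g)) a b sa sb \<longrightarrow> u = ?l sa sb)"
    by (simp add: resolution_construction_def res_sys_rsys)
  also have "\<dots> = ?u"
  proof (rule the_equality)
    show "\<forall>RB a b sa sb. horseshoe C f g (resn ch (Dom C f)) RB (resn ch (Cod C g)) a b sa sb \<longrightarrow> ?u = ?l sa sb"
      using e by simp
    fix u assume "\<forall>RB a b sa sb. horseshoe C f g (resn ch (Dom C f)) RB (resn ch (Cod C g)) a b sa sb \<longrightarrow> u = ?l sa sb"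
    then have "u = ?l sa sb" using hs by blast
    then show "u = ?u" using e[OF hs] by simp
  qed
  finally show ?thesis .
qed

lemma res_conn_simps:
  assumes fg: "short_exact C f g"
  shows "conn res n f g \<in> Arr D" "Dom D (conn res n f g) = lob n (Cod C g)" "Cod D (conn res n f g) = lob (n + 1) (Dom C f)"
proof -
  obtain h where l: "res_lift f g (Cod C g) (Ident C (Cod C g)) h" using ex_res_lift[OF fg] .
  have O: "Dom C f \<in> Obj C" "Cod C g \<in> Obj C" using C.short_exactD(4,5)[OF fg] by simp_all
  have hl: "h \<in> Arr C" "Dom C h = syz (Cod C g)" "Cod C h = Dom C f"
    using C.kernel_lift_hom[OF l] C.syzygiesD(3)[OF resn_syzygies[OF O(2)]] by (simp_all add: syz_def)
  show "conn res n f g \<in> Arr D" "Dom D (conn res n f g) = lob n (Cod C g)" "Cod D (conn res n f g) = lob (n + 1) (Dom C f)"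
    unfolding res_conn[OF fg l] using res_FAr(1-3)[OF hl, where n="n + 1"] sigma_simps[OF O(2), of n] by simp_all
qed

text \<open>By \<open>res_conn\<close> and \<open>sigma_natural\<close> both sides are
  \<open>sigma\<close> followed by arrows induced by lifts of the same \<open>c\<close>, namely
  \<open>a\<close> after \<open>h\<close> and \<open>h'\<close> after \<open>c1\<close>; the limit
  functor identifies these.\<close>

lemma res_conn_natural:
  assumes fg: "short_exact C f g" and fg': "short_exact C f' g'" and k: "kernel_lift C f g f' g' c a"
    and c: "c \<in> Arr C" "Dom C c = Cod C g" "Cod C c = Cod C g'"
  shows "FAr (fn res (n + 1)) a \<cdot> conn res n f g = conn res n f' g' \<cdot> FAr (fn res n) c"
proof -
  have O: "Dom C f \<in> Obj C" "Cod C g \<in> Obj C" "Dom C f' \<in> Obj C" "Cod C g' \<in> Obj C"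
    using C.short_exactD(4,5)[OF fg] C.short_exactD(4,5)[OF fg'] by simp_all
  note S = resn_syzygies[OF O(2)] and S' = resn_syzygies[OF O(4)]
  note s = C.syzygiesD[OF S] and s' = C.syzygiesD[OF S']
  obtain h where l: "res_lift f g (Cod C g) (Ident C (Cod C g)) h" using ex_res_lift[OF fg] .
  obtain h' where l': "res_lift f' g' (Cod C g') (Ident C (Cod C g')) h'" using ex_res_lift[OF fg'] .
  obtain c1 where c1: "res_lift (sincl (resn ch (Cod C g')) 0) (sproj (resn ch (Cod C g')) 0) (Cod C g) c c1"
    by (rule C.ex_kernel_lift[OF s(1)[of 0] s(2)[of 0] s'(1)[of 0] c(1)]) (use c s(4) s'(4) in simp_all)
  have hl: "h \<in> Arr C" "Dom C h = syz (Cod C g)" "Cod C h = Dom C f"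
    using C.kernel_lift_hom[OF l] s(3) by (simp_all add: syz_def)
  have hl': "h' \<in> Arr C" "Dom C h' = syz (Cod C g')" "Cod C h' = Dom C f'"
    using C.kernel_lift_hom[OF l'] s'(3) by (simp_all add: syz_def)
  have c1l: "c1 \<in> Arr C" "Dom C c1 = syz (Cod C g)" "Cod C c1 = syz (Cod C g')"
    using C.kernel_lift_hom[OF c1] s(3) s'(3) by (simp_all add: syz_def)
  note al = C.kernel_lift_hom[OF k]
  have k1: "res_lift f' g' (Cod C g) c (a \<cdot>\<^bsub>C\<^esub> h)"
    using C.kernel_lift_comp[OF l k s(1) fg fg'] c s(4) O by simp
  have k2: "res_lift f' g' (Cod C g) c (h' \<cdot>\<^bsub>C\<^esub> c1)"
    using C.kernel_lift_comp[OF c1 l' s(1) s'(1) fg'] c s(4) s'(4) O by simp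
  have e: "FAr (fn res (n + 1)) (a \<cdot>\<^bsub>C\<^esub> h) = FAr (fn res (n + 1)) (h' \<cdot>\<^bsub>C\<^esub> c1)"
    by (rule res_kernel_lift_eq[OF k1 k2 s(1) fg' s(2)])
  note rf = functor_simps[OF res_functor[of "n + 1"], unfolded res_FOb] and rn = functor_simps[OF res_functor[of n], unfolded res_FOb]
  note sg = sigma_simps[OF O(2), of n] and sg' = sigma_simps[OF O(4), of n]
  have "FAr (fn res (n + 1)) a \<cdot> conn res n f g = FAr (fn res (n + 1)) (a \<cdot>\<^bsub>C\<^esub> h) \<cdot> sigma n (Cod C g)"
    unfolding res_conn[OF fg l] using al hl rf(3-6) sg(1-3) by simp
  also have "\<dots> = FAr (fn res (n + 1)) h' \<cdot> (FAr (fn res (n + 1)) c1 \<cdot> sigma n (Cod C g))"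
    unfolding e using hl' c1l rf(3-6) sg(1-3) by simp
  also have "\<dots> = conn res n f' g' \<cdot> FAr (fn res n) c"
    unfolding res_conn[OF fg' l'] sigma_natural[OF c c1, symmetric] using hl' rf(3-6) rn(3-6) c sg'(1-3) by simp
  finally show ?thesis .
qed

text \<open>Negation is composition with the automorphism \<open>neg D (Ident D Y)\<close>, which
  preserves exactness on either side.\<close>

lemma signed_exact:
  assumes "x \<in> Arr D"
  shows "exact_at D y x \<Longrightarrow> exact_at D y (signed D k x)" "exact_at D x y \<Longrightarrow> exact_at D (signed D k x) y"
proof -
  have sD: "signed D k x = (if even k then x else neg D x)" by (simp add: signed_def neg_def)
  have i: "is_mono D (neg D (Ident D Y))" "is_epi D (neg D (Ident D Y))" if "Y \<in> Obj D" for Y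
  proof -
    have e: "neg D (Ident D Y) \<cdot> neg D (Ident D Y) = Ident D Y" using that by simp
    have "is_mono D (neg D (Ident D Y) \<cdot> neg D (Ident D Y))" "is_epi D (neg D (Ident D Y) \<cdot> neg D (Ident D Y))" unfolding e using that by simp_all
    then show "is_mono D (neg D (Ident D Y))" "is_epi D (neg D (Ident D Y))"
      using D.mono_cancel D.epi_cancel that by (metis D.Ident_simps D.neg_simps)+
  qed
  show "exact_at D y (signed D k x)" if "exact_at D y x"
    using D.exact_comp_mono[OF that i(1)[of "Cod D x"]] assms that by (simp add: sD)
  show "exact_at D (signed D k x) y" if "exact_at D x y"
    using D.exact_comp_epi[OF that i(2)[of "Dom D x"]] assms that by (simp add: sD)
qed

text \<open>The three systems are taken along horseshoe resolutions, where every stage is part of a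
  long exact sequence of \<open>T\<close>; \<open>limit_exact\<close> passes to the limit.\<close>

lemma res_exact:
  assumes fg: "short_exact C f g"
  shows "exact_at D (FAr (fn res n) f) (FAr (fn res n) g)" "exact_at D (FAr (fn res n) g) (conn res n f g)"
    "exact_at D (conn res n f g) (FAr (fn res (n + 1)) f)"
proof -
  obtain RB a b sa sb where hs: "horseshoe C f g (resn ch (Dom C f)) RB (resn ch (Cod C g)) a b sa sb"
    using obtain_horseshoe[OF fg] .
  obtain h where l: "res_lift f g (Cod C g) (Ident C (Cod C g)) h" using ex_res_lift[OF fg] .
  note H = C.horseshoeD[OF hs]
  have O: "Dom C f \<in> Obj C" "Cod C g \<in> Obj C" "Cod C f \<in> Obj C" using C.short_exactD(4,5)[OF fg] by simp_all
  note f = C.short_exactD[OF fg] and e = conn_exact[OF H(6)]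
  have gd: "Dom C g = Cod C f" using f by simp
  obtain \<phi> where \<phi>: "syzygy_lift C (shift (resn ch (Cod C g))) (resn ch (Dom C f)) (\<phi> 0) \<phi>"
    "\<And>n k. signed D (Suc k) (conn T (n + 1 + int k) (sa (Suc k)) (sb (Suc k))) = rsys T (n + 1) (resn ch (Dom C f)) k \<cdot> FAr (fn T (n + 1 + int k)) (\<phi> k)"
    "\<And>n k. FAr (fn T (n + 1 + int k)) (\<phi> k) \<cdot> rsys T n (resn ch (Cod C g)) k = signed D k (conn T (n + int k) (sa k) (sb k))"
    "kernel_lift C (sincl (resn ch (Cod C g)) 0) (sproj (resn ch (Cod C g)) 0) f g (Ident C (Cod C g)) (\<phi> 0)"
    by (rule signed_conn[OF hs]) blast
  have p0: "\<phi> 0 \<in> Arr C" "Dom C (\<phi> 0) = syz (Cod C g)" "Cod C (\<phi> 0) = Dom C f"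
    using C.kernel_lift_hom[OF \<phi>(4)] C.syzygiesD(3)[OF H(3)] by (simp_all add: syz_def)
  note ph = C.syzygy_lift_hom[OF \<phi>(1) syzygies_shift_resn[OF O(2)] H(1) p0]
  note rA = rsys_simps[OF H(1)] and rB = rsys_simps[OF H(2)] and rC = rsys_simps[OF H(3)]
  have sA: "sa k \<in> Arr C" "sb k \<in> Arr C" for k using C.short_exactD(4,5)[OF H(6)] by simp_all
  have LA: "seqlim D (rsys T n (resn ch (Dom C f))) (lob n (Dom C f)) (leg n (Dom C f))" for n by (rule seqlim_leg[OF O(1)])
  have LC: "seqlim D (rsys T n (resn ch (Cod C g))) (lob n (Cod C g)) (leg n (Cod C g))" for n by (rule seqlim_leg[OF O(2)])
  \<comment> \<open>\<open>RB\<close> need not be the chosen resolution of the middle term, so the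
    legs are those of \<open>rleg\<close>.\<close>
  have LB: "seqlim D (rsys T n RB) (lob n (Cod C f)) (rleg n RB)" for n by (rule seqlim_rleg[OF H(2)])
  note hl = C.horseshoe_lifts[OF hs]
  have nf: "FAr (fn T (n + 1 + int k)) (sa (Suc k)) \<cdot> rsys T n (resn ch (Dom C f)) k = rsys T n RB k \<cdot> FAr (fn T (n + int k)) (sa k)" for n k
    by (rule rsys_natural[OF hl(1) H(1,2) f(4) refl refl])
  have ng: "FAr (fn T (n + 1 + int k)) (sb (Suc k)) \<cdot> rsys T n RB k = rsys T n (resn ch (Cod C g)) k \<cdot> FAr (fn T (n + int k)) (sb k)" for n k
    by (rule rsys_natural[OF hl(2) H(2,3) f(5) gd refl])
  have uf: "FAr (fn res n) f \<cdot> leg n (Dom C f) k = rleg n RB k \<cdot> FAr (fn T (n + int k)) (sa k)" for n k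
    using res_FAr_rleg[OF hl(1) H(1,2) f(4) refl refl, of n k] rleg_resn[OF O(1)] by simp
  have ug: "FAr (fn res n) g \<cdot> rleg n RB k = leg n (Cod C g) k \<cdot> FAr (fn T (n + int k)) (sb k)" for n k
    using res_FAr_rleg[OF hl(2) H(2,3) f(5) gd refl, of n k] rleg_resn[OF O(2)] by simp
  have cu: "conn res n f g \<cdot> leg n (Cod C g) k = leg (n + 1) (Dom C f) k \<cdot> signed D k (conn T (n + int k) (sa k) (sb k))" for k
    unfolding res_conn[OF fg l] by (rule res_conn_lemma[OF fg hs l])
  note rf = res_FAr(1-3)[OF f(4) refl refl] and rg = res_FAr(1-3)[OF f(5) gd refl] and rc = res_conn_simps[OF fg, of n]
  have sg: "signed D k x \<in> Arr D" "Dom D (signed D k x) = Dom D x" "Cod D (signed D k x) = Cod D x" if "x \<in> Arr D" for k x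
    using that by (simp_all add: signed_def flip: neg_def)
  \<comment> \<open>Both sides are a transition along the resolution of \<open>Cod C g\<close>, the
    arrow of \<open>\<phi> k\<close>, and a transition along that of \<open>Dom C f\<close>. Without
    the signs the square would anticommute.\<close>
  have nc: "signed D (Suc k) (conn T (n + int (Suc k)) (sa (Suc k)) (sb (Suc k))) \<cdot> rsys T n (resn ch (Cod C g)) k =
     rsys T (n + 1) (resn ch (Dom C f)) k \<cdot> signed D k (conn T (n + int k) (sa k) (sb k))" for k
    using \<phi>(2)[of k n] \<phi>(3)[of n k, symmetric] rA rC ph[of k] by simp
  show "exact_at D (FAr (fn res n) f) (FAr (fn res n) g)"
    by (rule D.limit_exact[OF LA LB LC _ _ _ _ _ e(1)[of "n + int k" k for k] rf uf rg ug]) (use rA rB rC sA H(8-11) nf ng in simp_all)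
  show "exact_at D (FAr (fn res n) g) (conn res n f g)"
    by (rule D.limit_exact[OF LB LC LA _ _ _ _ _ signed_exact(1)[OF _ e(2)[of "n + int k" k for k]] rg ug rc cu])
      (use rA rB rC sA H(6,8-11) ng nc sg in simp_all)
  have nf': "FAr (fn T (m + int (Suc k))) (sa (Suc k)) \<cdot> rsys T m (resn ch (Dom C f)) k = rsys T m RB k \<cdot> FAr (fn T (m + int k)) (sa k)" for m k
    unfolding int_shift(1) by (rule nf)
  show "exact_at D (conn res n f g) (FAr (fn res (n + 1)) f)"
    by (rule D.limit_exact[OF LC LA LB _ _ _ _ nf'[of "n + 1"] _ rc cu rf uf])
      (use rA rB rC sA H(6,8-11) nf nc sg signed_exact(2)[OF _ e(3)[of "n + int k" k for k]] in simp_all)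
qed

lemma res_cohomological: "cohomological_functor C D res"
  unfolding cohomological_functor_def
proof (intro conjI allI impI)
  fix n f g f' g' a b c
  assume fg: "short_exact C f g" and fg': "short_exact C f' g'"
    and a: "a \<in> Hom C (Dom C f) (Dom C f')" and b: "b \<in> Hom C (Cod C f) (Cod C f')" and c: "c \<in> Hom C (Cod C g) (Cod C g')"
    and e: "b \<cdot>\<^bsub>C\<^esub> f = f' \<cdot>\<^bsub>C\<^esub> a" "c \<cdot>\<^bsub>C\<^esub> g = g' \<cdot>\<^bsub>C\<^esub> b"
  have "kernel_lift C f g f' g' c a"
    by (rule C.kernel_liftI[of b]) (use a b C.short_exactD(6)[OF fg] C.short_exactD(6)[OF fg'] in \<open>simp_all add: e\<close>)
  then show "FAr (fn res (n + 1)) a \<cdot> conn res n f g = conn res n f' g' \<cdot> FAr (fn res n) c"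
    using res_conn_natural[OF fg fg'] c by simp
qed (use res_functor res_conn_simps res_exact res_FOb in simp_all)

end

section \<open>Left satellites\<close>

context abelian
begin

section \<open>Factorisation through kernels, transport of exactness, interleaved systems\<close>

lemma ker_factor_eq:
  assumes "is_mono C k" "s \<in> Arr C" "Cod C s = Dom C k" "k \<cdot> s = t"
  shows "ker_factor C k t = s"
  unfolding ker_factor_def
proof (rule the_equality)
  have k: "k \<in> Arr C" using assms(1) by simp
  have d: "Dom C t = Dom C s" unfolding assms(4)[symmetric] using assms(2,3) k by simp
  show "s \<in> Hom C (Dom C t) (Dom C k) \<and> k \<cdot> s = t" using assms(2-4) d by simp
  fix s' assume "s' \<in> Hom C (Dom C t) (Dom C k) \<and> k \<cdot> s' = t"
  then have "s' \<in> Arr C" "Cod C s' = Dom C k" "k \<cdot> s' = k \<cdot> s" using assms(4) by auto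
  then show "s' = s" using is_monoD[OF assms(1)] assms(2,3) by blast
qed

lemma ker_factor_simps:
  assumes "is_kernel C f k" "t \<in> Arr C" "Cod C t = Dom C f" "f \<cdot> t = Zero C (Dom C t) (Cod C f)"
  shows "ker_factor C k t \<in> Arr C" "Dom C (ker_factor C k t) = Dom C t" "Cod C (ker_factor C k t) = Dom C k" "k \<cdot> ker_factor C k t = t"
proof -
  obtain s where s: "s \<in> Arr C" "Dom C s = Dom C t" "Cod C s = Dom C k" "k \<cdot> s = t"
    using kernel_factor[OF assms] .
  have "ker_factor C k t = s" by (rule ker_factor_eq[OF kernel_mono[OF assms(1)] s(1,3,4)])
  then show "ker_factor C k t \<in> Arr C" "Dom C (ker_factor C k t) = Dom C t" "Cod C (ker_factor C k t) = Dom C k" "k \<cdot> ker_factor C k t = t"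
    using s by simp_all
qed

lemma iso_inverse:
  assumes "is_iso C f"
  obtains g where "g \<in> Arr C" "Dom C g = Cod C f" "Cod C g = Dom C f" "g \<cdot> f = Ident C (Dom C f)" "f \<cdot> g = Ident C (Cod C f)"
  using assms by (auto simp: is_iso_def)

text \<open>An arrow killed by \<open>g\<close> is carried along \<open>b\<close>, lifted along
  \<open>f'\<close> after an epi and along \<open>a\<close> after a further epi; cancelling the mono
  \<open>b\<close> turns this into a lift along \<open>f\<close>.\<close>

lemma exact_at_iso:
  assumes ex: "exact_at C f' g'" and i: "is_iso C a" "is_iso C b" "is_iso C c"
    and f: "f \<in> Arr C" "Dom C f = Dom C a" "Cod C f = Dom C b" and g: "g \<in> Arr C" "Dom C g = Dom C b" "Cod C g = Dom C c"
    and ty: "Cod C a = Dom C f'" "Cod C b = Dom C g'" "Cod C c = Cod C g'"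
    and e: "b \<cdot> f = f' \<cdot> a" "c \<cdot> g = g' \<cdot> b"
  shows "exact_at C f g"
proof -
  note E = ex[unfolded exact_at_iff]
  have a: "is_epi C a" "a \<in> Arr C" and c: "is_mono C c" "c \<in> Arr C" and b: "is_mono C b" "b \<in> Arr C" using i by (auto simp: iso_iff)
  have f': "f' \<in> Arr C" "g' \<in> Arr C" "Cod C f' = Dom C g'" "g' \<cdot> f' = Zero C (Dom C f') (Cod C g')" using E by blast+
  show ?thesis unfolding exact_at_iff
  proof (intro conjI ballI impI)
    have "c \<cdot> (g \<cdot> f) = g' \<cdot> (f' \<cdot> a)" using reassoc[OF e(2), of f] f g b c f' ty e(1) by simp
    also have "\<dots> = Zero C (Dom C f) (Cod C c)" using reassoc[OF f'(4), of a] a f' ty f(2) by simp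
    finally show "g \<cdot> f = Zero C (Dom C f) (Cod C g)"
      by (intro mono_ZeroD[OF c(1), of "g \<cdot> f"]) (use f g in simp_all)
    fix t assume t: "t \<in> Arr C" "Cod C t = Dom C g" "g \<cdot> t = Zero C (Dom C t) (Cod C g)"
    have "g' \<cdot> (b \<cdot> t) = c \<cdot> (g \<cdot> t)" using reassoc[OF e(2), of t] t(1,2) g b c f' ty by simp
    also have "\<dots> = Zero C (Dom C t) (Cod C g')" unfolding t(3) using t(1) c g ty by simp
    finally have z: "g' \<cdot> (b \<cdot> t) = Zero C (Dom C (b \<cdot> t)) (Cod C g')" using t(1,2) g(2) b by simp
    have bt: "b \<cdot> t \<in> Arr C" "Cod C (b \<cdot> t) = Dom C g'" "Dom C (b \<cdot> t) = Dom C t" using t(1,2) g(2) b ty by simp_all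
    obtain e1 s where s: "is_epi C e1" "s \<in> Arr C" "Cod C e1 = Dom C (b \<cdot> t)" "Dom C s = Dom C e1" "Cod C s = Dom C f'" "f' \<cdot> s = (b \<cdot> t) \<cdot> e1"
      using E bt(1,2) z by blast
    have e1: "e1 \<in> Arr C" "Cod C e1 = Dom C t" using s(1,3) bt(3) by simp_all
    obtain e2 r where r: "is_epi C e2" "Cod C e2 = Dom C s" "r \<in> Arr C" "Dom C r = Dom C e2" "Cod C r = Dom C a" "a \<cdot> r = s \<cdot> e2"
      using epi_pullback[OF a(1), of s] s(2,5) ty(1) by metis
    have e2: "e2 \<in> Arr C" using r(1) by simp
    have "b \<cdot> (f \<cdot> r) = f' \<cdot> (a \<cdot> r)" using reassoc[OF e(1), of r] r(3-5) f b a f' ty by simp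
    also have "\<dots> = (f' \<cdot> s) \<cdot> e2" unfolding r(6) using s(2,4,5) r(2) e2 f' by simp
    also have "\<dots> = b \<cdot> (t \<cdot> (e1 \<cdot> e2))" unfolding s(6) using t(1,2) g(2) b e1 e2 r(2) s(4) by simp
    finally have "f \<cdot> r = t \<cdot> (e1 \<cdot> e2)"
      by (intro is_monoD[OF b(1), of "f \<cdot> r" "t \<cdot> (e1 \<cdot> e2)"]) (use r(2-5) f t(1,2) g(2) e1 e2 s(4) in simp_all)
    moreover have "is_epi C (e1 \<cdot> e2)" by (rule epi_comp[OF r(1) s(1)]) (use r(2) s(4) in simp)
    ultimately show "\<exists>e s. is_epi C e \<and> s \<in> Arr C \<and> Cod C e = Dom C t \<and> Dom C s = Dom C e \<and> Cod C s = Dom C f \<and> f \<cdot> s = t \<cdot> e"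
      using r(2-5) e1 e2 s(4) f by (intro exI[of _ "e1 \<cdot> e2"] exI[of _ r]) simp
  qed (use f g in simp_all)
qed

text \<open>Since \<open>w\<close> is mono, the \<open>\<rho> k\<close> factor the transitions of
  the first system as well: \<open>\<rho> k \<cdot> w k = x k\<close>. The systems interleave, and
  \<open>\<rho>\<close> induces the inverse on the limits.\<close>

lemma limit_interleaved_iso:
  assumes x: "seqlim C x L c" and y: "seqlim C y L' c'"
    and w: "\<And>k. is_mono C (w k)" "\<And>k. Dom C (w k) = Dom C (x k)" "\<And>k. Cod C (w k) = Dom C (y k)" "\<And>k. w (Suc k) \<cdot> x k = y k \<cdot> w k"
    and \<rho>: "\<And>k. \<rho> k \<in> Arr C" "\<And>k. Dom C (\<rho> k) = Dom C (y k)" "\<And>k. Cod C (\<rho> k) = Dom C (x (Suc k))" "\<And>k. w (Suc k) \<cdot> \<rho> k = y k"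
    and u: "u \<in> Arr C" "Dom C u = L" "Cod C u = L'" "\<And>k. u \<cdot> c k = c' k \<cdot> w k"
  shows "is_iso C u"
proof -
  note X = seqlimD[OF x] and Y = seqlimD[OF y]
  have wa: "w k \<in> Arr C" for k using w(1) by simp
  have \<rho>w: "\<rho> k \<cdot> w k = x k" for k
  proof (rule is_monoD[OF w(1)[of "Suc k"]])
    show "w (Suc k) \<cdot> (\<rho> k \<cdot> w k) = w (Suc k) \<cdot> x k"
      using reassoc[OF \<rho>(4)[of k], of "w k"] \<rho>(1-3) w(2,3) wa w(4)[of k] by simp
  qed (use \<rho>(1-3) w(2,3) wa X(7,8) in simp_all)
  have cc: "(c (Suc (Suc k)) \<cdot> \<rho> (Suc k)) \<cdot> y k = c (Suc k) \<cdot> \<rho> k" for k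
  proof -
    have "(c (Suc (Suc k)) \<cdot> \<rho> (Suc k)) \<cdot> y k = c (Suc (Suc k)) \<cdot> ((\<rho> (Suc k) \<cdot> w (Suc k)) \<cdot> \<rho> k)"
      unfolding \<rho>(4)[of k, symmetric] using X(3,4) \<rho>(1-3) wa w(2,3) by simp
    also have "\<dots> = (c (Suc (Suc k)) \<cdot> x (Suc k)) \<cdot> \<rho> k" unfolding \<rho>w using X(3,4,7,8) \<rho>(1-3) by simp
    finally show ?thesis unfolding X(6) .
  qed
  have ex: "\<exists>v. v \<in> Arr C \<and> Dom C v = L' \<and> Cod C v = L \<and> (\<forall>k. v \<cdot> c' k = c (Suc k) \<cdot> \<rho> k)"
  proof (rule seqlim_factor[OF y X(2), of "\<lambda>k. c (Suc k) \<cdot> \<rho> k"])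
    show "c (Suc (Suc k)) \<cdot> \<rho> (Suc k) \<cdot> y k = c (Suc k) \<cdot> \<rho> k" for k by (rule cc)
  qed (use X(3-5) \<rho>(1-3) in \<open>simp_all, blast\<close>)
  then obtain v where v: "v \<in> Arr C" "Dom C v = L'" "Cod C v = L" "\<And>k. v \<cdot> c' k = c (Suc k) \<cdot> \<rho> k" by blast
  have "v \<cdot> u = Ident C L"
  proof (rule seqlim_eq[OF x])
    fix k
    have "(v \<cdot> u) \<cdot> c (Suc k) = (v \<cdot> c' (Suc k)) \<cdot> w (Suc k)" using v(1-3) u X(3-5) Y(3-5) wa w(2,3) by simp
    also have "\<dots> = c (Suc (Suc k)) \<cdot> (\<rho> (Suc k) \<cdot> w (Suc k))" unfolding v(4) using X(3-5) \<rho>(1-3) wa w(2,3) by simp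
    also have "\<dots> = c (Suc k)" unfolding \<rho>w by (rule X(6))
    finally show "(v \<cdot> u) \<cdot> c (Suc k) = Ident C L \<cdot> c (Suc k)" using X(3-5) by simp
  qed (use u v X(2) in simp_all)
  moreover have "u \<cdot> v = Ident C L'"
  proof (rule seqlim_eq[OF y])
    fix k
    have "(u \<cdot> v) \<cdot> c' (Suc k) = (u \<cdot> c (Suc (Suc k))) \<cdot> \<rho> (Suc k)" using v u(1-3) X(3-5) Y(3-5) \<rho>(1-3) by simp
    also have "\<dots> = c' (Suc (Suc k)) \<cdot> (w (Suc (Suc k)) \<cdot> \<rho> (Suc k))" unfolding u(4) using Y(3-5) \<rho>(1-3) wa w(2,3) by simp
    also have "\<dots> = c' (Suc k)" unfolding \<rho>(4) by (rule Y(6))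
    finally show "(u \<cdot> v) \<cdot> c' (Suc k) = Ident C L' \<cdot> c' (Suc k)" using Y(3-5) by simp
  qed (use u v Y(2) in simp_all)
  ultimately show ?thesis using u(1-3) v(1-3) unfolding is_iso_def by auto
qed

end

context completion_setting
begin

section \<open>The left satellite of an additive functor\<close>

lemma pincl_facts:
  assumes "M \<in> Obj C"
  shows "short_exact C (pincl ch M) (pproj ch M)" "Cod C (pproj ch M) = M" "projective C (Dom C (pproj ch M))"
    "pincl ch M \<in> Arr C" "pproj ch M \<in> Arr C" "Cod C (pincl ch M) = Dom C (pproj ch M)"
  using valid assms C.short_exactD(4-6)[of "pincl ch M" "pproj ch M"] unfolding valid_choices_def by auto

abbreviation S where "S \<equiv> sat C D ch"
abbreviation eps where "eps F f g \<equiv> sat_conn C D ch F (Suc 0) f g"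

lemma sat_incl_simps:
  assumes F: "additive_functor C D F" and M: "M \<in> Obj C"
  shows "is_kernel D (FAr F (pincl ch M)) (sat_incl ch F M)" "is_mono D (sat_incl ch F M)" "sat_incl ch F M \<in> Arr D"
    "Dom D (sat_incl ch F M) = FOb (S F) M" "Cod D (sat_incl ch F M) = FOb F (Dom C (pincl ch M))"
    "FAr F (pincl ch M) \<cdot> sat_incl ch F M = Zero D (FOb (S F) M) (FOb F (Dom C (pproj ch M)))"
proof -
  have i: "FAr F (pincl ch M) \<in> Arr D" "Dom D (FAr F (pincl ch M)) = FOb F (Dom C (pincl ch M))" "Cod D (FAr F (pincl ch M)) = FOb F (Dom C (pproj ch M))"
    using functor_simps(3-5)[OF F] pincl_facts[OF M] by simp_all
  show k: "is_kernel D (FAr F (pincl ch M)) (sat_incl ch F M)"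
    using valid i(1) by (simp add: valid_choices_def sat_incl_def)
  show "is_mono D (sat_incl ch F M)" by (rule D.kernel_mono[OF k])
  show d: "Dom D (sat_incl ch F M) = FOb (S F) M" by (simp add: sat_def)
  show "sat_incl ch F M \<in> Arr D" "Cod D (sat_incl ch F M) = FOb F (Dom C (pincl ch M))"
    "FAr F (pincl ch M) \<cdot> sat_incl ch F M = Zero D (FOb (S F) M) (FOb F (Dom C (pproj ch M)))"
    using D.kernel_simps[OF k] i d by simp_all
qed

lemma sat_lift_eq:
  assumes F: "additive_functor C D F" and M: "M \<in> Obj C" and se: "short_exact C j q"
    and l: "kernel_lift C (pincl ch M) (pproj ch M) j q f fs" "kernel_lift C (pincl ch M) (pproj ch M) j q f gs"
  shows "FAr F fs \<cdot> sat_incl ch F M = FAr F gs \<cdot> sat_incl ch F M"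
  by (rule functor_kernel_lift_eq[OF F _ _ _ l pincl_facts(1)[OF M] se]) (use sat_incl_simps[OF F M] pincl_facts[OF M] in simp_all)

lemma sat_FAr:
  assumes F: "additive_functor C D F" and f: "f \<in> Arr C" "Dom C f = M" "Cod C f = N"
  shows "FAr (S F) f \<in> Arr D" "Dom D (FAr (S F) f) = FOb (S F) M" "Cod D (FAr (S F) f) = FOb (S F) N"
    "kernel_lift C (pincl ch M) (pproj ch M) (pincl ch N) (pproj ch N) f fs \<Longrightarrow>
       sat_incl ch F N \<cdot> FAr (S F) f = FAr F fs \<cdot> sat_incl ch F M"
proof -
  have O: "M \<in> Obj C" "N \<in> Obj C" using f by auto
  note p = pincl_facts[OF O(1)] and p' = pincl_facts[OF O(2)] and i = sat_incl_simps[OF F O(1)] and i' = sat_incl_simps[OF F O(2)]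
  let ?l = "kernel_lift C (pincl ch M) (pproj ch M) (pincl ch N) (pproj ch N) f"
  obtain gs where gs: "?l gs" by (rule C.ex_kernel_lift[OF p(1,3) p'(1) f(1)]) (use f p p' in simp_all)
  note hg = C.kernel_lift_hom[OF gs]
  obtain h where h: "h \<in> Arr C" "Dom C h = Dom C (pproj ch M)" "Cod C h = Dom C (pproj ch N)"
    "pincl ch N \<cdot>\<^bsub>C\<^esub> gs = h \<cdot>\<^bsub>C\<^esub> pincl ch M" using C.kernel_liftE[OF gs] by metis
  note s = functor_simps[OF F]
  let ?t = "FAr F gs \<cdot> sat_incl ch F M"
  have t: "?t \<in> Arr D" "Dom D ?t = FOb (S F) M" "Cod D ?t = FOb F (Dom C (pincl ch N))" using hg s(3-5) i by simp_all
  \<comment> \<open>The lift \<open>h\<close> on projectives moves the inclusion to the other side,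
    where it annihilates the satellite inclusion; hence \<open>?t\<close> factors through the
    kernel.\<close>
  have "FAr F (pincl ch N) \<cdot> ?t = FAr F (pincl ch N \<cdot>\<^bsub>C\<^esub> gs) \<cdot> sat_incl ch F M" using hg s(3-6) i p' by simp
  also have "\<dots> = FAr F h \<cdot> (FAr F (pincl ch M) \<cdot> sat_incl ch F M)" unfolding h(4) using h(1-3) s(3-6) i p by simp
  also have "\<dots> = Zero D (Dom D ?t) (Cod D (FAr F (pincl ch N)))"
  proof -
    have "FOb (S F) M \<in> Obj D" using D.Dom_Obj[OF i(3)] i(4) by simp
    then show ?thesis unfolding i(6) t(2) using h(1-3) s(3-5) p' by simp
  qed
  finally have z: "FAr F (pincl ch N) \<cdot> ?t = Zero D (Dom D ?t) (Cod D (FAr F (pincl ch N)))" .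
  have ct: "Cod D ?t = Dom D (FAr F (pincl ch N))" using t s(4) p' by simp
  note kf = D.ker_factor_simps[OF i'(1) t(1) ct z]
  have "FAr (S F) f = (THE s. \<forall>fs. ?l fs \<longrightarrow> s = ker_factor D (sat_incl ch F N) (FAr F fs \<cdot> sat_incl ch F M))"
    using f by (simp add: sat_def)
  also have "\<dots> = ker_factor D (sat_incl ch F N) ?t"
  proof (rule the_equality)
    have "FAr F fs \<cdot> sat_incl ch F M = ?t" if "?l fs" for fs by (rule sat_lift_eq[OF F O(1) p'(1) that gs])
    then show "\<forall>fs. ?l fs \<longrightarrow> ker_factor D (sat_incl ch F N) ?t = ker_factor D (sat_incl ch F N) (FAr F fs \<cdot> sat_incl ch F M)"
      by simp
  qed (use gs in blast)
  finally have e: "FAr (S F) f = ker_factor D (sat_incl ch F N) ?t" .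
  show "FAr (S F) f \<in> Arr D" "Dom D (FAr (S F) f) = FOb (S F) M" "Cod D (FAr (S F) f) = FOb (S F) N"
    using kf t i' by (simp_all add: e)
  show "sat_incl ch F N \<cdot> FAr (S F) f = FAr F fs \<cdot> sat_incl ch F M" if "?l fs"
    using kf(4) sat_lift_eq[OF F O(1) p'(1) gs that] by (simp add: e)
qed

text \<open>The functor laws are checked after the mono \<open>sat_incl\<close>, where they become
  laws for \<open>F\<close> on induced arrows.\<close>

lemma sat_functor:
  assumes F: "additive_functor C D F"
  shows "additive_functor C D (S F)"
  unfolding additive_functor_def
proof (intro conjI ballI allI impI)
  note s = functor_simps[OF F]
  fix A assume A: "A \<in> Obj C"
  note i = sat_incl_simps[OF F A] and p = pincl_facts[OF A]
  show O: "FOb (S F) A \<in> Obj D" using D.Dom_Obj[OF i(3)] i(4) by simp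
  note f = sat_FAr[OF F, where f="Ident C A" and M=A and N=A]
  have "kernel_lift C (pincl ch A) (pproj ch A) (pincl ch A) (pproj ch A) (Ident C A) (Ident C (Dom C (pincl ch A)))"
    using C.kernel_lift_Ident[OF p(1)] p(2) by simp
  then have e: "sat_incl ch F A \<cdot> FAr (S F) (Ident C A) = FAr F (Ident C (Dom C (pincl ch A))) \<cdot> sat_incl ch F A"
    using f(4) A by simp
  show "FAr (S F) (Ident C A) = Ident D (FOb (S F) A)"
    by (rule D.is_monoD[OF i(2)]) (use e f(1-3) A i O s p in simp_all)
next
  fix A B f assume "f \<in> Hom C A B"
  then show "FAr (S F) f \<in> Hom D (FOb (S F) A) (FOb (S F) B)" using sat_FAr(1-3)[OF F, of f A B] by simp
next
  note s = functor_simps[OF F]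
  fix X Y Z f g assume "f \<in> Hom C X Y" "g \<in> Hom C Y Z"
  then have f: "f \<in> Arr C" "Dom C f = X" "Cod C f = Y" and g: "g \<in> Arr C" "Dom C g = Y" "Cod C g = Z" by auto
  have gf: "g \<cdot>\<^bsub>C\<^esub> f \<in> Arr C" "Dom C (g \<cdot>\<^bsub>C\<^esub> f) = X" "Cod C (g \<cdot>\<^bsub>C\<^esub> f) = Z" using f g by simp_all
  have O: "X \<in> Obj C" "Y \<in> Obj C" "Z \<in> Obj C" using f g by auto
  note pX = pincl_facts[OF O(1)] and pY = pincl_facts[OF O(2)] and pZ = pincl_facts[OF O(3)]
  note iX = sat_incl_simps[OF F O(1)] and iY = sat_incl_simps[OF F O(2)] and iZ = sat_incl_simps[OF F O(3)]
  obtain fs where fs: "kernel_lift C (pincl ch X) (pproj ch X) (pincl ch Y) (pproj ch Y) f fs"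
    by (rule C.ex_kernel_lift[OF pX(1,3) pY(1) f(1)]) (use f pX pY in simp_all)
  obtain gs where gs: "kernel_lift C (pincl ch Y) (pproj ch Y) (pincl ch Z) (pproj ch Z) g gs"
    by (rule C.ex_kernel_lift[OF pY(1,3) pZ(1) g(1)]) (use g pY pZ in simp_all)
  note hf = C.kernel_lift_hom[OF fs] and hg = C.kernel_lift_hom[OF gs]
  have l: "kernel_lift C (pincl ch X) (pproj ch X) (pincl ch Z) (pproj ch Z) (g \<cdot>\<^bsub>C\<^esub> f) (gs \<cdot>\<^bsub>C\<^esub> fs)"
    using C.kernel_lift_comp[OF fs gs pX(1) pY(1) pZ(1)] f g pX pY pZ by simp
  note rf = sat_FAr[OF F f] and rg = sat_FAr[OF F g] and rgf = sat_FAr[OF F gf]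
  show "FAr (S F) (g \<cdot>\<^bsub>C\<^esub> f) = FAr (S F) g \<cdot> FAr (S F) f"
  proof (rule D.is_monoD[OF iZ(2)])
    have "sat_incl ch F Z \<cdot> FAr (S F) (g \<cdot>\<^bsub>C\<^esub> f) = FAr F gs \<cdot> (FAr F fs \<cdot> sat_incl ch F X)"
      using rgf(4)[OF l] hf hg s(3-6) iX by simp
    also have "\<dots> = (FAr F gs \<cdot> sat_incl ch F Y) \<cdot> FAr (S F) f"
      unfolding rf(4)[OF fs, symmetric] using hg s(3-5) iY rf(1-3) by simp
    also have "\<dots> = sat_incl ch F Z \<cdot> (FAr (S F) g \<cdot> FAr (S F) f)"
      unfolding rg(4)[OF gs, symmetric] using iZ rf(1-3) rg(1-3) by simp
    finally show "sat_incl ch F Z \<cdot> FAr (S F) (g \<cdot>\<^bsub>C\<^esub> f) = sat_incl ch F Z \<cdot> (FAr (S F) g \<cdot> FAr (S F) f)" .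
  qed (use rf(1-3) rg(1-3) rgf(1-3) iZ in simp_all)
next
  note s = functor_simps[OF F]
  fix X Y f g assume "f \<in> Hom C X Y" "g \<in> Hom C X Y"
  then have f: "f \<in> Arr C" "Dom C f = X" "Cod C f = Y" and g: "g \<in> Arr C" "Dom C g = X" "Cod C g = Y" by auto
  have gf: "Plus C f g \<in> Arr C" "Dom C (Plus C f g) = X" "Cod C (Plus C f g) = Y" using f g by simp_all
  have O: "X \<in> Obj C" "Y \<in> Obj C" using f g by auto
  note pX = pincl_facts[OF O(1)] and pY = pincl_facts[OF O(2)]
  note iX = sat_incl_simps[OF F O(1)] and iY = sat_incl_simps[OF F O(2)]
  obtain fs where fs: "kernel_lift C (pincl ch X) (pproj ch X) (pincl ch Y) (pproj ch Y) f fs"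
    by (rule C.ex_kernel_lift[OF pX(1,3) pY(1) f(1)]) (use f pX pY in simp_all)
  obtain gs where gs: "kernel_lift C (pincl ch X) (pproj ch X) (pincl ch Y) (pproj ch Y) g gs"
    by (rule C.ex_kernel_lift[OF pX(1,3) pY(1) g(1)]) (use g pX pY in simp_all)
  note hf = C.kernel_lift_hom[OF fs] and hg = C.kernel_lift_hom[OF gs]
  have l: "kernel_lift C (pincl ch X) (pproj ch X) (pincl ch Y) (pproj ch Y) (Plus C f g) (Plus C fs gs)"
    using C.kernel_lift_Plus[OF fs gs pX(1) pY(1)] f g pX pY by simp
  note rf = sat_FAr[OF F f] and rg = sat_FAr[OF F g] and rgf = sat_FAr[OF F gf]
  show "FAr (S F) (Plus C f g) = Plus D (FAr (S F) f) (FAr (S F) g)"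
    by (rule D.is_monoD[OF iY(2)]) (use rf rg rgf rgf(4)[OF l] rf(4)[OF fs] rg(4)[OF gs] hf hg s(3-5,7) iX iY in simp_all)
qed

lemma sat_pow_functor: "additive_functor C D F \<Longrightarrow> additive_functor C D ((S ^^ k) F)"
  by (induction k) (simp_all add: sat_functor)

text \<open>Lets an iterate be peeled from either end: the iteration adds the outermost satellite,
  while later inductions replace the innermost functor.\<close>

lemma sat_pow_swap: "(S ^^ k) (S F) = S ((S ^^ k) F)"
  by (metis funpow_swap1)

text \<open>As \<open>pproj ch P\<close> splits, the identity of \<open>P\<close> has a lift
  inducing zero on the kernel. Lifts are indistinguishable after the satellite inclusion, so that
  inclusion is zero; being mono, it has zero domain.\<close>

lemma sat_projective:
  assumes F: "additive_functor C D F" and P: "projective C P"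
  shows "zero_object D (FOb (S F) P)"
proof -
  have O: "P \<in> Obj C" using P by (simp add: projective_def)
  note p = pincl_facts[OF O] and i = sat_incl_simps[OF F O] and s = functor_simps[OF F]
  have SO: "FOb (S F) P \<in> Obj D" using functor_simps(1)[OF sat_functor[OF F] O] .
  have KO: "Dom C (pincl ch P) \<in> Obj C" using p(4) by simp
  obtain e where e: "e \<in> Arr C" "Dom C e = P" "Cod C e = Dom C (pproj ch P)" "pproj ch P \<cdot>\<^bsub>C\<^esub> e = Ident C P"
    by (rule C.projective_lift[OF P C.short_exactD(2)[OF p(1)], of "Ident C P"]) (use O p in simp_all)
  have l0: "kernel_lift C (pincl ch P) (pproj ch P) (pincl ch P) (pproj ch P) (Ident C P) (Zero C (Dom C (pincl ch P)) (Dom C (pincl ch P)))"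
  proof (rule C.kernel_liftI[of "e \<cdot>\<^bsub>C\<^esub> pproj ch P"])
    show "pproj ch P \<cdot>\<^bsub>C\<^esub> (e \<cdot>\<^bsub>C\<^esub> pproj ch P) = Ident C P \<cdot>\<^bsub>C\<^esub> pproj ch P"
      by (rule C.reassoc[OF e(4)]) (use e(1-3) p in simp_all)
  qed (use e(1-3) p KO C.short_exactD(7)[OF p(1)] in simp_all)
  have l1: "kernel_lift C (pincl ch P) (pproj ch P) (pincl ch P) (pproj ch P) (Ident C P) (Ident C (Dom C (pincl ch P)))"
    using C.kernel_lift_Ident[OF p(1)] p(2) by simp
  have "sat_incl ch F P = Zero D (FOb (S F) P) (FOb F (Dom C (pincl ch P)))"
    using sat_lift_eq[OF F O p(1) l1 l0] s(2)[OF KO] functor_Zero[OF F KO KO] i(3-5) s(1)[OF KO] by simp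
  then have "sat_incl ch F P \<cdot> Ident D (FOb (S F) P) = sat_incl ch F P \<cdot> Zero D (FOb (S F) P) (FOb (S F) P)"
    using i(3-5) SO by simp
  then have "Ident D (FOb (S F) P) = Zero D (FOb (S F) P) (FOb (S F) P)"
    by (rule D.is_monoD[OF i(2), rotated 4]) (use i SO in simp_all)
  then show ?thesis using D.Zero_objectI SO by blast
qed

section \<open>The connecting homomorphisms of satellites\<close>

lemma ex_pincl_lift:
  assumes "short_exact C f g"
  obtains hs where "kernel_lift C (pincl ch (Cod C g)) (pproj ch (Cod C g)) f g (Ident C (Cod C g)) hs"
proof -
  have O: "Cod C g \<in> Obj C" using C.short_exactD(5)[OF assms] by simp
  show ?thesis
    by (rule C.ex_kernel_lift[OF pincl_facts(1,3)[OF O] assms, of "Ident C (Cod C g)"]) (use O pincl_facts[OF O] that in auto)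
qed

lemma eps_eq:
  assumes G: "additive_functor C D G" and fg: "short_exact C f g"
    and hs: "kernel_lift C (pincl ch (Cod C g)) (pproj ch (Cod C g)) f g (Ident C (Cod C g)) hs"
  shows "eps G f g = FAr G hs \<cdot> sat_incl ch G (Cod C g)"
proof -
  have O: "Cod C g \<in> Obj C" using C.short_exactD(5)[OF fg] by simp
  let ?l = "kernel_lift C (pincl ch (Cod C g)) (pproj ch (Cod C g)) f g (Ident C (Cod C g))"
  have "eps G f g = (THE e. \<forall>hs. ?l hs \<longrightarrow> e = FAr G hs \<cdot> sat_incl ch G (Cod C g))"
    by (simp add: sat_conn_def Let_def)
  also have "\<dots> = FAr G hs \<cdot> sat_incl ch G (Cod C g)"
  proof (rule the_equality)
    show "\<forall>hs'. ?l hs' \<longrightarrow> FAr G hs \<cdot> sat_incl ch G (Cod C g) = FAr G hs' \<cdot> sat_incl ch G (Cod C g)"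
      by (intro allI impI) (rule sat_lift_eq[OF G O fg hs])
  qed (use hs in blast)
  finally show ?thesis .
qed

text \<open>\<open>sat_conn\<close> counts from one, so the index \<open>Suc k\<close> refers to the
  satellite of the \<open>k\<close>-th iterate.\<close>

lemma sat_conn_Suc: "sat_conn C D ch F (Suc k) f g = eps ((S ^^ k) F) f g"
  by (simp add: sat_conn_def)

lemma eps_simps:
  assumes G: "additive_functor C D G" and fg: "short_exact C f g"
  shows "eps G f g \<in> Arr D" "Dom D (eps G f g) = FOb (S G) (Cod C g)" "Cod D (eps G f g) = FOb G (Dom C f)"
proof -
  obtain hs where hs: "kernel_lift C (pincl ch (Cod C g)) (pproj ch (Cod C g)) f g (Ident C (Cod C g)) hs"
    using ex_pincl_lift[OF fg] .
  have O: "Cod C g \<in> Obj C" using C.short_exactD(5)[OF fg] by simp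
  show "eps G f g \<in> Arr D" "Dom D (eps G f g) = FOb (S G) (Cod C g)" "Cod D (eps G f g) = FOb G (Dom C f)"
    unfolding eps_eq[OF G fg hs] using C.kernel_lift_hom[OF hs] sat_incl_simps[OF G O] functor_simps(3-5)[OF G] by simp_all
qed

text \<open>Both sides come from lifts of \<open>c\<close> out of the chosen presentation,
  \<open>a\<close> after \<open>hs\<close> and \<open>hs'\<close> after \<open>cs\<close>, which
  agree after the satellite inclusion.\<close>

lemma eps_natural:
  assumes G: "additive_functor C D G" and fg: "short_exact C f g" and fg': "short_exact C f' g'"
    and k: "kernel_lift C f g f' g' c a" and c: "c \<in> Arr C" "Dom C c = Cod C g" "Cod C c = Cod C g'"
  shows "FAr G a \<cdot> eps G f g = eps G f' g' \<cdot> FAr (S G) c"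
proof -
  have O: "Cod C g \<in> Obj C" "Cod C g' \<in> Obj C" using C.short_exactD(5)[OF fg] C.short_exactD(5)[OF fg'] by simp_all
  note p = pincl_facts[OF O(1)] and p' = pincl_facts[OF O(2)] and i = sat_incl_simps[OF G O(1)] and i' = sat_incl_simps[OF G O(2)]
  obtain hs where hs: "kernel_lift C (pincl ch (Cod C g)) (pproj ch (Cod C g)) f g (Ident C (Cod C g)) hs"
    using ex_pincl_lift[OF fg] .
  obtain hs' where hs': "kernel_lift C (pincl ch (Cod C g')) (pproj ch (Cod C g')) f' g' (Ident C (Cod C g')) hs'"
    using ex_pincl_lift[OF fg'] .
  obtain cs where cs: "kernel_lift C (pincl ch (Cod C g)) (pproj ch (Cod C g)) (pincl ch (Cod C g')) (pproj ch (Cod C g')) c cs"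
    by (rule C.ex_kernel_lift[OF p(1,3) p'(1) c(1)]) (use c p p' in simp_all)
  note h = C.kernel_lift_hom[OF hs] and h' = C.kernel_lift_hom[OF hs'] and hc = C.kernel_lift_hom[OF cs] and ha = C.kernel_lift_hom[OF k]
  have l1: "kernel_lift C (pincl ch (Cod C g)) (pproj ch (Cod C g)) f' g' c (a \<cdot>\<^bsub>C\<^esub> hs)"
    using C.kernel_lift_comp[OF hs k p(1) fg fg'] c p O by simp
  have l2: "kernel_lift C (pincl ch (Cod C g)) (pproj ch (Cod C g)) f' g' c (hs' \<cdot>\<^bsub>C\<^esub> cs)"
    using C.kernel_lift_comp[OF cs hs' p(1) p'(1) fg'] c p p' O by simp
  note s = functor_simps[OF G] and sc = sat_FAr[OF G c]
  have "FAr G a \<cdot> eps G f g = FAr G (a \<cdot>\<^bsub>C\<^esub> hs) \<cdot> sat_incl ch G (Cod C g)"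
    unfolding eps_eq[OF G fg hs] using h ha s(3-6) i by simp
  also have "\<dots> = FAr G (hs' \<cdot>\<^bsub>C\<^esub> cs) \<cdot> sat_incl ch G (Cod C g)" by (rule sat_lift_eq[OF G O(1) fg' l1 l2])
  also have "\<dots> = FAr G hs' \<cdot> (FAr G cs \<cdot> sat_incl ch G (Cod C g))" using h' hc s(3-6) i by simp
  also have "\<dots> = eps G f' g' \<cdot> FAr (S G) c"
    unfolding sc(4)[OF cs, symmetric] eps_eq[OF G fg' hs'] using h' s(3-5) i' sc(1-3) by simp
  finally show ?thesis .
qed

text \<open>Independence of the satellite from the presentation: with a projective middle term there
  are comparison arrows \<open>hs\<close> and \<open>l\<close> in both directions, whose composites
  lift identities and so act trivially on the kernels.\<close>

lemma eps_kernel: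
  assumes G: "additive_functor C D G" and fg: "short_exact C f g" and P: "projective C (Dom C g)"
  shows "is_kernel D (FAr G f) (eps G f g)"
proof -
  have O: "Cod C g \<in> Obj C" using C.short_exactD(5)[OF fg] by simp
  note p = pincl_facts[OF O] and i = sat_incl_simps[OF G O] and f = C.short_exactD[OF fg] and s = functor_simps[OF G]
  obtain hs where hs: "kernel_lift C (pincl ch (Cod C g)) (pproj ch (Cod C g)) f g (Ident C (Cod C g)) hs"
    using ex_pincl_lift[OF fg] .
  obtain l where l: "kernel_lift C f g (pincl ch (Cod C g)) (pproj ch (Cod C g)) (Ident C (Cod C g)) l"
    by (rule C.ex_kernel_lift[OF fg P p(1), of "Ident C (Cod C g)"]) (use O p in simp_all)
  note h = C.kernel_lift_hom[OF hs] and hl = C.kernel_lift_hom[OF l] and e = eps_simps[OF G fg]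
  obtain h1 where h1: "h1 \<in> Arr C" "Dom C h1 = Dom C (pproj ch (Cod C g))" "Cod C h1 = Dom C g" "f \<cdot>\<^bsub>C\<^esub> hs = h1 \<cdot>\<^bsub>C\<^esub> pincl ch (Cod C g)"
    using C.kernel_liftE[OF hs] by metis
  obtain h2 where h2: "h2 \<in> Arr C" "Dom C h2 = Dom C g" "Cod C h2 = Dom C (pproj ch (Cod C g))" "pincl ch (Cod C g) \<cdot>\<^bsub>C\<^esub> l = h2 \<cdot>\<^bsub>C\<^esub> f"
    using C.kernel_liftE[OF l] by metis
  have ll: "kernel_lift C f g f g (Ident C (Cod C g)) (hs \<cdot>\<^bsub>C\<^esub> l)"
    using C.kernel_lift_comp[OF l hs fg p(1) fg] p O by simp
  have hh: "kernel_lift C (pincl ch (Cod C g)) (pproj ch (Cod C g)) (pincl ch (Cod C g)) (pproj ch (Cod C g)) (Ident C (Cod C g)) (l \<cdot>\<^bsub>C\<^esub> hs)"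
    using C.kernel_lift_comp[OF hs l p(1) fg p(1)] p O by simp
  have ih: "kernel_lift C (pincl ch (Cod C g)) (pproj ch (Cod C g)) (pincl ch (Cod C g)) (pproj ch (Cod C g)) (Ident C (Cod C g)) (Ident C (Dom C (pincl ch (Cod C g))))"
    using C.kernel_lift_Ident[OF p(1)] p(2) by simp
  have il: "kernel_lift C f g f g (Ident C (Cod C g)) (Ident C (Dom C f))" by (rule C.kernel_lift_Ident[OF fg])
  have KO: "Dom C (pincl ch (Cod C g)) \<in> Obj C" "Dom C f \<in> Obj C" "Dom C g \<in> Obj C" "FOb (S G) (Cod C g) \<in> Obj D"
    using p f D.Dom_Obj[OF i(3)] i(4) by simp_all
  have le: "FAr G l \<cdot> eps G f g = sat_incl ch G (Cod C g)"
  proof -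
    have "FAr G l \<cdot> eps G f g = FAr G (l \<cdot>\<^bsub>C\<^esub> hs) \<cdot> sat_incl ch G (Cod C g)"
      unfolding eps_eq[OF G fg hs] using h hl s(3-6) i by simp
    also have "\<dots> = FAr G (Ident C (Dom C (pincl ch (Cod C g)))) \<cdot> sat_incl ch G (Cod C g)"
      by (rule sat_lift_eq[OF G O p(1) hh ih])
    finally show ?thesis using s(1,2)[OF KO(1)] i by simp
  qed
  show ?thesis
  proof (rule D.kernelI)
    have "is_mono D (FAr G l \<cdot> eps G f g)" unfolding le by (rule i(2))
    then show "is_mono D (eps G f g)" by (rule D.mono_cancel) (use e hl s(3-5) in simp_all)
    have "FAr G f \<cdot> eps G f g = FAr G (f \<cdot>\<^bsub>C\<^esub> hs) \<cdot> sat_incl ch G (Cod C g)"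
      unfolding eps_eq[OF G fg hs] using h f s(3-6) i by simp
    also have "\<dots> = FAr G h1 \<cdot> (FAr G (pincl ch (Cod C g)) \<cdot> sat_incl ch G (Cod C g))"
      unfolding h1(4) using h1(1-3) p s(3-6) i by simp
    also have "\<dots> = Zero D (Dom D (eps G f g)) (Cod D (FAr G f))"
      unfolding i(6) using h1(1-3) s(3-5) e f KO by simp
    finally show "FAr G f \<cdot> eps G f g = Zero D (Dom D (eps G f g)) (Cod D (FAr G f))" .
    fix t assume t: "t \<in> Arr D" "Cod D t = Dom D (FAr G f)" "FAr G f \<cdot> t = Zero D (Dom D t) (Cod D (FAr G f))"
    have t2: "Cod D t = FOb G (Dom C f)" using t(2) s(4) f by simp
    have t3: "FAr G f \<cdot> t = Zero D (Dom D t) (FOb G (Dom C g))" using t(3) s(5) f by simp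
    \<comment> \<open>The arrow of \<open>l\<close> carries what \<open>FAr G f\<close> kills into
      the chosen kernel, and \<open>hs\<close> brings it back, because \<open>hs\<close> after
      \<open>l\<close> lifts the identity.\<close>
    have "FAr G (pincl ch (Cod C g)) \<cdot> (FAr G l \<cdot> t) = FAr G (pincl ch (Cod C g) \<cdot>\<^bsub>C\<^esub> l) \<cdot> t"
      using hl s(3-6) p t(1) t2 by simp
    also have "\<dots> = FAr G h2 \<cdot> (FAr G f \<cdot> t)" unfolding h2(4) using h2(1-3) s(3-6) f t(1) t2 by simp
    also have "\<dots> = Zero D (Dom D t) (FOb G (Dom C (pproj ch (Cod C g))))" unfolding t3 using h2(1-3) s(3-5) t(1) by simp
    finally obtain x where x: "x \<in> Arr D" "Dom D x = Dom D t" "Cod D x = FOb (S G) (Cod C g)" "sat_incl ch G (Cod C g) \<cdot> x = FAr G l \<cdot> t"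
      using D.kernel_factor[OF i(1), of "FAr G l \<cdot> t"] hl s(3-5) p t(1) t2 i by auto
    have "eps G f g \<cdot> x = FAr G hs \<cdot> (sat_incl ch G (Cod C g) \<cdot> x)"
      unfolding eps_eq[OF G fg hs] using h s(3-5) i x(1-3) by simp
    also have "\<dots> = FAr G (hs \<cdot>\<^bsub>C\<^esub> l) \<cdot> t" unfolding x(4) using h hl s(3-6) t(1) t2 by simp
    also have "\<dots> = FAr G (Ident C (Dom C f)) \<cdot> t"
      by (rule functor_kernel_lift_eq[OF G t(1) t2 _ ll il fg fg]) (use t3 f in simp)
    also have "\<dots> = t" using s(1,2)[OF KO(2)] t(1) t2 by simp
    finally show "\<exists>s. s \<in> Arr D \<and> Dom D s = Dom D t \<and> Cod D s = Dom D (eps G f g) \<and> eps G f g \<cdot> s = t"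
      using x e by (intro exI[of _ x]) simp
  qed (use f s(3-5) e in simp_all)
qed

text \<open>Here \<open>FAr G f\<close> has zero target, so its kernel is everything and the
  identity factors through \<open>eps\<close>.\<close>

lemma eps_epi:
  assumes G: "additive_functor C D G" and fg: "short_exact C f g" and P: "projective C (Dom C g)" and z: "zero_object D (FOb G (Dom C g))"
  shows "is_epi D (eps G f g)"
proof -
  note f = C.short_exactD[OF fg] and s = functor_simps[OF G] and e = eps_simps[OF G fg]
  have O: "Dom C f \<in> Obj C" "FOb G (Dom C f) \<in> Obj D" "FOb G (Dom C g) \<in> Obj D" using f s(1) by simp_all
  have "FAr G f = Zero D (FOb G (Dom C f)) (FOb G (Dom C g))"
    by (rule D.Zero_object_arrow[OF z]) (use f s in simp_all)
  then have "FAr G f \<cdot> Ident D (FOb G (Dom C f)) = Zero D (FOb G (Dom C f)) (Cod D (FAr G f))"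
    using f s(3-5) O by simp
  then obtain t where t: "t \<in> Arr D" "Cod D t = Dom D (eps G f g)" "eps G f g \<cdot> t = Ident D (FOb G (Dom C f))"
    using D.kernel_factor[OF eps_kernel[OF G fg P], of "Ident D (FOb G (Dom C f))"] O f(4) s(4) by auto
  have "is_epi D (eps G f g \<cdot> t)" unfolding t(3) using O by simp
  then show ?thesis by (rule D.epi_cancel) (use t e in simp_all)
qed

end

section \<open>The comparison with the satellite construction\<close>

context completion_setting
begin

section \<open>Satellites of natural transformations\<close>

lemma natural_transformationD:
  assumes "natural_transformation C D F G \<phi>"
  shows "A \<in> Obj C \<Longrightarrow> \<phi> A \<in> Arr D" "A \<in> Obj C \<Longrightarrow> Dom D (\<phi> A) = FOb F A" "A \<in> Obj C \<Longrightarrow> Cod D (\<phi> A) = FOb G A"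
    "f \<in> Arr C \<Longrightarrow> Dom C f = A \<Longrightarrow> Cod C f = B \<Longrightarrow> \<phi> B \<cdot> FAr F f = FAr G f \<cdot> \<phi> A"
  using assms unfolding natural_transformation_def by auto

lemma sat_trans_one:
  assumes F: "additive_functor C D F" and G: "additive_functor C D G" and \<phi>: "natural_transformation C D F G \<phi>" and M: "M \<in> Obj C"
  shows "sat_trans C D ch F G (Suc 0) \<phi> M \<in> Arr D" "Dom D (sat_trans C D ch F G (Suc 0) \<phi> M) = FOb (S F) M"
    "Cod D (sat_trans C D ch F G (Suc 0) \<phi> M) = FOb (S G) M"
    "sat_incl ch G M \<cdot> sat_trans C D ch F G (Suc 0) \<phi> M = \<phi> (Dom C (pincl ch M)) \<cdot> sat_incl ch F M"
proof -
  note p = pincl_facts[OF M] and i = sat_incl_simps[OF F M] and i' = sat_incl_simps[OF G M] and n = natural_transformationD[OF \<phi>]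
  note s = functor_simps[OF F] and s' = functor_simps[OF G]
  have O: "Dom C (pincl ch M) \<in> Obj C" "Dom C (pproj ch M) \<in> Obj C" "FOb (S F) M \<in> Obj D" using p D.Dom_Obj[OF i(3)] i(4) by simp_all
  let ?t = "\<phi> (Dom C (pincl ch M)) \<cdot> sat_incl ch F M"
  have t: "?t \<in> Arr D" "Dom D ?t = FOb (S F) M" "Cod D ?t = FOb G (Dom C (pincl ch M))" using n(1-3) O i by simp_all
  have "FAr G (pincl ch M) \<cdot> ?t = \<phi> (Dom C (pproj ch M)) \<cdot> (FAr F (pincl ch M) \<cdot> sat_incl ch F M)"
    using D.reassoc[OF n(4)[OF p(4) refl p(6), symmetric], of "sat_incl ch F M"] n(1-3) O i(3-5) s(3-5) s'(3-5) p by simp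
  also have "\<dots> = Zero D (Dom D ?t) (Cod D (FAr G (pincl ch M)))" unfolding i(6) t(2) using n(1-3) O s(1) s'(5) p by simp
  finally have z: "FAr G (pincl ch M) \<cdot> ?t = Zero D (Dom D ?t) (Cod D (FAr G (pincl ch M)))" .
  have c: "Cod D ?t = Dom D (FAr G (pincl ch M))" using t(3) s'(4) p by simp
  have e: "sat_trans C D ch F G (Suc 0) \<phi> M = ker_factor D (sat_incl ch G M) ?t" by simp
  note k = D.ker_factor_simps[OF i'(1) t(1) c z]
  show "sat_trans C D ch F G (Suc 0) \<phi> M \<in> Arr D" "Dom D (sat_trans C D ch F G (Suc 0) \<phi> M) = FOb (S F) M"
    "Cod D (sat_trans C D ch F G (Suc 0) \<phi> M) = FOb (S G) M"
    "sat_incl ch G M \<cdot> sat_trans C D ch F G (Suc 0) \<phi> M = \<phi> (Dom C (pincl ch M)) \<cdot> sat_incl ch F M"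
    unfolding e using k t(2) i'(4) by simp_all
qed

lemma sat_trans_one_natural:
  assumes F: "additive_functor C D F" and G: "additive_functor C D G" and \<phi>: "natural_transformation C D F G \<phi>"
  shows "natural_transformation C D (S F) (S G) (sat_trans C D ch F G (Suc 0) \<phi>)"
  unfolding natural_transformation_def
proof (intro conjI ballI allI impI)
  fix A assume "A \<in> Obj C"
  then show "sat_trans C D ch F G (Suc 0) \<phi> A \<in> Hom D (FOb (S F) A) (FOb (S G) A)"
    using sat_trans_one(1-3)[OF assms] unfolding Hom_iff by blast
next
  let ?s = "sat_trans C D ch F G (Suc 0) \<phi>"
  fix M N f assume "f \<in> Hom C M N"
  then have f: "f \<in> Arr C" "Dom C f = M" "Cod C f = N" by auto
  have O: "M \<in> Obj C" "N \<in> Obj C" using f by auto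
  note p = pincl_facts[OF O(1)] and p' = pincl_facts[OF O(2)]
  note iF = sat_incl_simps[OF F O(1)] and iG = sat_incl_simps[OF G O(2)] and iF' = sat_incl_simps[OF F O(2)] and iG' = sat_incl_simps[OF G O(1)]
  note n = natural_transformationD[OF \<phi>] and s = functor_simps[OF F] and s' = functor_simps[OF G]
  obtain fs where fs: "kernel_lift C (pincl ch M) (pproj ch M) (pincl ch N) (pproj ch N) f fs"
    by (rule C.ex_kernel_lift[OF p(1,3) p'(1) f(1)]) (use f p p' in simp_all)
  note h = C.kernel_lift_hom[OF fs]
  note sM = sat_trans_one[OF assms O(1)] and sN = sat_trans_one[OF assms O(2)]
  note rF = sat_FAr[OF F f] and rG = sat_FAr[OF G f]
  have KO: "Dom C (pincl ch M) \<in> Obj C" "Dom C (pincl ch N) \<in> Obj C" using p p' by simp_all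
  have "sat_incl ch G N \<cdot> (?s N \<cdot> FAr (S F) f) = (\<phi> (Dom C (pincl ch N)) \<cdot> sat_incl ch F N) \<cdot> FAr (S F) f"
    by (rule D.reassoc[OF sN(4)]) (use sN(1-3) iG(3-5) rF(1-3) in \<open>simp_all del: sat_trans.simps\<close>)
  also have "\<dots> = \<phi> (Dom C (pincl ch N)) \<cdot> (FAr F fs \<cdot> sat_incl ch F M)"
    unfolding rF(4)[OF fs, symmetric] using n(1-3) KO iF'(3-5) rF(1-3) by simp
  also have "\<dots> = FAr G fs \<cdot> (\<phi> (Dom C (pincl ch M)) \<cdot> sat_incl ch F M)"
    using D.reassoc[OF n(4)[OF h], of "sat_incl ch F M"] n(1-3) KO iF(3-5) h s(3-5) s'(3-5) by simp
  also have "\<dots> = (FAr G fs \<cdot> sat_incl ch G M) \<cdot> ?s M"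
    unfolding sM(4)[symmetric] using sM(1-3) h s'(3-5) iG'(3-5) by (simp del: sat_trans.simps)
  also have "\<dots> = sat_incl ch G N \<cdot> (FAr (S G) f \<cdot> ?s M)"
    unfolding rG(4)[OF fs, symmetric] using sM(1-3) rG(1-3) iG(3-5) by (simp del: sat_trans.simps)
  finally have e: "sat_incl ch G N \<cdot> (?s N \<cdot> FAr (S F) f) = sat_incl ch G N \<cdot> (FAr (S G) f \<cdot> ?s M)" .
  show "?s N \<cdot> FAr (S F) f = FAr (S G) f \<cdot> ?s M"
    by (rule D.is_monoD[OF iG(2) _ _ _ _ e]) (use sM(1-3) sN(1-3) rF(1-3) rG(1-3) iG(3-5) in \<open>simp_all del: sat_trans.simps\<close>)
qed

text \<open>Presents every step of the recursion as the one-step satellite of the previous iterate,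
  so that facts about one step extend by induction.\<close>

lemma sat_trans_Suc:
  "sat_trans C D ch F G (Suc k) \<phi> = sat_trans C D ch ((S ^^ k) F) ((S ^^ k) G) (Suc 0) (sat_trans C D ch F G k \<phi>)"
  by simp

lemma sat_trans_natural:
  assumes F: "additive_functor C D F" and G: "additive_functor C D G" and \<phi>: "natural_transformation C D F G \<phi>"
  shows "natural_transformation C D ((S ^^ k) F) ((S ^^ k) G) (sat_trans C D ch F G k \<phi>)"
proof (induction k)
  case (Suc k)
  show ?case unfolding sat_trans_Suc[of F G k]
    using sat_trans_one_natural[OF sat_pow_functor[OF F] sat_pow_functor[OF G] Suc] by (simp del: sat_trans.simps)
qed (use \<phi> in simp)

text \<open>Matches the recursion of \<open>omega_along\<close>, which changes the functors at each
  step.\<close>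

lemma sat_trans_swap:
  "sat_trans C D ch (S F) (S G) k (sat_trans C D ch F G (Suc 0) \<phi>) = sat_trans C D ch F G (Suc k) \<phi>"
proof (induction k)
  case (Suc k)
  show ?case
    unfolding sat_trans_Suc[of _ _ "Suc k"] sat_trans_Suc[of "S F" "S G" k] Suc by (simp add: sat_pow_swap del: sat_trans.simps)
qed simp

text \<open>Naturality in the functor: \<open>\<phi>\<close> moves past the arrow of
  \<open>hs\<close>, and its satellite is characterised by commuting with the satellite
  inclusions.\<close>

lemma eps_trans:
  assumes F: "additive_functor C D F" and G: "additive_functor C D G" and \<phi>: "natural_transformation C D F G \<phi>" and fg: "short_exact C f g"
  shows "\<phi> (Dom C f) \<cdot> eps F f g = eps G f g \<cdot> sat_trans C D ch F G (Suc 0) \<phi> (Cod C g)"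
proof -
  have O: "Cod C g \<in> Obj C" "Dom C f \<in> Obj C" using C.short_exactD(4,5)[OF fg] by simp_all
  obtain hs where hs: "kernel_lift C (pincl ch (Cod C g)) (pproj ch (Cod C g)) f g (Ident C (Cod C g)) hs"
    using ex_pincl_lift[OF fg] .
  note h = C.kernel_lift_hom[OF hs] and n = natural_transformationD[OF \<phi>] and p = pincl_facts[OF O(1)]
  note s = functor_simps[OF F] and s' = functor_simps[OF G] and i = sat_incl_simps[OF F O(1)] and i' = sat_incl_simps[OF G O(1)]
  note t = sat_trans_one[OF F G \<phi> O(1)]
  have KO: "Dom C (pincl ch (Cod C g)) \<in> Obj C" using p by simp
  have "\<phi> (Dom C f) \<cdot> eps F f g = (\<phi> (Dom C f) \<cdot> FAr F hs) \<cdot> sat_incl ch F (Cod C g)"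
    unfolding eps_eq[OF F fg hs] using n(1-3) O h s(3-5) i by simp
  also have "\<dots> = FAr G hs \<cdot> (\<phi> (Dom C (pincl ch (Cod C g))) \<cdot> sat_incl ch F (Cod C g))"
    unfolding n(4)[OF h] using n(1-3) KO h s'(3-5) i by simp
  also have "\<dots> = eps G f g \<cdot> sat_trans C D ch F G (Suc 0) \<phi> (Cod C g)"
    unfolding t(4)[symmetric] eps_eq[OF G fg hs] using t(1-3) h s'(3-5) i' by (simp del: sat_trans.simps)
  finally show ?thesis .
qed

text \<open>\<open>omega_along k F R\<close> is the composite \<open>S\<^sup>-\<^sup>k F(M) \<rightarrow> F(S\<^sub>k)\<close> along a resolution \<open>R\<close> of \<open>M\<close>;
  peeling off the last instead of the first factor makes \<open>F\<close> vary in the recursion.\<close>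

primrec omega_along where
  "omega_along 0 F R = Ident D (FOb F (Cod C (sproj R 0)))"
| "omega_along (Suc k) F R = eps F (sincl R k) (sproj R k) \<cdot> omega_along k (S F) R"

lemma omega_along_simps:
  assumes F: "additive_functor C D F" and R: "syzygies C M R"
  shows "omega_along k F R \<in> Arr D" "Dom D (omega_along k F R) = FOb ((S ^^ k) F) M" "Cod D (omega_along k F R) = FOb F (Cod C (sproj R k))"
proof -
  note r = C.syzygiesD[OF R]
  have "omega_along k F R \<in> Arr D \<and> Dom D (omega_along k F R) = FOb ((S ^^ k) F) M \<and> Cod D (omega_along k F R) = FOb F (Cod C (sproj R k))"
    using F
  proof (induction k arbitrary: F)
    case 0
    have "FOb F M \<in> Obj D" using functor_simps(1)[OF 0] r by simp
    then show ?case using r by simp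
  next
    case (Suc k)
    show ?case using Suc.IH[OF sat_functor[OF Suc.prems]] eps_simps[OF Suc.prems r(1)[of k]] r(3) by (simp add: sat_pow_swap)
  qed
  then show "omega_along k F R \<in> Arr D" "Dom D (omega_along k F R) = FOb ((S ^^ k) F) M" "Cod D (omega_along k F R) = FOb F (Cod C (sproj R k))" by auto
qed

text \<open>All the factors are kernels by \<open>eps_kernel\<close>, since the syzygy sequences
  have projective middle terms.\<close>

lemma omega_along_mono:
  assumes F: "additive_functor C D F" and R: "syzygies C M R"
  shows "is_mono D (omega_along k F R)"
  using F
proof (induction k arbitrary: F)
  case 0
  then show ?case using functor_simps(1)[OF 0] C.syzygiesD[OF R] by simp
next
  case (Suc k)
  note r = C.syzygiesD[OF R]
  show ?case unfolding omega_along.simps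
    by (rule D.mono_comp[OF Suc.IH[OF sat_functor[OF Suc.prems]] D.kernel_mono[OF eps_kernel[OF Suc.prems r(1,2)]]])
      (use omega_along_simps[OF sat_functor[OF Suc.prems] R] eps_simps[OF Suc.prems r(1)] in simp)
qed

text \<open>For \<open>S F\<close> in place of \<open>F\<close>, all functors involved are
  satellites. They vanish on projectives, so \<open>eps_epi\<close> applies to every factor.\<close>

lemma omega_along_epi:
  assumes F: "additive_functor C D F" and R: "syzygies C M R"
  shows "is_epi D (omega_along k (S F) R)"
  using F
proof (induction k arbitrary: F)
  case 0
  then show ?case using functor_simps(1)[OF sat_functor[OF 0]] C.syzygiesD[OF R] by simp
next
  case (Suc k)
  note r = C.syzygiesD[OF R] and SF = sat_functor[OF Suc.prems]
  show ?case unfolding omega_along.simps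
    by (rule D.epi_comp[OF Suc.IH[OF SF] eps_epi[OF SF r(1,2) sat_projective[OF Suc.prems r(2)]]])
      (use omega_along_simps[OF sat_functor[OF SF] R] eps_simps[OF SF r(1)] in simp)
qed

lemma omega_along_natural:
  assumes F: "additive_functor C D F" and ft: "syzygy_lift C R R' f ft" and R: "syzygies C M R" and R': "syzygies C N R'"
    and f: "f \<in> Arr C" "Dom C f = M" "Cod C f = N"
  shows "FAr F (ft k) \<cdot> omega_along k F R = omega_along k F R' \<cdot> FAr ((S ^^ k) F) f"
  using F
proof (induction k arbitrary: F)
  case 0
  show ?case using C.syzygy_liftD(1)[OF ft] C.syzygiesD[OF R] C.syzygiesD[OF R'] functor_simps(3-5)[OF 0] f by simp
next
  case (Suc k)
  note r = C.syzygiesD[OF R] and r' = C.syzygiesD[OF R'] and SF = sat_functor[OF Suc.prems] and h = C.syzygy_lift_hom[OF ft R R' f]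
  note w = omega_along_simps[OF SF R] and w' = omega_along_simps[OF SF R'] and e = eps_simps[OF Suc.prems r(1)] and e' = eps_simps[OF Suc.prems r'(1)]
  note s = functor_simps[OF Suc.prems] and ss = functor_simps[OF SF] and sp = functor_simps[OF sat_pow_functor[OF SF]]
  have "FAr F (ft (Suc k)) \<cdot> omega_along (Suc k) F R = (FAr F (ft (Suc k)) \<cdot> eps F (sincl R k) (sproj R k)) \<cdot> omega_along k (S F) R"
    using h s(3-5) e w r(3) by simp
  also have "\<dots> = (eps F (sincl R' k) (sproj R' k) \<cdot> FAr (S F) (ft k)) \<cdot> omega_along k (S F) R"
    using eps_natural[OF Suc.prems r(1) r'(1) C.syzygy_liftD(2)[OF ft, of k]] h by simp
  also have "\<dots> = eps F (sincl R' k) (sproj R' k) \<cdot> (omega_along k (S F) R' \<cdot> FAr ((S ^^ k) (S F)) f)"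
    unfolding Suc.IH[OF SF, symmetric] using h ss(3-5) e' w by simp
  also have "\<dots> = omega_along (Suc k) F R' \<cdot> FAr ((S ^^ Suc k) F) f"
    using sp(3-5)[OF f(1)] f e' w' by (simp add: sat_pow_swap)
  finally show ?case .
qed

lemma omega_along_trans:
  assumes F: "additive_functor C D F" and G: "additive_functor C D G" and \<phi>: "natural_transformation C D F G \<phi>" and R: "syzygies C M R"
  shows "\<phi> (Cod C (sproj R k)) \<cdot> omega_along k F R = omega_along k G R \<cdot> sat_trans C D ch F G k \<phi> M"
  using F G \<phi>
proof (induction k arbitrary: F G \<phi>)
  case 0
  show ?case using natural_transformationD[OF 0(3)] C.syzygiesD[OF R] by simp
next
  case (Suc k)
  note r = C.syzygiesD[OF R] and SF = sat_functor[OF Suc.prems(1)] and SG = sat_functor[OF Suc.prems(2)] and n = natural_transformationD[OF Suc.prems(3)]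
  let ?s = "sat_trans C D ch F G (Suc 0) \<phi>"
  note nt = sat_trans_one_natural[OF Suc.prems]
  note n1 = natural_transformationD[OF nt] and nk = natural_transformationD[OF sat_trans_natural[OF SF SG nt, of k]]
  note w = omega_along_simps[OF SF R] and w' = omega_along_simps[OF SG R] and e = eps_simps[OF Suc.prems(1) r(1)] and e' = eps_simps[OF Suc.prems(2) r(1)]
  have O: "Cod C (sproj R k) \<in> Obj C" for k using r(6) by simp
  have "\<phi> (Cod C (sproj R (Suc k))) \<cdot> omega_along (Suc k) F R = (\<phi> (Dom C (sincl R k)) \<cdot> eps F (sincl R k) (sproj R k)) \<cdot> omega_along k (S F) R"
    using n(1-3)[OF O] e w r(3) by simp
  also have "\<dots> = eps G (sincl R k) (sproj R k) \<cdot> (?s (Cod C (sproj R k)) \<cdot> omega_along k (S F) R)"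
    unfolding eps_trans[OF Suc.prems r(1)] using n1(1-3)[OF O] e' w by (simp del: sat_trans.simps)
  also have "\<dots> = omega_along (Suc k) G R \<cdot> sat_trans C D ch F G (Suc k) \<phi> M"
    unfolding Suc.IH[OF SF SG nt] unfolding sat_trans_swap[where F=F and G=G and k=k and \<phi>=\<phi>, symmetric] using nk(1-3)[OF r(9)] e' w' by (simp del: sat_trans.simps)
  finally show ?case .
qed

text \<open>Peels the composite at its other end, leaving a composite along the resolution of the
  first syzygy; the connecting homomorphisms of the two constructions are compared there.\<close>

lemma omega_along_shift:
  assumes F: "additive_functor C D F" and R: "syzygies C M R"
  shows "omega_along (Suc k) F R = omega_along k F (shift R) \<cdot> eps ((S ^^ k) F) (sincl R 0) (sproj R 0)"
  using F
proof (induction k arbitrary: F)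
  case 0
  note r = C.syzygiesD[OF R] and e = eps_simps[OF 0 C.syzygiesD(1)[OF R, of 0]]
  show ?case using e r(3,4) by simp
next
  case (Suc k)
  note r = C.syzygiesD[OF R] and SF = sat_functor[OF Suc.prems]
  note w = omega_along_simps[OF SF C.syzygies_shift[OF R]] and e = eps_simps[OF Suc.prems r(1)] and e0 = eps_simps[OF sat_pow_functor[OF SF] r(1)[of 0]]
  have "omega_along (Suc (Suc k)) F R = eps F (sincl R (Suc k)) (sproj R (Suc k)) \<cdot> omega_along (Suc k) (S F) R" by simp
  also have "\<dots> = omega_along (Suc k) F (shift R) \<cdot> eps ((S ^^ k) (S F)) (sincl R 0) (sproj R 0)"
    unfolding Suc.IH[OF SF] using w e e0 r(3) by simp
  also have "(S ^^ k) (S F) = (S ^^ Suc k) F" by (simp add: sat_pow_swap)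
  finally show ?case .
qed

text \<open>\<open>omega_part\<close> keeps the functor and counts down the iterates,
  \<open>omega_along\<close> replaces the functor by its satellite. The bound on \<open>j\<close>
  keeps the truncated differences \<open>Suc k - j\<close> and \<open>k - j\<close> one
  apart.\<close>

lemma omega_part_Suc:
  assumes "j \<le> k"
  shows "omega_part C D ch F M (Suc k) j = omega_part C D ch (S F) M k j"
  using assms
proof (induction j)
  case (Suc j)
  define i where "i = k - Suc j"
  have i: "k - j = Suc i" "Suc k - j = Suc (Suc i)" using Suc.prems by (simp_all add: i_def)
  show ?case unfolding omega_part.simps i sat_conn_Suc[of _ "Suc i"] sat_conn_Suc[of _ i] using Suc by (simp add: sat_pow_swap)
qed (simp add: sat_pow_swap)

lemma omega_part_omega_along:
  assumes M: "M \<in> Obj C"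
  shows "omega_part C D ch F M k k = omega_along k F (resn ch M)"
proof (induction k arbitrary: F)
  case 0
  show ?case using C.syzygiesD(4)[OF resn_syzygies[OF M]] by simp
next
  case (Suc k)
  show ?case using omega_part_Suc[of k k F M] Suc by simp
qed

text \<open>\<open>V\<close> is only known to consist of arrows of the right type that commute with
  the isomorphisms \<open>\<theta>\<close>. Equations hold because they hold in \<open>U\<close> and
  \<open>\<theta>\<close> can be cancelled; exactness is carried over by
  \<open>exact_at_iso\<close>.\<close>

lemma cohom_transport:
  assumes U: "cohomological_functor C D U"
    and \<theta>: "\<And>n M. M \<in> Obj C \<Longrightarrow> \<theta> n M \<in> Arr D" "\<And>n M. M \<in> Obj C \<Longrightarrow> Dom D (\<theta> n M) = FOb (fn V n) M"
      "\<And>n M. M \<in> Obj C \<Longrightarrow> Cod D (\<theta> n M) = FOb (fn U n) M" "\<And>n M. M \<in> Obj C \<Longrightarrow> is_iso D (\<theta> n M)"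
    and V: "\<And>n f. f \<in> Arr C \<Longrightarrow> FAr (fn V n) f \<in> Arr D" "\<And>n f. f \<in> Arr C \<Longrightarrow> Dom D (FAr (fn V n) f) = FOb (fn V n) (Dom C f)"
      "\<And>n f. f \<in> Arr C \<Longrightarrow> Cod D (FAr (fn V n) f) = FOb (fn V n) (Cod C f)"
      "\<And>n f. f \<in> Arr C \<Longrightarrow> \<theta> n (Cod C f) \<cdot> FAr (fn V n) f = FAr (fn U n) f \<cdot> \<theta> n (Dom C f)"
    and K: "\<And>n f g. short_exact C f g \<Longrightarrow> conn V n f g \<in> Arr D"
      "\<And>n f g. short_exact C f g \<Longrightarrow> Dom D (conn V n f g) = FOb (fn V n) (Cod C g)"
      "\<And>n f g. short_exact C f g \<Longrightarrow> Cod D (conn V n f g) = FOb (fn V (n + 1)) (Dom C f)"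
      "\<And>n f g. short_exact C f g \<Longrightarrow> \<theta> (n + 1) (Dom C f) \<cdot> conn V n f g = conn U n f g \<cdot> \<theta> n (Cod C g)"
  shows "cohom_isomorphism C D V U \<theta>"
proof -
  interpret U: cohom C D ch U by unfold_locales (rule U)
  have \<theta>m: "is_mono D (\<theta> n M)" if "M \<in> Obj C" for n M using \<theta>(4)[OF that] D.iso_iff by blast
  have nat: "\<theta> n B \<cdot> FAr (fn V n) f = FAr (fn U n) f \<cdot> \<theta> n A" if "f \<in> Arr C" "Dom C f = A" "Cod C f = B" for n f A B
    using V(4)[OF that(1)] that by simp
  have VO: "FOb (fn V n) M \<in> Obj D" if "M \<in> Obj C" for n M using D.Dom_Obj[OF \<theta>(1)[OF that, of n]] \<theta>(2)[OF that] by simp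
  have add: "additive_functor C D (fn V n)" for n
    unfolding additive_functor_def
  proof (intro conjI ballI allI impI)
    fix A assume A: "A \<in> Obj C"
    show "FOb (fn V n) A \<in> Obj D" using VO[OF A] .
    have i: "Ident C A \<in> Arr C" "Dom C (Ident C A) = A" "Cod C (Ident C A) = A" using A by simp_all
    show "FAr (fn V n) (Ident C A) = Ident D (FOb (fn V n) A)"
      by (rule D.is_monoD[OF \<theta>m[OF A, of n]]) (use nat[OF i] A i V(1-3)[OF i(1)] \<theta>(1-3)[OF A] VO in simp_all)
  next
    fix A B f assume "f \<in> Hom C A B"
    then show "FAr (fn V n) f \<in> Hom D (FOb (fn V n) A) (FOb (fn V n) B)" using V(1-3)[of f n] by simp
  next
    fix X Y Z f g assume "f \<in> Hom C X Y" "g \<in> Hom C Y Z"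
    then have f: "f \<in> Arr C" "Dom C f = X" "Cod C f = Y" and g: "g \<in> Arr C" "Dom C g = Y" "Cod C g = Z" by auto
    have gf: "g \<cdot>\<^bsub>C\<^esub> f \<in> Arr C" "Dom C (g \<cdot>\<^bsub>C\<^esub> f) = X" "Cod C (g \<cdot>\<^bsub>C\<^esub> f) = Z" using f g by simp_all
    have O: "X \<in> Obj C" "Y \<in> Obj C" "Z \<in> Obj C" using f g by auto
    note vf = V(1-3)[OF f(1)] and vg = V(1-3)[OF g(1)] and vgf = V(1-3)[OF gf(1)] and tX = \<theta>(1-3)[OF O(1)] and tY = \<theta>(1-3)[OF O(2)] and tZ = \<theta>(1-3)[OF O(3)]
    show "FAr (fn V n) (g \<cdot>\<^bsub>C\<^esub> f) = FAr (fn V n) g \<cdot> FAr (fn V n) f"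
    proof (rule D.is_monoD[OF \<theta>m[OF O(3), of n]])
      have "\<theta> n Z \<cdot> FAr (fn V n) (g \<cdot>\<^bsub>C\<^esub> f) = FAr (fn U n) g \<cdot> (FAr (fn U n) f \<cdot> \<theta> n X)"
        unfolding nat[OF gf] using f g tX by simp
      also have "\<dots> = (FAr (fn U n) g \<cdot> \<theta> n Y) \<cdot> FAr (fn V n) f"
        unfolding nat[OF f, symmetric] using f g tY vf by simp
      also have "\<dots> = \<theta> n Z \<cdot> (FAr (fn V n) g \<cdot> FAr (fn V n) f)"
        unfolding nat[OF g, symmetric] using f g tZ vf vg by simp
      finally show "\<theta> n Z \<cdot> FAr (fn V n) (g \<cdot>\<^bsub>C\<^esub> f) = \<theta> n Z \<cdot> (FAr (fn V n) g \<cdot> FAr (fn V n) f)" .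
    qed (use f g gf vf vg vgf tZ in simp_all)
  next
    fix X Y f g assume "f \<in> Hom C X Y" "g \<in> Hom C X Y"
    then have f: "f \<in> Arr C" "Dom C f = X" "Cod C f = Y" and g: "g \<in> Arr C" "Dom C g = X" "Cod C g = Y" by auto
    have gf: "Plus C f g \<in> Arr C" "Dom C (Plus C f g) = X" "Cod C (Plus C f g) = Y" using f g by simp_all
    have O: "X \<in> Obj C" "Y \<in> Obj C" using f g by auto
    note vf = V(1-3)[OF f(1)] and vg = V(1-3)[OF g(1)] and vgf = V(1-3)[OF gf(1)] and tX = \<theta>(1-3)[OF O(1)] and tY = \<theta>(1-3)[OF O(2)]
    show "FAr (fn V n) (Plus C f g) = Plus D (FAr (fn V n) f) (FAr (fn V n) g)"
      by (rule D.is_monoD[OF \<theta>m[OF O(2), of n]]) (use nat[OF f] nat[OF g] nat[OF gf] f g gf vf vg vgf tX tY in simp_all)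
  qed
  have cn: "FAr (fn V (n + 1)) a \<cdot> conn V n f g = conn V n f' g' \<cdot> FAr (fn V n) c"
    if fg: "short_exact C f g" and fg': "short_exact C f' g'" and k: "kernel_lift C f g f' g' c a" and c: "c \<in> Arr C" "Dom C c = Cod C g" "Cod C c = Cod C g'"
    for n f g f' g' a c
  proof -
    note a = C.kernel_lift_hom[OF k] and vc = V(1-3)[OF c(1)] and k1 = K(1-3)[OF fg] and k2 = K(1-3)[OF fg'] and u1 = U.conn_simps[OF fg] and u2 = U.conn_simps[OF fg']
    note va = V(1-3)[OF a(1)]
    have O: "Dom C f \<in> Obj C" "Dom C f' \<in> Obj C" "Cod C g \<in> Obj C" "Cod C g' \<in> Obj C"
      using C.short_exactD(4,5)[OF fg] C.short_exactD(4,5)[OF fg'] by simp_all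
    note t = \<theta>(1-3)
    show ?thesis
    proof (rule D.is_monoD[OF \<theta>m[OF O(2), of "n + 1"]])
      have "\<theta> (n + 1) (Dom C f') \<cdot> (FAr (fn V (n + 1)) a \<cdot> conn V n f g) = (\<theta> (n + 1) (Dom C f') \<cdot> FAr (fn V (n + 1)) a) \<cdot> conn V n f g"
        using t[OF O(2)] va a k1 by simp
      also have "\<dots> = FAr (fn U (n + 1)) a \<cdot> (\<theta> (n + 1) (Dom C f) \<cdot> conn V n f g)"
        unfolding nat[OF a] using t[OF O(1)] a k1 by simp
      also have "\<dots> = (FAr (fn U (n + 1)) a \<cdot> conn U n f g) \<cdot> \<theta> n (Cod C g)"
        unfolding K(4)[OF fg] using t[OF O(3)] a u1 by simp
      also have "\<dots> = conn U n f' g' \<cdot> (FAr (fn U n) c \<cdot> \<theta> n (Cod C g))"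
        unfolding U.conn_natural[OF fg fg' k c] using t[OF O(3)] c u2 by simp
      also have "\<dots> = (conn U n f' g' \<cdot> \<theta> n (Cod C g')) \<cdot> FAr (fn V n) c"
        unfolding nat[OF c, symmetric] using t[OF O(4)] c u2 vc by simp
      also have "\<dots> = \<theta> (n + 1) (Dom C f') \<cdot> (conn V n f' g' \<cdot> FAr (fn V n) c)"
        unfolding K(4)[OF fg', symmetric] using t[OF O(2)] c k2 vc by simp
      finally show "\<theta> (n + 1) (Dom C f') \<cdot> (FAr (fn V (n + 1)) a \<cdot> conn V n f g) = \<theta> (n + 1) (Dom C f') \<cdot> (conn V n f' g' \<cdot> FAr (fn V n) c)" .
    qed (use t[OF O(2)] va a k1 k2 vc c in simp_all)
  qed
  have ex: "exact_at D (FAr (fn V n) f) (FAr (fn V n) g)" "exact_at D (FAr (fn V n) g) (conn V n f g)" "exact_at D (conn V n f g) (FAr (fn V (n + 1)) f)"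
    if fg: "short_exact C f g" for n f g
  proof -
    note f = C.short_exactD[OF fg] and k = K[OF fg]
    have gd: "Dom C g = Cod C f" using f by simp
    have O: "Dom C f \<in> Obj C" "Cod C g \<in> Obj C" "Cod C f \<in> Obj C" using f by simp_all
    note t = \<theta>[OF O(1)] \<theta>[OF O(2)] \<theta>[OF O(3)] and vf = V(1-3)[OF f(4)] nat[OF f(4) refl refl] and vg = V(1-3)[OF f(5)] nat[OF f(5) gd refl]
    show "exact_at D (FAr (fn V n) f) (FAr (fn V n) g)"
      by (rule D.exact_at_iso[OF U.conn_exact(1)[OF fg] \<theta>(4)[OF O(1)] \<theta>(4)[OF O(3)] \<theta>(4)[OF O(2)]]) (use f gd O t vf vg in simp_all)
    show "exact_at D (FAr (fn V n) g) (conn V n f g)"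
      by (rule D.exact_at_iso[OF U.conn_exact(2)[OF fg] \<theta>(4)[OF O(3)] \<theta>(4)[OF O(2)] \<theta>(4)[OF O(1)]]) (use fg f gd O t k vg in simp_all)
    show "exact_at D (conn V n f g) (FAr (fn V (n + 1)) f)"
      by (rule D.exact_at_iso[OF U.conn_exact(3)[OF fg] \<theta>(4)[OF O(2)] \<theta>(4)[OF O(1)] \<theta>(4)[OF O(3)]]) (use fg f gd O t k vf in simp_all)
  qed
  have "cohomological_functor C D V"
    unfolding cohomological_functor_def
  proof (intro conjI allI impI)
    fix n f g f' g' a b c
    assume fg: "short_exact C f g" and fg': "short_exact C f' g'"
      and a: "a \<in> Hom C (Dom C f) (Dom C f')" and b: "b \<in> Hom C (Cod C f) (Cod C f')" and c: "c \<in> Hom C (Cod C g) (Cod C g')"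
      and e: "b \<cdot>\<^bsub>C\<^esub> f = f' \<cdot>\<^bsub>C\<^esub> a" "c \<cdot>\<^bsub>C\<^esub> g = g' \<cdot>\<^bsub>C\<^esub> b"
    have "kernel_lift C f g f' g' c a"
      by (rule C.kernel_liftI[of b]) (use a b C.short_exactD(6)[OF fg] C.short_exactD(6)[OF fg'] in \<open>simp_all add: e\<close>)
    then show "FAr (fn V (n + 1)) a \<cdot> conn V n f g = conn V n f' g' \<cdot> FAr (fn V n) c"
      using cn[OF fg fg'] c by simp
  qed (use add K(1-3) ex in simp_all)
  then show ?thesis
    unfolding cohom_isomorphism_def cohom_morphism_def natural_transformation_def
    using U \<theta> V(4) K(4) by simp
qed

end

context cohom
begin

section \<open>The comparison maps between the two direct systems\<close>

lemma under_delta_facts: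
  assumes M: "M \<in> Obj C"
  shows "under_delta D ch T n M \<in> Arr D" "Dom D (under_delta D ch T n M) = FOb (fn T n) M" "Cod D (under_delta D ch T n M) = FOb (S (fn T (n + 1))) M"
    "sat_incl ch (fn T (n + 1)) M \<cdot> under_delta D ch T n M = conn T n (pincl ch M) (pproj ch M)"
proof -
  note p = pincl_facts[OF M] and i = sat_incl_simps[OF fn_functor[of "n + 1"] M] and c = conn_simps[OF pincl_facts(1)[OF M], of n]
  have cd: "Cod D (conn T n (pincl ch M) (pproj ch M)) = Dom D (FAr (fn T (n + 1)) (pincl ch M))" using c p by simp
  have z: "FAr (fn T (n + 1)) (pincl ch M) \<cdot> conn T n (pincl ch M) (pproj ch M) = Zero D (Dom D (conn T n (pincl ch M) (pproj ch M))) (Cod D (FAr (fn T (n + 1)) (pincl ch M)))"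
    using conn_comp(2)[OF p(1), of n] c p by simp
  note k = D.ker_factor_simps[OF i(1) c(1) cd z]
  show "under_delta D ch T n M \<in> Arr D" "Dom D (under_delta D ch T n M) = FOb (fn T n) M" "Cod D (under_delta D ch T n M) = FOb (S (fn T (n + 1))) M"
    "sat_incl ch (fn T (n + 1)) M \<cdot> under_delta D ch T n M = conn T n (pincl ch M) (pproj ch M)"
    unfolding under_delta_def using k c p i by simp_all
qed

lemma under_delta_natural: "natural_transformation C D (fn T n) (S (fn T (n + 1))) (under_delta D ch T n)"
  unfolding natural_transformation_def
proof (intro conjI ballI allI impI)
  fix M N f assume "f \<in> Hom C M N"
  then have f: "f \<in> Arr C" "Dom C f = M" "Cod C f = N" by auto
  have O: "M \<in> Obj C" "N \<in> Obj C" using f by auto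
  note p = pincl_facts[OF O(1)] and p' = pincl_facts[OF O(2)] and u = under_delta_facts[OF O(1), of n] and u' = under_delta_facts[OF O(2), of n]
  note i = sat_incl_simps[OF fn_functor[of "n + 1"] O(1)] and i' = sat_incl_simps[OF fn_functor[of "n + 1"] O(2)]
  obtain fs where fs: "kernel_lift C (pincl ch M) (pproj ch M) (pincl ch N) (pproj ch N) f fs"
    by (rule C.ex_kernel_lift[OF p(1,3) p'(1) f(1)]) (use f p p' in simp_all)
  note h = C.kernel_lift_hom[OF fs] and r = sat_FAr[OF fn_functor[of "n + 1"] f]
  have "sat_incl ch (fn T (n + 1)) N \<cdot> (under_delta D ch T n N \<cdot> FAr (fn T n) f) = conn T n (pincl ch N) (pproj ch N) \<cdot> FAr (fn T n) f"
    by (rule D.reassoc[OF u'(4)]) (use u' i' f in simp_all)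
  also have "\<dots> = FAr (fn T (n + 1)) fs \<cdot> (sat_incl ch (fn T (n + 1)) M \<cdot> under_delta D ch T n M)"
    unfolding u(4) by (rule conn_natural[OF p(1) p'(1) fs, symmetric]) (use f p p' in simp_all)
  also have "\<dots> = (FAr (fn T (n + 1)) fs \<cdot> sat_incl ch (fn T (n + 1)) M) \<cdot> under_delta D ch T n M"
    using u i h by simp
  also have "\<dots> = sat_incl ch (fn T (n + 1)) N \<cdot> (FAr (S (fn T (n + 1))) f \<cdot> under_delta D ch T n M)"
    unfolding r(4)[OF fs, symmetric] using r(1-3) u i' by simp
  finally have e: "sat_incl ch (fn T (n + 1)) N \<cdot> (under_delta D ch T n N \<cdot> FAr (fn T n) f) =
    sat_incl ch (fn T (n + 1)) N \<cdot> (FAr (S (fn T (n + 1))) f \<cdot> under_delta D ch T n M)" .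
  show "under_delta D ch T n N \<cdot> FAr (fn T n) f = FAr (S (fn T (n + 1))) f \<cdot> under_delta D ch T n M"
    by (rule D.is_monoD[OF i'(2) _ _ _ _ e]) (use r(1-3) u u' i' f in simp_all)
qed (use under_delta_facts in simp)

text \<open>The lift \<open>hs\<close> compares the chosen presentation with the given sequence;
  naturality of the connecting homomorphism along it turns the chosen one into that of
  \<open>f\<close>, \<open>g\<close>.\<close>

lemma eps_under_delta:
  assumes fg: "short_exact C f g"
  shows "eps (fn T (n + 1)) f g \<cdot> under_delta D ch T n (Cod C g) = conn T n f g"
proof -
  have O: "Cod C g \<in> Obj C" using C.short_exactD(5)[OF fg] by simp
  obtain hs where hs: "kernel_lift C (pincl ch (Cod C g)) (pproj ch (Cod C g)) f g (Ident C (Cod C g)) hs"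
    using ex_pincl_lift[OF fg] .
  note h = C.kernel_lift_hom[OF hs] and p = pincl_facts[OF O] and i = sat_incl_simps[OF fn_functor[of "n + 1"] O] and u = under_delta_facts[OF O, of n]
  have "eps (fn T (n + 1)) f g \<cdot> under_delta D ch T n (Cod C g) = FAr (fn T (n + 1)) hs \<cdot> conn T n (pincl ch (Cod C g)) (pproj ch (Cod C g))"
    unfolding eps_eq[OF fn_functor fg hs] u(4)[symmetric] using h i u by simp
  also have "\<dots> = conn T n f g \<cdot> FAr (fn T n) (Ident C (Cod C g))"
    by (rule conn_natural[OF p(1) fg hs]) (use O p in simp_all)
  finally show ?thesis using O fg conn_simps[OF fg] by simp
qed

abbreviation sob :: "int \<Rightarrow> 'a \<Rightarrow> 'c" where "sob n M \<equiv> dlim ch (sat_sys C D ch T n M)"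
abbreviation sleg :: "int \<Rightarrow> 'a \<Rightarrow> nat \<Rightarrow> 'd" where "sleg n M \<equiv> dleg ch (sat_sys C D ch T n M)"

lemma sat_sys_simps:
  assumes M: "M \<in> Obj C"
  shows "sat_sys C D ch T n M k \<in> Arr D" "Dom D (sat_sys C D ch T n M k) = FOb ((S ^^ k) (fn T (n + int k))) M"
    "Cod D (sat_sys C D ch T n M k) = FOb (S ((S ^^ k) (fn T (n + 1 + int k)))) M"
  using natural_transformationD(1-3)[OF sat_trans_natural[OF fn_functor sat_functor[OF fn_functor] under_delta_natural[of "n + int k"]] M, of k]
  by (simp_all add: sat_sys_def sat_pow_swap)

lemma seqlim_sleg: "M \<in> Obj C \<Longrightarrow> seqlim D (sat_sys C D ch T n M) (sob n M) (sleg n M)"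
  by (rule seqlim_dlim) (simp add: sequential_def sat_sys_simps)

lemma sleg_simps:
  assumes "M \<in> Obj C"
  shows "sob n M \<in> Obj D" "sleg n M k \<in> Arr D" "Dom D (sleg n M k) = FOb ((S ^^ k) (fn T (n + int k))) M" "Cod D (sleg n M k) = sob n M"
  using D.seqlimD[OF seqlim_sleg[OF assms]] sat_sys_simps[OF assms] by simp_all

text \<open>The inner square is naturality of \<open>omega_along\<close> in the functor, applied to
  \<open>under_delta\<close>; the remaining \<open>eps\<close> combines with
  \<open>under_delta\<close> to the connecting homomorphism.\<close>

lemma omega_along_sat_sys:
  assumes M: "M \<in> Obj C" and R: "syzygies C M R"
  shows "omega_along (Suc k) (fn T (n + 1 + int k)) R \<cdot> sat_sys C D ch T n M k = rsys T n R k \<cdot> omega_along k (fn T (n + int k)) R"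
proof -
  let ?F = "fn T (n + int k)" and ?G = "fn T (n + int k + 1)" and ?u = "under_delta D ch T (n + int k)" and ?Q = "Cod C (sproj R k)"
  note r = C.syzygiesD[OF R] and ss = sat_sys_simps[OF M, of n k]
  note w = omega_along_simps[OF sat_functor[OF fn_functor[of "n + int k + 1"]] R, of k] and w' = omega_along_simps[OF fn_functor[of "n + int k"] R, of k]
    and e = eps_simps[OF fn_functor[of "n + int k + 1"] r(1)[of k]]
  have O: "?Q \<in> Obj C" using r(6) by simp
  note u = under_delta_facts[OF O, of "n + int k"]
  have "omega_along (Suc k) ?G R \<cdot> sat_sys C D ch T n M k = eps ?G (sincl R k) (sproj R k) \<cdot> (omega_along k (S ?G) R \<cdot> sat_trans C D ch ?F (S ?G) k ?u M)"
    using w e ss by (simp add: sat_sys_def sat_pow_swap)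
  also have "\<dots> = eps ?G (sincl R k) (sproj R k) \<cdot> (?u ?Q \<cdot> omega_along k ?F R)"
    unfolding omega_along_trans[OF fn_functor sat_functor[OF fn_functor] under_delta_natural R, of "n + int k" k] ..
  also have "\<dots> = (eps ?G (sincl R k) (sproj R k) \<cdot> ?u ?Q) \<cdot> omega_along k ?F R"
    using e u w' by simp
  also have "\<dots> = rsys T n R k \<cdot> omega_along k ?F R" unfolding eps_under_delta[OF r(1)] rsys_def ..
  finally show ?thesis by simp
qed

text \<open>By the long exact sequence the transition map lands in the kernel \<open>eps\<close>.
  The other factors of \<open>omega_along\<close> belong to a satellite functor and form an
  isomorphism, which is inverted.\<close>

lemma rsys_omega_along_factor:
  assumes M: "M \<in> Obj C" and R: "syzygies C M R"
  obtains \<rho> where "\<rho> \<in> Arr D" "Dom D \<rho> = Dom D (rsys T n R k)" "Cod D \<rho> = Dom D (omega_along (Suc k) (fn T (n + 1 + int k)) R)"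
    "omega_along (Suc k) (fn T (n + 1 + int k)) R \<cdot> \<rho> = rsys T n R k"
proof -
  let ?G = "fn T (n + 1 + int k)"
  note r = C.syzygiesD[OF R] and rs = rsys_simps[OF R, of n k]
  note w = omega_along_simps[OF sat_functor[OF fn_functor[of "n + 1 + int k"]] R, of k] and e = eps_simps[OF fn_functor[of "n + 1 + int k"] r(1)[of k]]
  have "FAr ?G (sincl R k) \<cdot> rsys T n R k = Zero D (Dom D (rsys T n R k)) (Cod D (FAr ?G (sincl R k)))"
    using conn_comp(2)[OF r(1)[of k], of "n + int k"] r(3,5,7) rs by (simp add: rsys_def)
  then obtain s where s: "s \<in> Arr D" "Dom D s = Dom D (rsys T n R k)" "Cod D s = Dom D (eps ?G (sincl R k) (sproj R k))"
    "eps ?G (sincl R k) (sproj R k) \<cdot> s = rsys T n R k"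
    using D.kernel_factor[OF eps_kernel[OF fn_functor r(1,2)], of "rsys T n R k" "n + 1 + int k" k] rs r(3,5) by auto
  have "is_iso D (omega_along k (S ?G) R)" using D.iso_iff omega_along_mono[OF sat_functor[OF fn_functor] R] omega_along_epi[OF fn_functor R] by blast
  then obtain v where v: "v \<in> Arr D" "Dom D v = Cod D (omega_along k (S ?G) R)" "Cod D v = Dom D (omega_along k (S ?G) R)"
    "omega_along k (S ?G) R \<cdot> v = Ident D (Cod D (omega_along k (S ?G) R))" using D.iso_inverse by metis
  have "omega_along (Suc k) ?G R \<cdot> (v \<cdot> s) = eps ?G (sincl R k) (sproj R k) \<cdot> ((omega_along k (S ?G) R \<cdot> v) \<cdot> s)"
    using v(1-3) s(1-3) w e by simp
  also have "\<dots> = rsys T n R k" unfolding v(4) using s w(3) e(2) by simp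
  finally have "omega_along (Suc k) ?G R \<cdot> (v \<cdot> s) = rsys T n R k" .
  then show ?thesis using that[of "v \<cdot> s"] v(1-3) s(1-3) w e by simp
qed

lemma omega_facts:
  assumes M: "M \<in> Obj C"
  shows "omega C D ch T n M \<in> Arr D" "Dom D (omega C D ch T n M) = sob n M" "Cod D (omega C D ch T n M) = lob n M"
    "omega C D ch T n M \<cdot> sleg n M k = leg n M k \<cdot> omega_along k (fn T (n + int k)) (resn ch M)" "is_iso D (omega C D ch T n M)"
proof -
  note R = resn_syzygies[OF M]
  let ?w = "\<lambda>k. omega_along k (fn T (n + int k)) (resn ch M)"
  note w = omega_along_simps[OF fn_functor R] and rs = rsys_simps[OF R] and ss = sat_sys_simps[OF M]
  have sq: "?w (Suc k) \<cdot> sat_sys C D ch T n M k = rsys T n (resn ch M) k \<cdot> ?w k" for k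
    unfolding int_shift(1) by (rule omega_along_sat_sys[OF M R])
  have "\<exists>u. u \<in> Arr D \<and> Dom D u = sob n M \<and> Cod D u = lob n M \<and> (\<forall>k. u \<cdot> sleg n M k = leg n M k \<cdot> ?w k)"
    by (rule D.seqlim_map[OF seqlim_sleg[OF M] seqlim_leg[OF M] _ _ _ sq]) (use w rs ss in \<open>simp_all, blast\<close>)
  then obtain u where u: "u \<in> Arr D" "Dom D u = sob n M" "Cod D u = lob n M" "\<And>k. u \<cdot> sleg n M k = leg n M k \<cdot> ?w k" by blast
  have "\<exists>\<rho>. \<rho> \<in> Arr D \<and> Dom D \<rho> = Dom D (rsys T n (resn ch M) k) \<and> Cod D \<rho> = Dom D (sat_sys C D ch T n M (Suc k)) \<and> ?w (Suc k) \<cdot> \<rho> = rsys T n (resn ch M) k" for k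
  proof (rule rsys_omega_along_factor[OF M R, of n k])
    fix \<rho> assume "\<rho> \<in> Arr D" "Dom D \<rho> = Dom D (rsys T n (resn ch M) k)" "Cod D \<rho> = Dom D (omega_along (Suc k) (fn T (n + 1 + int k)) (resn ch M))"
      "omega_along (Suc k) (fn T (n + 1 + int k)) (resn ch M) \<cdot> \<rho> = rsys T n (resn ch M) k"
    moreover have "Dom D (omega_along (Suc k) (fn T (n + 1 + int k)) (resn ch M)) = Dom D (sat_sys C D ch T n M (Suc k))"
      unfolding omega_along_simps(2)[OF fn_functor R] ss(2) int_shift(1) ..
    ultimately show ?thesis unfolding int_shift(1) by (intro exI[of _ \<rho>]) (simp del: omega_along.simps)
  qed
  then obtain \<rho> where \<rho>: "\<And>k. \<rho> k \<in> Arr D" "\<And>k. Dom D (\<rho> k) = Dom D (rsys T n (resn ch M) k)" "\<And>k. Cod D (\<rho> k) = Dom D (sat_sys C D ch T n M (Suc k))"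
    "\<And>k. ?w (Suc k) \<cdot> \<rho> k = rsys T n (resn ch M) k" by metis
  have iso: "is_iso D u"
    by (rule D.limit_interleaved_iso[OF seqlim_sleg[OF M] seqlim_leg[OF M] _ _ _ sq \<rho> u]) (use omega_along_mono[OF fn_functor R] w rs ss in simp_all)
  \<comment> \<open>The definition prescribes values for \<open>k \<ge> 1\<close>, and
    \<open>u\<close> has the corresponding values at every stage.\<close>
  have "omega C D ch T n M = u"
    unfolding omega_def res_sys_rsys
    by (rule D.lim_map_eq[OF seqlim_sleg[OF M] _ u(1-3)]) (use u(4) omega_part_omega_along[OF M] in simp_all)
  then show "omega C D ch T n M \<in> Arr D" "Dom D (omega C D ch T n M) = sob n M" "Cod D (omega C D ch T n M) = lob n M"
    "omega C D ch T n M \<cdot> sleg n M k = leg n M k \<cdot> omega_along k (fn T (n + int k)) (resn ch M)" "is_iso D (omega C D ch T n M)"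
    using u iso by simp_all
qed

section \<open>The satellite construction as a transported structure\<close>

lemma satellite_eq:
  "FOb (fn (satellite_construction C D ch T) n) M = sob n M"
  "FAr (fn (satellite_construction C D ch T) n) f = lim_map D UNIV (sob n (Dom C f)) (sleg n (Dom C f)) (sob n (Cod C f))
     (\<lambda>k. sleg n (Cod C f) k \<cdot> FAr ((S ^^ k) (fn T (n + int k))) f)"
  "conn (satellite_construction C D ch T) n f g = lim_map D {1..} (sob n (Cod C g)) (sleg n (Cod C g)) (sob (n + 1) (Dom C f))
     (\<lambda>k. sleg (n + 1) (Dom C f) (k - 1) \<cdot> sat_conn C D ch (fn T (n + int k)) k f g)"
  by (simp_all add: satellite_construction_def Let_def)

text \<open>The arrow is recognised as the conjugate by \<open>omega\<close> of the one for the
  resolution construction: naturality of \<open>omega_along\<close> gives the prescribed values on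
  legs, and the conjugate itself supplies existence of the limit arrow.\<close>

lemma satellite_FAr:
  assumes f: "f \<in> Arr C"
  shows "FAr (fn (satellite_construction C D ch T) n) f \<in> Arr D"
    "Dom D (FAr (fn (satellite_construction C D ch T) n) f) = sob n (Dom C f)"
    "Cod D (FAr (fn (satellite_construction C D ch T) n) f) = sob n (Cod C f)"
    "omega C D ch T n (Cod C f) \<cdot> FAr (fn (satellite_construction C D ch T) n) f = FAr (fn res n) f \<cdot> omega C D ch T n (Dom C f)"
proof -
  define M N where "M = Dom C f" "N = Cod C f"
  have f': "Dom C f = M" "Cod C f = N" by (simp_all add: M_N_def)
  have O: "M \<in> Obj C" "N \<in> Obj C" using f by (simp_all add: M_N_def)
  note R = resn_syzygies[OF O(1)] and R' = resn_syzygies[OF O(2)] and oM = omega_facts[OF O(1)] and oN = omega_facts[OF O(2)]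
  obtain ft where ft: "syzygy_lift C (resn ch M) (resn ch N) f ft" using C.ex_syzygy_lift[OF R R' f f'] .
  note h = C.syzygy_lift_hom[OF ft R R' f f'] and r = res_FAr[OF f f', where n=n] and lM = leg_simps[OF O(1)] and lN = leg_simps[OF O(2)]
    and sM = sleg_simps[OF O(1)] and sN = sleg_simps[OF O(2)]
  obtain v where v: "v \<in> Arr D" "Dom D v = lob n N" "Cod D v = sob n N" "v \<cdot> omega C D ch T n N = Ident D (sob n N)" "omega C D ch T n N \<cdot> v = Ident D (lob n N)"
    using D.iso_inverse[OF oN(5)[of n]] oN(2,3) by metis
  let ?u = "v \<cdot> (FAr (fn res n) f \<cdot> omega C D ch T n M)"
  have u: "?u \<in> Arr D" "Dom D ?u = sob n M" "Cod D ?u = sob n N" using v(1-3) r(1-3) oM(1-3) by simp_all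
  have "?u \<cdot> sleg n M k = sleg n N k \<cdot> FAr ((S ^^ k) (fn T (n + int k))) f" for k
  proof -
    let ?F = "fn T (n + int k)"
    note w = omega_along_simps[OF fn_functor[of "n + int k"] R, of k] and w' = omega_along_simps[OF fn_functor[of "n + int k"] R', of k]
      and sp = functor_simps(3-5)[OF sat_pow_functor[OF fn_functor[of "n + int k"]], of f k]
    have "?u \<cdot> sleg n M k = v \<cdot> ((FAr (fn res n) f \<cdot> leg n M k) \<cdot> omega_along k ?F (resn ch M))"
      using v(1-3) r(1-3) oM(1-4) sM lM w by simp
    also have "\<dots> = v \<cdot> (leg n N k \<cdot> (FAr ?F (ft k) \<cdot> omega_along k ?F (resn ch M)))"
      unfolding r(4)[OF ft] using lN h w by simp
    also have "\<dots> = v \<cdot> ((leg n N k \<cdot> omega_along k ?F (resn ch N)) \<cdot> FAr ((S ^^ k) ?F) f)"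
      unfolding omega_along_natural[OF fn_functor ft R R' f f'] using lN w' sp f f' by simp
    also have "\<dots> = (v \<cdot> omega C D ch T n N) \<cdot> (sleg n N k \<cdot> FAr ((S ^^ k) ?F) f)"
      unfolding oN(4)[symmetric] using v(1-3) oN(1-3) sN sp f f' by simp
    finally show ?thesis unfolding v(4) using sN sp f f' by simp
  qed
  then have e: "FAr (fn (satellite_construction C D ch T) n) f = ?u"
    unfolding satellite_eq f' by (intro D.lim_map_eq[OF seqlim_sleg[OF O(1)] _ u]) simp_all
  have "omega C D ch T n N \<cdot> ?u = FAr (fn res n) f \<cdot> omega C D ch T n M"
    using D.reassoc[OF v(5), of "FAr (fn res n) f \<cdot> omega C D ch T n M"] v(1-3) r(1-3) oM(1-3) oN(1-3) by simp
  then show "FAr (fn (satellite_construction C D ch T) n) f \<in> Arr D"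
    "Dom D (FAr (fn (satellite_construction C D ch T) n) f) = sob n (Dom C f)"
    "Cod D (FAr (fn (satellite_construction C D ch T) n) f) = sob n (Cod C f)"
    "omega C D ch T n (Cod C f) \<cdot> FAr (fn (satellite_construction C D ch T) n) f = FAr (fn res n) f \<cdot> omega C D ch T n (Dom C f)"
    unfolding e f' using u by simp_all
qed

text \<open>As in \<open>satellite_FAr\<close>, a conjugate has the prescribed values. On legs
  \<open>omega_along_shift\<close> splits off the first \<open>eps\<close>, which \<open>h\<close>
  turns into that of the given sequence, while the remaining factors move past \<open>\<phi>\<close>
  by naturality.\<close>

lemma satellite_conn:
  assumes fg: "short_exact C f g"
  shows "conn (satellite_construction C D ch T) n f g \<in> Arr D"
    "Dom D (conn (satellite_construction C D ch T) n f g) = sob n (Cod C g)"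
    "Cod D (conn (satellite_construction C D ch T) n f g) = sob (n + 1) (Dom C f)"
    "omega C D ch T (n + 1) (Dom C f) \<cdot> conn (satellite_construction C D ch T) n f g = conn res n f g \<cdot> omega C D ch T n (Cod C g)"
proof -
  define A M where "A = Dom C f" "M = Cod C g"
  have f': "Dom C f = A" "Cod C g = M" by (simp_all add: A_M_def)
  have O: "A \<in> Obj C" "M \<in> Obj C" using C.short_exactD(4,5)[OF fg] by (simp_all add: A_M_def)
  note RA = resn_syzygies[OF O(1)] and R = resn_syzygies[OF O(2)] and H = syzygies_shift_resn[OF O(2)]
    and oA = omega_facts[OF O(1)] and oM = omega_facts[OF O(2)]
  note c = res_conn_simps[OF fg, unfolded f', of n] and lA = leg_simps[OF O(1)] and lM = leg_simps[OF O(2)]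
    and sA = sleg_simps[OF O(1)] and sM = sleg_simps[OF O(2)] and r = C.syzygiesD[OF R]
  obtain h where l: "res_lift f g M (Ident C M) h" using ex_res_lift[OF fg] f' by auto
  have hl: "h \<in> Arr C" "Dom C h = syz M" "Cod C h = A"
    using C.kernel_lift_hom[OF l] r(3) f' by (simp_all add: syz_def)
  obtain \<phi> where \<phi>: "syzygy_lift C (shift (resn ch M)) (resn ch A) h \<phi>" using C.ex_syzygy_lift[OF H RA hl] .
  note hp = C.syzygy_lift_hom[OF \<phi> H RA hl] and rh = res_FAr(1-3)[OF hl, where n="n + 1"] and sg = sigma_simps[OF O(2), of n] and rl = rleg_simps[OF H]
  obtain v where v: "v \<in> Arr D" "Dom D v = lob (n + 1) A" "Cod D v = sob (n + 1) A"
    "v \<cdot> omega C D ch T (n + 1) A = Ident D (sob (n + 1) A)" "omega C D ch T (n + 1) A \<cdot> v = Ident D (lob (n + 1) A)"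
    using D.iso_inverse[OF oA(5)[of "n + 1"]] oA(2,3) by metis
  let ?u = "v \<cdot> (conn res n f g \<cdot> omega C D ch T n M)"
  have u: "?u \<in> Arr D" "Dom D ?u = sob n M" "Cod D ?u = sob (n + 1) A" using v(1-3) c oM(1-3) by simp_all
  have suc: "?u \<cdot> sleg n M (Suc k) = sleg (n + 1) A k \<cdot> eps ((S ^^ k) (fn T (n + 1 + int k))) f g" for k
  proof -
    let ?F = "fn T (n + 1 + int k)"
    note F = fn_functor[of "n + 1 + int k"]
    note w = omega_along_simps[OF F R] and wA = omega_along_simps[OF F RA] and wH = omega_along_simps[OF F H]
      and G = sat_pow_functor[OF F, of k] and e0 = eps_simps[OF sat_pow_functor[OF F] r(1)[of 0]] and e = eps_simps[OF sat_pow_functor[OF F] fg]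
    note sp = functor_simps[OF G]
    have cl: "conn res n f g \<cdot> leg n M (Suc k) = leg (n + 1) A k \<cdot> FAr ?F (\<phi> k)"
    proof -
      have "conn res n f g \<cdot> leg n M (Suc k) = FAr (fn res (n + 1)) h \<cdot> rleg (n + 1) (shift (resn ch M)) k"
        unfolding res_conn[OF fg l[folded f'(2)]] f' using rh sg lM by simp
      also have "\<dots> = rleg (n + 1) (resn ch A) k \<cdot> FAr ?F (\<phi> k)" by (rule res_FAr_rleg[OF \<phi> H RA hl])
      finally show ?thesis by (simp add: rleg_resn[OF O(1)])
    qed
    have eh: "FAr ((S ^^ k) ?F) h \<cdot> eps ((S ^^ k) ?F) (sincl (resn ch M) 0) (sproj (resn ch M) 0) = eps ((S ^^ k) ?F) f g"
      using eps_natural[OF G r(1) fg l] r(4) f' O sp(2) functor_simps(2)[OF sat_functor[OF G]] e by simp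
    have "?u \<cdot> sleg n M (Suc k) = v \<cdot> ((conn res n f g \<cdot> leg n M (Suc k)) \<cdot> omega_along (Suc k) ?F (resn ch M))"
      using v(1-3) c oM(1-3) oM(4)[of n "Suc k"] sM lM w by (simp del: omega_along.simps)
    also have "\<dots> = v \<cdot> (leg (n + 1) A k \<cdot> ((FAr ?F (\<phi> k) \<cdot> omega_along k ?F (shift (resn ch M))) \<cdot> eps ((S ^^ k) ?F) (sincl (resn ch M) 0) (sproj (resn ch M) 0)))"
      unfolding cl omega_along_shift[OF F R] using lA hp wH e0 r(3) by (simp add: syz_def)
    also have "\<dots> = v \<cdot> ((leg (n + 1) A k \<cdot> omega_along k ?F (resn ch A)) \<cdot> (FAr ((S ^^ k) ?F) h \<cdot> eps ((S ^^ k) ?F) (sincl (resn ch M) 0) (sproj (resn ch M) 0)))"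
      unfolding omega_along_natural[OF F \<phi> H RA hl] using lA wA e0 r(3) sp(3-5) hl by (simp add: syz_def)
    also have "\<dots> = (v \<cdot> omega C D ch T (n + 1) A) \<cdot> (sleg (n + 1) A k \<cdot> eps ((S ^^ k) ?F) f g)"
      unfolding oA(4)[symmetric] eh using v(1-3) oA(1-3) sA e f' by simp
    finally show ?thesis unfolding v(4) using sA e f' by simp
  qed
  have "conn (satellite_construction C D ch T) n f g = ?u"
    unfolding satellite_eq f'
  proof (rule D.lim_map_eq[OF seqlim_sleg[OF O(2)] _ u])
    \<comment> \<open>Stage \<open>Suc j\<close> in degree \<open>n\<close> goes to stage
      \<open>j\<close> in degree \<open>n + 1\<close>; this is the \<open>k - 1\<close> of the
      definition.\<close>
    fix k :: nat assume "k \<in> {1..}"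
    then obtain j where j: "k = Suc j" by (cases k) auto
    show "?u \<cdot> sleg n M k = sleg (n + 1) A (k - 1) \<cdot> sat_conn C D ch (fn T (n + int k)) k f g"
      unfolding j int_shift(1) sat_conn_Suc[of _ j] using suc[of j] by simp
  qed simp
  note e = this
  have "omega C D ch T (n + 1) A \<cdot> ?u = conn res n f g \<cdot> omega C D ch T n M"
    using D.reassoc[OF v(5), of "conn res n f g \<cdot> omega C D ch T n M"] v(1-3) c oM(1-3) oA(1-3) by simp
  then show "conn (satellite_construction C D ch T) n f g \<in> Arr D"
    "Dom D (conn (satellite_construction C D ch T) n f g) = sob n (Cod C g)"
    "Cod D (conn (satellite_construction C D ch T) n f g) = sob (n + 1) (Dom C f)"
    "omega C D ch T (n + 1) (Dom C f) \<cdot> conn (satellite_construction C D ch T) n f g = conn res n f g \<cdot> omega C D ch T n (Cod C g)"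
    unfolding e f' using u by simp_all
qed

lemma omega_isomorphism: "cohom_isomorphism C D (satellite_construction C D ch T) res (omega C D ch T)"
  by (rule cohom_transport[OF res_cohomological])
    (use omega_facts satellite_FAr satellite_conn in \<open>simp_all add: satellite_eq(1) res_FOb\<close>)

end

section \<open>The universal property\<close>

context abelian
begin

text \<open>The composites \<open>d k\<close> of inverse transitions from stage \<open>k\<close>
  back to stage zero form a cocone, and the arrow it induces inverts leg zero.\<close>

lemma limit_constant_iso:
  assumes x: "seqlim C x L c" and i: "\<And>k. is_iso C (x k)"
  shows "is_iso C (c 0)"
proof -
  note X = seqlimD[OF x]
  have "\<exists>y. y \<in> Arr C \<and> Dom C y = Cod C (x k) \<and> Cod C y = Dom C (x k) \<and> y \<cdot> x k = Ident C (Dom C (x k)) \<and> x k \<cdot> y = Ident C (Cod C (x k))" for k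
    using iso_inverse[OF i[of k]] by metis
  then obtain y where y: "\<And>k. y k \<in> Arr C" "\<And>k. Dom C (y k) = Dom C (x (Suc k))" "\<And>k. Cod C (y k) = Dom C (x k)"
    "\<And>k. y k \<cdot> x k = Ident C (Dom C (x k))" "\<And>k. x k \<cdot> y k = Ident C (Dom C (x (Suc k)))" using X(8) by metis
  have O: "Dom C (x k) \<in> Obj C" for k using X(7) by simp
  define d where "d = rec_nat (Ident C (Dom C (x 0))) (\<lambda>k r. r \<cdot> y k)"
  have d_simps: "d 0 = Ident C (Dom C (x 0))" "d (Suc k) = d k \<cdot> y k" for k by (simp_all add: d_def)
  have d: "d k \<in> Arr C \<and> Dom C (d k) = Dom C (x k) \<and> Cod C (d k) = Dom C (x 0) \<and> c 0 \<cdot> d k = c k" for k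
  proof (induction k)
    case 0
    then show ?case using O X(3-5) by (simp add: d_simps)
  next
    case (Suc k)
    then have e: "c 0 \<cdot> d k = c k" by simp
    have "c 0 \<cdot> d (Suc k) = (c 0 \<cdot> d k) \<cdot> y k"
      unfolding e d_simps by (rule reassoc[OF e]) (use Suc X(3-5) y(1-3) in simp_all)
    also have "\<dots> = (c (Suc k) \<cdot> x k) \<cdot> y k" unfolding e X(6) ..
    also have "\<dots> = c (Suc k)" using X(3,4,5,7,8) y(1-3) y(5)[of k] by simp
    finally show ?case using Suc y(1-3) by (simp add: d_simps)
  qed
  have dx: "d (Suc k) \<cdot> x k = d k" for k using d[of k] y(1-3) y(4)[of k] X(7,8) by (simp add: d_simps)
  have "\<exists>v. v \<in> Arr C \<and> Dom C v = L \<and> Cod C v = Dom C (x 0) \<and> (\<forall>k. v \<cdot> c k = d k)"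
    by (rule seqlim_factor[OF x O[of 0], of d]) (use d dx in \<open>simp_all, blast\<close>)
  then obtain v where v: "v \<in> Arr C" "Dom C v = L" "Cod C v = Dom C (x 0)" "\<And>k. v \<cdot> c k = d k" by blast
  have "c 0 \<cdot> v = Ident C L"
  proof (rule seqlim_eq[OF x])
    fix k
    have "(c 0 \<cdot> v) \<cdot> c (Suc k) = c 0 \<cdot> d (Suc k)" using X(3-5) v by simp
    also have "\<dots> = c (Suc k)" using d by blast
    finally show "(c 0 \<cdot> v) \<cdot> c (Suc k) = Ident C L \<cdot> c (Suc k)" using X(3-5) by simp
  qed (use X v in simp_all)
  moreover have "v \<cdot> c 0 = Ident C (Dom C (x 0))" using v(4)[of 0] by (simp add: d_simps)
  ultimately show ?thesis using X(3-5) v(1-3) unfolding is_iso_def by auto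
qed

end

context completion_setting
begin

section \<open>Composition and inversion of morphisms of cohomological functors\<close>

lemma cohom_morphismD:
  assumes "cohom_morphism C D U V \<mu>"
  shows "cohomological_functor C D U" "cohomological_functor C D V"
    "M \<in> Obj C \<Longrightarrow> \<mu> n M \<in> Arr D" "M \<in> Obj C \<Longrightarrow> Dom D (\<mu> n M) = FOb (fn U n) M" "M \<in> Obj C \<Longrightarrow> Cod D (\<mu> n M) = FOb (fn V n) M"
    "f \<in> Arr C \<Longrightarrow> Dom C f = A \<Longrightarrow> Cod C f = B \<Longrightarrow> \<mu> n B \<cdot> FAr (fn U n) f = FAr (fn V n) f \<cdot> \<mu> n A"
    "short_exact C f g \<Longrightarrow> \<mu> (n + 1) (Dom C f) \<cdot> conn U n f g = conn V n f g \<cdot> \<mu> n (Cod C g)"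
  using assms natural_transformationD[of "fn U n" "fn V n" "\<mu> n"] unfolding cohom_morphism_def by auto

lemma cohom_morphismI:
  assumes "cohomological_functor C D U" "cohomological_functor C D V"
    "\<And>n M. M \<in> Obj C \<Longrightarrow> \<mu> n M \<in> Arr D" "\<And>n M. M \<in> Obj C \<Longrightarrow> Dom D (\<mu> n M) = FOb (fn U n) M" "\<And>n M. M \<in> Obj C \<Longrightarrow> Cod D (\<mu> n M) = FOb (fn V n) M"
    "\<And>n f A B. f \<in> Arr C \<Longrightarrow> Dom C f = A \<Longrightarrow> Cod C f = B \<Longrightarrow> \<mu> n B \<cdot> FAr (fn U n) f = FAr (fn V n) f \<cdot> \<mu> n A"
    "\<And>n f g. short_exact C f g \<Longrightarrow> \<mu> (n + 1) (Dom C f) \<cdot> conn U n f g = conn V n f g \<cdot> \<mu> n (Cod C g)"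
  shows "cohom_morphism C D U V \<mu>"
  using assms unfolding cohom_morphism_def natural_transformation_def by simp

lemma cohom_morphism_comp:
  assumes \<alpha>: "cohom_morphism C D U V \<alpha>" and \<beta>: "cohom_morphism C D V W \<beta>"
  shows "cohom_morphism C D U W (\<lambda>n M. \<beta> n M \<cdot> \<alpha> n M)"
proof -
  note a = cohom_morphismD[OF \<alpha>] and b = cohom_morphismD[OF \<beta>]
  interpret U: cohom C D ch U by unfold_locales (rule a(1))
  interpret V: cohom C D ch V by unfold_locales (rule a(2))
  interpret W: cohom C D ch W by unfold_locales (rule b(2))
  show ?thesis
  proof (rule cohom_morphismI[OF a(1) b(2)])
    fix n f A B assume f: "f \<in> Arr C" "Dom C f = A" "Cod C f = B"
    have O: "A \<in> Obj C" "B \<in> Obj C" using f by auto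
    note ty = a(3-5)[OF O(1)] a(3-5)[OF O(2)] b(3-5)[OF O(1)] b(3-5)[OF O(2)]
    have "(\<beta> n B \<cdot> \<alpha> n B) \<cdot> FAr (fn U n) f = \<beta> n B \<cdot> (FAr (fn V n) f \<cdot> \<alpha> n A)"
      unfolding a(6)[OF f, symmetric] using ty f by simp
    also have "\<dots> = (\<beta> n B \<cdot> FAr (fn V n) f) \<cdot> \<alpha> n A" using ty f by simp
    also have "\<dots> = FAr (fn W n) f \<cdot> (\<beta> n A \<cdot> \<alpha> n A)" unfolding b(6)[OF f] using ty f by simp
    finally show "(\<beta> n B \<cdot> \<alpha> n B) \<cdot> FAr (fn U n) f = FAr (fn W n) f \<cdot> (\<beta> n A \<cdot> \<alpha> n A)" .
  next
    fix n f g assume fg: "short_exact C f g"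
    have O: "Dom C f \<in> Obj C" "Cod C g \<in> Obj C" using C.short_exactD(4,5)[OF fg] by simp_all
    note ty = a(3-5)[OF O(1)] a(3-5)[OF O(2)] b(3-5)[OF O(1)] b(3-5)[OF O(2)] U.conn_simps[OF fg] V.conn_simps[OF fg] W.conn_simps[OF fg]
    have "(\<beta> (n + 1) (Dom C f) \<cdot> \<alpha> (n + 1) (Dom C f)) \<cdot> conn U n f g = \<beta> (n + 1) (Dom C f) \<cdot> (conn V n f g \<cdot> \<alpha> n (Cod C g))"
      unfolding a(7)[OF fg, symmetric] using ty by simp
    also have "\<dots> = (\<beta> (n + 1) (Dom C f) \<cdot> conn V n f g) \<cdot> \<alpha> n (Cod C g)" using ty by simp
    also have "\<dots> = conn W n f g \<cdot> (\<beta> n (Cod C g) \<cdot> \<alpha> n (Cod C g))" unfolding b(7)[OF fg] using ty by simp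
    finally show "(\<beta> (n + 1) (Dom C f) \<cdot> \<alpha> (n + 1) (Dom C f)) \<cdot> conn U n f g = conn W n f g \<cdot> (\<beta> n (Cod C g) \<cdot> \<alpha> n (Cod C g))" .
  qed (use a(3-5) b(3-5) in simp_all)
qed

lemma cohom_isomorphism_inverse:
  assumes iso: "cohom_isomorphism C D U V \<theta>"
  obtains \<theta>' where "cohom_morphism C D V U \<theta>'" "\<And>n M. M \<in> Obj C \<Longrightarrow> \<theta>' n M \<cdot> \<theta> n M = Ident D (FOb (fn U n) M)"
proof -
  have m: "cohom_morphism C D U V \<theta>" and i: "is_iso D (\<theta> n M)" if "M \<in> Obj C" for n M
    using iso that unfolding cohom_isomorphism_def by auto
  have m: "cohom_morphism C D U V \<theta>" using iso unfolding cohom_isomorphism_def by simp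
  note t = cohom_morphismD[OF m]
  interpret U: cohom C D ch U by unfold_locales (rule t(1))
  interpret V: cohom C D ch V by unfold_locales (rule t(2))
  have ex: "\<exists>g. M \<in> Obj C \<longrightarrow> g \<in> Arr D \<and> Dom D g = FOb (fn V n) M \<and> Cod D g = FOb (fn U n) M \<and>
     g \<cdot> \<theta> n M = Ident D (FOb (fn U n) M) \<and> \<theta> n M \<cdot> g = Ident D (FOb (fn V n) M)" for n M
    using D.iso_inverse[OF i[of M n]] t(3-5)[of M n] by metis
  have "\<exists>\<theta>'. \<forall>n M. M \<in> Obj C \<longrightarrow> \<theta>' n M \<in> Arr D \<and> Dom D (\<theta>' n M) = FOb (fn V n) M \<and> Cod D (\<theta>' n M) = FOb (fn U n) M \<and>
     \<theta>' n M \<cdot> \<theta> n M = Ident D (FOb (fn U n) M) \<and> \<theta> n M \<cdot> \<theta>' n M = Ident D (FOb (fn V n) M)"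
    by (rule choice, rule allI, rule choice, rule allI, rule ex)
  then obtain \<theta>' where \<theta>': "\<forall>n M. M \<in> Obj C \<longrightarrow> \<theta>' n M \<in> Arr D \<and> Dom D (\<theta>' n M) = FOb (fn V n) M \<and> Cod D (\<theta>' n M) = FOb (fn U n) M \<and>
     \<theta>' n M \<cdot> \<theta> n M = Ident D (FOb (fn U n) M) \<and> \<theta> n M \<cdot> \<theta>' n M = Ident D (FOb (fn V n) M)"
    by (rule exE)
  have s: "\<theta>' n M \<in> Arr D" "Dom D (\<theta>' n M) = FOb (fn V n) M" "Cod D (\<theta>' n M) = FOb (fn U n) M"
     "\<theta>' n M \<cdot> \<theta> n M = Ident D (FOb (fn U n) M)" "\<theta> n M \<cdot> \<theta>' n M = Ident D (FOb (fn V n) M)" if "M \<in> Obj C" for n M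
    using \<theta>' that by blast+
  \<comment> \<open>Naturality and compatibility with connecting homomorphisms have the same shape,
    so one inversion of a commuting square serves both; hence the two degrees \<open>n\<close> and
    \<open>n'\<close>.\<close>
  have sq: "\<theta>' n' B \<cdot> y = x \<cdot> \<theta>' n A"
    if O: "A \<in> Obj C" "B \<in> Obj C" and x: "x \<in> Arr D" "Dom D x = FOb (fn U n) A" "Cod D x = FOb (fn U n') B"
      and y: "y \<in> Arr D" "Dom D y = FOb (fn V n) A" "Cod D y = FOb (fn V n') B" and e: "\<theta> n' B \<cdot> x = y \<cdot> \<theta> n A" for n n' A B x y
  proof -
    note ty = t(3-5)[OF O(1)] t(3-5)[OF O(2)] s(1-3)[OF O(1)] s(1-3)[OF O(2)]
    have "\<theta>' n' B \<cdot> y = \<theta>' n' B \<cdot> (y \<cdot> (\<theta> n A \<cdot> \<theta>' n A))" unfolding s(5)[OF O(1)] using ty y by simp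
    also have "\<dots> = \<theta>' n' B \<cdot> ((y \<cdot> \<theta> n A) \<cdot> \<theta>' n A)" using ty y by simp
    also have "\<dots> = (\<theta>' n' B \<cdot> \<theta> n' B) \<cdot> (x \<cdot> \<theta>' n A)" unfolding e[symmetric] using ty x by simp
    also have "\<dots> = x \<cdot> \<theta>' n A" unfolding s(4)[OF O(2)] using ty x by simp
    finally show ?thesis .
  qed
  have "cohom_morphism C D V U \<theta>'"
  proof (rule cohom_morphismI[OF t(2,1) s(1-3)])
    fix n f A B assume f: "f \<in> Arr C" "Dom C f = A" "Cod C f = B"
    have O: "A \<in> Obj C" "B \<in> Obj C" using f by auto
    show "\<theta>' n B \<cdot> FAr (fn V n) f = FAr (fn U n) f \<cdot> \<theta>' n A"
      by (rule sq[OF O _ _ _ _ _ _ t(6)[OF f]]) (use f in simp_all)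
  next
    fix n f g assume fg: "short_exact C f g"
    have O: "Dom C f \<in> Obj C" "Cod C g \<in> Obj C" using C.short_exactD(4,5)[OF fg] by simp_all
    show "\<theta>' (n + 1) (Dom C f) \<cdot> conn V n f g = conn U n f g \<cdot> \<theta>' n (Cod C g)"
      by (rule sq[OF O(2,1) _ _ _ _ _ _ t(7)[OF fg]]) (use fg U.conn_simps[OF fg] V.conn_simps[OF fg] in simp_all)
  qed
  then show ?thesis using that s(4) by blast
qed

end

context cohom
begin

section \<open>Leg zero, dimension shifting and the universal property\<close>

lemma leg_zero_simps:
  assumes M: "M \<in> Obj C"
  shows "leg n M 0 \<in> Arr D" "Dom D (leg n M 0) = FOb (fn T n) M" "Cod D (leg n M 0) = lob n M"
  using leg_simps(2-4)[OF M, of n 0] C.syzygiesD(4)[OF resn_syzygies[OF M]] by simp_all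

text \<open>\<open>\<nu>\<close> is constrained on objects only, which suits the composite of the
  canonical morphism with \<open>omega\<close>. At stage zero the horseshoe sequence is the given
  one and the sign is trivial.\<close>

lemma leg_zero_morphism:
  assumes \<nu>: "\<And>n M. M \<in> Obj C \<Longrightarrow> \<nu> n M = leg n M 0"
  shows "cohom_morphism C D T res \<nu>"
proof (rule cohom_morphismI[OF T res_cohomological])
  fix n f A B assume f: "f \<in> Arr C" "Dom C f = A" "Cod C f = B"
  have O: "A \<in> Obj C" "B \<in> Obj C" using f by auto
  obtain ft where ft: "syzygy_lift C (resn ch A) (resn ch B) f ft"
    using C.ex_syzygy_lift[OF resn_syzygies[OF O(1)] resn_syzygies[OF O(2)] f] .
  show "\<nu> n B \<cdot> FAr (fn T n) f = FAr (fn res n) f \<cdot> \<nu> n A"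
    using res_FAr(4)[OF f ft, of n 0] C.syzygy_liftD(1)[OF ft] \<nu>[OF O(1)] \<nu>[OF O(2)] by simp
next
  fix n f g assume fg: "short_exact C f g"
  have O: "Dom C f \<in> Obj C" "Cod C g \<in> Obj C" using C.short_exactD(4,5)[OF fg] by simp_all
  obtain RB a b sa sb where hs: "horseshoe C f g (resn ch (Dom C f)) RB (resn ch (Cod C g)) a b sa sb"
    using obtain_horseshoe[OF fg] .
  obtain h where l: "res_lift f g (Cod C g) (Ident C (Cod C g)) h" using ex_res_lift[OF fg] .
  have "signed D 0 x = x" for x by (simp add: signed_def)
  then show "\<nu> (n + 1) (Dom C f) \<cdot> conn T n f g = conn res n f g \<cdot> \<nu> n (Cod C g)"
    using res_conn_lemma[OF fg hs l, of n 0] res_conn[OF fg l, of n] C.horseshoeD(4,5)[OF hs] \<nu>[OF O(1)] \<nu>[OF O(2)] by simp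
qed (use leg_zero_simps \<nu> res_FOb in simp_all)

text \<open>Dimension shifting: the neighbouring arrows of the long exact sequence start or end at
  the value on the projective \<open>Dom C g\<close>, so they are zero.\<close>

lemma vanishing_conn:
  assumes v: "vanishes_on_projectives C D T" and fg: "short_exact C f g" and P: "projective C (Dom C g)"
  shows "is_mono D (conn T n f g)" "is_epi D (conn T n f g)"
proof -
  note f = C.short_exactD[OF fg]
  have z: "zero_object D (FOb (fn T m) (Dom C g))" for m using v P by (simp add: vanishes_on_projectives_def)
  have O: "Dom C f \<in> Obj C" "Cod C g \<in> Obj C" "Dom C g \<in> Obj C" using f by simp_all
  have g0: "FAr (fn T n) g = Zero D (FOb (fn T n) (Dom C g)) (FOb (fn T n) (Cod C g))"
    by (rule D.Zero_object_arrow[OF z[of n]]) (use f in simp_all)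
  have f0: "FAr (fn T (n + 1)) f = Zero D (FOb (fn T (n + 1)) (Dom C f)) (FOb (fn T (n + 1)) (Dom C g))"
    by (rule D.Zero_object_arrow[OF z[of "n + 1"]]) (use f in simp_all)
  show "is_mono D (conn T n f g)" by (rule D.exact_Zero_mono[OF conn_exact(2)[OF fg, of n, unfolded g0]]) (use O in simp_all)
  show "is_epi D (conn T n f g)" by (rule D.exact_Zero_epi[OF conn_exact(3)[OF fg, of n, unfolded f0]]) (use O in simp_all)
qed

text \<open>All transition maps are isomorphisms by \<open>vanishing_conn\<close>, so the limit is
  attained at stage zero.\<close>

lemma leg_zero_isomorphism:
  assumes v: "vanishes_on_projectives C D T"
  shows "cohom_isomorphism C D T res (\<lambda>n M. leg n M 0)"
  unfolding cohom_isomorphism_def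
proof (intro conjI allI ballI)
  show "cohom_morphism C D T res (\<lambda>n M. leg n M 0)" by (rule leg_zero_morphism) simp
  fix n M assume M: "M \<in> Obj C"
  note r = C.syzygiesD[OF resn_syzygies[OF M]]
  have "is_iso D (rsys T n (resn ch M) k)" for k
    unfolding rsys_def D.iso_iff using vanishing_conn[OF v r(1,2)] by blast
  then show "is_iso D (leg n M 0)" by (rule D.limit_constant_iso[OF seqlim_leg[OF M]])
qed

text \<open>Functoriality of the construction in \<open>T\<close>. Through \<open>res_conn\<close>,
  compatibility with connecting homomorphisms reduces to compatibility with \<open>sigma\<close> and
  with induced arrows.\<close>

lemma res_morphism:
  assumes \<mu>: "cohom_morphism C D T V \<mu>"
  obtains m where "cohom_morphism C D res (resolution_construction C D ch V) m"
    "\<And>n M. M \<in> Obj C \<Longrightarrow> m n M \<cdot> leg n M 0 = dleg ch (rsys V n (resn ch M)) 0 \<cdot> \<mu> n M"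
proof -
  note t = cohom_morphismD[OF \<mu>]
  interpret V: cohom C D ch V by unfold_locales (rule t(2))
  have mr: "\<mu> (n + 1 + int k) (Cod C (sproj R (Suc k))) \<cdot> rsys T n R k = rsys V n R k \<cdot> \<mu> (n + int k) (Cod C (sproj R k))"
    if R: "syzygies C M R" for n k M R
    using t(7)[OF C.syzygiesD(1)[OF R], of "n + int k" k] C.syzygiesD(3)[OF R] by (simp add: rsys_def)
  have mr': "\<mu> (n + int (Suc k)) (Cod C (sproj R (Suc k))) \<cdot> rsys T n R k = rsys V n R k \<cdot> \<mu> (n + int k) (Cod C (sproj R k))"
    if R: "syzygies C M R" for n k M R using mr[OF R] by simp
  have sO: "Cod C (sproj R k) \<in> Obj C" if R: "syzygies C M R" for k M R using C.syzygiesD(6)[OF R] by simp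
  have ex: "\<exists>u. M \<in> Obj C \<longrightarrow> u \<in> Arr D \<and> Dom D u = lob n M \<and> Cod D u = V.lob n M \<and>
    (\<forall>k. u \<cdot> leg n M k = V.leg n M k \<cdot> \<mu> (n + int k) (Cod C (sproj (resn ch M) k)))" for n M
  proof (cases "M \<in> Obj C")
    case M: True
    note R = resn_syzygies[OF M]
    show ?thesis
      by (rule D.seqlim_map[OF seqlim_leg[OF M] V.seqlim_leg[OF M] _ _ _ mr'[OF R]])
        (use t(3-5)[OF sO[OF R]] rsys_simps[OF R] V.rsys_simps[OF R] in \<open>simp_all, blast\<close>)
  qed simp
  have "\<exists>m. \<forall>n M. M \<in> Obj C \<longrightarrow> m n M \<in> Arr D \<and> Dom D (m n M) = lob n M \<and> Cod D (m n M) = V.lob n M \<and>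
    (\<forall>k. m n M \<cdot> leg n M k = V.leg n M k \<cdot> \<mu> (n + int k) (Cod C (sproj (resn ch M) k)))"
    by (rule choice, rule allI, rule choice, rule allI, rule ex)
  then obtain m where m0: "\<forall>n M. M \<in> Obj C \<longrightarrow> m n M \<in> Arr D \<and> Dom D (m n M) = lob n M \<and> Cod D (m n M) = V.lob n M \<and>
    (\<forall>k. m n M \<cdot> leg n M k = V.leg n M k \<cdot> \<mu> (n + int k) (Cod C (sproj (resn ch M) k)))"
    by (rule exE)
  have m: "m n M \<in> Arr D" "Dom D (m n M) = lob n M" "Cod D (m n M) = V.lob n M"
    "m n M \<cdot> leg n M k = V.leg n M k \<cdot> \<mu> (n + int k) (Cod C (sproj (resn ch M) k))" if "M \<in> Obj C" for n M k
    using m0 that by blast+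
  \<comment> \<open>\<open>sigma\<close> involves a resolution of the syzygy other than the chosen
    one, so the legs are compared along arbitrary resolutions.\<close>
  have mrl: "m n M \<cdot> rleg n R k = V.rleg n R k \<cdot> \<mu> (n + int k) (Cod C (sproj R k))" if R: "syzygies C M R" for n M R k
  proof -
    have M: "M \<in> Obj C" using C.syzygiesD[OF R] by simp
    note S = resn_syzygies[OF M]
    obtain \<theta> where \<theta>: "syzygy_lift C R (resn ch M) (Ident C M) \<theta>" "\<And>n k. rleg n R k = leg n M k \<cdot> FAr (fn T (n + int k)) (\<theta> k)"
      "\<And>k. \<theta> k \<in> Arr C" "\<And>k. Dom C (\<theta> k) = Cod C (sproj R k)" "\<And>k. Cod C (\<theta> k) = Cod C (sproj (resn ch M) k)"
      using obtain_rleg[OF R] by metis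
    note l = leg_simps[OF M] and l' = V.leg_simps[OF M] and tR = t(3-5)[OF sO[OF R]] and tS = t(3-5)[OF sO[OF S]]
    have "m n M \<cdot> rleg n R k = (m n M \<cdot> leg n M k) \<cdot> FAr (fn T (n + int k)) (\<theta> k)"
      using \<theta>(2-) m(1-3)[OF M] l by simp
    also have "\<dots> = V.leg n M k \<cdot> (\<mu> (n + int k) (Cod C (sproj (resn ch M) k)) \<cdot> FAr (fn T (n + int k)) (\<theta> k))"
      unfolding m(4)[OF M] using \<theta>(3-) l' tS by simp
    also have "\<dots> = (V.leg n M k \<cdot> FAr (fn V (n + int k)) (\<theta> k)) \<cdot> \<mu> (n + int k) (Cod C (sproj R k))"
      unfolding t(6)[OF \<theta>(3-5)] using \<theta>(3-) l' tR by simp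
    finally show ?thesis unfolding V.rleg_eq[OF R \<theta>(1)] .
  qed
  have ms: "m (n + 1) (syz M) \<cdot> sigma n M = V.sigma n M \<cdot> m n M" if M: "M \<in> Obj C" for n M
  proof (rule D.seqlim_eq[OF seqlim_leg[OF M, of n]])
    note R = resn_syzygies[OF M] and H = syzygies_shift_resn[OF M] and sO' = syz_Obj[OF M]
    note sg = sigma_simps[OF M] and sg' = V.sigma_simps[OF M] and l = leg_simps[OF M] and l' = V.leg_simps[OF M] and tS = t(3-5)[OF sO[OF R]]
    fix k
    have "(m (n + 1) (syz M) \<cdot> sigma n M) \<cdot> leg n M (Suc k) = m (n + 1) (syz M) \<cdot> rleg (n + 1) (shift (resn ch M)) k"
      using m(1-3)[OF sO'] sg l by simp
    also have "\<dots> = (V.sigma n M \<cdot> V.leg n M (Suc k)) \<cdot> \<mu> (n + int (Suc k)) (Cod C (sproj (resn ch M) (Suc k)))"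
      unfolding mrl[OF H] sg'(4) by simp
    also have "\<dots> = V.sigma n M \<cdot> (m n M \<cdot> leg n M (Suc k))"
      unfolding m(4)[OF M] using sg'(1-3) l' tS by simp
    also have "\<dots> = (V.sigma n M \<cdot> m n M) \<cdot> leg n M (Suc k)" using sg'(1-3) l m(1-3)[OF M] by simp
    finally show "(m (n + 1) (syz M) \<cdot> sigma n M) \<cdot> leg n M (Suc k) = (V.sigma n M \<cdot> m n M) \<cdot> leg n M (Suc k)" .
  qed (use m(1-3)[OF M] m(1-3)[OF syz_Obj[OF M]] sigma_simps[OF M] V.sigma_simps[OF M] in simp_all)
  have mf: "m n N \<cdot> FAr (fn res n) f = FAr (fn V.res n) f \<cdot> m n M" if f: "f \<in> Arr C" "Dom C f = M" "Cod C f = N" for n f M N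
  proof -
    have O: "M \<in> Obj C" "N \<in> Obj C" using f by auto
    note R = resn_syzygies[OF O(1)] and R' = resn_syzygies[OF O(2)]
    obtain ft where ft: "syzygy_lift C (resn ch M) (resn ch N) f ft" using C.ex_syzygy_lift[OF R R' f] .
    note h = C.syzygy_lift_hom[OF ft R R' f] and r = res_FAr[OF f, where n=n] and r' = V.res_FAr[OF f, where n=n]
    note lM = leg_simps[OF O(1)] and lN = leg_simps[OF O(2)] and lM' = V.leg_simps[OF O(1)] and lN' = V.leg_simps[OF O(2)]
      and tR = t(3-5)[OF sO[OF R]] and tR' = t(3-5)[OF sO[OF R']]
    show ?thesis
    proof (rule D.seqlim_eq[OF seqlim_leg[OF O(1), of n]])
      fix k
      let ?k = "Suc k"
      have "(m n N \<cdot> FAr (fn res n) f) \<cdot> leg n M ?k = m n N \<cdot> (leg n N ?k \<cdot> FAr (fn T (n + int ?k)) (ft ?k))"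
        unfolding r(4)[OF ft, symmetric] using m(1-3)[OF O(2)] r(1-3) lM by simp
      also have "\<dots> = (m n N \<cdot> leg n N ?k) \<cdot> FAr (fn T (n + int ?k)) (ft ?k)"
        using m(1-3)[OF O(2)] lN h by simp
      also have "\<dots> = V.leg n N ?k \<cdot> (\<mu> (n + int ?k) (Cod C (sproj (resn ch N) ?k)) \<cdot> FAr (fn T (n + int ?k)) (ft ?k))"
        unfolding m(4)[OF O(2)] using lN' tR' h by simp
      also have "\<dots> = (V.leg n N ?k \<cdot> FAr (fn V (n + int ?k)) (ft ?k)) \<cdot> \<mu> (n + int ?k) (Cod C (sproj (resn ch M) ?k))"
        unfolding t(6)[OF h] using lN' tR h by simp
      also have "\<dots> = FAr (fn V.res n) f \<cdot> (m n M \<cdot> leg n M ?k)"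
        unfolding r'(4)[OF ft, symmetric] m(4)[OF O(1)] using r'(1-3) lM' tR by simp
      also have "\<dots> = (FAr (fn V.res n) f \<cdot> m n M) \<cdot> leg n M ?k" using r'(1-3) lM m(1-3)[OF O(1)] by simp
      finally show "(m n N \<cdot> FAr (fn res n) f) \<cdot> leg n M ?k = (FAr (fn V.res n) f \<cdot> m n M) \<cdot> leg n M ?k" .
    qed (use m(1-3)[OF O(1)] m(1-3)[OF O(2)] r(1-3) r'(1-3) in simp_all)
  qed
  have "cohom_morphism C D res V.res m"
  proof (rule cohom_morphismI[OF res_cohomological V.res_cohomological])
    fix n f g assume fg: "short_exact C f g"
    have O: "Dom C f \<in> Obj C" "Cod C g \<in> Obj C" using C.short_exactD(4,5)[OF fg] by simp_all
    obtain h where l: "res_lift f g (Cod C g) (Ident C (Cod C g)) h" using ex_res_lift[OF fg] .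
    have hl: "h \<in> Arr C" "Dom C h = syz (Cod C g)" "Cod C h = Dom C f"
      using C.kernel_lift_hom[OF l] C.syzygiesD(3)[OF resn_syzygies[OF O(2)]] by (simp_all add: syz_def)
    note r = res_FAr(1-3)[OF hl] and r' = V.res_FAr(1-3)[OF hl] and s = sigma_simps[OF O(2)] and s' = V.sigma_simps[OF O(2)]
      and mm = m(1-3)[OF O(1)] m(1-3)[OF O(2)] m(1-3)[OF syz_Obj[OF O(2)]]
    have "m (n + 1) (Dom C f) \<cdot> conn res n f g = (m (n + 1) (Dom C f) \<cdot> FAr (fn res (n + 1)) h) \<cdot> sigma n (Cod C g)"
      unfolding res_conn[OF fg l] using r s mm by simp
    also have "\<dots> = FAr (fn V.res (n + 1)) h \<cdot> (m (n + 1) (syz (Cod C g)) \<cdot> sigma n (Cod C g))"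
      unfolding mf[OF hl] using r' s mm by simp
    also have "\<dots> = conn V.res n f g \<cdot> m n (Cod C g)"
      unfolding ms[OF O(2)] V.res_conn[OF fg l] using r' s' mm by simp
    finally show "m (n + 1) (Dom C f) \<cdot> conn res n f g = conn V.res n f g \<cdot> m n (Cod C g)" .
  qed (use m(1-3) mf res_FOb V.res_FOb in simp_all)
  moreover have "m n M \<cdot> leg n M 0 = dleg ch (rsys V n (resn ch M)) 0 \<cdot> \<mu> n M" if "M \<in> Obj C" for n M
    using m(4)[OF that, of n 0] C.syzygiesD(4)[OF resn_syzygies[OF that]] by simp
  ultimately show ?thesis using that by blast
qed

lemma res_morphism_unique:
  assumes V: "cohomological_functor C D V" "vanishes_on_projectives C D V"
    and k: "cohom_morphism C D res V \<kappa>" "cohom_morphism C D res V \<kappa>'"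
    and e: "\<And>n M. M \<in> Obj C \<Longrightarrow> \<kappa> n M \<cdot> leg n M 0 = \<kappa>' n M \<cdot> leg n M 0"
    and M: "M \<in> Obj C"
  shows "\<kappa> n M = \<kappa>' n M"
proof -
  interpret V: cohom C D ch V by unfold_locales (rule V(1))
  note k1 = cohom_morphismD[OF k(1), unfolded res_FOb] and k2 = cohom_morphismD[OF k(2), unfolded res_FOb]
  \<comment> \<open>For the first syzygy sequence the identity is an admissible lift, so the
    connecting homomorphism of \<open>res\<close> is \<open>sigma\<close> itself. It trades leg
    \<open>k + 1\<close> at \<open>M\<close> for leg \<open>k\<close> along the shifted
    resolution.\<close>
  have step: "conn V n (sincl (resn ch M) 0) (sproj (resn ch M) 0) \<cdot> (\<tau> n M \<cdot> leg n M (Suc k)) = \<tau> (n + 1) (syz M) \<cdot> rleg (n + 1) (shift (resn ch M)) k"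
    if M: "M \<in> Obj C" and l: "cohom_morphism C D res V \<tau>" for n M k \<tau>
  proof -
    note R = C.syzygiesD[OF resn_syzygies[OF M]] and l = cohom_morphismD[OF l, unfolded res_FOb] and SO = syz_Obj[OF M] and lg = leg_simps[OF M]
    note l1 = l(3-5)[OF M] l(3-5)[OF SO] and sg = sigma_simps[OF M]
    let ?i = "sincl (resn ch M) 0" and ?p = "sproj (resn ch M) 0"
    have d: "Dom C ?i = syz M" by (simp add: R(3) syz_def)
    have il: "res_lift ?i ?p (Cod C ?p) (Ident C (Cod C ?p)) (Ident C (syz M))"
      using C.kernel_lift_Ident[OF R(1)[of 0]] R(4) d by simp
    have cc: "conn res n ?i ?p = sigma n M"
      using res_conn[OF R(1)[of 0] il, of n] functor_simps(2)[OF res_functor SO, of "n + 1"] R(4) sg by (simp add: res_FOb)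
    note c = V.conn_simps[OF R(1)[of 0], of n]
    have "conn V n ?i ?p \<cdot> (\<tau> n M \<cdot> leg n M (Suc k)) = (conn V n ?i ?p \<cdot> \<tau> n (Cod C ?p)) \<cdot> leg n M (Suc k)"
      using c l1 lg R(4) by simp
    also have "\<dots> = \<tau> (n + 1) (syz M) \<cdot> (sigma n M \<cdot> leg n M (Suc k))"
      unfolding l(7)[OF R(1)[of 0], symmetric] cc d using l1 sg(1-3) lg by simp
    finally show ?thesis unfolding sg(4) .
  qed
  \<comment> \<open>The induction moves to degree \<open>n + 1\<close> and to the syzygy, so
    \<open>n\<close> and \<open>M\<close> vary; the connecting homomorphism of \<open>V\<close> is
    mono and can be cancelled.\<close>
  have "\<kappa> n M \<cdot> leg n M k = \<kappa>' n M \<cdot> leg n M k" if "M \<in> Obj C" for n M k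
    using that
  proof (induction k arbitrary: n M)
    case 0
    then show ?case by (rule e)
  next
    case (Suc k)
    note M = Suc.prems and SO = syz_Obj[OF Suc.prems]
    note R = C.syzygiesD[OF resn_syzygies[OF M]] and H = syzygies_shift_resn[OF M] and lg = leg_simps[OF M] and lg' = leg_simps[OF SO]
    let ?i = "sincl (resn ch M) 0" and ?p = "sproj (resn ch M) 0"
    obtain \<theta> where \<theta>: "\<And>n k. rleg n (shift (resn ch M)) k = leg n (syz M) k \<cdot> FAr (fn T (n + int k)) (\<theta> k)"
      "\<And>k. \<theta> k \<in> Arr C" "\<And>k. Dom C (\<theta> k) = Cod C (sproj (shift (resn ch M)) k)" "\<And>k. Cod C (\<theta> k) = Cod C (sproj (resn ch (syz M)) k)"
      using obtain_rleg[OF H] by metis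
    have s: "\<kappa> (n + 1) (syz M) \<cdot> rleg (n + 1) (shift (resn ch M)) k = \<kappa>' (n + 1) (syz M) \<cdot> rleg (n + 1) (shift (resn ch M)) k"
    proof -
      have "\<kappa> (n + 1) (syz M) \<cdot> rleg (n + 1) (shift (resn ch M)) k = (\<kappa> (n + 1) (syz M) \<cdot> leg (n + 1) (syz M) k) \<cdot> FAr (fn T (n + 1 + int k)) (\<theta> k)"
        unfolding \<theta>(1) using \<theta>(2-4) lg' k1(3-5)[OF SO] by simp
      also have "\<dots> = \<kappa>' (n + 1) (syz M) \<cdot> rleg (n + 1) (shift (resn ch M)) k"
        unfolding Suc.IH[OF SO] \<theta>(1) using \<theta>(2-4) lg' k2(3-5)[OF SO] by simp
      finally show ?thesis .
    qed
    show ?case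
    proof (rule D.is_monoD[OF V.vanishing_conn(1)[OF V(2) R(1)[of 0] R(2)[of 0], of n]])
      show "conn V n ?i ?p \<cdot> (\<kappa> n M \<cdot> leg n M (Suc k)) = conn V n ?i ?p \<cdot> (\<kappa>' n M \<cdot> leg n M (Suc k))"
        unfolding step[OF M k(1)] step[OF M k(2)] by (rule s)
    qed (use lg k1(3-5)[OF M] k2(3-5)[OF M] V.conn_simps[OF R(1)[of 0]] R(4) in simp_all)
  qed
  note legs = this
  show ?thesis
    by (rule D.seqlim_eq[OF seqlim_leg[OF M, of n]]) (use legs[OF M] k1(3-5)[OF M] k2(3-5)[OF M] in simp_all)
qed

text \<open>A morphism from \<open>T\<close> to \<open>V\<close> is first completed by
  \<open>res_morphism\<close>; the completion of \<open>V\<close> is then brought back to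
  \<open>V\<close> by inverting its leg zero, an isomorphism because \<open>V\<close> vanishes on
  projectives.\<close>

lemma res_mislin_completion:
  assumes \<nu>: "\<And>n M. M \<in> Obj C \<Longrightarrow> \<nu> n M = leg n M 0"
  shows "mislin_completion C D T res \<nu>"
  unfolding mislin_completion_def
proof (intro conjI allI impI)
  show "cohomological_functor C D res" by (rule res_cohomological)
  show "cohom_morphism C D T res \<nu>" by (rule leg_zero_morphism[OF \<nu>])
  show "vanishes_on_projectives C D res"
    using res_projective by (simp add: vanishes_on_projectives_def res_FOb)
  fix V \<mu> assume V: "cohomological_functor C D V" "vanishes_on_projectives C D V" and \<mu>: "cohom_morphism C D T V \<mu>"
  interpret V: cohom C D ch V by unfold_locales (rule V(1))
  obtain m where m: "cohom_morphism C D res V.res m" "\<And>n M. M \<in> Obj C \<Longrightarrow> m n M \<cdot> leg n M 0 = V.leg n M 0 \<cdot> \<mu> n M"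
    using res_morphism[OF \<mu>] by blast
  obtain \<theta> where \<theta>: "cohom_morphism C D V.res V \<theta>" "\<And>n M. M \<in> Obj C \<Longrightarrow> \<theta> n M \<cdot> V.leg n M 0 = Ident D (FOb (fn V n) M)"
    using cohom_isomorphism_inverse[OF V.leg_zero_isomorphism[OF V(2)]] by blast
  let ?\<kappa> = "\<lambda>n M. \<theta> n M \<cdot> m n M"
  have k: "cohom_morphism C D res V ?\<kappa>" by (rule cohom_morphism_comp[OF m(1) \<theta>(1)])
  have e: "?\<kappa> n M \<cdot> leg n M 0 = \<mu> n M" if M: "M \<in> Obj C" for n M
  proof -
    note mm = cohom_morphismD(3-5)[OF m(1) M, unfolded res_FOb V.res_FOb] and tt = cohom_morphismD(3-5)[OF \<theta>(1) M, unfolded V.res_FOb]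
      and uu = cohom_morphismD(3-5)[OF \<mu> M] and l = leg_zero_simps[OF M] and l' = V.leg_zero_simps[OF M]
    have "?\<kappa> n M \<cdot> leg n M 0 = (\<theta> n M \<cdot> V.leg n M 0) \<cdot> \<mu> n M" using m(2)[OF M, of n] mm tt uu l l' by simp
    then show ?thesis unfolding \<theta>(2)[OF M] using uu by simp
  qed
  show "\<exists>\<kappa>. cohom_morphism C D res V \<kappa> \<and> (\<forall>n. \<forall>M\<in>Obj C. \<kappa> n M \<cdot> \<nu> n M = \<mu> n M) \<and>
           (\<forall>\<kappa>'. cohom_morphism C D res V \<kappa>' \<longrightarrow>
              (\<forall>n. \<forall>M\<in>Obj C. \<kappa>' n M \<cdot> \<nu> n M = \<mu> n M) \<longrightarrow>
              (\<forall>n. \<forall>M\<in>Obj C. \<kappa>' n M = \<kappa> n M))"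
  proof (intro exI[of _ ?\<kappa>] conjI allI impI ballI k)
    fix n M assume M: "M \<in> Obj C"
    show "?\<kappa> n M \<cdot> \<nu> n M = \<mu> n M" using e[OF M] \<nu>[OF M] by simp
    fix \<kappa>' assume k': "cohom_morphism C D res V \<kappa>'" and e': "\<forall>n. \<forall>M\<in>Obj C. \<kappa>' n M \<cdot> \<nu> n M = \<mu> n M"
    show "\<kappa>' n M = ?\<kappa> n M"
      by (rule res_morphism_unique[OF V k' k _ M]) (use e e' \<nu> in simp)
  qed
qed

text \<open>At stage zero the composite of connecting homomorphisms is empty, so
  \<open>omega\<close> carries leg zero to leg zero.\<close>

lemma omega_canonical:
  assumes M: "M \<in> Obj C"
  shows "omega C D ch T n M \<cdot> satellite_canonical C D ch T n M = leg n M 0"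
  using omega_facts(4)[OF M, of n 0] leg_zero_simps[OF M, of n] C.syzygiesD(4)[OF resn_syzygies[OF M]]
  by (simp add: satellite_canonical_def)

end

theorem theorem4p6:
  fixes C :: "('o, 'a) category" and D :: "('p, 'b) category"
    and T :: "('o, 'a, 'p, 'b) cohom" and ch :: "('o, 'a, 'p, 'b) choices"
  assumes "abelian_category C" and "enough_projectives C"
    and "abelian_category D"
    and "infinite (UNIV :: 'i set)"
    and "has_direct_limits TYPE('i) D" and "exact_direct_limits TYPE('i) D"
    and "cohomological_functor C D T"
    and "valid_choices C D ch"
  shows "mislin_completion C D T (resolution_construction C D ch T)
           (\<lambda>n M. omega C D ch T n M \<cdot>\<^bsub>D\<^esub> satellite_canonical C D ch T n M) \<and>
         cohomological_functor C D (resolution_construction C D ch T) \<and>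
         cohom_isomorphism C D (satellite_construction C D ch T)
           (resolution_construction C D ch T) (omega C D ch T)"
proof -
  interpret D: abelian D by unfold_locales (rule assms(3))
  interpret cohom C D ch T
  proof unfold_locales
    show "\<exists>L c. is_seq_limit D x L c" if "sequential D x" for x
      using assms(8) that unfolding valid_choices_def by blast
    show "exact_seq_limits D" by (rule D.exact_direct_limits_sequential[OF assms(4,6)])
  qed (rule assms)+
  show ?thesis
    using res_mislin_completion[OF omega_canonical] res_cohomological omega_isomorphism by simp
qed

end
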